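(* Let $\mathcal{B}=(\mathcal{B}_{xy},\circ,I,/,\backslash,\ldots)$ be a biclosed bicategory (over $\mathcal{V}$) and let $\theta:\mathcal{C}\to\mathcal{B}$ be a family of full embeddings $\theta_{xy}:\mathcal{C}_{xy}\to\mathcal{B}_{xy}$, indexed by pairs $(x,y)$ of objects of $\mathcal{B}$, with left adjoints $\psi=\{\psi_{xy}\}$. Omit $\theta$ from the notation, and denote the unit of the adjunction by $\eta:1\to\psi:\mathcal{B}\to\mathcal{B}$. Further, let $\mathcal{A}_{xy}\subset\mathcal{B}_{xy}$ be a locally strongly generating class of 1-cells in $\mathcal{B}$ and let $\mathcal{D}_{xy}\subset\mathcal{C}_{xy}$ be a locally strongly cogenerating class of 1-cells in $\mathcal{C}$. Then, in order that there should exist a biclosed bicategory structure on $\mathcal{C}$ for which $\psi:\mathcal{B}\to\mathcal{C}$ admits enrichment to a strong map of biclosed bicategories, it is sufficient that at least one of the following conditions 1--6 hold, where in each condition the displayed morphism(s) are required to be isomorphisms for all objects $x,y,z$ and all 1-cells of the indicated kinds. 1. (a) $\eta: C/B\to\psi(C/B)$ for all $C\in\mathcal{C}_{xz}$, $B\in\mathcal{B}_{xy}$; and (b) $\eta: B\backslash C\to\psi(B\backslash C)$ for all $B\in\mathcal{B}_{yz}$, $C\in\mathcal{C}_{xz}$. 2. (a) $\eta: D/A\to\psi(D/A)$ for all $D\in\mathcal{D}_{xz}$, $A\in\mathcal{A}_{xy}$; and (b) $\eta: A\backslash D\to\psi(A\backslash D)$ for all $A\in\mathcal{A}_{yz}$,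 $D\in\mathcal{D}_{xz}$. 3. (a) $\eta\backslash 1:\psi B\backslash C\to B\backslash C$ for all $B\in\mathcal{B}_{yz}$, $C\in\mathcal{C}_{xz}$; and (b) $1/\eta: C/\psi B\to C/B$ for all $C\in\mathcal{C}_{xz}$, $B\in\mathcal{B}_{xy}$. 4. (a) $\psi(\eta\circ 1):\psi(B\circ B')\to\psi(\psi B\circ B')$ for all $B\in\mathcal{B}_{yz}$, $B'\in\mathcal{B}_{xy}$; and (b) $\psi(1\circ\eta):\psi(B'\circ B)\to\psi(B'\circ\psi B)$ for all $B'\in\mathcal{B}_{yz}$, $B\in\mathcal{B}_{xy}$. 5. (a) $\psi(\eta\circ 1):\psi(B\circ A)\to\psi(\psi B\circ A)$ for all $B\in\mathcal{B}_{yz}$, $A\in\mathcal{A}_{xy}$; and (b) $\psi(1\circ\eta):\psi(A\circ B)\to\psi(A\circ\psi B)$ for all $A\in\mathcal{A}_{yz}$, $B\in\mathcal{B}_{xy}$. 6. $\psi(\eta\circ\eta):\psi(B\circ B')\to\psi(\psi B\circ\psi B')$ for all $B\in\mathcal{B}_{yz}$, $B'\in\mathcal{B}_{xy}$.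
   Context: All categorical algebra is relative to a fixed complete and cocomplete symmetric monoidal closed category $\mathcal{V}=(\mathcal{V},\otimes,I,[-,-],\ldots)$: "category", "functor", "natural", "full embedding" (fully faithful), "adjoint" mean the $\mathcal{V}$-enriched notions. A bicategory $\mathcal{B}$ consists of a class of objects $x,y,z,\ldots$, for each pair a $\mathcal{V}$-category $\mathcal{B}_{xy}$ (whose objects are the 1-cells from $x$ to $y$), composition $\mathcal{V}$-functors $\circ:\mathcal{B}_{yz}\otimes\mathcal{B}_{xy}\to\mathcal{B}_{xz}$, identity 1-cells $I\in\mathcal{B}_{xx}$, and $\mathcal{V}$-natural associativity and unit isomorphisms satisfying the usual coherence axioms. It is biclosed if there are functors $-/-:\mathcal{B}_{xz}\otimes\mathcal{B}_{xy}^{\mathrm{op}}\to\mathcal{B}_{yz}$ and $-\backslash-:\mathcal{B}_{yz}^{\mathrm{op}}\otimes\mathcal{B}_{xz}\to\mathcal{B}_{xy}$ with $\mathcal{V}$-natural isomorphisms $\mathcal{B}_{xz}(A\circ B,C)\cong\mathcal{B}_{xy}(B,A\backslash C)\cong\mathcal{B}_{yz}(A,C/B)$. The family $\mathcal{C}=\{\mathcal{C}_{xy}\}$ is a family of $\mathcal{V}$-categories indexed by pairs of objects of $\mathcal{B}$; a biclosed bicategory structure on $\mathcal{C}$ has the same objects as $\mathcal{B}$ and hom-categories $\mathcal{C}_{xy}$, and $\psi$ is the identity on objects. A morphism of bicategories $\psi=(\psi,\tilde\psi,\psi^\circ):\mathcal{B}\to\mathcal{C}$ (in the sense of Bénabou,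 i.e. a lax functor) has comparison maps $\tilde\psi:\psi B\circ\psi B'\to\psi(B\circ B')$ and $\psi^\circ:I\to\psi I$, natural and coherent; it is called strong if each of these comparison maps is an isomorphism. A class $\mathcal{A}_{xy}\subset\mathcal{B}_{xy}$ is locally strongly generating if, for every $x,y$, the functors $\mathcal{B}_{xy}(A,-)$, $A\in\mathcal{A}_{xy}$, jointly reflect isomorphisms; a class $\mathcal{D}_{xy}\subset\mathcal{C}_{xy}$ is locally strongly cogenerating if, for every $x,y$, the functors $\mathcal{C}_{xy}(-,D)$, $D\in\mathcal{D}_{xy}$, jointly reflect isomorphisms. *)

theory Defs
  imports Main "HOL-Library.Equipollence"
begin

section \<open>Ordinary categories\<close>

record ('o, 'm) cat =
  Ob :: "'o set"
  Arr :: "'m set"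
  Dom :: "'m \<Rightarrow> 'o"
  Cod :: "'m \<Rightarrow> 'o"
  Idn :: "'o \<Rightarrow> 'm" ("\<one>\<index>")
  Cmp :: "'m \<Rightarrow> 'm \<Rightarrow> 'm" (infixr "\<cdot>\<index>" 70)

definition Hom :: "('o, 'm, 'r) cat_scheme \<Rightarrow> 'o \<Rightarrow> 'o \<Rightarrow> 'm set" where
  "Hom C a b = {f \<in> Arr C. Dom C f = a \<and> Cod C f = b}"

locale category =
  fixes C :: "('o, 'm, 'r) cat_scheme" (structure)
  assumes Dom_in: "f \<in> Arr C \<Longrightarrow> Dom C f \<in> Ob C"
    and Cod_in: "f \<in> Arr C \<Longrightarrow> Cod C f \<in> Ob C"
    and Idn_in: "a \<in> Ob C \<Longrightarrow> \<one> a \<in> Hom C a a"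
    and Cmp_in: "\<lbrakk>f \<in> Hom C a b; g \<in> Hom C b c\<rbrakk> \<Longrightarrow> g \<cdot> f \<in> Hom C a c"
    and Cmp_Idn: "f \<in> Hom C a b \<Longrightarrow> f \<cdot> \<one> a = f"
    and Idn_Cmp: "f \<in> Hom C a b \<Longrightarrow> \<one> b \<cdot> f = f"
    and Cmp_assoc:
      "\<lbrakk>f \<in> Hom C a b; g \<in> Hom C b c; h \<in> Hom C c d\<rbrakk> \<Longrightarrow> (h \<cdot> g) \<cdot> f = h \<cdot> (g \<cdot> f)"

definition inverse_arrows :: "('o, 'm, 'r) cat_scheme \<Rightarrow> 'm \<Rightarrow> 'm \<Rightarrow> bool" where
  "inverse_arrows C f g \<longleftrightarrow> f \<in> Arr C \<and> g \<in> Hom C (Cod C f) (Dom C f) \<and>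
     g \<cdot>\<^bsub>C\<^esub> f = \<one>\<^bsub>C\<^esub> (Dom C f) \<and> f \<cdot>\<^bsub>C\<^esub> g = \<one>\<^bsub>C\<^esub> (Cod C f)"

definition iso :: "('o, 'm, 'r) cat_scheme \<Rightarrow> 'm \<Rightarrow> bool" where
  "iso C f \<longleftrightarrow> (\<exists>g. inverse_arrows C f g)"

definition inv_arr :: "('o, 'm, 'r) cat_scheme \<Rightarrow> 'm \<Rightarrow> 'm" where
  "inv_arr C f = (THE g. inverse_arrows C f g)"

subsection \<open>Small limits and colimits\<close>

definition is_diagram ::
    "('j, 'k, 'q) cat_scheme \<Rightarrow> ('o, 'm, 'r) cat_scheme \<Rightarrow> ('j \<Rightarrow> 'o) \<Rightarrow> ('k \<Rightarrow> 'm) \<Rightarrow> bool" where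
  "is_diagram J C Do Dm \<longleftrightarrow>
     (\<forall>j\<in>Ob J. Do j \<in> Ob C) \<and>
     (\<forall>u\<in>Arr J. Dm u \<in> Hom C (Do (Dom J u)) (Do (Cod J u))) \<and>
     (\<forall>j\<in>Ob J. Dm (\<one>\<^bsub>J\<^esub> j) = \<one>\<^bsub>C\<^esub> (Do j)) \<and>
     (\<forall>u\<in>Arr J. \<forall>v\<in>Arr J. Dom J v = Cod J u \<longrightarrow> Dm (v \<cdot>\<^bsub>J\<^esub> u) = Dm v \<cdot>\<^bsub>C\<^esub> Dm u)"

definition is_cone ::
    "('j, 'k, 'q) cat_scheme \<Rightarrow> ('o, 'm, 'r) cat_scheme \<Rightarrow> ('j \<Rightarrow> 'o) \<Rightarrow> ('k \<Rightarrow> 'm) \<Rightarrow>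
     'o \<Rightarrow> ('j \<Rightarrow> 'm) \<Rightarrow> bool" where
  "is_cone J C Do Dm a p \<longleftrightarrow> a \<in> Ob C \<and> (\<forall>j\<in>Ob J. p j \<in> Hom C a (Do j)) \<and>
     (\<forall>u\<in>Arr J. Dm u \<cdot>\<^bsub>C\<^esub> p (Dom J u) = p (Cod J u))"

definition is_cocone ::
    "('j, 'k, 'q) cat_scheme \<Rightarrow> ('o, 'm, 'r) cat_scheme \<Rightarrow> ('j \<Rightarrow> 'o) \<Rightarrow> ('k \<Rightarrow> 'm) \<Rightarrow>
     'o \<Rightarrow> ('j \<Rightarrow> 'm) \<Rightarrow> bool" where
  "is_cocone J C Do Dm a p \<longleftrightarrow> a \<in> Ob C \<and> (\<forall>j\<in>Ob J. p j \<in> Hom C (Do j) a) \<and>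
     (\<forall>u\<in>Arr J. p (Cod J u) \<cdot>\<^bsub>C\<^esub> Dm u = p (Dom J u))"

definition is_limit where
  "is_limit J C Do Dm a p \<longleftrightarrow> is_cone J C Do Dm a p \<and>
     (\<forall>b q. is_cone J C Do Dm b q \<longrightarrow>
        (\<exists>!h. h \<in> Hom C b a \<and> (\<forall>j\<in>Ob J. p j \<cdot>\<^bsub>C\<^esub> h = q j)))"

definition is_colimit where
  "is_colimit J C Do Dm a p \<longleftrightarrow> is_cocone J C Do Dm a p \<and>
     (\<forall>b q. is_cocone J C Do Dm b q \<longrightarrow>
        (\<exists>!h. h \<in> Hom C a b \<and> (\<forall>j\<in>Ob J. h \<cdot>\<^bsub>C\<^esub> p j = q j)))"

text \<open>Smallness is relative to a universe, given as a type \<open>'s\<close>: a set is small when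
  its cardinality is strictly below that of \<open>'s\<close>. Every small category is then
  isomorphic to one whose objects and arrows are elements of \<open>'s\<close>.\<close>

definition small_category :: "('s, 's) cat \<Rightarrow> bool" where
  "small_category J \<longleftrightarrow> category J \<and>
     Ob J \<prec> (UNIV :: 's set) \<and> Arr J \<prec> (UNIV :: 's set)"

definition complete :: "'s itself \<Rightarrow> ('o, 'm, 'r) cat_scheme \<Rightarrow> bool" where
  "complete _ C \<longleftrightarrow> (\<forall>(J :: ('s, 's) cat) Do Dm.
     small_category J \<and> is_diagram J C Do Dm \<longrightarrow> (\<exists>a p. is_limit J C Do Dm a p))"

definition cocomplete :: "'s itself \<Rightarrow> ('o, 'm, 'r) cat_scheme \<Rightarrow> bool" where
  "cocomplete _ C \<longleftrightarrow> (\<forall>(J :: ('s, 's) cat) Do Dm.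
     small_category J \<and> is_diagram J C Do Dm \<longrightarrow> (\<exists>a p. is_colimit J C Do Dm a p))"


section \<open>Symmetric monoidal closed categories\<close>

text \<open>The components of the structure are
  \<open>assoc a b c : (a \<otimes> b) \<otimes> c \<rightarrow> a \<otimes> (b \<otimes> c)\<close>, \<open>lunit a : \<I> \<otimes> a \<rightarrow> a\<close>,
  \<open>runit a : a \<otimes> \<I> \<rightarrow> a\<close>, \<open>braid a b : a \<otimes> b \<rightarrow> b \<otimes> a\<close> and
  \<open>ev b c : [b, c] \<otimes> b \<rightarrow> c\<close>.
  The symbol \<open>\<otimes>\<close> is the tensor product of objects, \<open>\<odot>\<close> that of arrows.\<close>

record ('o, 'm) smc = "('o, 'm) cat" +
  tensor_ob :: "'o \<Rightarrow> 'o \<Rightarrow> 'o" (infixl "\<otimes>\<index>" 80)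
  tensor_arr :: "'m \<Rightarrow> 'm \<Rightarrow> 'm" (infixl "\<odot>\<index>" 80)
  tensor_unit :: "'o" ("\<I>\<index>")
  assoc :: "'o \<Rightarrow> 'o \<Rightarrow> 'o \<Rightarrow> 'm"
  lunit :: "'o \<Rightarrow> 'm"
  runit :: "'o \<Rightarrow> 'm"
  braid :: "'o \<Rightarrow> 'o \<Rightarrow> 'm"
  ihom :: "'o \<Rightarrow> 'o \<Rightarrow> 'o"
  ev :: "'o \<Rightarrow> 'o \<Rightarrow> 'm"

locale symmetric_monoidal_closed_category =
  category V for V :: "('o, 'm) smc" (structure) +
  assumes tensor_ob_in: "\<lbrakk>a \<in> Ob V; b \<in> Ob V\<rbrakk> \<Longrightarrow> a \<otimes> b \<in> Ob V"
    and tensor_arr_in: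
      "\<lbrakk>f \<in> Hom V a a'; g \<in> Hom V b b'\<rbrakk> \<Longrightarrow> f \<odot> g \<in> Hom V (a \<otimes> b) (a' \<otimes> b')"
    and tensor_Idn: "\<lbrakk>a \<in> Ob V; b \<in> Ob V\<rbrakk> \<Longrightarrow> \<one> a \<odot> \<one> b = \<one> (a \<otimes> b)"
    and tensor_Cmp:
      "\<lbrakk>f \<in> Hom V a a'; f' \<in> Hom V a' a''; g \<in> Hom V b b'; g' \<in> Hom V b' b''\<rbrakk> \<Longrightarrow>
         (f' \<cdot> f) \<odot> (g' \<cdot> g) = (f' \<odot> g') \<cdot> (f \<odot> g)"
    and unit_in: "\<I> \<in> Ob V"
    and assoc_in: "\<lbrakk>a \<in> Ob V; b \<in> Ob V; c \<in> Ob V\<rbrakk> \<Longrightarrow>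
         assoc V a b c \<in> Hom V (a \<otimes> b \<otimes> c) (a \<otimes> (b \<otimes> c))"
    and assoc_iso: "\<lbrakk>a \<in> Ob V; b \<in> Ob V; c \<in> Ob V\<rbrakk> \<Longrightarrow> iso V (assoc V a b c)"
    and assoc_nat: "\<lbrakk>f \<in> Hom V a a'; g \<in> Hom V b b'; h \<in> Hom V c c'\<rbrakk> \<Longrightarrow>
         assoc V a' b' c' \<cdot> (f \<odot> g \<odot> h) = (f \<odot> (g \<odot> h)) \<cdot> assoc V a b c"
    and lunit_in: "a \<in> Ob V \<Longrightarrow> lunit V a \<in> Hom V (\<I> \<otimes> a) a"
    and lunit_iso: "a \<in> Ob V \<Longrightarrow> iso V (lunit V a)"
    and lunit_nat: "f \<in> Hom V a a' \<Longrightarrow> lunit V a' \<cdot> (\<one> \<I> \<odot> f) = f \<cdot> lunit V a"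
    and runit_in: "a \<in> Ob V \<Longrightarrow> runit V a \<in> Hom V (a \<otimes> \<I>) a"
    and runit_iso: "a \<in> Ob V \<Longrightarrow> iso V (runit V a)"
    and runit_nat: "f \<in> Hom V a a' \<Longrightarrow> runit V a' \<cdot> (f \<odot> \<one> \<I>) = f \<cdot> runit V a"
    and pentagon: "\<lbrakk>a \<in> Ob V; b \<in> Ob V; c \<in> Ob V; d \<in> Ob V\<rbrakk> \<Longrightarrow>
         assoc V a b (c \<otimes> d) \<cdot> assoc V (a \<otimes> b) c d =
         (\<one> a \<odot> assoc V b c d) \<cdot> assoc V a (b \<otimes> c) d \<cdot> (assoc V a b c \<odot> \<one> d)"
    and triangle: "\<lbrakk>a \<in> Ob V; b \<in> Ob V\<rbrakk> \<Longrightarrow>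
         (\<one> a \<odot> lunit V b) \<cdot> assoc V a \<I> b = runit V a \<odot> \<one> b"
    and braid_in: "\<lbrakk>a \<in> Ob V; b \<in> Ob V\<rbrakk> \<Longrightarrow> braid V a b \<in> Hom V (a \<otimes> b) (b \<otimes> a)"
    and braid_nat: "\<lbrakk>f \<in> Hom V a a'; g \<in> Hom V b b'\<rbrakk> \<Longrightarrow>
         braid V a' b' \<cdot> (f \<odot> g) = (g \<odot> f) \<cdot> braid V a b"
    and braid_sym: "\<lbrakk>a \<in> Ob V; b \<in> Ob V\<rbrakk> \<Longrightarrow> braid V b a \<cdot> braid V a b = \<one> (a \<otimes> b)"
    and braid_unit: "a \<in> Ob V \<Longrightarrow> lunit V a \<cdot> braid V a \<I> = runit V a"
    and hexagon: "\<lbrakk>a \<in> Ob V; b \<in> Ob V; c \<in> Ob V\<rbrakk> \<Longrightarrow>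
         assoc V b c a \<cdot> braid V a (b \<otimes> c) \<cdot> assoc V a b c =
         (\<one> b \<odot> braid V a c) \<cdot> assoc V b a c \<cdot> (braid V a b \<odot> \<one> c)"
    and ihom_in: "\<lbrakk>b \<in> Ob V; c \<in> Ob V\<rbrakk> \<Longrightarrow> ihom V b c \<in> Ob V"
    and ev_in: "\<lbrakk>b \<in> Ob V; c \<in> Ob V\<rbrakk> \<Longrightarrow> ev V b c \<in> Hom V (ihom V b c \<otimes> b) c"
    and closed: "\<lbrakk>a \<in> Ob V; b \<in> Ob V; c \<in> Ob V; f \<in> Hom V (a \<otimes> b) c\<rbrakk> \<Longrightarrow>
         \<exists>!g. g \<in> Hom V a (ihom V b c) \<and> ev V b c \<cdot> (g \<odot> \<one> b) = f"

text \<open>The arrow \<open>a \<rightarrow> [b, c]\<close> corresponding to \<open>f : a \<otimes> b \<rightarrow> c\<close>.\<close>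

definition curry_arr :: "('o, 'm) smc \<Rightarrow> 'o \<Rightarrow> 'o \<Rightarrow> 'o \<Rightarrow> 'm \<Rightarrow> 'm" where
  "curry_arr V a b c f =
     (THE g. g \<in> Hom V a (ihom V b c) \<and> ev V b c \<cdot>\<^bsub>V\<^esub> (g \<odot>\<^bsub>V\<^esub> \<one>\<^bsub>V\<^esub> b) = f)"

text \<open>The interchange \<open>(p \<otimes> q) \<otimes> (r \<otimes> s) \<rightarrow> (p \<otimes> r) \<otimes> (q \<otimes> s)\<close>.\<close>

definition interchange :: "('o, 'm) smc \<Rightarrow> 'o \<Rightarrow> 'o \<Rightarrow> 'o \<Rightarrow> 'o \<Rightarrow> 'm" where
  "interchange V p q r s =
     inv_arr V (assoc V p r (q \<otimes>\<^bsub>V\<^esub> s)) \<cdot>\<^bsub>V\<^esub>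
     (\<one>\<^bsub>V\<^esub> p \<odot>\<^bsub>V\<^esub> (assoc V r q s \<cdot>\<^bsub>V\<^esub> (braid V q r \<odot>\<^bsub>V\<^esub> \<one>\<^bsub>V\<^esub> s) \<cdot>\<^bsub>V\<^esub>
                  inv_arr V (assoc V q r s))) \<cdot>\<^bsub>V\<^esub>
     assoc V p q (r \<otimes>\<^bsub>V\<^esub> s)"


section \<open>Enriched categories, functors and natural transformations\<close>

text \<open>\<open>VId X a : \<I> \<rightarrow> X(a, a)\<close> and
  \<open>VCmp X a b c : X(b, c) \<otimes> X(a, b) \<rightarrow> X(a, c)\<close>.\<close>

record ('a, 'o, 'm) vcat =
  VOb :: "'a set"
  VHom :: "'a \<Rightarrow> 'a \<Rightarrow> 'o"
  VId :: "'a \<Rightarrow> 'm"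
  VCmp :: "'a \<Rightarrow> 'a \<Rightarrow> 'a \<Rightarrow> 'm"

locale vcategory =
  fixes V :: "('o, 'm) smc" (structure) and X :: "('a, 'o, 'm) vcat"
  assumes VHom_in: "\<lbrakk>a \<in> VOb X; b \<in> VOb X\<rbrakk> \<Longrightarrow> VHom X a b \<in> Ob V"
    and VId_in: "a \<in> VOb X \<Longrightarrow> VId X a \<in> Hom V \<I> (VHom X a a)"
    and VCmp_in: "\<lbrakk>a \<in> VOb X; b \<in> VOb X; c \<in> VOb X\<rbrakk> \<Longrightarrow>
         VCmp X a b c \<in> Hom V (VHom X b c \<otimes> VHom X a b) (VHom X a c)"
    and VCmp_assoc: "\<lbrakk>a \<in> VOb X; b \<in> VOb X; c \<in> VOb X; d \<in> VOb X\<rbrakk> \<Longrightarrow>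
         VCmp X a b d \<cdot> (VCmp X b c d \<odot> \<one> (VHom X a b)) =
         VCmp X a c d \<cdot> (\<one> (VHom X c d) \<odot> VCmp X a b c) \<cdot>
           assoc V (VHom X c d) (VHom X b c) (VHom X a b)"
    and VCmp_VId_left: "\<lbrakk>a \<in> VOb X; b \<in> VOb X\<rbrakk> \<Longrightarrow>
         VCmp X a b b \<cdot> (VId X b \<odot> \<one> (VHom X a b)) = lunit V (VHom X a b)"
    and VCmp_VId_right: "\<lbrakk>a \<in> VOb X; b \<in> VOb X\<rbrakk> \<Longrightarrow>
         VCmp X a a b \<cdot> (\<one> (VHom X a b) \<odot> VId X a) = runit V (VHom X a b)"

record ('a, 'b, 'm) vfun =
  FO :: "'a \<Rightarrow> 'b"
  FM :: "'a \<Rightarrow> 'a \<Rightarrow> 'm"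

locale vfunctor =
  fixes V :: "('o, 'm) smc" (structure)
    and X :: "('a, 'o, 'm) vcat" and Y :: "('b, 'o, 'm) vcat" and F :: "('a, 'b, 'm) vfun"
  assumes FO_in: "a \<in> VOb X \<Longrightarrow> FO F a \<in> VOb Y"
    and FM_in: "\<lbrakk>a \<in> VOb X; b \<in> VOb X\<rbrakk> \<Longrightarrow>
         FM F a b \<in> Hom V (VHom X a b) (VHom Y (FO F a) (FO F b))"
    and FM_VId: "a \<in> VOb X \<Longrightarrow> FM F a a \<cdot> VId X a = VId Y (FO F a)"
    and FM_VCmp: "\<lbrakk>a \<in> VOb X; b \<in> VOb X; c \<in> VOb X\<rbrakk> \<Longrightarrow>
         FM F a c \<cdot> VCmp X a b c =
         VCmp Y (FO F a) (FO F b) (FO F c) \<cdot> (FM F b c \<odot> FM F a b)"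

definition fully_faithful :: "('o, 'm) smc \<Rightarrow> ('a, 'o, 'm) vcat \<Rightarrow> ('a, 'b, 'm) vfun \<Rightarrow> bool" where
  "fully_faithful V X F \<longleftrightarrow> (\<forall>a\<in>VOb X. \<forall>b\<in>VOb X. iso V (FM F a b))"

subsection \<open>The underlying category of an enriched category\<close>

text \<open>Its arrows \<open>a \<rightarrow> b\<close> (called cells) are the arrows \<open>\<I> \<rightarrow> X(a, b)\<close> of \<open>V\<close>.\<close>

definition cell :: "('o, 'm) smc \<Rightarrow> ('a, 'o, 'm) vcat \<Rightarrow> 'a \<Rightarrow> 'a \<Rightarrow> 'm set" where
  "cell V X a b = Hom V \<I>\<^bsub>V\<^esub> (VHom X a b)"

definition pair_cell :: "('o, 'm) smc \<Rightarrow> 'm \<Rightarrow> 'm \<Rightarrow> 'm" where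
  "pair_cell V f g = (f \<odot>\<^bsub>V\<^esub> g) \<cdot>\<^bsub>V\<^esub> inv_arr V (lunit V \<I>\<^bsub>V\<^esub>)"

definition cell_comp ::
    "('o, 'm) smc \<Rightarrow> ('a, 'o, 'm) vcat \<Rightarrow> 'a \<Rightarrow> 'a \<Rightarrow> 'a \<Rightarrow> 'm \<Rightarrow> 'm \<Rightarrow> 'm" where
  "cell_comp V X a b c g f = VCmp X a b c \<cdot>\<^bsub>V\<^esub> pair_cell V g f"

definition cell_iso :: "('o, 'm) smc \<Rightarrow> ('a, 'o, 'm) vcat \<Rightarrow> 'a \<Rightarrow> 'a \<Rightarrow> 'm \<Rightarrow> bool" where
  "cell_iso V X a b f \<longleftrightarrow> f \<in> cell V X a b \<and>
     (\<exists>g \<in> cell V X b a. cell_comp V X a b a g f = VId X a \<and> cell_comp V X b a b f g = VId X b)"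

definition map_cell :: "('o, 'm) smc \<Rightarrow> ('a, 'b, 'm) vfun \<Rightarrow> 'a \<Rightarrow> 'a \<Rightarrow> 'm \<Rightarrow> 'm" where
  "map_cell V F a b f = FM F a b \<cdot>\<^bsub>V\<^esub> f"

text \<open>The value \<open>F(f, g)\<close> of a functor of two variables
  at \<open>f : a \<rightarrow> a'\<close> and \<open>g : b \<rightarrow> b'\<close>.\<close>

definition map_cell2 ::
    "('o, 'm) smc \<Rightarrow> ('a \<times> 'b, 'c, 'm) vfun \<Rightarrow> 'a \<Rightarrow> 'a \<Rightarrow> 'b \<Rightarrow> 'b \<Rightarrow> 'm \<Rightarrow> 'm \<Rightarrow> 'm" where
  "map_cell2 V F a a' b b' f g = map_cell V F (a, b) (a', b') (pair_cell V f g)"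

text \<open>\<open>X(d, f) : X(d, a) \<rightarrow> X(d, b)\<close> and \<open>X(f, d) : X(b, d) \<rightarrow> X(a, d)\<close>
  for a cell \<open>f : a \<rightarrow> b\<close>.\<close>

definition post_comp :: "('o, 'm) smc \<Rightarrow> ('a, 'o, 'm) vcat \<Rightarrow> 'a \<Rightarrow> 'a \<Rightarrow> 'a \<Rightarrow> 'm \<Rightarrow> 'm" where
  "post_comp V X d a b f =
     VCmp X d a b \<cdot>\<^bsub>V\<^esub> (f \<odot>\<^bsub>V\<^esub> \<one>\<^bsub>V\<^esub> (VHom X d a)) \<cdot>\<^bsub>V\<^esub> inv_arr V (lunit V (VHom X d a))"

definition pre_comp :: "('o, 'm) smc \<Rightarrow> ('a, 'o, 'm) vcat \<Rightarrow> 'a \<Rightarrow> 'a \<Rightarrow> 'a \<Rightarrow> 'm \<Rightarrow> 'm" where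
  "pre_comp V X d a b f =
     VCmp X a b d \<cdot>\<^bsub>V\<^esub> (\<one>\<^bsub>V\<^esub> (VHom X b d) \<odot>\<^bsub>V\<^esub> f) \<cdot>\<^bsub>V\<^esub> inv_arr V (runit V (VHom X b d))"

subsection \<open>Natural transformations and adjunctions\<close>

text \<open>\<open>F\<close> and \<open>G\<close> are meant to be functors from \<open>X\<close> to \<open>Y\<close>;
  this is not repeated among the assumptions.\<close>

locale vnatural =
  fixes V :: "('o, 'm) smc" (structure)
    and X :: "('a, 'o, 'm) vcat" and Y :: "('b, 'o, 'm) vcat"
    and F G :: "('a, 'b, 'm) vfun" and t :: "'a \<Rightarrow> 'm"
  assumes component_in: "a \<in> VOb X \<Longrightarrow> t a \<in> cell V Y (FO F a) (FO G a)"
    and naturality: "\<lbrakk>a \<in> VOb X; b \<in> VOb X\<rbrakk> \<Longrightarrow>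
         VCmp Y (FO F a) (FO F b) (FO G b) \<cdot> (t b \<odot> FM F a b) \<cdot> inv_arr V (lunit V (VHom X a b)) =
         VCmp Y (FO F a) (FO G a) (FO G b) \<cdot> (FM G a b \<odot> t a) \<cdot> inv_arr V (runit V (VHom X a b))"

locale vnatural_iso = vnatural +
  assumes component_iso: "a \<in> VOb X \<Longrightarrow> cell_iso V Y (FO F a) (FO G a) (t a)"

definition vfun_id :: "('o, 'm) smc \<Rightarrow> ('a, 'o, 'm) vcat \<Rightarrow> ('a, 'a, 'm) vfun" where
  "vfun_id V X = \<lparr>FO = \<lambda>a. a, FM = \<lambda>a b. \<one>\<^bsub>V\<^esub> (VHom X a b)\<rparr>"

definition vfun_comp ::
    "('o, 'm) smc \<Rightarrow> ('b, 'c, 'm) vfun \<Rightarrow> ('a, 'b, 'm) vfun \<Rightarrow> ('a, 'c, 'm) vfun" where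
  "vfun_comp V G F =
     \<lparr>FO = \<lambda>a. FO G (FO F a), FM = \<lambda>a b. FM G (FO F a) (FO F b) \<cdot>\<^bsub>V\<^esub> FM F a b\<rparr>"

abbreviation reflection ::
    "('x \<Rightarrow> 'x \<Rightarrow> ('c, 'b, 'm) vfun) \<Rightarrow> ('x \<Rightarrow> 'x \<Rightarrow> ('b, 'c, 'm) vfun) \<Rightarrow> 'x \<Rightarrow> 'x \<Rightarrow> 'b \<Rightarrow> 'b" where
  "reflection \<theta> \<psi> x y b \<equiv> FO (\<theta> x y) (FO (\<psi> x y) b)"

text \<open>\<open>L : X \<rightarrow> Y\<close> is left adjoint to \<open>R : Y \<rightarrow> X\<close> with unit \<open>\<eta>\<close> and counit \<open>\<epsilon>\<close>.\<close>

locale vadjunction =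
  left: vfunctor V X Y L + right: vfunctor V Y X R +
  unit: vnatural V X X "vfun_id V X" "vfun_comp V R L" \<eta> +
  counit: vnatural V Y Y "vfun_comp V L R" "vfun_id V Y" \<epsilon>
  for V :: "('o, 'm) smc" (structure)
    and X :: "('a, 'o, 'm) vcat" and Y :: "('b, 'o, 'm) vcat"
    and L :: "('a, 'b, 'm) vfun" and R :: "('b, 'a, 'm) vfun"
    and \<eta> :: "'a \<Rightarrow> 'm" and \<epsilon> :: "'b \<Rightarrow> 'm" +
  assumes triangle_left: "a \<in> VOb X \<Longrightarrow>
      cell_comp V Y (FO L a) (FO L (FO R (FO L a))) (FO L a)
        (\<epsilon> (FO L a)) (map_cell V L a (FO R (FO L a)) (\<eta> a)) = VId Y (FO L a)"
    and triangle_right: "c \<in> VOb Y \<Longrightarrow>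
      cell_comp V X (FO R c) (FO R (FO L (FO R c))) (FO R c)
        (map_cell V R (FO L (FO R c)) c (\<epsilon> c)) (\<eta> (FO R c)) = VId X (FO R c)"

subsection \<open>Opposites, tensor products and hom functors\<close>

definition vop :: "('o, 'm) smc \<Rightarrow> ('a, 'o, 'm) vcat \<Rightarrow> ('a, 'o, 'm) vcat" where
  "vop V X =
     \<lparr>VOb = VOb X,
      VHom = \<lambda>a b. VHom X b a,
      VId = VId X,
      VCmp = \<lambda>a b c. VCmp X c b a \<cdot>\<^bsub>V\<^esub> braid V (VHom X c b) (VHom X b a)\<rparr>"

definition vtensor ::
    "('o, 'm) smc \<Rightarrow> ('a, 'o, 'm) vcat \<Rightarrow> ('b, 'o, 'm) vcat \<Rightarrow> ('a \<times> 'b, 'o, 'm) vcat" where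
  "vtensor V X Y =
     \<lparr>VOb = VOb X \<times> VOb Y,
      VHom = \<lambda>(a, b) (a', b'). VHom X a a' \<otimes>\<^bsub>V\<^esub> VHom Y b b',
      VId = \<lambda>(a, b). pair_cell V (VId X a) (VId Y b),
      VCmp = \<lambda>(a, b) (a', b') (a'', b'').
        (VCmp X a a' a'' \<odot>\<^bsub>V\<^esub> VCmp Y b b' b'') \<cdot>\<^bsub>V\<^esub>
        interchange V (VHom X a' a'') (VHom Y b' b'') (VHom X a a') (VHom Y b b')\<rparr>"

text \<open>The functor \<open>X\<^sup>o\<^sup>p \<rightarrow> Y\<^sup>o\<^sup>p\<close> induced by \<open>F : X \<rightarrow> Y\<close>. If \<open>X\<close> is a tensor product, it is
  also a functor on the tensor product of the opposites of the factors.\<close>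

definition vfun_op :: "('a, 'b, 'm) vfun \<Rightarrow> ('a, 'b, 'm) vfun" where
  "vfun_op F = \<lparr>FO = FO F, FM = \<lambda>a b. FM F b a\<rparr>"

definition vfun_tensor ::
    "('o, 'm) smc \<Rightarrow> ('a, 'c, 'm) vfun \<Rightarrow> ('b, 'd, 'm) vfun \<Rightarrow> ('a \<times> 'b, 'c \<times> 'd, 'm) vfun" where
  "vfun_tensor V F G =
     \<lparr>FO = \<lambda>(a, b). (FO F a, FO G b),
      FM = \<lambda>(a, b) (a', b'). FM F a a' \<odot>\<^bsub>V\<^esub> FM G b b'\<rparr>"

definition vfun_assoc ::
    "('o, 'm) smc \<Rightarrow> ('a, 'o, 'm) vcat \<Rightarrow> ('b, 'o, 'm) vcat \<Rightarrow> ('c, 'o, 'm) vcat \<Rightarrow>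
     (('a \<times> 'b) \<times> 'c, 'a \<times> ('b \<times> 'c), 'm) vfun" where
  "vfun_assoc V X Y Z =
     \<lparr>FO = \<lambda>((a, b), c). (a, (b, c)),
      FM = \<lambda>((a, b), c) ((a', b'), c'). assoc V (VHom X a a') (VHom Y b b') (VHom Z c c')\<rparr>"

definition vfun_swap ::
    "('o, 'm) smc \<Rightarrow> ('a, 'o, 'm) vcat \<Rightarrow> ('b, 'o, 'm) vcat \<Rightarrow> ('a \<times> 'b, 'b \<times> 'a, 'm) vfun" where
  "vfun_swap V X Y =
     \<lparr>FO = \<lambda>(a, b). (b, a),
      FM = \<lambda>(a, b) (a', b'). braid V (VHom X a a') (VHom Y b b')\<rparr>"

text \<open>The partial functors \<open>F(a, -)\<close> and \<open>F(-, b)\<close> of \<open>F : X \<otimes> Y \<rightarrow> Z\<close>.\<close>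

definition vfun_fix_left ::
    "('o, 'm) smc \<Rightarrow> ('a, 'o, 'm) vcat \<Rightarrow> ('b, 'o, 'm) vcat \<Rightarrow> ('a \<times> 'b, 'c, 'm) vfun \<Rightarrow>
     'a \<Rightarrow> ('b, 'c, 'm) vfun" where
  "vfun_fix_left V X Y F a =
     \<lparr>FO = \<lambda>b. FO F (a, b),
      FM = \<lambda>b b'. FM F (a, b) (a, b') \<cdot>\<^bsub>V\<^esub> (VId X a \<odot>\<^bsub>V\<^esub> \<one>\<^bsub>V\<^esub> (VHom Y b b')) \<cdot>\<^bsub>V\<^esub>
                  inv_arr V (lunit V (VHom Y b b'))\<rparr>"

definition vfun_fix_right ::
    "('o, 'm) smc \<Rightarrow> ('a, 'o, 'm) vcat \<Rightarrow> ('b, 'o, 'm) vcat \<Rightarrow> ('a \<times> 'b, 'c, 'm) vfun \<Rightarrow>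
     'b \<Rightarrow> ('a, 'c, 'm) vfun" where
  "vfun_fix_right V X Y F b =
     \<lparr>FO = \<lambda>a. FO F (a, b),
      FM = \<lambda>a a'. FM F (a, b) (a', b) \<cdot>\<^bsub>V\<^esub> (\<one>\<^bsub>V\<^esub> (VHom X a a') \<odot>\<^bsub>V\<^esub> VId Y b) \<cdot>\<^bsub>V\<^esub>
                  inv_arr V (runit V (VHom X a a'))\<rparr>"

text \<open>\<open>V\<close> as a category enriched in itself, and the functor \<open>X(-, -) : X\<^sup>o\<^sup>p \<otimes> X \<rightarrow> V\<close>. The latter acts by
  the transpose of \<open>(X(a', a) \<otimes> X(b, b')) \<otimes> X(a, b) \<rightarrow> X(a', b')\<close>.\<close>

definition vself :: "('o, 'm) smc \<Rightarrow> ('o, 'o, 'm) vcat" where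
  "vself V =
     \<lparr>VOb = Ob V,
      VHom = ihom V,
      VId = \<lambda>a. curry_arr V \<I>\<^bsub>V\<^esub> a a (lunit V a),
      VCmp = \<lambda>a b c. curry_arr V (ihom V b c \<otimes>\<^bsub>V\<^esub> ihom V a b) a c
        (ev V b c \<cdot>\<^bsub>V\<^esub> (\<one>\<^bsub>V\<^esub> (ihom V b c) \<odot>\<^bsub>V\<^esub> ev V a b) \<cdot>\<^bsub>V\<^esub> assoc V (ihom V b c) (ihom V a b) a)\<rparr>"

definition vhom :: "('o, 'm) smc \<Rightarrow> ('a, 'o, 'm) vcat \<Rightarrow> ('a \<times> 'a, 'o, 'm) vfun" where
  "vhom V X =
     \<lparr>FO = \<lambda>(a, b). VHom X a b,
      FM = \<lambda>(a, b) (a', b').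
        curry_arr V (VHom X a' a \<otimes>\<^bsub>V\<^esub> VHom X b b') (VHom X a b) (VHom X a' b')
          (VCmp X a' b b' \<cdot>\<^bsub>V\<^esub>
           (\<one>\<^bsub>V\<^esub> (VHom X b b') \<odot>\<^bsub>V\<^esub> (VCmp X a' a b \<cdot>\<^bsub>V\<^esub> braid V (VHom X a' a) (VHom X a b))) \<cdot>\<^bsub>V\<^esub>
           assoc V (VHom X b b') (VHom X a' a) (VHom X a b) \<cdot>\<^bsub>V\<^esub>
           (braid V (VHom X a' a) (VHom X b b') \<odot>\<^bsub>V\<^esub> \<one>\<^bsub>V\<^esub> (VHom X a b)))\<rparr>"


section \<open>Enriched bicategories\<close>

text \<open>\<open>BCmp x y z : B\<^sub>y\<^sub>z \<otimes> B\<^sub>x\<^sub>y \<rightarrow> B\<^sub>x\<^sub>z\<close> is composition,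
  \<open>BAssoc w x y z ((f, g), h) : (f \<circ> g) \<circ> h \<rightarrow> f \<circ> (g \<circ> h)\<close>
  for \<open>f \<in> B\<^sub>y\<^sub>z\<close>, \<open>g \<in> B\<^sub>x\<^sub>y\<close>, \<open>h \<in> B\<^sub>w\<^sub>x\<close>, and
  \<open>BLunit x y f : I\<^sub>y \<circ> f \<rightarrow> f\<close>, \<open>BRunit x y f : f \<circ> I\<^sub>x \<rightarrow> f\<close> for \<open>f \<in> B\<^sub>x\<^sub>y\<close>.\<close>

record ('x, 'b, 'o, 'm) bicat =
  BOb :: "'x set"
  BHom :: "'x \<Rightarrow> 'x \<Rightarrow> ('b, 'o, 'm) vcat"
  BCmp :: "'x \<Rightarrow> 'x \<Rightarrow> 'x \<Rightarrow> ('b \<times> 'b, 'b, 'm) vfun"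
  BId :: "'x \<Rightarrow> 'b"
  BAssoc :: "'x \<Rightarrow> 'x \<Rightarrow> 'x \<Rightarrow> 'x \<Rightarrow> ('b \<times> 'b) \<times> 'b \<Rightarrow> 'm"
  BLunit :: "'x \<Rightarrow> 'x \<Rightarrow> 'b \<Rightarrow> 'm"
  BRunit :: "'x \<Rightarrow> 'x \<Rightarrow> 'b \<Rightarrow> 'm"

abbreviation hcomp :: "('x, 'b, 'o, 'm, 'r) bicat_scheme \<Rightarrow> 'x \<Rightarrow> 'x \<Rightarrow> 'x \<Rightarrow> 'b \<Rightarrow> 'b \<Rightarrow> 'b" where
  "hcomp B x y z f g \<equiv> FO (BCmp B x y z) (f, g)"

locale bicategory =
  fixes V :: "('o, 'm) smc" (structure) and B :: "('x, 'b, 'o, 'm, 'r) bicat_scheme"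
  assumes BHom_vcategory: "\<lbrakk>x \<in> BOb B; y \<in> BOb B\<rbrakk> \<Longrightarrow> vcategory V (BHom B x y)"
    and BCmp_vfunctor: "\<lbrakk>x \<in> BOb B; y \<in> BOb B; z \<in> BOb B\<rbrakk> \<Longrightarrow>
      vfunctor V (vtensor V (BHom B y z) (BHom B x y)) (BHom B x z) (BCmp B x y z)"
    and BId_in: "x \<in> BOb B \<Longrightarrow> BId B x \<in> VOb (BHom B x x)"
    and BAssoc_natural:
      "\<lbrakk>w \<in> BOb B; x \<in> BOb B; y \<in> BOb B; z \<in> BOb B\<rbrakk> \<Longrightarrow>
       vnatural_iso V (vtensor V (vtensor V (BHom B y z) (BHom B x y)) (BHom B w x)) (BHom B w z)
         (vfun_comp V (BCmp B w x z) (vfun_tensor V (BCmp B x y z) (vfun_id V (BHom B w x))))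
         (vfun_comp V (BCmp B w y z)
           (vfun_comp V (vfun_tensor V (vfun_id V (BHom B y z)) (BCmp B w x y))
             (vfun_assoc V (BHom B y z) (BHom B x y) (BHom B w x))))
         (BAssoc B w x y z)"
    and BLunit_natural: "\<lbrakk>x \<in> BOb B; y \<in> BOb B\<rbrakk> \<Longrightarrow>
       vnatural_iso V (BHom B x y) (BHom B x y)
         (vfun_fix_left V (BHom B y y) (BHom B x y) (BCmp B x y y) (BId B y))
         (vfun_id V (BHom B x y)) (BLunit B x y)"
    and BRunit_natural: "\<lbrakk>x \<in> BOb B; y \<in> BOb B\<rbrakk> \<Longrightarrow>
       vnatural_iso V (BHom B x y) (BHom B x y)
         (vfun_fix_right V (BHom B x y) (BHom B x x) (BCmp B x x y) (BId B x))
         (vfun_id V (BHom B x y)) (BRunit B x y)"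
    and bicat_pentagon:
      "\<lbrakk>v \<in> BOb B; w \<in> BOb B; x \<in> BOb B; y \<in> BOb B; z \<in> BOb B;
        f \<in> VOb (BHom B y z); g \<in> VOb (BHom B x y); h \<in> VOb (BHom B w x); k \<in> VOb (BHom B v w)\<rbrakk> \<Longrightarrow>
       let fg = hcomp B x y z f g; gh = hcomp B w x y g h; hk = hcomp B v w x h k;
           p1 = hcomp B v w z (hcomp B w x z fg h) k;
           p2 = hcomp B v x z fg hk;
           p3 = hcomp B v y z f (hcomp B v x y g hk);
           p4 = hcomp B v w z (hcomp B w y z f gh) k;
           p5 = hcomp B v y z f (hcomp B v w y gh k)
       in cell_comp V (BHom B v z) p1 p2 p3 (BAssoc B v x y z ((f, g), hk)) (BAssoc B v w x z ((fg, h), k)) =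
          cell_comp V (BHom B v z) p1 p5 p3
            (map_cell2 V (BCmp B v y z) f f (hcomp B v w y gh k) (hcomp B v x y g hk)
              (VId (BHom B y z) f) (BAssoc B v w x y ((g, h), k)))
            (cell_comp V (BHom B v z) p1 p4 p5
              (BAssoc B v w y z ((f, gh), k))
              (map_cell2 V (BCmp B v w z) (hcomp B w x z fg h) (hcomp B w y z f gh) k k
                (BAssoc B w x y z ((f, g), h)) (VId (BHom B v w) k)))"
    and bicat_triangle:
      "\<lbrakk>x \<in> BOb B; y \<in> BOb B; z \<in> BOb B; f \<in> VOb (BHom B y z); g \<in> VOb (BHom B x y)\<rbrakk> \<Longrightarrow>
       let fI = hcomp B y y z f (BId B y); Ig = hcomp B x y y (BId B y) g
       in cell_comp V (BHom B x z) (hcomp B x y z fI g) (hcomp B x y z f Ig) (hcomp B x y z f g)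
            (map_cell2 V (BCmp B x y z) f f Ig g (VId (BHom B y z) f) (BLunit B x y g))
            (BAssoc B x y y z ((f, BId B y), g)) =
          map_cell2 V (BCmp B x y z) fI f g g (BRunit B y z f) (VId (BHom B x y) g)"

text \<open>\<open>RDiv x y z : B\<^sub>x\<^sub>z \<otimes> B\<^sub>x\<^sub>y\<^sup>o\<^sup>p \<rightarrow> B\<^sub>y\<^sub>z\<close> sends \<open>(h, g)\<close> to the right
  quotient \<open>h / g\<close>, and \<open>LDiv x y z : B\<^sub>y\<^sub>z\<^sup>o\<^sup>p \<otimes> B\<^sub>x\<^sub>z \<rightarrow> B\<^sub>x\<^sub>y\<close> sends \<open>(f, h)\<close> to the
  left quotient of \<open>h\<close> by \<open>f\<close>.
  The isomorphisms are indexed by triples \<open>((f, g), h)\<close> with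
  \<open>f \<in> B\<^sub>y\<^sub>z\<close>, \<open>g \<in> B\<^sub>x\<^sub>y\<close>, \<open>h \<in> B\<^sub>x\<^sub>z\<close>: \<open>LIso\<close> is \<open>B(f \<circ> g, h) \<cong> B(g, LDiv (f, h))\<close>
  and \<open>RIso\<close> is \<open>B(f \<circ> g, h) \<cong> B(f, RDiv (h, g))\<close>.\<close>

record ('x, 'b, 'o, 'm) biclosed_bicat = "('x, 'b, 'o, 'm) bicat" +
  RDiv :: "'x \<Rightarrow> 'x \<Rightarrow> 'x \<Rightarrow> ('b \<times> 'b, 'b, 'm) vfun"
  LDiv :: "'x \<Rightarrow> 'x \<Rightarrow> 'x \<Rightarrow> ('b \<times> 'b, 'b, 'm) vfun"
  LIso :: "'x \<Rightarrow> 'x \<Rightarrow> 'x \<Rightarrow> ('b \<times> 'b) \<times> 'b \<Rightarrow> 'm"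
  RIso :: "'x \<Rightarrow> 'x \<Rightarrow> 'x \<Rightarrow> ('b \<times> 'b) \<times> 'b \<Rightarrow> 'm"

abbreviation rdiv :: "('x, 'b, 'o, 'm) biclosed_bicat \<Rightarrow> 'x \<Rightarrow> 'x \<Rightarrow> 'x \<Rightarrow> 'b \<Rightarrow> 'b \<Rightarrow> 'b" where
  "rdiv B x y z h g \<equiv> FO (RDiv B x y z) (h, g)"

abbreviation ldiv :: "('x, 'b, 'o, 'm) biclosed_bicat \<Rightarrow> 'x \<Rightarrow> 'x \<Rightarrow> 'x \<Rightarrow> 'b \<Rightarrow> 'b \<Rightarrow> 'b" where
  "ldiv B x y z f h \<equiv> FO (LDiv B x y z) (f, h)"

locale biclosed_bicategory = bicategory V B
  for V :: "('o, 'm) smc" (structure) and B :: "('x, 'b, 'o, 'm) biclosed_bicat" +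
  assumes RDiv_vfunctor: "\<lbrakk>x \<in> BOb B; y \<in> BOb B; z \<in> BOb B\<rbrakk> \<Longrightarrow>
      vfunctor V (vtensor V (BHom B x z) (vop V (BHom B x y))) (BHom B y z) (RDiv B x y z)"
    and LDiv_vfunctor: "\<lbrakk>x \<in> BOb B; y \<in> BOb B; z \<in> BOb B\<rbrakk> \<Longrightarrow>
      vfunctor V (vtensor V (vop V (BHom B y z)) (BHom B x z)) (BHom B x y) (LDiv B x y z)"
    and LIso_natural: "\<lbrakk>x \<in> BOb B; y \<in> BOb B; z \<in> BOb B\<rbrakk> \<Longrightarrow>
      vnatural_iso V
        (vtensor V (vtensor V (vop V (BHom B y z)) (vop V (BHom B x y))) (BHom B x z)) (vself V)
        (vfun_comp V (vhom V (BHom B x z))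
          (vfun_tensor V (vfun_op (BCmp B x y z)) (vfun_id V (BHom B x z))))
        (vfun_comp V (vhom V (BHom B x y))
          (vfun_comp V (vfun_tensor V (vfun_id V (vop V (BHom B x y))) (LDiv B x y z))
            (vfun_comp V (vfun_assoc V (vop V (BHom B x y)) (vop V (BHom B y z)) (BHom B x z))
              (vfun_tensor V (vfun_swap V (vop V (BHom B y z)) (vop V (BHom B x y)))
                (vfun_id V (BHom B x z))))))
        (LIso B x y z)"
    and RIso_natural: "\<lbrakk>x \<in> BOb B; y \<in> BOb B; z \<in> BOb B\<rbrakk> \<Longrightarrow>
      vnatural_iso V
        (vtensor V (vtensor V (vop V (BHom B y z)) (vop V (BHom B x y))) (BHom B x z)) (vself V)
        (vfun_comp V (vhom V (BHom B x z))
          (vfun_tensor V (vfun_op (BCmp B x y z)) (vfun_id V (BHom B x z))))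
        (vfun_comp V (vhom V (BHom B y z))
          (vfun_comp V (vfun_tensor V (vfun_id V (vop V (BHom B y z))) (RDiv B x y z))
            (vfun_comp V (vfun_tensor V (vfun_id V (vop V (BHom B y z)))
                (vfun_swap V (vop V (BHom B x y)) (BHom B x z)))
              (vfun_assoc V (vop V (BHom B y z)) (vop V (BHom B x y)) (BHom B x z)))))
        (RIso B x y z)"

subsection \<open>Morphisms of bicategories\<close>

text \<open>\<open>p\<close> is the action on objects, \<open>F x y\<close> the functor from \<open>B\<^sub>x\<^sub>y\<close> to \<open>C\<^sub>p\<^sub>x\<^sub>,\<^sub>p\<^sub>y\<close>,
  \<open>Ft x y z (f, g) : F f \<circ> F g \<rightarrow> F (f \<circ> g)\<close> and \<open>F0 x : I \<rightarrow> F I\<close> are the comparison cells.\<close>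

locale bicat_morphism =
  fixes V :: "('o, 'm) smc" (structure)
    and B :: "('x, 'b, 'o, 'm, 'r) bicat_scheme" and C :: "('y, 'c, 'o, 'm, 's) bicat_scheme"
    and p :: "'x \<Rightarrow> 'y" and F :: "'x \<Rightarrow> 'x \<Rightarrow> ('b, 'c, 'm) vfun"
    and Ft :: "'x \<Rightarrow> 'x \<Rightarrow> 'x \<Rightarrow> 'b \<times> 'b \<Rightarrow> 'm" and F0 :: "'x \<Rightarrow> 'm"
  assumes p_in: "x \<in> BOb B \<Longrightarrow> p x \<in> BOb C"
    and F_vfunctor: "\<lbrakk>x \<in> BOb B; y \<in> BOb B\<rbrakk> \<Longrightarrow>
      vfunctor V (BHom B x y) (BHom C (p x) (p y)) (F x y)"
    and Ft_natural: "\<lbrakk>x \<in> BOb B; y \<in> BOb B; z \<in> BOb B\<rbrakk> \<Longrightarrow>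
      vnatural V (vtensor V (BHom B y z) (BHom B x y)) (BHom C (p x) (p z))
        (vfun_comp V (BCmp C (p x) (p y) (p z)) (vfun_tensor V (F y z) (F x y)))
        (vfun_comp V (F x z) (BCmp B x y z)) (Ft x y z)"
    and F0_in: "x \<in> BOb B \<Longrightarrow>
      F0 x \<in> cell V (BHom C (p x) (p x)) (BId C (p x)) (FO (F x x) (BId B x))"
    and morphism_assoc:
      "\<lbrakk>w \<in> BOb B; x \<in> BOb B; y \<in> BOb B; z \<in> BOb B;
        f \<in> VOb (BHom B y z); g \<in> VOb (BHom B x y); h \<in> VOb (BHom B w x)\<rbrakk> \<Longrightarrow>
       let Ff = FO (F y z) f; Fg = FO (F x y) g; Fh = FO (F w x) h;
           fg = hcomp B x y z f g; gh = hcomp B w x y g h;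
           Ffg = FO (F x z) fg; Fgh = FO (F w y) gh;
           FfFg = hcomp C (p x) (p y) (p z) Ff Fg; FgFh = hcomp C (p w) (p x) (p y) Fg Fh;
           q1 = hcomp C (p w) (p x) (p z) FfFg Fh;
           q2 = hcomp C (p w) (p y) (p z) Ff FgFh;
           q3 = hcomp C (p w) (p y) (p z) Ff Fgh;
           q4 = FO (F w z) (hcomp B w y z f gh);
           q5 = hcomp C (p w) (p x) (p z) Ffg Fh;
           q6 = FO (F w z) (hcomp B w x z fg h)
       in cell_comp V (BHom C (p w) (p z)) q1 q3 q4 (Ft w y z (f, gh))
            (cell_comp V (BHom C (p w) (p z)) q1 q2 q3
              (map_cell2 V (BCmp C (p w) (p y) (p z)) Ff Ff FgFh Fgh
                (VId (BHom C (p y) (p z)) Ff) (Ft w x y (g, h)))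
              (BAssoc C (p w) (p x) (p y) (p z) ((Ff, Fg), Fh))) =
          cell_comp V (BHom C (p w) (p z)) q1 q6 q4
            (map_cell V (F w z) (hcomp B w x z fg h) (hcomp B w y z f gh) (BAssoc B w x y z ((f, g), h)))
            (cell_comp V (BHom C (p w) (p z)) q1 q5 q6
              (Ft w x z (fg, h))
              (map_cell2 V (BCmp C (p w) (p x) (p z)) FfFg Ffg Fh Fh
                (Ft x y z (f, g)) (VId (BHom C (p w) (p x)) Fh)))"
    and morphism_lunit:
      "\<lbrakk>x \<in> BOb B; y \<in> BOb B; f \<in> VOb (BHom B x y)\<rbrakk> \<Longrightarrow>
       let Ff = FO (F x y) f; If = hcomp B x y y (BId B y) f; FI = FO (F y y) (BId B y);
           q1 = hcomp C (p x) (p y) (p y) (BId C (p y)) Ff;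
           q2 = hcomp C (p x) (p y) (p y) FI Ff;
           q3 = FO (F x y) If
       in cell_comp V (BHom C (p x) (p y)) q1 q3 Ff
            (map_cell V (F x y) If f (BLunit B x y f))
            (cell_comp V (BHom C (p x) (p y)) q1 q2 q3
              (Ft x y y (BId B y, f))
              (map_cell2 V (BCmp C (p x) (p y) (p y)) (BId C (p y)) FI Ff Ff
                (F0 y) (VId (BHom C (p x) (p y)) Ff))) =
          BLunit C (p x) (p y) Ff"
    and morphism_runit:
      "\<lbrakk>x \<in> BOb B; y \<in> BOb B; f \<in> VOb (BHom B x y)\<rbrakk> \<Longrightarrow>
       let Ff = FO (F x y) f; fI = hcomp B x x y f (BId B x); FI = FO (F x x) (BId B x);
           q1 = hcomp C (p x) (p x) (p y) Ff (BId C (p x));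
           q2 = hcomp C (p x) (p x) (p y) Ff FI;
           q3 = FO (F x y) fI
       in cell_comp V (BHom C (p x) (p y)) q1 q3 Ff
            (map_cell V (F x y) fI f (BRunit B x y f))
            (cell_comp V (BHom C (p x) (p y)) q1 q2 q3
              (Ft x x y (f, BId B x))
              (map_cell2 V (BCmp C (p x) (p x) (p y)) Ff Ff (BId C (p x)) FI
                (VId (BHom C (p x) (p y)) Ff) (F0 x))) =
          BRunit C (p x) (p y) Ff"

locale strong_bicat_morphism = bicat_morphism +
  assumes Ft_iso:
      "\<lbrakk>x \<in> BOb B; y \<in> BOb B; z \<in> BOb B; f \<in> VOb (BHom B y z); g \<in> VOb (BHom B x y)\<rbrakk> \<Longrightarrow>
       cell_iso V (BHom C (p x) (p z))
         (hcomp C (p x) (p y) (p z) (FO (F y z) f) (FO (F x y) g))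
         (FO (F x z) (hcomp B x y z f g)) (Ft x y z (f, g))"
    and F0_iso: "x \<in> BOb B \<Longrightarrow>
       cell_iso V (BHom C (p x) (p x)) (BId C (p x)) (FO (F x x) (BId B x)) (F0 x)"

subsection \<open>Local generators and cogenerators\<close>

definition locally_strongly_generating ::
    "('o, 'm) smc \<Rightarrow> 'x set \<Rightarrow> ('x \<Rightarrow> 'x \<Rightarrow> ('a, 'o, 'm) vcat) \<Rightarrow> ('x \<Rightarrow> 'x \<Rightarrow> 'a set) \<Rightarrow> bool" where
  "locally_strongly_generating V S X A \<longleftrightarrow> (\<forall>x\<in>S. \<forall>y\<in>S. A x y \<subseteq> VOb (X x y) \<and>
     (\<forall>a\<in>VOb (X x y). \<forall>b\<in>VOb (X x y). \<forall>f\<in>cell V (X x y) a b.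
        (\<forall>d\<in>A x y. iso V (post_comp V (X x y) d a b f)) \<longrightarrow> cell_iso V (X x y) a b f))"

definition locally_strongly_cogenerating ::
    "('o, 'm) smc \<Rightarrow> 'x set \<Rightarrow> ('x \<Rightarrow> 'x \<Rightarrow> ('a, 'o, 'm) vcat) \<Rightarrow> ('x \<Rightarrow> 'x \<Rightarrow> 'a set) \<Rightarrow> bool" where
  "locally_strongly_cogenerating V S X D \<longleftrightarrow> (\<forall>x\<in>S. \<forall>y\<in>S. D x y \<subseteq> VOb (X x y) \<and>
     (\<forall>a\<in>VOb (X x y). \<forall>b\<in>VOb (X x y). \<forall>f\<in>cell V (X x y) a b.
        (\<forall>d\<in>D x y. iso V (pre_comp V (X x y) d a b f)) \<longrightarrow> cell_iso V (X x y) a b f))"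

end

theory Submission
  imports Defs
begin

text \<open>
  For a cell \<open>u\<close> of \<open>B\<close>, adjunction shows that \<open>\<psi> u\<close> is invertible as soon as \<open>B(u, D)\<close> is, for all \<open>D\<close> in the
  cogenerating class, and that then \<open>B(u, C)\<close> is invertible for all \<open>C\<close>. For \<open>u = \<eta> \<circ> 1\<close> with \<open>1\<close> the identity of \<open>A\<close>,
  residuation turns \<open>B(\<eta> \<circ> 1, D)\<close> into \<open>B(\<eta>, D / A)\<close> and into \<open>B(A, \<eta> \ D)\<close>; the first is invertible when
  the unit at \<open>D / A\<close> is, and in the second strong generation frees \<open>A\<close> from the generating class. So each of the
  first five conditions makes \<open>\<psi>\<close> invert \<open>\<eta> \<circ> 1\<close> and \<open>1 \<circ> \<eta>\<close>; the sixth does so by two-out-of-three, since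
  \<open>\<eta>\<close> is invertible at objects of \<open>C\<close>.

  The composite in \<open>C\<close> is \<open>\<psi>(\<theta> f \<circ> \<theta> g)\<close>. Its associativity is the unique cell \<open>a\<close> with
  \<open>a \<cdot> \<psi>(\<eta> \<circ> 1) = \<psi>(1 \<circ> \<eta>) \<cdot> \<psi> \<alpha>\<close>, the units and comparison cells are obtained likewise, and naturality and coherence
  follow from those of \<open>B\<close> on cancelling the inverted cells. Conversely the inverted cells force \<open>\<eta>\<close> to be invertible
  at all quotients of objects of \<open>C\<close>, so that the quotients of \<open>B\<close> restrict to \<open>C\<close>.

  Enriched naturality of \<open>t\<close> is handled as the equation \<open>Y(1, t b) \<cdot> F = Y(t a, 1) \<cdot> G\<close> between arrows
  \<open>X(a, b) \<rightarrow> Y(F a, G b)\<close>, in which no tensor products occur.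
\<close>

section \<open>Calculations in a category\<close>

text \<open>The hypotheses and the conclusion live on two levels. Strong generation, cogeneration
  and residuation speak of hom-objects, so invertibility is tested by arrows of \<open>V\<close>
  such as \<open>pre_comp\<close>, and one condition is reduced to another by squares of such arrows
  with two invertible sides. The pentagon, the triangle and the axioms of a morphism are equations
  between cells, for which underlying categories suffice; they are verified in a single category
  containing all 2-cells, so that no indices have to be carried along. What remains enriched is
  naturality of the new constraints. Since these are defined by cancelling something invertible,
  their naturality comes from the same cancellation: a family is natural when its composite with an
  invertible natural family is natural. For functors into \<open>V\<close>, as in the isomorphisms
  of a biclosed structure, both sides of a square are first transposed along evaluation, so that the
  self-enrichment of \<open>V\<close> disappears from the calculation.\<close>

text \<open>Testing composability through this predicate instead of through \<open>Arr\<close>, \<open>Dom\<close> and \<open>Cod\<close>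
  keeps the cost of the side conditions of simp rules linear in the length of a composite.\<close>

definition into :: "('o, 'm, 'r) cat_scheme \<Rightarrow> 'o \<Rightarrow> 'm \<Rightarrow> bool" where
  "into C b f \<longleftrightarrow> f \<in> Arr C \<and> Cod C f = b"

lemma HomI: "\<lbrakk>f \<in> Arr C; Dom C f = a; Cod C f = b\<rbrakk> \<Longrightarrow> f \<in> Hom C a b"
  by (simp add: Hom_def)

lemma Hom_Arr: "f \<in> Hom C a b \<Longrightarrow> f \<in> Arr C"
  and Hom_Dom: "f \<in> Hom C a b \<Longrightarrow> Dom C f = a"
  and Hom_Cod: "f \<in> Hom C a b \<Longrightarrow> Cod C f = b"
  by (simp_all add: Hom_def)

lemmas HomD = Hom_Arr Hom_Dom Hom_Cod

lemma intoI: "\<lbrakk>f \<in> Arr C; Cod C f = b\<rbrakk> \<Longrightarrow> into C b f"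
  by (simp add: into_def)

context category
begin

lemma into_Cmp: "\<lbrakk>g \<in> Arr C; Cod C g = c; into C (Dom C g) f\<rbrakk> \<Longrightarrow> into C c (g \<cdot> f)"
  and Arr_Cmp: "\<lbrakk>g \<in> Arr C; into C (Dom C g) f\<rbrakk> \<Longrightarrow> g \<cdot> f \<in> Arr C"
  and Cod_Cmp: "\<lbrakk>g \<in> Arr C; into C (Dom C g) f\<rbrakk> \<Longrightarrow> Cod C (g \<cdot> f) = Cod C g"
  and Dom_Cmp: "\<lbrakk>g \<in> Arr C; into C (Dom C g) f\<rbrakk> \<Longrightarrow> Dom C (g \<cdot> f) = Dom C f"
  using Cmp_in[of f "Dom C f" "Dom C g" g "Cod C g"] by (auto simp: into_def Hom_def)

lemma Arr_Idn: "a \<in> Ob C \<Longrightarrow> \<one> a \<in> Arr C"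
  and Dom_Idn: "a \<in> Ob C \<Longrightarrow> Dom C (\<one> a) = a"
  and Cod_Idn: "a \<in> Ob C \<Longrightarrow> Cod C (\<one> a) = a"
  using Idn_in[of a] by (auto simp: Hom_def)

lemma assoc_Cmp:
  "\<lbrakk>h \<in> Arr C; into C (Dom C h) g; into C (Dom C g) f\<rbrakk> \<Longrightarrow> (h \<cdot> g) \<cdot> f = h \<cdot> (g \<cdot> f)"
  using Cmp_assoc[of f "Dom C f" "Dom C g" g "Dom C h" h "Cod C h"]
  by (auto simp: into_def Hom_def)

lemma Idn_left: "into C b f \<Longrightarrow> \<one> b \<cdot> f = f"
  using Idn_Cmp[of f "Dom C f" b] by (auto simp: into_def Hom_def)

lemma Idn_right: "\<lbrakk>f \<in> Arr C; Dom C f = a\<rbrakk> \<Longrightarrow> f \<cdot> \<one> a = f"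
  using Cmp_Idn[of f a "Cod C f"] by (auto simp: Hom_def)

text \<open>\<open>assoc_Cmp\<close> keeps composites nested to the right, where a law
  \<open>g \<cdot> f = k\<close> would match only at the end of a chain. The tail \<open>r\<close>
  makes it applicable inside.\<close>

lemma reassoc:
  "\<lbrakk>g \<cdot> f = k; g \<in> Arr C; into C (Dom C g) f; into C (Dom C f) r\<rbrakk> \<Longrightarrow> g \<cdot> (f \<cdot> r) = k \<cdot> r"
  using assoc_Cmp by metis

lemmas typing = intoI into_Cmp Arr_Cmp Cod_Cmp Dom_Cmp Arr_Idn Dom_Idn Cod_Idn Dom_in Cod_in
lemmas cat_simps = typing assoc_Cmp Idn_left Idn_right

section \<open>Isomorphisms and cancellation\<close>

lemma inverse_unique:
  assumes "inverse_arrows C f g" "inverse_arrows C f h"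
  shows "g = h"
proof -
  have "(g \<cdot> f) \<cdot> h = g \<cdot> (f \<cdot> h)"
    using assms by (intro assoc_Cmp) (auto simp: inverse_arrows_def Hom_def into_def)
  then show ?thesis
    using assms by (auto simp: inverse_arrows_def Hom_def typing Idn_left Idn_right)
qed

lemma inv_arr_inverse: "iso C f \<Longrightarrow> inverse_arrows C f (inv_arr C f)"
  unfolding iso_def inv_arr_def by (metis inverse_unique the_equality)

lemma
  assumes "iso C f"
  shows iso_Arr: "f \<in> Arr C"
    and Arr_inv: "inv_arr C f \<in> Arr C"
    and Dom_inv: "Dom C (inv_arr C f) = Cod C f"
    and Cod_inv: "Cod C (inv_arr C f) = Dom C f"
    and inv_left: "inv_arr C f \<cdot> f = \<one> (Dom C f)"
    and inv_right: "f \<cdot> inv_arr C f = \<one> (Cod C f)"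
  using inv_arr_inverse[OF assms] by (auto simp: inverse_arrows_def Hom_def)

lemma inv_in: "\<lbrakk>iso C f; f \<in> Hom C a b\<rbrakk> \<Longrightarrow> inv_arr C f \<in> Hom C b a"
  by (simp add: Hom_def Arr_inv Dom_inv Cod_inv)

lemma inv_left': "\<lbrakk>iso C f; into C (Dom C f) r\<rbrakk> \<Longrightarrow> inv_arr C f \<cdot> (f \<cdot> r) = r"
  using reassoc[OF inv_left] by (simp add: iso_Arr Arr_inv Dom_inv cat_simps)

lemma inv_right': "\<lbrakk>iso C f; into C (Cod C f) r\<rbrakk> \<Longrightarrow> f \<cdot> (inv_arr C f \<cdot> r) = r"
  using reassoc[OF inv_right] by (simp add: iso_Arr Arr_inv Dom_inv Cod_inv cat_simps)

lemmas inv_simps = iso_Arr Arr_inv Dom_inv Cod_inv inv_left inv_right inv_left' inv_right'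

lemma isoI:
  assumes "f \<in> Hom C a b" "g \<in> Hom C b a" "g \<cdot> f = \<one> a" "f \<cdot> g = \<one> b"
  shows "iso C f"
  using assms by (auto simp: iso_def inverse_arrows_def Hom_def)

lemma iso_Idn: "a \<in> Ob C \<Longrightarrow> iso C (\<one> a)"
  by (rule isoI[of _ a a "\<one> a"]) (auto simp: Idn_in Cmp_Idn[OF Idn_in])

lemma iso_inv: "iso C f \<Longrightarrow> iso C (inv_arr C f)"
  by (rule isoI[of _ "Cod C f" "Dom C f" f]) (auto simp: HomI inv_simps)

lemma iso_Cmp: "\<lbrakk>iso C g; iso C f; Dom C g = Cod C f\<rbrakk> \<Longrightarrow> iso C (g \<cdot> f)"
  by (rule isoI[of _ "Dom C f" "Cod C g" "inv_arr C f \<cdot> inv_arr C g"])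
    (auto intro!: HomI simp: inv_simps cat_simps)

lemma epi_cancel:
  assumes "iso C g" "f \<cdot> g = f' \<cdot> g" "f \<in> Arr C" "Dom C f = Cod C g" "f' \<in> Arr C" "Dom C f' = Cod C g"
  shows "f = f'"
proof -
  have "(f \<cdot> g) \<cdot> inv_arr C g = (f' \<cdot> g) \<cdot> inv_arr C g" using assms(2) by simp
  then show ?thesis using assms(1,3-) by (simp add: inv_simps cat_simps)
qed

lemma mono_cancel:
  assumes "iso C g" "g \<cdot> f = g \<cdot> f'" "into C (Dom C g) f" "into C (Dom C g) f'"
  shows "f = f'"
  using assms inv_left' by metis

lemma iso_cancel_left:
  assumes "iso C g" "iso C (g \<cdot> f)" "into C (Dom C g) f"
  shows "iso C f"
proof -
  have "iso C (inv_arr C g \<cdot> (g \<cdot> f))"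
    using assms by (intro iso_Cmp[OF iso_inv]) (auto simp: inv_simps cat_simps)
  then show ?thesis using assms by (simp add: inv_left')
qed

lemma iso_cancel_right:
  assumes "iso C f" "iso C (g \<cdot> f)" "g \<in> Arr C" "Dom C g = Cod C f"
  shows "iso C g"
proof -
  have "iso C ((g \<cdot> f) \<cdot> inv_arr C f)"
    using assms by (intro iso_Cmp[OF _ iso_inv]) (auto simp: inv_simps cat_simps)
  then show ?thesis using assms by (simp add: inv_simps cat_simps)
qed

text \<open>In applications \<open>g\<close> and \<open>g'\<close> are components of natural
  isomorphisms: transposition under the adjunction, residuation, or composition with an invertible
  unit. The square then carries invertibility from one action of a cell to another.\<close>

lemma iso_square:
  assumes "g \<cdot> f = f' \<cdot> g'" "iso C g" "iso C g'" "into C (Dom C g) f" "f' \<in> Arr C" "Dom C f' = Cod C g'"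
  shows "iso C f \<longleftrightarrow> iso C f'"
proof
  assume "iso C f"
  then have "iso C (f' \<cdot> g')" using assms by (metis iso_Cmp into_def)
  then show "iso C f'" using assms iso_cancel_right by blast
next
  assume "iso C f'"
  then have "iso C (g \<cdot> f)" using assms by (metis iso_Cmp)
  then show "iso C f" using assms iso_cancel_left by blast
qed

end

section \<open>Unit coherence in a symmetric monoidal category\<close>

context symmetric_monoidal_closed_category
begin

lemma
  assumes "f \<in> Arr V" "g \<in> Arr V"
  shows Arr_tensor: "f \<odot> g \<in> Arr V"
    and Dom_tensor: "Dom V (f \<odot> g) = Dom V f \<otimes> Dom V g"
    and Cod_tensor: "Cod V (f \<odot> g) = Cod V f \<otimes> Cod V g"
  using tensor_arr_in[of f "Dom V f" "Cod V f" g "Dom V g" "Cod V g"] assms by (auto simp: Hom_def)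

lemma into_tensor: "\<lbrakk>into V a f; into V b g\<rbrakk> \<Longrightarrow> into V (a \<otimes> b) (f \<odot> g)"
  by (simp add: into_def Arr_tensor Cod_tensor)

lemma merge:
  "\<lbrakk>f' \<in> Arr V; into V (Dom V f') f; g' \<in> Arr V; into V (Dom V g') g\<rbrakk> \<Longrightarrow>
     (f' \<odot> g') \<cdot> (f \<odot> g) = (f' \<cdot> f) \<odot> (g' \<cdot> g)"
  using tensor_Cmp[of f "Dom V f" "Dom V f'" f' "Cod V f'" g "Dom V g" "Dom V g'" g' "Cod V g'"]
  by (auto simp: into_def Hom_def)

lemma merge':
  "\<lbrakk>f' \<in> Arr V; into V (Dom V f') f; g' \<in> Arr V; into V (Dom V g') g; into V (Dom V f \<otimes> Dom V g) r\<rbrakk> \<Longrightarrow>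
     (f' \<odot> g') \<cdot> ((f \<odot> g) \<cdot> r) = ((f' \<cdot> f) \<odot> (g' \<cdot> g)) \<cdot> r"
  by (rule reassoc[OF merge]) (auto simp: into_def Arr_tensor Dom_tensor Cod_tensor)

abbreviation li where "li a \<equiv> inv_arr V (lunit V a)"
abbreviation ri where "ri a \<equiv> inv_arr V (runit V a)"
abbreviation ai where "ai a b c \<equiv> inv_arr V (assoc V a b c)"

lemma
  assumes "a \<in> Ob V"
  shows Arr_lunit: "lunit V a \<in> Arr V" and Dom_lunit: "Dom V (lunit V a) = \<I> \<otimes> a"
    and Cod_lunit: "Cod V (lunit V a) = a"
    and Arr_runit: "runit V a \<in> Arr V" and Dom_runit: "Dom V (runit V a) = a \<otimes> \<I>"
    and Cod_runit: "Cod V (runit V a) = a"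
  using lunit_in[OF assms] runit_in[OF assms] by (auto simp: Hom_def)

lemma
  assumes "a \<in> Ob V"
  shows Arr_li: "li a \<in> Arr V" and Dom_li: "Dom V (li a) = a" and Cod_li: "Cod V (li a) = \<I> \<otimes> a"
    and Arr_ri: "ri a \<in> Arr V" and Dom_ri: "Dom V (ri a) = a" and Cod_ri: "Cod V (ri a) = a \<otimes> \<I>"
  using lunit_iso[OF assms] runit_iso[OF assms] assms
  by (simp_all add: inv_simps Dom_lunit Dom_runit Cod_lunit Cod_runit)

lemma
  assumes "a \<in> Ob V" "b \<in> Ob V" "c \<in> Ob V"
  shows Arr_assoc: "assoc V a b c \<in> Arr V"
    and Dom_assoc: "Dom V (assoc V a b c) = a \<otimes> b \<otimes> c"
    and Cod_assoc: "Cod V (assoc V a b c) = a \<otimes> (b \<otimes> c)"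
  using assoc_in[OF assms] by (auto simp: Hom_def)

lemma
  assumes "a \<in> Ob V" "b \<in> Ob V" "c \<in> Ob V"
  shows Arr_ai: "ai a b c \<in> Arr V"
    and Dom_ai: "Dom V (ai a b c) = a \<otimes> (b \<otimes> c)"
    and Cod_ai: "Cod V (ai a b c) = a \<otimes> b \<otimes> c"
  using assoc_iso[OF assms] assms by (simp_all add: inv_simps Dom_assoc Cod_assoc)

lemma
  assumes "a \<in> Ob V" "b \<in> Ob V"
  shows Arr_braid: "braid V a b \<in> Arr V"
    and Dom_braid: "Dom V (braid V a b) = a \<otimes> b"
    and Cod_braid: "Cod V (braid V a b) = b \<otimes> a"
  using braid_in[OF assms] by (auto simp: Hom_def)

lemmas mon_typing = typing into_tensor Arr_tensor Dom_tensor Cod_tensor tensor_ob_in unit_in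
  Arr_lunit Dom_lunit Cod_lunit Arr_runit Dom_runit Cod_runit
  Arr_li Dom_li Cod_li Arr_ri Dom_ri Cod_ri
  Arr_assoc Dom_assoc Cod_assoc Arr_ai Dom_ai Cod_ai Arr_braid Dom_braid Cod_braid

lemma li_left: "a \<in> Ob V \<Longrightarrow> li a \<cdot> lunit V a = \<one> (\<I> \<otimes> a)"
  and li_right: "a \<in> Ob V \<Longrightarrow> lunit V a \<cdot> li a = \<one> a"
  and ri_left: "a \<in> Ob V \<Longrightarrow> ri a \<cdot> runit V a = \<one> (a \<otimes> \<I>)"
  and ri_right: "a \<in> Ob V \<Longrightarrow> runit V a \<cdot> ri a = \<one> a"
  by (simp_all add: inv_simps lunit_iso runit_iso mon_typing)

lemma ai_left: "\<lbrakk>a \<in> Ob V; b \<in> Ob V; c \<in> Ob V\<rbrakk> \<Longrightarrow> ai a b c \<cdot> assoc V a b c = \<one> (a \<otimes> b \<otimes> c)"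
  and ai_right: "\<lbrakk>a \<in> Ob V; b \<in> Ob V; c \<in> Ob V\<rbrakk> \<Longrightarrow> assoc V a b c \<cdot> ai a b c = \<one> (a \<otimes> (b \<otimes> c))"
  by (simp_all add: inv_simps assoc_iso mon_typing)

lemmas mon_simps = mon_typing assoc_Cmp Idn_left Idn_right tensor_Idn merge merge'
  li_left li_right ri_left ri_right ai_left ai_right

lemma lunit_natural: "\<lbrakk>f \<in> Arr V; Cod V f = b\<rbrakk> \<Longrightarrow> lunit V b \<cdot> (\<one> \<I> \<odot> f) = f \<cdot> lunit V (Dom V f)"
  using lunit_nat[of f "Dom V f" b] by (simp add: Hom_def)

lemma runit_natural: "\<lbrakk>f \<in> Arr V; Cod V f = b\<rbrakk> \<Longrightarrow> runit V b \<cdot> (f \<odot> \<one> \<I>) = f \<cdot> runit V (Dom V f)"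
  using runit_nat[of f "Dom V f" b] by (simp add: Hom_def)

lemma assoc_natural:
  "\<lbrakk>f \<in> Arr V; g \<in> Arr V; h \<in> Arr V; Cod V f = a; Cod V g = b; Cod V h = c\<rbrakk> \<Longrightarrow>
     assoc V a b c \<cdot> (f \<odot> g \<odot> h) = (f \<odot> (g \<odot> h)) \<cdot> assoc V (Dom V f) (Dom V g) (Dom V h)"
  using assoc_nat[of f "Dom V f" a g "Dom V g" b h "Dom V h" c] by (simp add: Hom_def)

text \<open>A form of naturality that still matches when simplification has merged a further factor
  \<open>k\<close>, in practice a braiding, into the first slot of the tensor product.\<close>

lemma assoc_natural_split:
  assumes "f \<in> Arr V" "g \<in> Arr V" "h \<in> Arr V" "Cod V f = a" "Cod V g = b" "Cod V h = c"
    and "into V (Dom V f \<otimes> Dom V g) k"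
  shows "assoc V a b c \<cdot> (((f \<odot> g) \<cdot> k) \<odot> h) =
    (f \<odot> (g \<odot> h)) \<cdot> assoc V (Dom V f) (Dom V g) (Dom V h) \<cdot> (k \<odot> \<one> (Dom V h))"
proof -
  have k: "k \<in> Arr V" "Cod V k = Dom V f \<otimes> Dom V g" using assms(7) by (auto simp: into_def)
  have ob: "a \<in> Ob V" "b \<in> Ob V" "c \<in> Ob V" "Dom V f \<in> Ob V" "Dom V g \<in> Ob V" "Dom V h \<in> Ob V"
    using assms by (auto simp: mon_typing)
  have "assoc V a b c \<cdot> (((f \<odot> g) \<cdot> k) \<odot> h) = assoc V a b c \<cdot> (f \<odot> g \<odot> h) \<cdot> (k \<odot> \<one> (Dom V h))"
    using assms k by (simp add: mon_simps)
  also have "\<dots> = (f \<odot> (g \<odot> h)) \<cdot> assoc V (Dom V f) (Dom V g) (Dom V h) \<cdot> (k \<odot> \<one> (Dom V h))"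
    using assms k ob by (subst reassoc[OF assoc_natural]) (simp_all add: mon_typing assoc_Cmp)
  finally show ?thesis .
qed

lemma braid_natural:
  "\<lbrakk>f \<in> Arr V; g \<in> Arr V; Cod V f = a; Cod V g = b\<rbrakk> \<Longrightarrow>
     braid V a b \<cdot> (f \<odot> g) = (g \<odot> f) \<cdot> braid V (Dom V f) (Dom V g)"
  using braid_nat[of f "Dom V f" a g "Dom V g" b] by (simp add: Hom_def)

lemma li_natural:
  assumes "f \<in> Arr V" "Cod V f = b"
  shows "li b \<cdot> f = (\<one> \<I> \<odot> f) \<cdot> li (Dom V f)"
proof (rule mono_cancel[of "lunit V b"])
  have b: "b \<in> Ob V" "Dom V f \<in> Ob V" using assms by (auto simp: mon_typing)
  show "iso V (lunit V b)" by (rule lunit_iso[OF b(1)])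
  show "lunit V b \<cdot> (li b \<cdot> f) = lunit V b \<cdot> ((\<one> \<I> \<odot> f) \<cdot> li (Dom V f))"
    using assms b reassoc[OF li_right[OF b(1)]] reassoc[OF lunit_natural[OF assms]]
    by (simp add: mon_simps)
qed (use assms in \<open>auto simp: mon_simps\<close>)

lemma ri_natural:
  assumes "f \<in> Arr V" "Cod V f = b"
  shows "ri b \<cdot> f = (f \<odot> \<one> \<I>) \<cdot> ri (Dom V f)"
proof (rule mono_cancel[of "runit V b"])
  have b: "b \<in> Ob V" "Dom V f \<in> Ob V" using assms by (auto simp: mon_typing)
  show "iso V (runit V b)" by (rule runit_iso[OF b(1)])
  show "runit V b \<cdot> (ri b \<cdot> f) = runit V b \<cdot> ((f \<odot> \<one> \<I>) \<cdot> ri (Dom V f))"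
    using assms b reassoc[OF ri_right[OF b(1)]] reassoc[OF runit_natural[OF assms]]
    by (simp add: mon_simps)
qed (use assms in \<open>auto simp: mon_simps\<close>)

lemma ai_natural:
  assumes "f \<in> Arr V" "g \<in> Arr V" "h \<in> Arr V" "Cod V f = a" "Cod V g = b" "Cod V h = c"
  shows "ai a b c \<cdot> (f \<odot> (g \<odot> h)) = (f \<odot> g \<odot> h) \<cdot> ai (Dom V f) (Dom V g) (Dom V h)"
proof (rule mono_cancel[of "assoc V a b c"])
  have b: "a \<in> Ob V" "b \<in> Ob V" "c \<in> Ob V" "Dom V f \<in> Ob V" "Dom V g \<in> Ob V" "Dom V h \<in> Ob V"
    using assms by (auto simp: mon_typing)
  show "iso V (assoc V a b c)" by (rule assoc_iso[OF b(1-3)])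
  show "assoc V a b c \<cdot> (ai a b c \<cdot> (f \<odot> (g \<odot> h))) =
      assoc V a b c \<cdot> ((f \<odot> g \<odot> h) \<cdot> ai (Dom V f) (Dom V g) (Dom V h))"
    using assms b reassoc[OF ai_right[OF b(1-3)]] reassoc[OF assoc_natural[OF assms]]
    by (simp add: mon_simps)
qed (use assms in \<open>auto simp: mon_simps\<close>)

text \<open>Tensoring with the unit object is naturally isomorphic to the identity. Hence an
  equation may be checked after tensoring with \<open>\<I>\<close>, which is where the pentagon and
  the triangle get a grip on the unit constraints.\<close>

lemma tensor_unit_faithful:
  assumes "f \<in> Hom V a b" "g \<in> Hom V a b"
  shows "\<one> \<I> \<odot> f = \<one> \<I> \<odot> g \<Longrightarrow> f = g" and "f \<odot> \<one> \<I> = g \<odot> \<one> \<I> \<Longrightarrow> f = g"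
proof -
  have ab: "f \<in> Arr V" "Cod V f = b" "Dom V f = a" "g \<in> Arr V" "Cod V g = b" "Dom V g = a" "a \<in> Ob V"
    using assms by (auto simp: Hom_def mon_typing)
  show "f = g" if "\<one> \<I> \<odot> f = \<one> \<I> \<odot> g"
    using lunit_natural[OF ab(1,2)] lunit_natural[OF ab(4,5)] that ab
      epi_cancel[OF lunit_iso[OF ab(7)], of f g] by (simp add: mon_typing)
  show "f = g" if "f \<odot> \<one> \<I> = g \<odot> \<one> \<I>"
    using runit_natural[OF ab(1,2)] runit_natural[OF ab(4,5)] that ab
      epi_cancel[OF runit_iso[OF ab(7)], of f g] by (simp add: mon_typing)
qed

lemma iso_tensor:
  assumes "iso V f" "iso V g"
  shows "iso V (f \<odot> g)"
  by (rule isoI[of _ "Dom V f \<otimes> Dom V g" "Cod V f \<otimes> Cod V g" "inv_arr V f \<odot> inv_arr V g"])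
    (use assms in \<open>auto intro!: HomI simp: inv_simps mon_simps\<close>)

text \<open>The axioms give only the triangle with the unit in the middle. After tensoring with
  \<open>\<I>\<close> and composing with the invertible \<open>?X\<close>, the pentagon at
  \<open>\<I>\<close>, \<open>\<I>\<close>, \<open>p\<close>, \<open>q\<close> and two instances of
  that triangle identify the two sides; both steps are then cancelled.\<close>

lemma lunit_tensor:
  assumes p: "p \<in> Ob V" and q: "q \<in> Ob V"
  shows "lunit V (p \<otimes> q) \<cdot> assoc V \<I> p q = lunit V p \<odot> \<one> q"
proof -
  note pq = p q unit_in
  let ?X = "assoc V \<I> (\<I> \<otimes> p) q \<cdot> (assoc V \<I> \<I> p \<odot> \<one> q)"
  have "(\<one> \<I> \<odot> (lunit V (p \<otimes> q) \<cdot> assoc V \<I> p q)) \<cdot> ?X =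
      (\<one> \<I> \<odot> lunit V (p \<otimes> q)) \<cdot> ((\<one> \<I> \<odot> assoc V \<I> p q) \<cdot> ?X)"
    using pq by (simp add: mon_simps)
  also have "\<dots> = (\<one> \<I> \<odot> lunit V (p \<otimes> q)) \<cdot> (assoc V \<I> \<I> (p \<otimes> q) \<cdot> assoc V (\<I> \<otimes> \<I>) p q)"
    using pentagon[of \<I> \<I> p q] pq by simp
  also have "\<dots> = (runit V \<I> \<odot> \<one> (p \<otimes> q)) \<cdot> assoc V (\<I> \<otimes> \<I>) p q"
    by (rule reassoc[OF triangle]) (use pq in \<open>auto simp: mon_simps\<close>)
  also have "\<dots> = (runit V \<I> \<odot> (\<one> p \<odot> \<one> q)) \<cdot> assoc V (\<I> \<otimes> \<I>) p q"
    using pq by (simp add: tensor_Idn)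
  also have "\<dots> = assoc V \<I> p q \<cdot> (runit V \<I> \<odot> \<one> p \<odot> \<one> q)"
    using pq assoc_natural[of "runit V \<I>" "\<one> p" "\<one> q" \<I> p q] by (simp add: mon_typing)
  also have "\<dots> = assoc V \<I> p q \<cdot> ((\<one> \<I> \<odot> lunit V p \<odot> \<one> q) \<cdot> (assoc V \<I> \<I> p \<odot> \<one> q))"
    using pq triangle[of \<I> p] by (simp add: mon_simps)
  also have "\<dots> = (\<one> \<I> \<odot> (lunit V p \<odot> \<one> q)) \<cdot> ?X"
    using pq reassoc[OF assoc_natural[of "\<one> \<I>" "lunit V p" "\<one> q" \<I> p q]]
    by (simp add: mon_typing assoc_Cmp)
  finally have "\<one> \<I> \<odot> (lunit V (p \<otimes> q) \<cdot> assoc V \<I> p q) = \<one> \<I> \<odot> (lunit V p \<odot> \<one> q)"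
    using pq epi_cancel[of ?X "\<one> \<I> \<odot> (lunit V (p \<otimes> q) \<cdot> assoc V \<I> p q)"
        "\<one> \<I> \<odot> (lunit V p \<odot> \<one> q)"]
    by (simp add: mon_typing iso_Cmp iso_tensor assoc_iso iso_Idn)
  then show ?thesis
    by (rule tensor_unit_faithful(1)[rotated 2, where a = "\<I> \<otimes> p \<otimes> q" and b = "p \<otimes> q"])
      (use pq in \<open>auto intro!: HomI simp: mon_typing\<close>)
qed

text \<open>Mirror image of \<open>lunit_tensor\<close>, with the pentagon at \<open>p\<close>,
  \<open>q\<close>, \<open>\<I>\<close>, \<open>\<I>\<close> and an associator cancelled on the
  other side.\<close>

lemma runit_tensor:
  assumes p: "p \<in> Ob V" and q: "q \<in> Ob V"
  shows "(\<one> p \<odot> runit V q) \<cdot> assoc V p q \<I> = runit V (p \<otimes> q)"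
proof -
  note pq = p q unit_in
  let ?P = "assoc V p (q \<otimes> \<I>) \<I> \<cdot> (assoc V p q \<I> \<odot> \<one> \<I>)"
  have "assoc V p q \<I> \<cdot> (((\<one> p \<odot> runit V q) \<cdot> assoc V p q \<I>) \<odot> \<one> \<I>) =
      assoc V p q \<I> \<cdot> ((\<one> p \<odot> runit V q \<odot> \<one> \<I>) \<cdot> (assoc V p q \<I> \<odot> \<one> \<I>))"
    using pq by (simp add: mon_simps)
  also have "\<dots> = (\<one> p \<odot> (runit V q \<odot> \<one> \<I>)) \<cdot> ?P"
    using pq reassoc[OF assoc_natural[of "\<one> p" "runit V q" "\<one> \<I>" p q \<I>]]
    by (simp add: mon_typing assoc_Cmp)
  also have "\<dots> = (\<one> p \<odot> (\<one> q \<odot> lunit V \<I>)) \<cdot> ((\<one> p \<odot> assoc V q \<I> \<I>) \<cdot> ?P)"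
    using pq triangle[of q \<I>] by (simp add: mon_simps)
  also have "\<dots> = (\<one> p \<odot> (\<one> q \<odot> lunit V \<I>)) \<cdot>
      (assoc V p q (\<I> \<otimes> \<I>) \<cdot> assoc V (p \<otimes> q) \<I> \<I>)"
    using pentagon[of p q \<I> \<I>] pq by simp
  also have "\<dots> = (assoc V p q \<I> \<cdot> (\<one> p \<odot> \<one> q \<odot> lunit V \<I>)) \<cdot> assoc V (p \<otimes> q) \<I> \<I>"
    using pq reassoc[OF assoc_natural[of "\<one> p" "\<one> q" "lunit V \<I>" p q \<I>]]
    by (subst assoc_natural) (simp_all add: mon_typing assoc_Cmp)
  also have "\<dots> = assoc V p q \<I> \<cdot> (runit V (p \<otimes> q) \<odot> \<one> \<I>)"
    using pq triangle[of "p \<otimes> q" \<I>] by (simp add: mon_typing assoc_Cmp tensor_Idn)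
  finally have "((\<one> p \<odot> runit V q) \<cdot> assoc V p q \<I>) \<odot> \<one> \<I> = runit V (p \<otimes> q) \<odot> \<one> \<I>"
    by (rule mono_cancel[OF assoc_iso, rotated 3]) (use pq in \<open>auto simp: mon_typing\<close>)
  then show ?thesis
    by (rule tensor_unit_faithful(2)[rotated 2, where a = "p \<otimes> q \<otimes> \<I>" and b = "p \<otimes> q"])
      (use pq in \<open>auto intro!: HomI simp: mon_typing\<close>)
qed

text \<open>Naturality of \<open>lunit\<close> at itself gives \<open>\<one> \<I> \<odot> lunit V
  \<I> = lunit V (\<I> \<otimes> \<I>)\<close>. Composed with the associator, the left side becomes
  \<open>runit V \<I> \<odot> \<one> \<I>\<close> by the triangle and the right side
  \<open>lunit V \<I> \<odot> \<one> \<I>\<close> by \<open>lunit_tensor\<close>.\<close>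

lemma lunit_runit_unit: "lunit V \<I> = runit V \<I>"
proof (rule tensor_unit_faithful(2))
  have "lunit V \<I> \<cdot> (\<one> \<I> \<odot> lunit V \<I>) = lunit V \<I> \<cdot> lunit V (\<I> \<otimes> \<I>)"
    using lunit_natural[of "lunit V \<I>" \<I>] by (simp add: mon_typing)
  then have "\<one> \<I> \<odot> lunit V \<I> = lunit V (\<I> \<otimes> \<I>)"
    by (rule mono_cancel[rotated]) (auto simp: lunit_iso mon_typing)
  then show "lunit V \<I> \<odot> \<one> \<I> = runit V \<I> \<odot> \<one> \<I>"
    using lunit_tensor[of \<I> \<I>] triangle[of \<I> \<I>] by (simp add: unit_in)
qed (auto intro!: HomI simp: mon_typing)

text \<open>This and its companions \<open>ri_tensor\<close> and \<open>ri_triangle\<close> remove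
  the associator that appears when a cell is put in the first, last or middle place of a threefold
  composite.\<close>

lemma li_tensor:
  assumes "p \<in> Ob V" "q \<in> Ob V"
  shows "assoc V \<I> p q \<cdot> (li p \<odot> \<one> q) = li (p \<otimes> q)"
proof (rule mono_cancel[of "lunit V (p \<otimes> q)"])
  show "lunit V (p \<otimes> q) \<cdot> (assoc V \<I> p q \<cdot> (li p \<odot> \<one> q)) = lunit V (p \<otimes> q) \<cdot> li (p \<otimes> q)"
    using assms reassoc[OF lunit_tensor[OF assms]] by (simp add: mon_simps)
qed (use assms in \<open>auto simp: mon_typing lunit_iso\<close>)

lemma ri_tensor:
  assumes "p \<in> Ob V" "q \<in> Ob V"
  shows "assoc V p q \<I> \<cdot> ri (p \<otimes> q) = \<one> p \<odot> ri q"
proof (rule mono_cancel[of "\<one> p \<odot> runit V q"])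
  show "(\<one> p \<odot> runit V q) \<cdot> (assoc V p q \<I> \<cdot> ri (p \<otimes> q)) = (\<one> p \<odot> runit V q) \<cdot> (\<one> p \<odot> ri q)"
    using assms reassoc[OF runit_tensor[OF assms]] by (simp add: mon_simps)
qed (use assms in \<open>auto simp: mon_typing runit_iso iso_tensor iso_Idn\<close>)

lemma ri_triangle:
  assumes "p \<in> Ob V" "q \<in> Ob V"
  shows "assoc V p \<I> q \<cdot> (ri p \<odot> \<one> q) = \<one> p \<odot> li q"
proof (rule mono_cancel[of "\<one> p \<odot> lunit V q"])
  show "(\<one> p \<odot> lunit V q) \<cdot> (assoc V p \<I> q \<cdot> (ri p \<odot> \<one> q)) = (\<one> p \<odot> lunit V q) \<cdot> (\<one> p \<odot> li q)"
    using assms reassoc[OF triangle[OF assms]] by (simp add: mon_simps)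
qed (use assms in \<open>auto simp: mon_typing lunit_iso iso_tensor iso_Idn\<close>)

lemma ai_li:
  assumes "p \<in> Ob V" "q \<in> Ob V"
  shows "ai \<I> p q \<cdot> li (p \<otimes> q) = li p \<odot> \<one> q"
  using assms li_tensor[OF assms, symmetric] reassoc[OF ai_left[of \<I> p q]] by (simp add: mon_simps)

lemma ai_li_mid:
  assumes "p \<in> Ob V" "q \<in> Ob V"
  shows "ai p \<I> q \<cdot> (\<one> p \<odot> li q) = ri p \<odot> \<one> q"
  using assms ri_triangle[OF assms, symmetric] reassoc[OF ai_left[of p \<I> q]] by (simp add: mon_simps)

lemma li_ri_unit: "li \<I> = ri \<I>"
  by (simp add: lunit_runit_unit)

lemma braid_li:
  assumes "a \<in> Ob V"
  shows "braid V \<I> a \<cdot> li a = ri a" and "braid V a \<I> \<cdot> ri a = li a"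
proof -
  note a = assms unit_in
  have b: "braid V a \<I> \<cdot> ri a = li a"
  proof (rule mono_cancel[of "lunit V a"])
    show "lunit V a \<cdot> (braid V a \<I> \<cdot> ri a) = lunit V a \<cdot> li a"
      using a reassoc[OF braid_unit[OF assms]] by (simp add: mon_simps)
  qed (use a in \<open>auto simp: mon_typing lunit_iso\<close>)
  then show "braid V a \<I> \<cdot> ri a = li a" .
  show "braid V \<I> a \<cdot> li a = ri a"
    using a reassoc[OF braid_sym[of a \<I>]] by (simp add: b[symmetric] mon_simps)
qed

lemma braid_unit_unit: "braid V \<I> \<I> = \<one> (\<I> \<otimes> \<I>)"
proof (rule epi_cancel[of "li \<I>"])
  show "braid V \<I> \<I> \<cdot> li \<I> = \<one> (\<I> \<otimes> \<I>) \<cdot> li \<I>"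
    using braid_li(1)[of \<I>] li_ri_unit by (simp add: mon_simps)
qed (auto simp: mon_typing lunit_iso iso_inv)

end

section \<open>Composition with cells\<close>

text \<open>Tensor products of enriched categories enter the argument only as domains of functors, so
  that their composition needs to be well-typed but not associative.\<close>

definition vgraph :: "('o, 'm) smc \<Rightarrow> ('a, 'o, 'm) vcat \<Rightarrow> bool" where
  "vgraph V X \<longleftrightarrow> (\<forall>a\<in>VOb X. \<forall>b\<in>VOb X. VHom X a b \<in> Ob V) \<and>
     (\<forall>a\<in>VOb X. VId X a \<in> Hom V \<I>\<^bsub>V\<^esub> (VHom X a a)) \<and>
     (\<forall>a\<in>VOb X. \<forall>b\<in>VOb X. \<forall>c\<in>VOb X.
        VCmp X a b c \<in> Hom V (VHom X b c \<otimes>\<^bsub>V\<^esub> VHom X a b) (VHom X a c))"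

definition vmap :: "('o, 'm) smc \<Rightarrow> ('a, 'o, 'm) vcat \<Rightarrow> ('b, 'o, 'm) vcat \<Rightarrow> ('a, 'b, 'm) vfun \<Rightarrow> bool" where
  "vmap V X Y F \<longleftrightarrow> (\<forall>a\<in>VOb X. FO F a \<in> VOb Y) \<and>
     (\<forall>a\<in>VOb X. \<forall>b\<in>VOb X. FM F a b \<in> Hom V (VHom X a b) (VHom Y (FO F a) (FO F b)))"

lemma vcategory_vgraph: "vcategory V X \<Longrightarrow> vgraph V X"
  by (simp add: vcategory_def vgraph_def)

lemma vfunctor_vmap: "vfunctor V X Y F \<Longrightarrow> vmap V X Y F"
  by (simp add: vfunctor_def vmap_def)

lemma VHom_Ob: "\<lbrakk>vgraph V X; a \<in> VOb X; b \<in> VOb X\<rbrakk> \<Longrightarrow> VHom X a b \<in> Ob V"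
  by (simp add: vgraph_def)

lemma
  assumes "vgraph V X" "a \<in> VOb X"
  shows Arr_VId: "VId X a \<in> Arr V" and Dom_VId: "Dom V (VId X a) = \<I>\<^bsub>V\<^esub>"
    and Cod_VId: "Cod V (VId X a) = VHom X a a"
  using assms by (auto simp: vgraph_def Hom_def)

lemma
  assumes "vgraph V X" "a \<in> VOb X" "b \<in> VOb X" "c \<in> VOb X"
  shows Arr_VCmp: "VCmp X a b c \<in> Arr V"
    and Dom_VCmp: "Dom V (VCmp X a b c) = VHom X b c \<otimes>\<^bsub>V\<^esub> VHom X a b"
    and Cod_VCmp: "Cod V (VCmp X a b c) = VHom X a c"
  using assms by (auto simp: vgraph_def Hom_def)

lemma vmap_FO: "\<lbrakk>vmap V X Y F; a \<in> VOb X\<rbrakk> \<Longrightarrow> FO F a \<in> VOb Y"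
  by (simp add: vmap_def)

lemma
  assumes "vmap V X Y F" "a \<in> VOb X" "b \<in> VOb X"
  shows Arr_FM: "FM F a b \<in> Arr V" and Dom_FM: "Dom V (FM F a b) = VHom X a b"
    and Cod_FM: "Cod V (FM F a b) = VHom Y (FO F a) (FO F b)"
  using assms by (auto simp: vmap_def Hom_def)

lemma
  assumes "f \<in> cell V X a b"
  shows cell_Arr: "f \<in> Arr V" and cell_Dom: "Dom V f = \<I>\<^bsub>V\<^esub>" and cell_Cod: "Cod V f = VHom X a b"
  using assms by (auto simp: cell_def Hom_def)

lemmas cellD = cell_Arr cell_Dom cell_Cod

lemma cellI: "\<lbrakk>f \<in> Arr V; Dom V f = \<I>\<^bsub>V\<^esub>; Cod V f = VHom X a b\<rbrakk> \<Longrightarrow> f \<in> cell V X a b"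
  by (simp add: cell_def Hom_def)

lemma VId_cell: "\<lbrakk>vgraph V X; a \<in> VOb X\<rbrakk> \<Longrightarrow> VId X a \<in> cell V X a a"
  by (simp add: vgraph_def cell_def)

lemma cell_iso_cell: "cell_iso V X a b f \<Longrightarrow> f \<in> cell V X a b"
  by (simp add: cell_iso_def)

context symmetric_monoidal_closed_category
begin

lemmas v_typing = mon_typing VHom_Ob Arr_VId Dom_VId Cod_VId Arr_VCmp Dom_VCmp Cod_VCmp VId_cell

lemmas v_simps = mon_simps v_typing

lemma
  assumes "vgraph V X" "a \<in> VOb X" "b \<in> VOb X" "d \<in> VOb X" "f \<in> cell V X a b"
  shows Arr_post: "post_comp V X d a b f \<in> Arr V"
    and Dom_post: "Dom V (post_comp V X d a b f) = VHom X d a"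
    and Cod_post: "Cod V (post_comp V X d a b f) = VHom X d b"
    and Arr_pre: "pre_comp V X d a b f \<in> Arr V"
    and Dom_pre: "Dom V (pre_comp V X d a b f) = VHom X b d"
    and Cod_pre: "Cod V (pre_comp V X d a b f) = VHom X a d"
  using assms cellD[OF assms(5)] by (simp_all add: post_comp_def pre_comp_def v_typing)

lemmas pp_typing = Arr_post Dom_post Cod_post Arr_pre Dom_pre Cod_pre

text \<open>Naturality pushes the inverse unit constraint to the domain of \<open>h\<close>. The
  right-hand side is the shape in which \<open>vnatural\<close> writes its squares, so those squares
  become equations about \<open>post_comp\<close> and \<open>pre_comp\<close>.\<close>

lemma post_Cmp:
  assumes "vgraph V X" "a \<in> VOb X" "b \<in> VOb X" "d \<in> VOb X" "f \<in> cell V X a b"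
    and "h \<in> Arr V" "Cod V h = VHom X d a"
  shows "post_comp V X d a b f \<cdot> h = VCmp X d a b \<cdot> (f \<odot> h) \<cdot> li (Dom V h)"
  using assms cellD[OF assms(5)] reassoc[OF li_natural[OF assms(6,7)]]
  by (simp add: post_comp_def v_simps li_natural)

lemma pre_Cmp:
  assumes "vgraph V X" "a \<in> VOb X" "b \<in> VOb X" "d \<in> VOb X" "f \<in> cell V X a b"
    and "h \<in> Arr V" "Cod V h = VHom X b d"
  shows "pre_comp V X d a b f \<cdot> h = VCmp X a b d \<cdot> (h \<odot> f) \<cdot> ri (Dom V h)"
  using assms cellD[OF assms(5)] reassoc[OF ri_natural[OF assms(6,7)]]
  by (simp add: pre_comp_def v_simps ri_natural)

lemma post_cell:
  assumes "vgraph V X" "a \<in> VOb X" "b \<in> VOb X" "d \<in> VOb X" "g \<in> cell V X a b" "f \<in> cell V X d a"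
  shows "post_comp V X d a b g \<cdot> f = cell_comp V X d a b g f"
  using assms cellD[OF assms(5)] cellD[OF assms(6)]
  by (simp add: post_Cmp cell_comp_def pair_cell_def v_typing)

lemma pre_cell:
  assumes "vgraph V X" "a \<in> VOb X" "b \<in> VOb X" "d \<in> VOb X" "f \<in> cell V X a b" "g \<in> cell V X b d"
  shows "pre_comp V X d a b f \<cdot> g = cell_comp V X a b d g f"
  using assms cellD[OF assms(5)] cellD[OF assms(6)]
  by (simp add: pre_Cmp cell_comp_def pair_cell_def v_typing li_ri_unit)

lemma cell_comp_cell:
  assumes "vgraph V X" "a \<in> VOb X" "b \<in> VOb X" "c \<in> VOb X" "g \<in> cell V X b c" "f \<in> cell V X a b"
  shows "cell_comp V X a b c g f \<in> cell V X a c"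
  using assms cellD[OF assms(5)] cellD[OF assms(6)]
  by (intro cellI) (simp_all add: cell_comp_def pair_cell_def v_typing)

text \<open>Associativity tested on arbitrary arrows into the three hom-objects. Taking one of them
  to be a cell and the others identities yields \<open>post_VCmp\<close>, \<open>pre_VCmp\<close>
  and \<open>VCmp_pre\<close>, the position of the cell deciding which.\<close>

lemma VCmp_VCmp:
  assumes "vcategory V X" "a \<in> VOb X" "b \<in> VOb X" "c \<in> VOb X" "d \<in> VOb X"
    and "h \<in> Arr V" "Cod V h = VHom X c d" "g \<in> Arr V" "Cod V g = VHom X b c"
    and "f \<in> Arr V" "Cod V f = VHom X a b"
  shows "VCmp X a b d \<cdot> ((VCmp X b c d \<cdot> (h \<odot> g)) \<odot> f) =
    VCmp X a c d \<cdot> (h \<odot> (VCmp X a b c \<cdot> (g \<odot> f))) \<cdot> assoc V (Dom V h) (Dom V g) (Dom V f)"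
proof -
  note X = vcategory_vgraph[OF assms(1)]
  have "VCmp X a b d \<cdot> ((VCmp X b c d \<cdot> (h \<odot> g)) \<odot> f) =
      VCmp X a b d \<cdot> ((VCmp X b c d \<odot> \<one> (VHom X a b)) \<cdot> (h \<odot> g \<odot> f))"
    using assms X by (simp add: v_simps)
  also have "\<dots> = (VCmp X a c d \<cdot> (\<one> (VHom X c d) \<odot> VCmp X a b c) \<cdot>
      assoc V (VHom X c d) (VHom X b c) (VHom X a b)) \<cdot> (h \<odot> g \<odot> f)"
    by (rule reassoc[OF vcategory.VCmp_assoc]) (use assms X in \<open>auto simp: v_typing\<close>)
  also have "\<dots> = VCmp X a c d \<cdot> (\<one> (VHom X c d) \<odot> VCmp X a b c) \<cdot>
      ((h \<odot> (g \<odot> f)) \<cdot> assoc V (Dom V h) (Dom V g) (Dom V f))"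
    using assms X by (simp add: v_typing assoc_Cmp assoc_natural)
  also have "\<dots> = VCmp X a c d \<cdot> (h \<odot> (VCmp X a b c \<cdot> (g \<odot> f))) \<cdot> assoc V (Dom V h) (Dom V g) (Dom V f)"
    using assms X by (simp add: v_simps)
  finally show ?thesis .
qed

lemma post_VCmp:
  assumes "vcategory V X" "a \<in> VOb X" "b \<in> VOb X" "c \<in> VOb X" "d \<in> VOb X" "f \<in> cell V X c d"
  shows "post_comp V X a c d f \<cdot> VCmp X a b c =
    VCmp X a b d \<cdot> (post_comp V X b c d f \<odot> \<one> (VHom X a b))"
proof -
  note X = vcategory_vgraph[OF assms(1)] and f = cellD[OF assms(6)]
  let ?p = "VHom X b c" and ?q = "VHom X a b"
  have pq: "?p \<in> Ob V" "?q \<in> Ob V" using assms X by (simp_all add: v_typing)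
  have "VCmp X a b d \<cdot> (post_comp V X b c d f \<odot> \<one> ?q) =
      (VCmp X a b d \<cdot> ((VCmp X b c d \<cdot> (f \<odot> \<one> ?p)) \<odot> \<one> ?q)) \<cdot> (li ?p \<odot> \<one> ?q)"
    using assms X f by (simp add: post_comp_def v_simps)
  also have "\<dots> = VCmp X a c d \<cdot> (f \<odot> VCmp X a b c) \<cdot> (assoc V \<I> ?p ?q \<cdot> (li ?p \<odot> \<one> ?q))"
    using assms X f by (subst VCmp_VCmp) (simp_all add: v_simps)
  also have "\<dots> = post_comp V X a c d f \<cdot> VCmp X a b c"
    using assms X f by (simp add: li_tensor post_Cmp v_typing)
  finally show ?thesis ..
qed

lemma pre_VCmp:
  assumes "vcategory V X" "a \<in> VOb X" "b \<in> VOb X" "c \<in> VOb X" "d \<in> VOb X" "f \<in> cell V X a b"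
  shows "pre_comp V X d a b f \<cdot> VCmp X b c d =
    VCmp X a c d \<cdot> (\<one> (VHom X c d) \<odot> pre_comp V X c a b f)"
proof -
  note X = vcategory_vgraph[OF assms(1)] and f = cellD[OF assms(6)]
  let ?p = "VHom X c d" and ?q = "VHom X b c"
  have pq: "?p \<in> Ob V" "?q \<in> Ob V" using assms X by (simp_all add: v_typing)
  have "pre_comp V X d a b f \<cdot> VCmp X b c d =
      (VCmp X a b d \<cdot> ((VCmp X b c d \<cdot> (\<one> ?p \<odot> \<one> ?q)) \<odot> f)) \<cdot> ri (?p \<otimes> ?q)"
    using assms X f by (simp add: pre_Cmp v_simps)
  also have "\<dots> = VCmp X a c d \<cdot> (\<one> ?p \<odot> (VCmp X a b c \<cdot> (\<one> ?q \<odot> f))) \<cdot> (assoc V ?p ?q \<I> \<cdot> ri (?p \<otimes> ?q))"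
    using assms X f by (subst VCmp_VCmp) (simp_all add: v_simps)
  also have "\<dots> = VCmp X a c d \<cdot> (\<one> ?p \<odot> pre_comp V X c a b f)"
    using assms X f by (simp add: ri_tensor[OF pq] pre_comp_def v_simps)
  finally show ?thesis .
qed

lemma VCmp_pre:
  assumes "vcategory V X" "a \<in> VOb X" "b \<in> VOb X" "c \<in> VOb X" "d \<in> VOb X" "f \<in> cell V X b c"
  shows "VCmp X a b d \<cdot> (pre_comp V X d b c f \<odot> \<one> (VHom X a b)) =
    VCmp X a c d \<cdot> (\<one> (VHom X c d) \<odot> post_comp V X a b c f)"
proof -
  note X = vcategory_vgraph[OF assms(1)] and f = cellD[OF assms(6)]
  let ?p = "VHom X c d" and ?q = "VHom X a b"
  have pq: "?p \<in> Ob V" "?q \<in> Ob V" using assms X by (simp_all add: v_typing)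
  have "VCmp X a b d \<cdot> (pre_comp V X d b c f \<odot> \<one> ?q) =
      (VCmp X a b d \<cdot> ((VCmp X b c d \<cdot> (\<one> ?p \<odot> f)) \<odot> \<one> ?q)) \<cdot> (ri ?p \<odot> \<one> ?q)"
    using assms X f by (simp add: pre_comp_def v_simps)
  also have "\<dots> = VCmp X a c d \<cdot> (\<one> ?p \<odot> (VCmp X a b c \<cdot> (f \<odot> \<one> ?q))) \<cdot>
      (assoc V ?p \<I> ?q \<cdot> (ri ?p \<odot> \<one> ?q))"
    using assms X f by (subst VCmp_VCmp) (simp_all add: v_simps)
  also have "\<dots> = VCmp X a c d \<cdot> (\<one> ?p \<odot> post_comp V X a b c f)"
    using assms X f by (simp add: ri_triangle[OF pq] post_comp_def v_simps)
  finally show ?thesis .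
qed

lemma post_cell_comp:
  assumes "vcategory V X" "a \<in> VOb X" "b \<in> VOb X" "c \<in> VOb X" "d \<in> VOb X"
    and "g \<in> cell V X b c" "f \<in> cell V X a b"
  shows "post_comp V X d a c (cell_comp V X a b c g f) = post_comp V X d b c g \<cdot> post_comp V X d a b f"
proof -
  note X = vcategory_vgraph[OF assms(1)] and f = cellD[OF assms(7)]
  let ?q = "VHom X d a"
  have "post_comp V X d b c g \<cdot> post_comp V X d a b f =
      (post_comp V X d b c g \<cdot> VCmp X d a b) \<cdot> (f \<odot> \<one> ?q) \<cdot> li ?q"
    unfolding post_comp_def[of V X d a b] using assms X f by (simp add: v_simps pp_typing)
  also have "\<dots> = VCmp X d a c \<cdot> ((post_comp V X a b c g \<cdot> f) \<odot> \<one> ?q) \<cdot> li ?q"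
    using assms X f by (simp add: post_VCmp v_simps pp_typing)
  also have "\<dots> = post_comp V X d a c (cell_comp V X a b c g f)"
    using assms X by (simp add: post_cell post_comp_def[of V X d a c])
  finally show ?thesis ..
qed

lemma pre_cell_comp:
  assumes "vcategory V X" "a \<in> VOb X" "b \<in> VOb X" "c \<in> VOb X" "d \<in> VOb X"
    and "g \<in> cell V X b c" "f \<in> cell V X a b"
  shows "pre_comp V X d a c (cell_comp V X a b c g f) = pre_comp V X d a b f \<cdot> pre_comp V X d b c g"
proof -
  note X = vcategory_vgraph[OF assms(1)] and g = cellD[OF assms(6)]
  let ?q = "VHom X c d"
  have "pre_comp V X d a b f \<cdot> pre_comp V X d b c g =
      (pre_comp V X d a b f \<cdot> VCmp X b c d) \<cdot> (\<one> ?q \<odot> g) \<cdot> ri ?q"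
    unfolding pre_comp_def[of V X d b c] using assms X g by (simp add: v_simps pp_typing)
  also have "\<dots> = VCmp X a c d \<cdot> (\<one> ?q \<odot> (pre_comp V X c a b f \<cdot> g)) \<cdot> ri ?q"
    using assms X g by (simp add: pre_VCmp v_simps pp_typing)
  also have "\<dots> = pre_comp V X d a c (cell_comp V X a b c g f)"
    using assms X by (simp add: pre_cell pre_comp_def[of V X d a c])
  finally show ?thesis ..
qed

lemma post_VId:
  assumes "vcategory V X" "a \<in> VOb X" "d \<in> VOb X"
  shows "post_comp V X d a a (VId X a) = \<one> (VHom X d a)"
  using assms vcategory_vgraph[OF assms(1)] reassoc[OF vcategory.VCmp_VId_left[OF assms(1,3,2)]]
  by (simp add: post_comp_def v_simps)

lemma pre_VId:
  assumes "vcategory V X" "a \<in> VOb X" "d \<in> VOb X"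
  shows "pre_comp V X d a a (VId X a) = \<one> (VHom X a d)"
  using assms vcategory_vgraph[OF assms(1)] reassoc[OF vcategory.VCmp_VId_right[OF assms(1,2,3)]]
  by (simp add: pre_comp_def v_simps)

text \<open>Commutation of the two actions on a hom-object; it moves a naturality square past a cell
  acting on the other side.\<close>

lemma post_pre:
  assumes "vcategory V X" "a \<in> VOb X" "b \<in> VOb X" "c \<in> VOb X" "d \<in> VOb X"
    and "u \<in> cell V X c d" "v \<in> cell V X a b"
  shows "post_comp V X a c d u \<cdot> pre_comp V X c a b v = pre_comp V X d a b v \<cdot> post_comp V X b c d u"
proof -
  note X = vcategory_vgraph[OF assms(1)] and v = cellD[OF assms(7)]
  let ?q = "VHom X b c"
  have "post_comp V X a c d u \<cdot> pre_comp V X c a b v =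
      (post_comp V X a c d u \<cdot> VCmp X a b c) \<cdot> (\<one> ?q \<odot> v) \<cdot> ri ?q"
    unfolding pre_comp_def using assms X v by (simp add: v_simps pp_typing)
  also have "\<dots> = VCmp X a b d \<cdot> (post_comp V X b c d u \<odot> v) \<cdot> ri ?q"
    using assms X v by (simp add: post_VCmp v_simps pp_typing)
  also have "\<dots> = pre_comp V X d a b v \<cdot> post_comp V X b c d u"
    using assms X by (simp add: pre_Cmp pp_typing v_typing)
  finally show ?thesis .
qed

lemma cell_comp_assoc:
  assumes "vcategory V X" "a \<in> VOb X" "b \<in> VOb X" "c \<in> VOb X" "d \<in> VOb X"
    and "h \<in> cell V X c d" "g \<in> cell V X b c" "f \<in> cell V X a b"
  shows "cell_comp V X a b d (cell_comp V X b c d h g) f = cell_comp V X a c d h (cell_comp V X a b c g f)"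
proof -
  note X = vcategory_vgraph[OF assms(1)] and f = cellD[OF assms(8)]
  have "cell_comp V X a b d (cell_comp V X b c d h g) f = post_comp V X a b d (cell_comp V X b c d h g) \<cdot> f"
    by (rule post_cell[symmetric]) (use assms X in \<open>auto simp: cell_comp_cell\<close>)
  also have "\<dots> = post_comp V X a c d h \<cdot> (post_comp V X a b c g \<cdot> f)"
    using assms X f by (simp add: post_cell_comp v_simps pp_typing)
  finally show ?thesis using assms X by (simp add: post_cell cell_comp_cell)
qed

lemma cell_comp_VId_left:
  assumes "vcategory V X" "a \<in> VOb X" "b \<in> VOb X" "f \<in> cell V X a b"
  shows "cell_comp V X a b b (VId X b) f = f"
  using assms vcategory_vgraph[OF assms(1)] cellD[OF assms(4)]
  by (simp add: post_cell[symmetric] post_VId v_simps)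

lemma cell_comp_VId_right:
  assumes "vcategory V X" "a \<in> VOb X" "b \<in> VOb X" "f \<in> cell V X a b"
  shows "cell_comp V X a a b f (VId X a) = f"
  using assms vcategory_vgraph[OF assms(1)] cellD[OF assms(4)]
  by (simp add: pre_cell[symmetric] pre_VId v_simps)

lemma
  assumes "vcategory V X" "a \<in> VOb X" "b \<in> VOb X" "d \<in> VOb X" "cell_iso V X a b f"
  shows iso_post: "iso V (post_comp V X d a b f)" and iso_pre: "iso V (pre_comp V X d a b f)"
proof -
  note X = vcategory_vgraph[OF assms(1)]
  obtain g where g: "f \<in> cell V X a b" "g \<in> cell V X b a"
    "cell_comp V X a b a g f = VId X a" "cell_comp V X b a b f g = VId X b"
    using assms(5) by (auto simp: cell_iso_def)
  show "iso V (post_comp V X d a b f)"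
    by (rule isoI[of _ "VHom X d a" "VHom X d b" "post_comp V X d b a g"])
      (use assms(1-4) X g in \<open>auto intro!: HomI simp: pp_typing post_cell_comp[symmetric] post_VId\<close>)
  show "iso V (pre_comp V X d a b f)"
    by (rule isoI[of _ "VHom X b d" "VHom X a d" "pre_comp V X d b a g"])
      (use assms(1-4) X g in \<open>auto intro!: HomI simp: pp_typing pre_cell_comp[symmetric] pre_VId\<close>)
qed

subsection \<open>Functors\<close>

lemma map_cell_cell:
  assumes "vmap V X Y F" "a \<in> VOb X" "b \<in> VOb X" "f \<in> cell V X a b"
  shows "map_cell V F a b f \<in> cell V Y (FO F a) (FO F b)"
  using assms cellD[OF assms(4)] by (intro cellI) (simp_all add: map_cell_def v_typing Arr_FM Dom_FM Cod_FM)

lemma FM_post: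
  assumes F: "vfunctor V X Y F" and "vgraph V X" "vgraph V Y"
    and "a \<in> VOb X" "b \<in> VOb X" "d \<in> VOb X" "f \<in> cell V X a b"
  shows "FM F d b \<cdot> post_comp V X d a b f =
    post_comp V Y (FO F d) (FO F a) (FO F b) (map_cell V F a b f) \<cdot> FM F d a"
proof -
  note F' = vfunctor_vmap[OF F] and f = cellD[OF assms(7)]
  note [simp] = Arr_FM[OF F'] Dom_FM[OF F'] Cod_FM[OF F'] vmap_FO[OF F'] map_cell_cell[OF F']
  have "FM F d b \<cdot> post_comp V X d a b f = (FM F d b \<cdot> VCmp X d a b) \<cdot> (f \<odot> \<one> (VHom X d a)) \<cdot> li (VHom X d a)"
    using assms(2-) f by (simp add: post_comp_def v_simps)
  also have "\<dots> = VCmp Y (FO F d) (FO F a) (FO F b) \<cdot> (map_cell V F a b f \<odot> FM F d a) \<cdot> li (VHom X d a)"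
    using assms(2-) f by (simp add: vfunctor.FM_VCmp[OF F] map_cell_def v_simps)
  also have "\<dots> = post_comp V Y (FO F d) (FO F a) (FO F b) (map_cell V F a b f) \<cdot> FM F d a"
    using assms(2-) by (simp add: post_Cmp)
  finally show ?thesis .
qed

lemma FM_pre:
  assumes F: "vfunctor V X Y F" and "vgraph V X" "vgraph V Y"
    and "a \<in> VOb X" "b \<in> VOb X" "d \<in> VOb X" "f \<in> cell V X a b"
  shows "FM F a d \<cdot> pre_comp V X d a b f =
    pre_comp V Y (FO F d) (FO F a) (FO F b) (map_cell V F a b f) \<cdot> FM F b d"
proof -
  note F' = vfunctor_vmap[OF F] and f = cellD[OF assms(7)]
  note [simp] = Arr_FM[OF F'] Dom_FM[OF F'] Cod_FM[OF F'] vmap_FO[OF F'] map_cell_cell[OF F']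
  have "FM F a d \<cdot> pre_comp V X d a b f = (FM F a d \<cdot> VCmp X a b d) \<cdot> (\<one> (VHom X b d) \<odot> f) \<cdot> ri (VHom X b d)"
    using assms(2-) f by (simp add: pre_comp_def v_simps)
  also have "\<dots> = VCmp Y (FO F a) (FO F b) (FO F d) \<cdot> (FM F b d \<odot> map_cell V F a b f) \<cdot> ri (VHom X b d)"
    using assms(2-) f by (simp add: vfunctor.FM_VCmp[OF F] map_cell_def v_simps)
  also have "\<dots> = pre_comp V Y (FO F d) (FO F a) (FO F b) (map_cell V F a b f) \<cdot> FM F b d"
    using assms(2-) by (simp add: pre_Cmp)
  finally show ?thesis .
qed

lemma map_cell_comp:
  assumes F: "vfunctor V X Y F" and "vgraph V X" "vgraph V Y"
    and "a \<in> VOb X" "b \<in> VOb X" "c \<in> VOb X" "g \<in> cell V X b c" "f \<in> cell V X a b"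
  shows "map_cell V F a c (cell_comp V X a b c g f) =
    cell_comp V Y (FO F a) (FO F b) (FO F c) (map_cell V F b c g) (map_cell V F a b f)"
proof -
  note F' = vfunctor_vmap[OF F] and f = cellD[OF assms(8)]
  note [simp] = Arr_FM[OF F'] Dom_FM[OF F'] Cod_FM[OF F'] vmap_FO[OF F'] map_cell_cell[OF F']
  have "map_cell V F a c (cell_comp V X a b c g f) = (FM F a c \<cdot> post_comp V X a b c g) \<cdot> f"
    using assms(2-) f by (simp add: map_cell_def post_cell[symmetric] v_simps pp_typing)
  also have "\<dots> = post_comp V Y (FO F a) (FO F b) (FO F c) (map_cell V F b c g) \<cdot> map_cell V F a b f"
    using assms(2-) f by (simp add: FM_post[OF F] map_cell_def[of V F a b] v_simps pp_typing)
  finally show ?thesis using assms(2-) by (simp add: post_cell)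
qed

lemma map_cell_VId: "\<lbrakk>vfunctor V X Y F; a \<in> VOb X\<rbrakk> \<Longrightarrow> map_cell V F a a (VId X a) = VId Y (FO F a)"
  by (simp add: map_cell_def vfunctor.FM_VId)

lemma vfunctor_id:
  assumes "vgraph V X"
  shows "vfunctor V X X (vfun_id V X)"
  by unfold_locales (use assms in \<open>auto simp: vfun_id_def v_simps intro!: HomI\<close>)

lemma vmap_comp:
  assumes "vmap V X Y F" "vmap V Y Z G"
  shows "vmap V X Z (vfun_comp V G F)"
  using assms by (auto simp: vmap_def vfun_comp_def intro!: Cmp_in)

lemma vfunctor_comp:
  assumes F: "vfunctor V X Y F" and G: "vfunctor V Y Z G" and "vgraph V X" "vgraph V Y" "vgraph V Z"
  shows "vfunctor V X Z (vfun_comp V G F)"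
proof
  note F' = vfunctor_vmap[OF F] and G' = vfunctor_vmap[OF G]
  note [simp] = Arr_FM[OF F'] Dom_FM[OF F'] Cod_FM[OF F'] vmap_FO[OF F']
    Arr_FM[OF G'] Dom_FM[OF G'] Cod_FM[OF G'] vmap_FO[OF G']
  fix a assume a: "a \<in> VOb X"
  show "FO (vfun_comp V G F) a \<in> VOb Z" using a by (simp add: vfun_comp_def)
  show "FM (vfun_comp V G F) a a \<cdot> VId X a = VId Z (FO (vfun_comp V G F) a)"
    using a assms(3-) by (simp add: vfun_comp_def v_simps vfunctor.FM_VId[OF F] vfunctor.FM_VId[OF G])
  fix b assume b: "b \<in> VOb X"
  show "FM (vfun_comp V G F) a b \<in> Hom V (VHom X a b) (VHom Z (FO (vfun_comp V G F) a) (FO (vfun_comp V G F) b))"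
    using a b by (auto simp: vfun_comp_def v_typing intro!: HomI)
  fix c assume c: "c \<in> VOb X"
  show "FM (vfun_comp V G F) a c \<cdot> VCmp X a b c =
      VCmp Z (FO (vfun_comp V G F) a) (FO (vfun_comp V G F) b) (FO (vfun_comp V G F) c) \<cdot>
      (FM (vfun_comp V G F) b c \<odot> FM (vfun_comp V G F) a b)"
    using a b c assms(3-) reassoc[OF vfunctor.FM_VCmp[OF G]]
    by (simp add: vfun_comp_def v_simps vfunctor.FM_VCmp[OF F])
qed

end

section \<open>Natural transformations\<close>

text \<open>Functors assembled by composition and tensoring in different ways agree on objects of
  \<open>X\<close> without being equal as records. Naturality is therefore carried over by comparing
  values on \<open>VOb X\<close>.\<close>

lemma vnatural_cong:
  assumes "vnatural V X Y F G t"
    and "\<And>a. a \<in> VOb X \<Longrightarrow> FO F' a = FO F a" "\<And>a b. \<lbrakk>a \<in> VOb X; b \<in> VOb X\<rbrakk> \<Longrightarrow> FM F' a b = FM F a b"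
    and "\<And>a. a \<in> VOb X \<Longrightarrow> FO G' a = FO G a" "\<And>a b. \<lbrakk>a \<in> VOb X; b \<in> VOb X\<rbrakk> \<Longrightarrow> FM G' a b = FM G a b"
    and "\<And>a. a \<in> VOb X \<Longrightarrow> t' a = t a"
  shows "vnatural V X Y F' G' t'"
  using assms by (simp add: vnatural_def)

lemma vop_simps [simp]:
  "VOb (vop V X) = VOb X" "VHom (vop V X) a b = VHom X b a" "VId (vop V X) = VId X"
  "VCmp (vop V X) a b c = VCmp X c b a \<cdot>\<^bsub>V\<^esub> braid V (VHom X c b) (VHom X b a)"
  by (simp_all add: vop_def)

lemma vtensor_simps [simp]:
  "VOb (vtensor V X Y) = VOb X \<times> VOb Y"
  "VHom (vtensor V X Y) (a, b) (a', b') = VHom X a a' \<otimes>\<^bsub>V\<^esub> VHom Y b b'"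
  "VId (vtensor V X Y) (a, b) = pair_cell V (VId X a) (VId Y b)"
  by (simp_all add: vtensor_def)

lemma vfun_op_simps [simp]: "FO (vfun_op F) a = FO F a" "FM (vfun_op F) a b = FM F b a"
  by (simp_all add: vfun_op_def)

lemma vfun_id_simps [simp]: "FO (vfun_id V X) a = a" "FM (vfun_id V X) a b = \<one>\<^bsub>V\<^esub> (VHom X a b)"
  by (simp_all add: vfun_id_def)

lemma vfun_comp_simps [simp]:
  "FO (vfun_comp V G F) a = FO G (FO F a)"
  "FM (vfun_comp V G F) a b = FM G (FO F a) (FO F b) \<cdot>\<^bsub>V\<^esub> FM F a b"
  by (simp_all add: vfun_comp_def)

lemma vfun_tensor_simps [simp]:
  "FO (vfun_tensor V F G) (a, b) = (FO F a, FO G b)"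
  "FM (vfun_tensor V F G) (a, b) (a', b') = FM F a a' \<odot>\<^bsub>V\<^esub> FM G b b'"
  by (simp_all add: vfun_tensor_def)

lemma vfun_assoc_simps [simp]:
  "FO (vfun_assoc V X Y Z) ((a, b), c) = (a, (b, c))"
  "FM (vfun_assoc V X Y Z) ((a, b), c) ((a', b'), c') = assoc V (VHom X a a') (VHom Y b b') (VHom Z c c')"
  by (simp_all add: vfun_assoc_def)

lemma vfun_swap_simps [simp]:
  "FO (vfun_swap V X Y) (a, b) = (b, a)"
  "FM (vfun_swap V X Y) (a, b) (a', b') = braid V (VHom X a a') (VHom Y b b')"
  by (simp_all add: vfun_swap_def)

context symmetric_monoidal_closed_category
begin

lemma vnatural_iff:
  assumes Y: "vgraph V Y" and F: "vmap V X Y F" and G: "vmap V X Y G"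
  shows "vnatural V X Y F G t \<longleftrightarrow> (\<forall>a\<in>VOb X. t a \<in> cell V Y (FO F a) (FO G a)) \<and>
    (\<forall>a\<in>VOb X. \<forall>b\<in>VOb X. post_comp V Y (FO F a) (FO F b) (FO G b) (t b) \<cdot> FM F a b =
       pre_comp V Y (FO G b) (FO F a) (FO G a) (t a) \<cdot> FM G a b)"
proof -
  note [simp] = Arr_FM[OF F] Dom_FM[OF F] Cod_FM[OF F] vmap_FO[OF F]
    Arr_FM[OF G] Dom_FM[OF G] Cod_FM[OF G] vmap_FO[OF G]
  show ?thesis
    using Y by (auto simp: vnatural_def post_Cmp pre_Cmp)
qed

lemma vnatural_cell: "\<lbrakk>vnatural V X Y F G t; a \<in> VOb X\<rbrakk> \<Longrightarrow> t a \<in> cell V Y (FO F a) (FO G a)"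
  by (simp add: vnatural_def)

text \<open>Makes it unnecessary to invert transformations.\<close>

lemma vnatural_cancel:
  assumes Y: "vcategory V Y" and F: "vmap V X Y F" and G: "vmap V X Y G" and H: "vmap V X Y H"
    and t: "vnatural V X Y F G t" and r: "vnatural V X Y F H r"
    and iso: "\<And>a. a \<in> VOb X \<Longrightarrow> cell_iso V Y (FO F a) (FO G a) (t a)"
    and s: "\<And>a. a \<in> VOb X \<Longrightarrow> s a \<in> cell V Y (FO G a) (FO H a)"
    and eq: "\<And>a. a \<in> VOb X \<Longrightarrow> r a = cell_comp V Y (FO F a) (FO G a) (FO H a) (s a) (t a)"
  shows "vnatural V X Y G H s"
proof -
  note Y' = vcategory_vgraph[OF Y]
  note [simp] = Arr_FM[OF F] Dom_FM[OF F] Cod_FM[OF F] vmap_FO[OF F]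
    Arr_FM[OF G] Dom_FM[OF G] Cod_FM[OF G] vmap_FO[OF G]
    Arr_FM[OF H] Dom_FM[OF H] Cod_FM[OF H] vmap_FO[OF H]
  note tc = vnatural_cell[OF t] and rc = vnatural_cell[OF r]
  have "post_comp V Y (FO G a) (FO G b) (FO H b) (s b) \<cdot> FM G a b =
      pre_comp V Y (FO H b) (FO G a) (FO H a) (s a) \<cdot> FM H a b"
    if ab: "a \<in> VOb X" "b \<in> VOb X" for a b
  proof (rule mono_cancel[OF iso_pre[OF Y _ _ _ iso[OF ab(1)], of "FO H b"]])
    note [simp] = pp_typing[OF Y'] tc[OF ab(1)] tc[OF ab(2)] rc s
    have "pre_comp V Y (FO H b) (FO F a) (FO G a) (t a) \<cdot> post_comp V Y (FO G a) (FO G b) (FO H b) (s b) \<cdot> FM G a b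
        = (post_comp V Y (FO F a) (FO G b) (FO H b) (s b) \<cdot> pre_comp V Y (FO G b) (FO F a) (FO G a) (t a)) \<cdot> FM G a b"
      using ab Y' by (simp add: post_pre[OF Y] v_simps)
    also have "\<dots> = post_comp V Y (FO F a) (FO G b) (FO H b) (s b) \<cdot>
        post_comp V Y (FO F a) (FO F b) (FO G b) (t b) \<cdot> FM F a b"
      using ab Y' t by (simp add: vnatural_iff[OF Y' F G] v_simps)
    also have "\<dots> = post_comp V Y (FO F a) (FO F b) (FO H b) (r b) \<cdot> FM F a b"
      using ab Y' by (simp add: eq post_cell_comp[OF Y] v_simps)
    also have "\<dots> = pre_comp V Y (FO H b) (FO F a) (FO H a) (r a) \<cdot> FM H a b"
      using ab r by (simp add: vnatural_iff[OF Y' F H])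
    also have "\<dots> = pre_comp V Y (FO H b) (FO F a) (FO G a) (t a) \<cdot>
        pre_comp V Y (FO H b) (FO G a) (FO H a) (s a) \<cdot> FM H a b"
      using ab Y' by (simp add: eq pre_cell_comp[OF Y] v_simps)
    finally show "pre_comp V Y (FO H b) (FO F a) (FO G a) (t a) \<cdot>
        post_comp V Y (FO G a) (FO G b) (FO H b) (s b) \<cdot> FM G a b =
      pre_comp V Y (FO H b) (FO F a) (FO G a) (t a) \<cdot>
        pre_comp V Y (FO H b) (FO G a) (FO H a) (s a) \<cdot> FM H a b" .
  qed (use ab Y' in \<open>auto simp: pp_typing s tc v_typing\<close>)
  then show ?thesis
    using s by (simp add: vnatural_iff[OF Y' G H])
qed

lemma vnatural_VId:
  assumes Y: "vcategory V Y" and F: "vmap V X Y F"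
  shows "vnatural V X Y F F (\<lambda>a. VId Y (FO F a))"
  using Y vcategory_vgraph[OF Y] vmap_FO[OF F] Arr_FM[OF F] Dom_FM[OF F] Cod_FM[OF F]
  by (simp add: vnatural_iff[OF _ F F] post_VId pre_VId v_simps)

lemma vnatural_comp:
  assumes Y: "vcategory V Y" and F: "vmap V X Y F" and G: "vmap V X Y G" and H: "vmap V X Y H"
    and t: "vnatural V X Y F G t" and s: "vnatural V X Y G H s"
  shows "vnatural V X Y F H (\<lambda>a. cell_comp V Y (FO F a) (FO G a) (FO H a) (s a) (t a))"
proof -
  note Y' = vcategory_vgraph[OF Y]
  note [simp] = Arr_FM[OF F] Dom_FM[OF F] Cod_FM[OF F] vmap_FO[OF F]
    Arr_FM[OF G] Dom_FM[OF G] Cod_FM[OF G] vmap_FO[OF G]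
    Arr_FM[OF H] Dom_FM[OF H] Cod_FM[OF H] vmap_FO[OF H]
  note [simp] = pp_typing[OF Y'] vnatural_cell[OF t] vnatural_cell[OF s] cell_comp_cell[OF Y']
  have "post_comp V Y (FO F a) (FO F b) (FO H b) (cell_comp V Y (FO F b) (FO G b) (FO H b) (s b) (t b)) \<cdot> FM F a b =
      pre_comp V Y (FO H b) (FO F a) (FO H a) (cell_comp V Y (FO F a) (FO G a) (FO H a) (s a) (t a)) \<cdot> FM H a b"
    if ab: "a \<in> VOb X" "b \<in> VOb X" for a b
  proof -
    have "post_comp V Y (FO F a) (FO F b) (FO H b) (cell_comp V Y (FO F b) (FO G b) (FO H b) (s b) (t b)) \<cdot> FM F a b
        = post_comp V Y (FO F a) (FO G b) (FO H b) (s b) \<cdot> pre_comp V Y (FO G b) (FO F a) (FO G a) (t a) \<cdot> FM G a b"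
      using ab Y' t by (simp add: post_cell_comp[OF Y] vnatural_iff[OF Y' F G] v_simps)
    also have "\<dots> = (pre_comp V Y (FO H b) (FO F a) (FO G a) (t a) \<cdot> post_comp V Y (FO G a) (FO G b) (FO H b) (s b)) \<cdot> FM G a b"
      using ab Y' by (simp add: post_pre[OF Y, symmetric] v_simps)
    also have "\<dots> = pre_comp V Y (FO H b) (FO F a) (FO H a) (cell_comp V Y (FO F a) (FO G a) (FO H a) (s a) (t a)) \<cdot> FM H a b"
      using ab Y' s by (simp add: pre_cell_comp[OF Y] vnatural_iff[OF Y' G H] v_simps)
    finally show ?thesis .
  qed
  then show ?thesis
    using Y' by (simp add: vnatural_iff[OF Y' F H])
qed

lemma vnatural_whisker:
  assumes t: "vnatural V X Y F G t" and K: "vmap V W X K"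
    and Y: "vgraph V Y" and F: "vmap V X Y F" and G: "vmap V X Y G"
  shows "vnatural V W Y (vfun_comp V F K) (vfun_comp V G K) (\<lambda>w. t (FO K w))"
proof -
  note [simp] = Arr_FM[OF F] Dom_FM[OF F] Cod_FM[OF F] vmap_FO[OF F]
    Arr_FM[OF G] Dom_FM[OF G] Cod_FM[OF G] vmap_FO[OF G]
    Arr_FM[OF K] Dom_FM[OF K] Cod_FM[OF K] vmap_FO[OF K]
    pp_typing[OF Y] vnatural_cell[OF t]
  have "post_comp V Y (FO F (FO K a)) (FO F (FO K b)) (FO G (FO K b)) (t (FO K b)) \<cdot> (FM F (FO K a) (FO K b) \<cdot> FM K a b) =
      pre_comp V Y (FO G (FO K b)) (FO F (FO K a)) (FO G (FO K a)) (t (FO K a)) \<cdot> (FM G (FO K a) (FO K b) \<cdot> FM K a b)"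
    if ab: "a \<in> VOb W" "b \<in> VOb W" for a b
  proof -
    have "post_comp V Y (FO F (FO K a)) (FO F (FO K b)) (FO G (FO K b)) (t (FO K b)) \<cdot> FM F (FO K a) (FO K b) =
      pre_comp V Y (FO G (FO K b)) (FO F (FO K a)) (FO G (FO K a)) (t (FO K a)) \<cdot> FM G (FO K a) (FO K b)"
      using ab t by (simp add: vnatural_iff[OF Y F G])
    from reassoc[OF this, of "FM K a b"] show ?thesis using ab Y by (simp add: v_simps)
  qed
  then show ?thesis
    by (simp add: vnatural_iff[OF Y vmap_comp[OF K F] vmap_comp[OF K G]])
qed

lemma vnatural_apply:
  assumes t: "vnatural V X Y F G t" and H: "vfunctor V Y Z H" and Y: "vgraph V Y" and Z: "vgraph V Z"
    and F: "vmap V X Y F" and G: "vmap V X Y G"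
  shows "vnatural V X Z (vfun_comp V H F) (vfun_comp V H G) (\<lambda>a. map_cell V H (FO F a) (FO G a) (t a))"
proof -
  note H' = vfunctor_vmap[OF H]
  note [simp] = Arr_FM[OF F] Dom_FM[OF F] Cod_FM[OF F] vmap_FO[OF F]
    Arr_FM[OF G] Dom_FM[OF G] Cod_FM[OF G] vmap_FO[OF G]
    Arr_FM[OF H'] Dom_FM[OF H'] Cod_FM[OF H'] vmap_FO[OF H']
    pp_typing vnatural_cell[OF t] map_cell_cell[OF H']
  have "post_comp V Z (FO H (FO F a)) (FO H (FO F b)) (FO H (FO G b)) (map_cell V H (FO F b) (FO G b) (t b)) \<cdot>
        FM H (FO F a) (FO F b) \<cdot> FM F a b =
      pre_comp V Z (FO H (FO G b)) (FO H (FO F a)) (FO H (FO G a)) (map_cell V H (FO F a) (FO G a) (t a)) \<cdot>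
        FM H (FO G a) (FO G b) \<cdot> FM G a b"
    if ab: "a \<in> VOb X" "b \<in> VOb X" for a b
  proof -
    have "post_comp V Z (FO H (FO F a)) (FO H (FO F b)) (FO H (FO G b)) (map_cell V H (FO F b) (FO G b) (t b)) \<cdot>
        FM H (FO F a) (FO F b) \<cdot> FM F a b =
        (FM H (FO F a) (FO G b) \<cdot> post_comp V Y (FO F a) (FO F b) (FO G b) (t b)) \<cdot> FM F a b"
      using ab Y Z by (simp add: FM_post[OF H] v_simps)
    also have "\<dots> = FM H (FO F a) (FO G b) \<cdot> post_comp V Y (FO F a) (FO F b) (FO G b) (t b) \<cdot> FM F a b"
      using ab Y Z by (simp add: v_simps)
    also have "\<dots> = FM H (FO F a) (FO G b) \<cdot> pre_comp V Y (FO G b) (FO F a) (FO G a) (t a) \<cdot> FM G a b"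
      using ab t by (simp add: vnatural_iff[OF Y F G])
    also have "\<dots> = pre_comp V Z (FO H (FO G b)) (FO H (FO F a)) (FO H (FO G a)) (map_cell V H (FO F a) (FO G a) (t a)) \<cdot>
        FM H (FO G a) (FO G b) \<cdot> FM G a b"
      using ab Y Z by (subst reassoc[OF FM_pre[OF H]]) (simp_all add: v_simps)
    finally show ?thesis .
  qed
  then show ?thesis
    by (simp add: vnatural_iff[OF Z vmap_comp[OF F H'] vmap_comp[OF G H']])
qed

subsection \<open>Opposites and tensor products\<close>

lemma vgraph_vop: "vgraph V X \<Longrightarrow> vgraph V (vop V X)"
  by (auto simp: vgraph_def intro!: Cmp_in braid_in)

lemma vfunctor_op:
  assumes F: "vfunctor V X Y F" and "vgraph V X" "vgraph V Y"
  shows "vfunctor V (vop V X) (vop V Y) (vfun_op F)"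
proof -
  note F' = vfunctor_vmap[OF F]
  note [simp] = Arr_FM[OF F'] Dom_FM[OF F'] Cod_FM[OF F'] vmap_FO[OF F']
  have "FM F c a \<cdot> VCmp X c b a \<cdot> braid V (VHom X c b) (VHom X b a) =
      (VCmp Y (FO F c) (FO F b) (FO F a) \<cdot> braid V (VHom Y (FO F c) (FO F b)) (VHom Y (FO F b) (FO F a))) \<cdot>
      (FM F c b \<odot> FM F b a)"
    if "a \<in> VOb X" "b \<in> VOb X" "c \<in> VOb X" for a b c
    using that assms(2,3) reassoc[OF vfunctor.FM_VCmp[OF F, of c b a]]
    by (simp add: v_typing assoc_Cmp braid_natural)
  then show ?thesis
    by unfold_locales (auto intro!: HomI simp: vfunctor.FM_VId[OF F])
qed

section \<open>Interchange of tensor factors\<close>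

lemma
  assumes "p \<in> Ob V" "q \<in> Ob V" "r \<in> Ob V" "s \<in> Ob V"
  shows Arr_interchange: "interchange V p q r s \<in> Arr V"
    and Dom_interchange: "Dom V (interchange V p q r s) = p \<otimes> q \<otimes> (r \<otimes> s)"
    and Cod_interchange: "Cod V (interchange V p q r s) = p \<otimes> r \<otimes> (q \<otimes> s)"
  using assms by (simp_all add: interchange_def mon_typing)

lemmas interchange_typing = Arr_interchange Dom_interchange Cod_interchange

text \<open>Every factor of \<open>interchange\<close> is natural. The block \<open>?m\<close>,
  which swaps the two middle objects, sits inside a tensor product with \<open>\<one> p\<close> and
  is therefore moved past \<open>g\<close>, \<open>h\<close>, \<open>k\<close> beforehand.\<close>

lemma interchange_natural:
  assumes "f \<in> Arr V" "g \<in> Arr V" "h \<in> Arr V" "k \<in> Arr V"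
    and "Cod V f = p" "Cod V g = q" "Cod V h = r" "Cod V k = s"
  shows "interchange V p q r s \<cdot> (f \<odot> g \<odot> (h \<odot> k)) =
    (f \<odot> h \<odot> (g \<odot> k)) \<cdot> interchange V (Dom V f) (Dom V g) (Dom V h) (Dom V k)"
proof -
  have ob: "p \<in> Ob V" "q \<in> Ob V" "r \<in> Ob V" "s \<in> Ob V"
    "Dom V f \<in> Ob V" "Dom V g \<in> Ob V" "Dom V h \<in> Ob V" "Dom V k \<in> Ob V"
    using assms by (auto simp: mon_typing)
  let ?m = "assoc V r q s \<cdot> (braid V q r \<odot> \<one> s) \<cdot> ai q r s"
  let ?n = "assoc V (Dom V h) (Dom V g) (Dom V k) \<cdot> (braid V (Dom V g) (Dom V h) \<odot> \<one> (Dom V k)) \<cdot>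
    ai (Dom V g) (Dom V h) (Dom V k)"
  have "?m \<cdot> (g \<odot> (h \<odot> k)) = assoc V r q s \<cdot> (braid V q r \<odot> \<one> s) \<cdot> (g \<odot> h \<odot> k) \<cdot> ai (Dom V g) (Dom V h) (Dom V k)"
    using assms ob by (simp add: mon_typing assoc_Cmp ai_natural)
  also have "\<dots> = assoc V r q s \<cdot> (h \<odot> g \<odot> k) \<cdot> (braid V (Dom V g) (Dom V h) \<odot> \<one> (Dom V k)) \<cdot> ai (Dom V g) (Dom V h) (Dom V k)"
    using assms ob by (simp add: mon_simps braid_natural)
  also have "\<dots> = (h \<odot> (g \<odot> k)) \<cdot> ?n"
    using assms ob by (subst reassoc[OF assoc_natural]) (simp_all add: mon_typing assoc_Cmp)
  finally have mid: "?m \<cdot> (g \<odot> (h \<odot> k)) = (h \<odot> (g \<odot> k)) \<cdot> ?n" .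
  have "interchange V p q r s \<cdot> (f \<odot> g \<odot> (h \<odot> k)) =
      ai p r (q \<otimes> s) \<cdot> (\<one> p \<odot> ?m) \<cdot> (f \<odot> (g \<odot> (h \<odot> k))) \<cdot> assoc V (Dom V f) (Dom V g) (Dom V h \<otimes> Dom V k)"
    unfolding interchange_def using assms ob by (simp add: mon_typing assoc_Cmp assoc_natural)
  also have "\<dots> = ai p r (q \<otimes> s) \<cdot> (f \<odot> (?m \<cdot> (g \<odot> (h \<odot> k)))) \<cdot> assoc V (Dom V f) (Dom V g) (Dom V h \<otimes> Dom V k)"
    using assms ob by (simp add: mon_typing merge' Idn_left del: assoc_Cmp)
  also have "\<dots> = ai p r (q \<otimes> s) \<cdot> (f \<odot> (h \<odot> (g \<odot> k))) \<cdot> (\<one> (Dom V f) \<odot> ?n) \<cdot> assoc V (Dom V f) (Dom V g) (Dom V h \<otimes> Dom V k)"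
    unfolding mid using assms ob by (simp add: mon_typing merge' Idn_right)
  also have "\<dots> = (f \<odot> h \<odot> (g \<odot> k)) \<cdot> interchange V (Dom V f) (Dom V g) (Dom V h) (Dom V k)"
    unfolding interchange_def using assms ob by (subst reassoc[OF ai_natural]) (simp_all add: mon_typing assoc_Cmp)
  finally show ?thesis .
qed

text \<open>A cell of a tensor product is a pair preceded by a splitting of \<open>\<I>\<close> into
  \<open>\<I> \<otimes> \<I>\<close>. After the interchange this splitting amounts to one inserted
  unit in each factor; \<open>interchange_ri\<close> is the counterpart for precomposition.\<close>

lemma interchange_li:
  assumes "p \<in> Ob V" "q \<in> Ob V"
  shows "interchange V \<I> \<I> p q \<cdot> (li \<I> \<odot> \<one> (p \<otimes> q)) \<cdot> li (p \<otimes> q) = li p \<odot> li q"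
proof -
  note pq = assms unit_in
  let ?m = "assoc V p \<I> q \<cdot> (braid V \<I> p \<odot> \<one> q) \<cdot> ai \<I> p q"
  have "?m \<cdot> li (p \<otimes> q) = \<one> p \<odot> li q"
    using pq by (simp add: mon_simps ai_li braid_li ri_triangle)
  then have "(\<one> \<I> \<odot> ?m) \<cdot> (\<one> \<I> \<odot> li (p \<otimes> q)) = \<one> \<I> \<odot> (\<one> p \<odot> li q)"
    using pq by (subst merge) (simp_all add: mon_typing Idn_left)
  note m = reassoc[OF this]
  have "interchange V \<I> \<I> p q \<cdot> (li \<I> \<odot> \<one> (p \<otimes> q)) \<cdot> li (p \<otimes> q) =
      ai \<I> p (\<I> \<otimes> q) \<cdot> (\<one> \<I> \<odot> ?m) \<cdot> (assoc V \<I> \<I> (p \<otimes> q) \<cdot> (ri \<I> \<odot> \<one> (p \<otimes> q))) \<cdot> li (p \<otimes> q)"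
    unfolding interchange_def using pq by (simp add: mon_typing assoc_Cmp li_ri_unit)
  also have "\<dots> = ai \<I> p (\<I> \<otimes> q) \<cdot> (\<one> \<I> \<odot> (\<one> p \<odot> li q)) \<cdot> li (p \<otimes> q)"
    using pq by (simp add: ri_triangle m mon_typing)
  also have "\<dots> = (\<one> \<I> \<odot> \<one> p \<odot> li q) \<cdot> ai \<I> p q \<cdot> li (p \<otimes> q)"
    using pq by (subst reassoc[OF ai_natural]) (simp_all add: mon_typing assoc_Cmp)
  also have "\<dots> = li p \<odot> li q"
    using pq by (simp add: ai_li mon_simps)
  finally show ?thesis .
qed

lemma interchange_ri:
  assumes "p \<in> Ob V" "q \<in> Ob V"
  shows "interchange V p q \<I> \<I> \<cdot> (\<one> (p \<otimes> q) \<odot> li \<I>) \<cdot> ri (p \<otimes> q) = ri p \<odot> ri q"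
proof -
  note pq = assms unit_in
  let ?m = "assoc V \<I> q \<I> \<cdot> (braid V q \<I> \<odot> \<one> \<I>) \<cdot> ai q \<I> \<I>"
  have "?m \<cdot> (\<one> q \<odot> li \<I>) \<cdot> ri q = assoc V \<I> q \<I> \<cdot> (braid V q \<I> \<odot> \<one> \<I>) \<cdot> (ri q \<odot> \<one> \<I>) \<cdot> ri q"
    using pq by (simp add: mon_typing assoc_Cmp reassoc[OF ai_li_mid])
  also have "\<dots> = (assoc V \<I> q \<I> \<cdot> (li q \<odot> \<one> \<I>)) \<cdot> ri q"
    using pq by (simp add: mon_simps braid_li)
  also have "\<dots> = (\<one> \<I> \<odot> ri q) \<cdot> li q"
    using pq li_natural[of "ri q" "q \<otimes> \<I>"] by (simp add: li_tensor mon_typing)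
  finally have m: "?m \<cdot> ((\<one> q \<odot> li \<I>) \<cdot> ri q) = (\<one> \<I> \<odot> ri q) \<cdot> li q" .
  have "interchange V p q \<I> \<I> \<cdot> (\<one> (p \<otimes> q) \<odot> li \<I>) \<cdot> ri (p \<otimes> q) =
      ai p \<I> (q \<otimes> \<I>) \<cdot> (\<one> p \<odot> ?m) \<cdot> (assoc V p q (\<I> \<otimes> \<I>) \<cdot> (\<one> p \<odot> \<one> q \<odot> li \<I>)) \<cdot> ri (p \<otimes> q)"
    unfolding interchange_def using pq by (simp add: mon_typing assoc_Cmp tensor_Idn)
  also have "\<dots> = ai p \<I> (q \<otimes> \<I>) \<cdot> (\<one> p \<odot> ?m) \<cdot> (\<one> p \<odot> (\<one> q \<odot> li \<I>)) \<cdot> (\<one> p \<odot> ri q)"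
    using pq by (subst assoc_natural) (simp_all add: mon_typing assoc_Cmp ri_tensor)
  also have "\<dots> = ai p \<I> (q \<otimes> \<I>) \<cdot> (\<one> p \<odot> (?m \<cdot> ((\<one> q \<odot> li \<I>) \<cdot> ri q)))"
    using pq by (simp add: mon_typing merge Idn_left)
  also have "\<dots> = (ai p \<I> (q \<otimes> \<I>) \<cdot> (\<one> p \<odot> (\<one> \<I> \<odot> ri q))) \<cdot> (\<one> p \<odot> li q)"
    unfolding m using pq by (simp add: mon_typing merge assoc_Cmp Idn_left)
  also have "\<dots> = (\<one> p \<odot> \<one> \<I> \<odot> ri q) \<cdot> ai p \<I> q \<cdot> (\<one> p \<odot> li q)"
    using pq by (subst ai_natural) (simp_all add: mon_typing assoc_Cmp)
  also have "\<dots> = ri p \<odot> ri q"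
    using pq by (simp add: ai_li_mid mon_simps)
  finally show ?thesis .
qed

lemma VCmp_vtensor:
  "VCmp (vtensor V X Y) (a, b) (a', b') (a'', b'') = (VCmp X a a' a'' \<odot> VCmp Y b b' b'') \<cdot>
    interchange V (VHom X a' a'') (VHom Y b' b'') (VHom X a a') (VHom Y b b')"
  by (simp add: vtensor_def)

lemma pair_cell_cell:
  assumes "u \<in> cell V X a a'" "v \<in> cell V Y b b'"
  shows "pair_cell V u v \<in> cell V (vtensor V X Y) (a, b) (a', b')"
  using cellD[OF assms(1)] cellD[OF assms(2)] by (intro cellI) (simp_all add: pair_cell_def mon_typing)

lemma pair_cell_tensor:
  assumes "u \<in> cell V X a a'" "v \<in> cell V Y b b'"
    and "f \<in> Arr V" "Dom V f = VHom X a a'" "g \<in> Arr V" "Dom V g = VHom Y b b'"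
  shows "(f \<odot> g) \<cdot> pair_cell V u v = pair_cell V (f \<cdot> u) (g \<cdot> v)"
  using cellD[OF assms(1)] cellD[OF assms(2)] assms(3-) by (simp add: pair_cell_def mon_simps)

lemma vgraph_vtensor:
  assumes X: "vgraph V X" and Y: "vgraph V Y"
  shows "vgraph V (vtensor V X Y)"
  unfolding vgraph_def using assms pair_cell_cell[of "VId X a" X a a "VId Y b" Y b b for a b]
  by (auto simp: VCmp_vtensor v_typing interchange_typing cell_def pair_cell_def intro!: HomI)

lemma vmap_tensor:
  assumes F: "vmap V X X' F" and G: "vmap V Y Y' G"
  shows "vmap V (vtensor V X Y) (vtensor V X' Y') (vfun_tensor V F G)"
  using assms by (auto simp: vmap_def intro!: tensor_arr_in)

lemma vfunctor_tensor:
  assumes F: "vfunctor V X X' F" and G: "vfunctor V Y Y' G"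
    and "vgraph V X" "vgraph V X'" "vgraph V Y" "vgraph V Y'"
  shows "vfunctor V (vtensor V X Y) (vtensor V X' Y') (vfun_tensor V F G)"
proof -
  note F' = vfunctor_vmap[OF F] and G' = vfunctor_vmap[OF G]
  note [simp] = Arr_FM[OF F'] Dom_FM[OF F'] Cod_FM[OF F'] vmap_FO[OF F']
    Arr_FM[OF G'] Dom_FM[OF G'] Cod_FM[OF G'] vmap_FO[OF G']
  show ?thesis
    by unfold_locales
      (use assms(3-) in \<open>auto intro!: HomI simp: v_simps VCmp_vtensor interchange_typing interchange_natural
        pair_cell_def vfunctor.FM_VId[OF F] vfunctor.FM_VId[OF G]
        vfunctor.FM_VCmp[OF F] vfunctor.FM_VCmp[OF G]\<close>)
qed

text \<open>Naturality carries the pair \<open>u\<close>, \<open>v\<close> through the interchange,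
  and \<open>interchange_li\<close> absorbs what is left of it. From here on cells act on a tensor
  product factor by factor and the interchange no longer shows.\<close>

lemma post_vtensor:
  assumes X: "vgraph V X" and Y: "vgraph V Y"
    and "a \<in> VOb X" "a' \<in> VOb X" "d \<in> VOb X" "b \<in> VOb Y" "b' \<in> VOb Y" "e \<in> VOb Y"
    and u: "u \<in> cell V X a a'" and v: "v \<in> cell V Y b b'"
  shows "post_comp V (vtensor V X Y) (d, e) (a, b) (a', b') (pair_cell V u v) =
    post_comp V X d a a' u \<odot> post_comp V Y e b b' v"
proof -
  let ?p = "VHom X d a" and ?q = "VHom Y e b"
  note uv = cellD[OF u] cellD[OF v]
  have "post_comp V (vtensor V X Y) (d, e) (a, b) (a', b') (pair_cell V u v) =
      (VCmp X d a a' \<odot> VCmp Y e b b') \<cdot>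
      (interchange V (VHom X a a') (VHom Y b b') ?p ?q \<cdot> (u \<odot> v \<odot> (\<one> ?p \<odot> \<one> ?q))) \<cdot>
      (li \<I> \<odot> \<one> (?p \<otimes> ?q)) \<cdot> li (?p \<otimes> ?q)"
    using assms uv by (simp add: post_comp_def VCmp_vtensor pair_cell_def interchange_typing v_simps)
  also have "\<dots> = (VCmp X d a a' \<odot> VCmp Y e b b') \<cdot>
      (u \<odot> \<one> ?p \<odot> (v \<odot> \<one> ?q)) \<cdot> (interchange V \<I> \<I> ?p ?q \<cdot> (li \<I> \<odot> \<one> (?p \<otimes> ?q)) \<cdot> li (?p \<otimes> ?q))"
    using assms uv by (subst interchange_natural) (simp_all add: interchange_typing v_typing assoc_Cmp)
  also have "\<dots> = post_comp V X d a a' u \<odot> post_comp V Y e b b' v"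
    using assms uv by (subst interchange_li) (simp_all add: post_comp_def v_simps)
  finally show ?thesis .
qed

lemma pre_vtensor:
  assumes X: "vgraph V X" and Y: "vgraph V Y"
    and "a \<in> VOb X" "a' \<in> VOb X" "d \<in> VOb X" "b \<in> VOb Y" "b' \<in> VOb Y" "e \<in> VOb Y"
    and u: "u \<in> cell V X a a'" and v: "v \<in> cell V Y b b'"
  shows "pre_comp V (vtensor V X Y) (d, e) (a, b) (a', b') (pair_cell V u v) =
    pre_comp V X d a a' u \<odot> pre_comp V Y e b b' v"
proof -
  let ?p = "VHom X a' d" and ?q = "VHom Y b' e"
  note uv = cellD[OF u] cellD[OF v]
  have "pre_comp V (vtensor V X Y) (d, e) (a, b) (a', b') (pair_cell V u v) =
      (VCmp X a a' d \<odot> VCmp Y b b' e) \<cdot>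
      (interchange V ?p ?q (VHom X a a') (VHom Y b b') \<cdot> (\<one> ?p \<odot> \<one> ?q \<odot> (u \<odot> v))) \<cdot>
      (\<one> (?p \<otimes> ?q) \<odot> li \<I>) \<cdot> ri (?p \<otimes> ?q)"
    using assms uv by (simp add: pre_comp_def VCmp_vtensor pair_cell_def interchange_typing v_simps)
  also have "\<dots> = (VCmp X a a' d \<odot> VCmp Y b b' e) \<cdot>
      (\<one> ?p \<odot> u \<odot> (\<one> ?q \<odot> v)) \<cdot> (interchange V ?p ?q \<I> \<I> \<cdot> (\<one> (?p \<otimes> ?q) \<odot> li \<I>) \<cdot> ri (?p \<otimes> ?q))"
    using assms uv by (subst interchange_natural) (simp_all add: interchange_typing v_typing assoc_Cmp)
  also have "\<dots> = pre_comp V X d a a' u \<odot> pre_comp V Y e b b' v"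
    using assms uv by (subst interchange_ri) (simp_all add: pre_comp_def v_simps)
  finally show ?thesis .
qed

lemma pair_cell_comp:
  assumes X: "vgraph V X" and Y: "vgraph V Y"
    and "a \<in> VOb X" "a' \<in> VOb X" "a'' \<in> VOb X" "b \<in> VOb Y" "b' \<in> VOb Y" "b'' \<in> VOb Y"
    and u: "u \<in> cell V X a a'" "u' \<in> cell V X a' a''" and v: "v \<in> cell V Y b b'" "v' \<in> cell V Y b' b''"
  shows "cell_comp V (vtensor V X Y) (a, b) (a', b') (a'', b'') (pair_cell V u' v') (pair_cell V u v) =
    pair_cell V (cell_comp V X a a' a'' u' u) (cell_comp V Y b b' b'' v' v)"
  using assms by (simp add: post_cell[symmetric] pair_cell_cell vgraph_vtensor post_vtensor
      pair_cell_tensor[OF u(1) v(1)] pp_typing)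

lemma vnatural_tensor:
  assumes t: "vnatural V X X' F F' t" and s: "vnatural V Y Y' G G' s"
    and X: "vgraph V X'" and Y: "vgraph V Y'"
    and F: "vmap V X X' F" "vmap V X X' F'" and G: "vmap V Y Y' G" "vmap V Y Y' G'"
  shows "vnatural V (vtensor V X Y) (vtensor V X' Y') (vfun_tensor V F G) (vfun_tensor V F' G')
    (\<lambda>(a, b). pair_cell V (t a) (s b))"
proof -
  note [simp] = Arr_FM[OF F(1)] Dom_FM[OF F(1)] Cod_FM[OF F(1)] vmap_FO[OF F(1)]
    Arr_FM[OF F(2)] Dom_FM[OF F(2)] Cod_FM[OF F(2)] vmap_FO[OF F(2)]
    Arr_FM[OF G(1)] Dom_FM[OF G(1)] Cod_FM[OF G(1)] vmap_FO[OF G(1)]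
    Arr_FM[OF G(2)] Dom_FM[OF G(2)] Cod_FM[OF G(2)] vmap_FO[OF G(2)]
    vnatural_cell[OF t] vnatural_cell[OF s] pp_typing
  show ?thesis
    unfolding vnatural_iff[OF vgraph_vtensor[OF X Y] vmap_tensor[OF F(1) G(1)] vmap_tensor[OF F(2) G(2)]]
    using X Y t s
    by (auto simp: pair_cell_cell post_vtensor pre_vtensor v_simps
        vnatural_iff[OF X F] vnatural_iff[OF Y G])
qed

lemma map_cell2_cell:
  assumes F: "vmap V (vtensor V X Y) Z F" and "a \<in> VOb X" "a' \<in> VOb X" "b \<in> VOb Y" "b' \<in> VOb Y"
    and "u \<in> cell V X a a'" "v \<in> cell V Y b b'"
  shows "map_cell2 V F a a' b b' u v \<in> cell V Z (FO F (a, b)) (FO F (a', b'))"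
  unfolding map_cell2_def by (rule map_cell_cell[OF F]) (use assms in \<open>auto intro: pair_cell_cell\<close>)

lemma map_cell2_comp:
  assumes F: "vfunctor V (vtensor V X Y) Z F" and "vgraph V X" "vgraph V Y" "vgraph V Z"
    and "a \<in> VOb X" "a' \<in> VOb X" "a'' \<in> VOb X" "b \<in> VOb Y" "b' \<in> VOb Y" "b'' \<in> VOb Y"
    and "u \<in> cell V X a a'" "u' \<in> cell V X a' a''" "v \<in> cell V Y b b'" "v' \<in> cell V Y b' b''"
  shows "map_cell2 V F a a'' b b'' (cell_comp V X a a' a'' u' u) (cell_comp V Y b b' b'' v' v) =
    cell_comp V Z (FO F (a, b)) (FO F (a', b')) (FO F (a'', b''))
      (map_cell2 V F a' a'' b' b'' u' v') (map_cell2 V F a a' b b' u v)"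
  using assms by (simp add: map_cell2_def map_cell_comp[OF F, symmetric] vgraph_vtensor pair_cell_cell
      pair_cell_comp)

lemma map_cell2_VId:
  assumes F: "vfunctor V (vtensor V X Y) Z F" and "a \<in> VOb X" "b \<in> VOb Y"
  shows "map_cell2 V F a a b b (VId X a) (VId Y b) = VId Z (FO F (a, b))"
  using map_cell_VId[OF F, of "(a, b)"] assms(2-) by (simp add: map_cell2_def)

subsection \<open>Partial functors\<close>

text \<open>Fixing a variable of \<open>F\<close> is composing \<open>F\<close> with this functor,
  so that partial functors fall under the lemmas on whiskering.\<close>

definition vfun_pair_left :: "('a, 'o, 'm) vcat \<Rightarrow> ('b, 'o, 'm) vcat \<Rightarrow> 'a \<Rightarrow> ('b, 'a \<times> 'b, 'm) vfun" where
  "vfun_pair_left X Y a =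
     \<lparr>FO = \<lambda>b. (a, b), FM = \<lambda>b b'. (VId X a \<odot> \<one> (VHom Y b b')) \<cdot> li (VHom Y b b')\<rparr>"

definition vfun_pair_right :: "('a, 'o, 'm) vcat \<Rightarrow> ('b, 'o, 'm) vcat \<Rightarrow> 'b \<Rightarrow> ('a, 'a \<times> 'b, 'm) vfun" where
  "vfun_pair_right X Y b =
     \<lparr>FO = \<lambda>a. (a, b), FM = \<lambda>a a'. (\<one> (VHom X a a') \<odot> VId Y b) \<cdot> ri (VHom X a a')\<rparr>"

lemma vfun_fix_left_eq: "vfun_fix_left V X Y F a = vfun_comp V F (vfun_pair_left X Y a)"
  by (simp add: vfun_fix_left_def vfun_comp_def vfun_pair_left_def)

lemma vfun_fix_right_eq: "vfun_fix_right V X Y F b = vfun_comp V F (vfun_pair_right X Y b)"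
  by (simp add: vfun_fix_right_def vfun_comp_def vfun_pair_right_def)

lemma
  assumes "vgraph V X" "vgraph V Y"
  shows vmap_pair_left: "a \<in> VOb X \<Longrightarrow> vmap V Y (vtensor V X Y) (vfun_pair_left X Y a)"
    and vmap_pair_right: "b \<in> VOb Y \<Longrightarrow> vmap V X (vtensor V X Y) (vfun_pair_right X Y b)"
  using assms by (auto simp: vmap_def vfun_pair_left_def vfun_pair_right_def v_typing intro!: HomI)

text \<open>Applied with \<open>u\<close> the unit of the reflection at an identity 1-cell, in order
  to see that whiskering this one cell with a variable 1-cell is natural.\<close>

lemma vnatural_pair_left:
  assumes X: "vcategory V X" and Y: "vcategory V Y" and a: "a \<in> VOb X" "a' \<in> VOb X"
    and u: "u \<in> cell V X a a'"
  shows "vnatural V Y (vtensor V X Y) (vfun_pair_left X Y a) (vfun_pair_left X Y a')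
    (\<lambda>b. pair_cell V u (VId Y b))"
proof -
  note XY = vcategory_vgraph[OF X] vcategory_vgraph[OF Y] and u' = cellD[OF u]
  have "(post_comp V X a a a' u \<odot> \<one> q) \<cdot> (VId X a \<odot> \<one> q) = u \<odot> \<one> q"
    "(pre_comp V X a' a a' u \<odot> \<one> q) \<cdot> (VId X a' \<odot> \<one> q) = u \<odot> \<one> q" if "q \<in> Ob V" for q
    using that a u u' X XY
    by (simp_all add: merge v_typing pp_typing Idn_left post_cell pre_cell cell_comp_VId_left cell_comp_VId_right)
  note eq = reassoc[OF this(1)] reassoc[OF this(2)]
  show ?thesis
    unfolding vnatural_iff[OF vgraph_vtensor[OF XY] vmap_pair_left[OF XY a(1)] vmap_pair_left[OF XY a(2)]]
    using a u u' X Y XY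
    by (auto simp: vfun_pair_left_def pair_cell_cell post_vtensor pre_vtensor post_VId pre_VId eq v_typing pp_typing)
qed

lemma vnatural_pair_right:
  assumes X: "vcategory V X" and Y: "vcategory V Y" and b: "b \<in> VOb Y" "b' \<in> VOb Y"
    and u: "u \<in> cell V Y b b'"
  shows "vnatural V X (vtensor V X Y) (vfun_pair_right X Y b) (vfun_pair_right X Y b')
    (\<lambda>a. pair_cell V (VId X a) u)"
proof -
  note XY = vcategory_vgraph[OF X] vcategory_vgraph[OF Y] and u' = cellD[OF u]
  have "(\<one> q \<odot> post_comp V Y b b b' u) \<cdot> (\<one> q \<odot> VId Y b) = \<one> q \<odot> u"
    "(\<one> q \<odot> pre_comp V Y b' b b' u) \<cdot> (\<one> q \<odot> VId Y b') = \<one> q \<odot> u" if "q \<in> Ob V" for q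
    using that b u u' Y XY
    by (simp_all add: merge v_typing pp_typing Idn_left post_cell pre_cell cell_comp_VId_left cell_comp_VId_right)
  note eq = reassoc[OF this(1)] reassoc[OF this(2)]
  show ?thesis
    unfolding vnatural_iff[OF vgraph_vtensor[OF XY] vmap_pair_right[OF XY b(1)] vmap_pair_right[OF XY b(2)]]
    using b u u' X Y XY
    by (auto simp: vfun_pair_right_def pair_cell_cell post_vtensor pre_vtensor post_VId pre_VId eq v_typing pp_typing)
qed

end

section \<open>Functors into the base category\<close>

lemma vself_simps [simp]: "VOb (vself V) = Ob V" "VHom (vself V) = ihom V"
  by (simp_all add: vself_def)

lemma FO_vhom [simp]: "FO (vhom V X) (a, b) = VHom X a b"
  by (simp add: vhom_def)

context symmetric_monoidal_closed_category
begin

lemma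
  assumes "b \<in> Ob V" "c \<in> Ob V"
  shows Arr_ev: "ev V b c \<in> Arr V" and Dom_ev: "Dom V (ev V b c) = ihom V b c \<otimes> b"
    and Cod_ev: "Cod V (ev V b c) = c"
  using ev_in[OF assms] by (auto simp: Hom_def)

lemmas c_simps = v_simps ihom_in Arr_ev Dom_ev Cod_ev

lemma curry_arr:
  assumes "a \<in> Ob V" "b \<in> Ob V" "c \<in> Ob V" "f \<in> Hom V (a \<otimes> b) c"
  shows "curry_arr V a b c f \<in> Hom V a (ihom V b c)" "ev V b c \<cdot> (curry_arr V a b c f \<odot> \<one> b) = f"
  using theI'[OF closed[OF assms]] by (simp_all add: curry_arr_def)

lemma uncurry_inject:
  assumes "f \<in> Hom V a (ihom V b c)" "g \<in> Hom V a (ihom V b c)" "b \<in> Ob V" "c \<in> Ob V"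
    and "ev V b c \<cdot> (f \<odot> \<one> b) = ev V b c \<cdot> (g \<odot> \<one> b)"
  shows "f = g"
proof -
  have "a \<in> Ob V" using assms(1) by (auto simp: Hom_def mon_typing)
  moreover have "ev V b c \<cdot> (g \<odot> \<one> b) \<in> Hom V (a \<otimes> b) c"
    using assms by (auto simp: Hom_def c_simps)
  ultimately show ?thesis using closed[of a b c] assms by blast
qed

text \<open>Transformations into \<open>vself V\<close> consist of cells
  \<open>\<I> \<rightarrow> [a, b]\<close>, whereas calculations are done with arrows
  \<open>a \<rightarrow> b\<close>; \<open>name\<close> and \<open>unname\<close> are the two
  directions of this correspondence.\<close>

definition name :: "'o \<Rightarrow> 'o \<Rightarrow> 'm \<Rightarrow> 'm" where
  "name a b f = curry_arr V \<I> a b (f \<cdot> lunit V a)"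

definition unname :: "'o \<Rightarrow> 'o \<Rightarrow> 'm \<Rightarrow> 'm" where
  "unname a b t = ev V a b \<cdot> (t \<odot> \<one> a) \<cdot> li a"

lemma
  assumes "f \<in> Hom V a b"
  shows name_in: "name a b f \<in> Hom V \<I> (ihom V a b)"
    and ev_name: "ev V a b \<cdot> (name a b f \<odot> \<one> a) = f \<cdot> lunit V a"
    and unname_name: "unname a b (name a b f) = f"
proof -
  have ob: "a \<in> Ob V" "b \<in> Ob V" and f: "f \<in> Arr V" "Dom V f = a" "Cod V f = b"
    using assms by (auto simp: Hom_def mon_typing)
  have *: "f \<cdot> lunit V a \<in> Hom V (\<I> \<otimes> a) b" using ob f by (auto intro!: HomI simp: mon_typing)
  show n: "name a b f \<in> Hom V \<I> (ihom V a b)" and e: "ev V a b \<cdot> (name a b f \<odot> \<one> a) = f \<cdot> lunit V a"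
    using curry_arr[OF unit_in ob *] by (simp_all add: name_def)
  show "unname a b (name a b f) = f"
    using reassoc[OF e, of "li a"] ob f HomD[OF n] by (simp add: unname_def c_simps)
qed

lemma
  assumes "t \<in> Hom V \<I> (ihom V a b)" "a \<in> Ob V" "b \<in> Ob V"
  shows unname_in: "unname a b t \<in> Hom V a b"
    and name_unname: "name a b (unname a b t) = t"
proof -
  show u: "unname a b t \<in> Hom V a b"
    using assms by (auto simp: unname_def Hom_def c_simps)
  show "name a b (unname a b t) = t"
    by (rule uncurry_inject[OF name_in[OF u] assms])
      (use assms HomD[OF assms(1)] in \<open>simp add: ev_name[OF u], simp add: unname_def c_simps\<close>)
qed

lemma vgraph_vself: "vgraph V (vself V)"
proof -
  have "ev V b c \<cdot> (\<one> (ihom V b c) \<odot> ev V a b) \<cdot> assoc V (ihom V b c) (ihom V a b) a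
      \<in> Hom V (ihom V b c \<otimes> ihom V a b \<otimes> a) c" if "a \<in> Ob V" "b \<in> Ob V" "c \<in> Ob V" for a b c
    using that by (auto intro!: HomI simp: c_simps)
  then show ?thesis
    by (simp add: vgraph_def vself_def curry_arr(1) lunit_in unit_in ihom_in tensor_ob_in)
qed

lemma uncurry_VCmp:
  assumes "a \<in> Ob V" "b \<in> Ob V" "c \<in> Ob V"
    and "g \<in> Arr V" "Cod V g = ihom V b c" "f \<in> Arr V" "Cod V f = ihom V a b"
  shows "ev V a c \<cdot> ((VCmp (vself V) a b c \<cdot> (g \<odot> f)) \<odot> \<one> a) =
    ev V b c \<cdot> (g \<odot> (ev V a b \<cdot> (f \<odot> \<one> a))) \<cdot> assoc V (Dom V g) (Dom V f) a"
proof -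
  let ?c = "VCmp (vself V) a b c"
  note G = vgraph_vself
  have "ev V a c \<cdot> (?c \<odot> \<one> a) = ev V b c \<cdot> (\<one> (ihom V b c) \<odot> ev V a b) \<cdot> assoc V (ihom V b c) (ihom V a b) a"
    unfolding vself_def vcat.simps
    by (rule curry_arr(2)) (use assms in \<open>auto intro!: HomI simp: c_simps\<close>)
  note e = reassoc[OF this]
  have "ev V a c \<cdot> ((?c \<cdot> (g \<odot> f)) \<odot> \<one> a) = ev V a c \<cdot> (?c \<odot> \<one> a) \<cdot> (g \<odot> f \<odot> \<one> a)"
    using assms G by (simp add: c_simps)
  also have "\<dots> = ev V b c \<cdot> (\<one> (ihom V b c) \<odot> ev V a b) \<cdot> (assoc V (ihom V b c) (ihom V a b) a \<cdot> (g \<odot> f \<odot> \<one> a))"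
    using assms G by (subst e) (simp_all add: c_simps)
  also have "\<dots> = ev V b c \<cdot> (g \<odot> (ev V a b \<cdot> (f \<odot> \<one> a))) \<cdot> assoc V (Dom V g) (Dom V f) a"
    using assms by (subst assoc_natural) (simp_all add: c_simps)
  finally show ?thesis .
qed

text \<open>Transposed along evaluation, the action of a named arrow on an internal hom becomes
  plain composition in \<open>V\<close>. With \<open>uncurry_pre\<close> this eliminates
  \<open>vself V\<close> from both sides of a naturality square.\<close>

lemma uncurry_post:
  assumes "f \<in> Hom V a b" "d \<in> Ob V" "h \<in> Arr V" "Cod V h = ihom V d a"
  shows "ev V d b \<cdot> ((post_comp V (vself V) d a b (name a b f) \<cdot> h) \<odot> \<one> d) = f \<cdot> ev V d a \<cdot> (h \<odot> \<one> d)"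
proof -
  have ob: "a \<in> Ob V" "b \<in> Ob V" "Dom V h \<in> Ob V"
    and f: "f \<in> Arr V" "Dom V f = a" "Cod V f = b"
    using assms by (auto simp: Hom_def mon_typing)
  note n = HomD[OF name_in[OF assms(1)]]
  have nc: "name a b f \<in> cell V (vself V) a b" using name_in[OF assms(1)] by (simp add: cell_def)
  let ?k = "ev V d a \<cdot> (h \<odot> \<one> d)"
  have "ev V d b \<cdot> ((post_comp V (vself V) d a b (name a b f) \<cdot> h) \<odot> \<one> d) =
      (ev V d b \<cdot> ((VCmp (vself V) d a b \<cdot> (name a b f \<odot> h)) \<odot> \<one> d)) \<cdot> (li (Dom V h) \<odot> \<one> d)"
    using assms ob n nc vgraph_vself by (simp add: post_Cmp c_simps)
  also have "\<dots> = ev V a b \<cdot> (name a b f \<odot> ?k) \<cdot> (assoc V \<I> (Dom V h) d \<cdot> (li (Dom V h) \<odot> \<one> d))"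
    using assms ob n by (subst uncurry_VCmp) (simp_all add: c_simps)
  also have "\<dots> = ev V a b \<cdot> (name a b f \<odot> \<one> a) \<cdot> (\<one> \<I> \<odot> ?k) \<cdot> li (Dom V h \<otimes> d)"
    using assms ob n by (subst li_tensor) (simp_all add: c_simps)
  also have "\<dots> = f \<cdot> (lunit V a \<cdot> (\<one> \<I> \<odot> ?k)) \<cdot> li (Dom V h \<otimes> d)"
    using assms ob n f by (subst reassoc[OF ev_name[OF assms(1)]]) (simp_all add: c_simps)
  also have "\<dots> = f \<cdot> ?k"
    using assms ob f by (subst lunit_natural) (simp_all add: c_simps)
  finally show ?thesis .
qed

lemma uncurry_pre:
  assumes "f \<in> Hom V a b" "d \<in> Ob V" "h \<in> Arr V" "Cod V h = ihom V b d"
  shows "ev V a d \<cdot> ((pre_comp V (vself V) d a b (name a b f) \<cdot> h) \<odot> \<one> a) =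
    (ev V b d \<cdot> (h \<odot> \<one> b)) \<cdot> (\<one> (Dom V h) \<odot> f)"
proof -
  have ob: "a \<in> Ob V" "b \<in> Ob V" "Dom V h \<in> Ob V"
    and f: "f \<in> Arr V" "Dom V f = a" "Cod V f = b"
    using assms by (auto simp: Hom_def mon_typing)
  note n = HomD[OF name_in[OF assms(1)]]
  have nc: "name a b f \<in> cell V (vself V) a b" using name_in[OF assms(1)] by (simp add: cell_def)
  have "ev V a d \<cdot> ((pre_comp V (vself V) d a b (name a b f) \<cdot> h) \<odot> \<one> a) =
      (ev V a d \<cdot> ((VCmp (vself V) a b d \<cdot> (h \<odot> name a b f)) \<odot> \<one> a)) \<cdot> (ri (Dom V h) \<odot> \<one> a)"
    using assms ob n nc vgraph_vself by (simp add: pre_Cmp c_simps)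
  also have "\<dots> = ev V b d \<cdot> (h \<odot> (f \<cdot> lunit V a)) \<cdot> (assoc V (Dom V h) \<I> a \<cdot> (ri (Dom V h) \<odot> \<one> a))"
    using assms ob n f by (subst uncurry_VCmp) (simp_all add: ev_name c_simps)
  also have "\<dots> = (ev V b d \<cdot> (h \<odot> \<one> b)) \<cdot> (\<one> (Dom V h) \<odot> f)"
    using assms ob f by (subst ri_triangle) (simp_all add: c_simps)
  finally show ?thesis .
qed

lemma name_Cmp:
  assumes "g \<in> Hom V b c" "f \<in> Hom V a b"
  shows "cell_comp V (vself V) a b c (name b c g) (name a b f) = name a c (g \<cdot> f)"
proof (rule uncurry_inject)
  have ob: "a \<in> Ob V" "b \<in> Ob V" "c \<in> Ob V" using assms by (auto simp: Hom_def mon_typing)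
  have n: "name b c g \<in> cell V (vself V) b c" "name a b f \<in> cell V (vself V) a b"
    using name_in assms by (simp_all add: cell_def)
  have gf: "g \<cdot> f \<in> Hom V a c" using assms by (intro Cmp_in)
  show "cell_comp V (vself V) a b c (name b c g) (name a b f) \<in> Hom V \<I> (ihom V a c)"
    using cell_comp_cell[OF vgraph_vself _ _ _ n] ob by (simp add: cell_def)
  show "name a c (g \<cdot> f) \<in> Hom V \<I> (ihom V a c)" by (rule name_in[OF gf])
  show "a \<in> Ob V" "c \<in> Ob V" by (fact ob)+
  have "ev V a c \<cdot> (cell_comp V (vself V) a b c (name b c g) (name a b f) \<odot> \<one> a) = g \<cdot> f \<cdot> lunit V a"
    using uncurry_post[OF assms(1) ob(1), of "name a b f"] n ob cellD[OF n(2)] assms vgraph_vself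
    by (simp add: post_cell ev_name)
  then show "ev V a c \<cdot> (cell_comp V (vself V) a b c (name b c g) (name a b f) \<odot> \<one> a) =
      ev V a c \<cdot> (name a c (g \<cdot> f) \<odot> \<one> a)"
    using ob assms by (simp add: ev_name[OF gf] HomD[OF assms(1)] HomD[OF assms(2)] c_simps)
qed

lemma name_Idn: "a \<in> Ob V \<Longrightarrow> VId (vself V) a = name a a (\<one> a)"
  by (simp add: vself_def name_def mon_simps)

lemma cell_iso_name:
  assumes "f \<in> Hom V a b"
  shows "cell_iso V (vself V) a b (name a b f) \<longleftrightarrow> iso V f"
proof
  have ob: "a \<in> Ob V" "b \<in> Ob V" using assms by (auto simp: Hom_def mon_typing)
  assume "cell_iso V (vself V) a b (name a b f)"
  then obtain t where t: "t \<in> Hom V \<I> (ihom V b a)"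
    "cell_comp V (vself V) a b a t (name a b f) = VId (vself V) a"
    "cell_comp V (vself V) b a b (name a b f) t = VId (vself V) b"
    by (auto simp: cell_iso_def cell_def)
  define g where "g = unname b a t"
  have g: "g \<in> Hom V b a" "t = name b a g"
    using t(1) ob by (simp_all add: g_def unname_in name_unname)
  have "name a a (g \<cdot> f) = name a a (\<one> a)" "name b b (f \<cdot> g) = name b b (\<one> b)"
    using t g ob assms by (simp_all add: name_Cmp name_Idn)
  then have "g \<cdot> f = \<one> a" "f \<cdot> g = \<one> b"
    using unname_name ob assms g(1) Cmp_in Idn_in by metis+
  then show "iso V f" using assms g(1) by (intro isoI)
next
  have ob: "a \<in> Ob V" "b \<in> Ob V" using assms by (auto simp: Hom_def mon_typing)
  assume i: "iso V f"
  have g: "inv_arr V f \<in> Hom V b a" using inv_in[OF i assms] .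
  show "cell_iso V (vself V) a b (name a b f)"
    unfolding cell_iso_def
  proof (intro conjI bexI[of _ "name b a (inv_arr V f)"])
  qed (use assms g i ob HomD[OF assms] name_in in \<open>auto simp: cell_def name_Cmp name_Idn inv_left inv_right\<close>)
qed

text \<open>Enriched naturality of arrows \<open>F a \<rightarrow> G a\<close> of \<open>V\<close>, in terms of the transposes
  \<open>X(a, b) \<otimes> F a \<rightarrow> F b\<close> of the actions on hom-objects.\<close>

definition hnatural :: "('a, 'o, 'm) vcat \<Rightarrow> ('a, 'o, 'm) vfun \<Rightarrow> ('a, 'o, 'm) vfun \<Rightarrow> ('a \<Rightarrow> 'm) \<Rightarrow> bool" where
  "hnatural X F G t \<longleftrightarrow> (\<forall>a\<in>VOb X. t a \<in> Hom V (FO F a) (FO G a)) \<and>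
    (\<forall>a\<in>VOb X. \<forall>b\<in>VOb X. t b \<cdot> ev V (FO F a) (FO F b) \<cdot> (FM F a b \<odot> \<one> (FO F a)) =
       (ev V (FO G a) (FO G b) \<cdot> (FM G a b \<odot> \<one> (FO G a))) \<cdot> (\<one> (VHom X a b) \<odot> t a))"

lemma hnatural_in: "\<lbrakk>hnatural X F G t; a \<in> VOb X\<rbrakk> \<Longrightarrow> t a \<in> Hom V (FO F a) (FO G a)"
  by (simp add: hnatural_def)

text \<open>Arrows into an internal hom are equal exactly when their transposes are, by
  \<open>uncurry_inject\<close>, and the transposes of the two sides of the enriched square are the
  two sides of \<open>hnatural\<close>.\<close>

lemma vnatural_hnatural:
  assumes F: "vmap V X (vself V) F" and G: "vmap V X (vself V) G"
    and t: "\<And>a. a \<in> VOb X \<Longrightarrow> t a \<in> Hom V (FO F a) (FO G a)"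
  shows "vnatural V X (vself V) F G (\<lambda>a. name (FO F a) (FO G a) (t a)) \<longleftrightarrow> hnatural X F G t"
proof -
  note [simp] = Arr_FM[OF F] Dom_FM[OF F] Cod_FM[OF F] vmap_FO[OF F, simplified]
    Arr_FM[OF G] Dom_FM[OF G] Cod_FM[OF G] vmap_FO[OF G, simplified]
  have nc: "name (FO F a) (FO G a) (t a) \<in> cell V (vself V) (FO F a) (FO G a)" if "a \<in> VOb X" for a
    using name_in[OF t[OF that]] by (simp add: cell_def)
  have "post_comp V (vself V) (FO F a) (FO F b) (FO G b) (name (FO F b) (FO G b) (t b)) \<cdot> FM F a b =
       pre_comp V (vself V) (FO G b) (FO F a) (FO G a) (name (FO F a) (FO G a) (t a)) \<cdot> FM G a b \<longleftrightarrow>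
     t b \<cdot> ev V (FO F a) (FO F b) \<cdot> (FM F a b \<odot> \<one> (FO F a)) =
       (ev V (FO G a) (FO G b) \<cdot> (FM G a b \<odot> \<one> (FO G a))) \<cdot> (\<one> (VHom X a b) \<odot> t a)"
    (is "?l = ?r \<longleftrightarrow> _") if ab: "a \<in> VOb X" "b \<in> VOb X" for a b
  proof -
    have lr: "?l \<in> Hom V (VHom X a b) (ihom V (FO F a) (FO G b))" "?r \<in> Hom V (VHom X a b) (ihom V (FO F a) (FO G b))"
      using ab nc vgraph_vself by (auto intro!: HomI simp: pp_typing c_simps)
    have "?l = ?r \<longleftrightarrow> ev V (FO F a) (FO G b) \<cdot> (?l \<odot> \<one> (FO F a)) = ev V (FO F a) (FO G b) \<cdot> (?r \<odot> \<one> (FO F a))"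
      using uncurry_inject[OF lr] ab by auto
    then show ?thesis
      using ab by (simp add: uncurry_post[OF t] uncurry_pre[OF t])
  qed
  then show ?thesis
    unfolding vnatural_iff[OF vgraph_vself F G] hnatural_def using nc t by auto
qed

lemma hnatural_cong:
  assumes "hnatural X F G t"
    and "\<And>a. a \<in> VOb X \<Longrightarrow> FO F' a = FO F a" "\<And>a b. \<lbrakk>a \<in> VOb X; b \<in> VOb X\<rbrakk> \<Longrightarrow> FM F' a b = FM F a b"
    and "\<And>a. a \<in> VOb X \<Longrightarrow> FO G' a = FO G a" "\<And>a b. \<lbrakk>a \<in> VOb X; b \<in> VOb X\<rbrakk> \<Longrightarrow> FM G' a b = FM G a b"
    and "\<And>a. a \<in> VOb X \<Longrightarrow> t' a = t a"
  shows "hnatural X F' G' t'"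
  using assms by (simp add: hnatural_def)

lemma hnatural_comp:
  assumes F: "vmap V X (vself V) F" and G: "vmap V X (vself V) G" and H: "vmap V X (vself V) H"
    and t: "hnatural X F G t" and s: "hnatural X G H s"
  shows "hnatural X F H (\<lambda>a. s a \<cdot> t a)"
proof -
  note [simp] = Arr_FM[OF F] Dom_FM[OF F] Cod_FM[OF F] vmap_FO[OF F, simplified]
    Arr_FM[OF G] Dom_FM[OF G] Cod_FM[OF G] vmap_FO[OF G, simplified]
    Arr_FM[OF H] Dom_FM[OF H] Cod_FM[OF H] vmap_FO[OF H, simplified]
    HomD[OF hnatural_in[OF t]] HomD[OF hnatural_in[OF s]]
  have "(s b \<cdot> t b) \<cdot> ev V (FO F a) (FO F b) \<cdot> (FM F a b \<odot> \<one> (FO F a)) =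
       (ev V (FO H a) (FO H b) \<cdot> (FM H a b \<odot> \<one> (FO H a))) \<cdot> (\<one> (VHom X a b) \<odot> (s a \<cdot> t a))"
    if ab: "a \<in> VOb X" "b \<in> VOb X" for a b
  proof -
    have X: "VHom X a b \<in> Ob V" using ab Dom_in[of "FM F a b"] by simp
    have "(s b \<cdot> t b) \<cdot> ev V (FO F a) (FO F b) \<cdot> (FM F a b \<odot> \<one> (FO F a)) =
        (s b \<cdot> ev V (FO G a) (FO G b) \<cdot> (FM G a b \<odot> \<one> (FO G a))) \<cdot> (\<one> (VHom X a b) \<odot> t a)"
      using ab X t by (simp add: hnatural_def typing assoc_Cmp Arr_tensor Cod_tensor Dom_tensor into_tensor c_simps del: merge merge')
    also have "\<dots> = (ev V (FO H a) (FO H b) \<cdot> (FM H a b \<odot> \<one> (FO H a))) \<cdot> (\<one> (VHom X a b) \<odot> (s a \<cdot> t a))"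
      using ab X s by (simp add: hnatural_def c_simps)
    finally show ?thesis .
  qed
  then show ?thesis
    unfolding hnatural_def using hnatural_in[OF t] hnatural_in[OF s] by (blast intro: Cmp_in)
qed

text \<open>Counterpart of \<open>vnatural_cancel\<close> with the invertible family on the outer
  side. It fits the reflected residuation isomorphisms, whose last factor inverts the action of a
  fully faithful embedding.\<close>

lemma hnatural_cancel:
  assumes F: "vmap V X (vself V) F" and G: "vmap V X (vself V) G" and H: "vmap V X (vself V) H"
    and t: "hnatural X G H t" and r: "hnatural X F H r" and iso: "\<And>a. a \<in> VOb X \<Longrightarrow> iso V (t a)"
    and s: "\<And>a. a \<in> VOb X \<Longrightarrow> s a \<in> Hom V (FO F a) (FO G a)"
    and eq: "\<And>a. a \<in> VOb X \<Longrightarrow> t a \<cdot> s a = r a"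
  shows "hnatural X F G s"
proof -
  note [simp] = Arr_FM[OF F] Dom_FM[OF F] Cod_FM[OF F] vmap_FO[OF F, simplified]
    Arr_FM[OF G] Dom_FM[OF G] Cod_FM[OF G] vmap_FO[OF G, simplified]
    Arr_FM[OF H] Dom_FM[OF H] Cod_FM[OF H] vmap_FO[OF H, simplified]
    HomD[OF hnatural_in[OF t]] HomD[OF s]
  have "s b \<cdot> ev V (FO F a) (FO F b) \<cdot> (FM F a b \<odot> \<one> (FO F a)) =
       (ev V (FO G a) (FO G b) \<cdot> (FM G a b \<odot> \<one> (FO G a))) \<cdot> (\<one> (VHom X a b) \<odot> s a)"
    if ab: "a \<in> VOb X" "b \<in> VOb X" for a b
  proof (rule mono_cancel[OF iso[OF ab(2)]])
    have X: "VHom X a b \<in> Ob V" using ab Dom_in[of "FM F a b"] by simp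
    have "t b \<cdot> s b \<cdot> ev V (FO F a) (FO F b) \<cdot> (FM F a b \<odot> \<one> (FO F a)) =
        r b \<cdot> ev V (FO F a) (FO F b) \<cdot> (FM F a b \<odot> \<one> (FO F a))"
      using ab X by (simp add: eq[symmetric] c_simps)
    also have "\<dots> = (ev V (FO H a) (FO H b) \<cdot> (FM H a b \<odot> \<one> (FO H a))) \<cdot> (\<one> (VHom X a b) \<odot> r a)"
      using ab r by (simp add: hnatural_def)
    also have "\<dots> = ((ev V (FO H a) (FO H b) \<cdot> (FM H a b \<odot> \<one> (FO H a))) \<cdot> (\<one> (VHom X a b) \<odot> t a)) \<cdot> (\<one> (VHom X a b) \<odot> s a)"
      using ab X by (simp add: eq[symmetric] c_simps)
    also have "\<dots> = (t b \<cdot> ev V (FO G a) (FO G b) \<cdot> (FM G a b \<odot> \<one> (FO G a))) \<cdot> (\<one> (VHom X a b) \<odot> s a)"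
      using ab t by (simp add: hnatural_def)
    finally show "t b \<cdot> s b \<cdot> ev V (FO F a) (FO F b) \<cdot> (FM F a b \<odot> \<one> (FO F a)) =
        t b \<cdot> (ev V (FO G a) (FO G b) \<cdot> (FM G a b \<odot> \<one> (FO G a))) \<cdot> (\<one> (VHom X a b) \<odot> s a)"
      using ab X by (simp add: c_simps)
  qed (use ab Dom_in[of "FM F a b"] in \<open>auto simp: c_simps\<close>)
  then show ?thesis
    unfolding hnatural_def using s by blast
qed

lemma hnatural_whisker:
  assumes t: "hnatural X F G t" and K: "vmap V W X K"
    and F: "vmap V X (vself V) F" and G: "vmap V X (vself V) G"
  shows "hnatural W (vfun_comp V F K) (vfun_comp V G K) (\<lambda>w. t (FO K w))"
proof -
  note [simp] = Arr_FM[OF F] Dom_FM[OF F] Cod_FM[OF F] vmap_FO[OF F, simplified]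
    Arr_FM[OF G] Dom_FM[OF G] Cod_FM[OF G] vmap_FO[OF G, simplified]
    Arr_FM[OF K] Dom_FM[OF K] Cod_FM[OF K] vmap_FO[OF K]
    HomD[OF hnatural_in[OF t]]
  have "t b' \<cdot> ev V (FO F a') (FO F b') \<cdot> ((FM F a' b' \<cdot> FM K a b) \<odot> \<one> (FO F a')) =
       (ev V (FO G a') (FO G b') \<cdot> ((FM G a' b' \<cdot> FM K a b) \<odot> \<one> (FO G a'))) \<cdot> (\<one> (VHom W a b) \<odot> t a')"
    if ab: "a \<in> VOb W" "b \<in> VOb W" and e: "a' = FO K a" "b' = FO K b" for a b a' b'
  proof -
    have X: "VHom X a' b' \<in> Ob V" "VHom W a b \<in> Ob V"
      using ab Dom_in[of "FM F a' b'"] Dom_in[of "FM K a b"] by (simp_all add: e)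
    have "t b' \<cdot> ev V (FO F a') (FO F b') \<cdot> ((FM F a' b' \<cdot> FM K a b) \<odot> \<one> (FO F a')) =
        (t b' \<cdot> ev V (FO F a') (FO F b') \<cdot> (FM F a' b' \<odot> \<one> (FO F a'))) \<cdot> (FM K a b \<odot> \<one> (FO F a'))"
      using ab X by (simp add: e c_simps)
    also have "\<dots> = ((ev V (FO G a') (FO G b') \<cdot> (FM G a' b' \<odot> \<one> (FO G a'))) \<cdot> (\<one> (VHom X a' b') \<odot> t a')) \<cdot> (FM K a b \<odot> \<one> (FO F a'))"
      using ab t by (simp add: hnatural_def e)
    also have "\<dots> = (ev V (FO G a') (FO G b') \<cdot> ((FM G a' b' \<cdot> FM K a b) \<odot> \<one> (FO G a'))) \<cdot> (\<one> (VHom W a b) \<odot> t a')"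
      using ab X by (simp add: e c_simps)
    finally show ?thesis .
  qed
  then show ?thesis
    unfolding hnatural_def using hnatural_in[OF t] by simp
qed

text \<open>Composing the transposed square with \<open>k \<odot> \<one>\<close> and a unit
  constraint leaves a commutative square of arrows of \<open>V\<close>, the form needed for
  comparing invertibility.\<close>

lemma hnatural_cell:
  assumes t: "hnatural X F G t" and F: "vmap V X (vself V) F" and G: "vmap V X (vself V) G"
    and ab: "a \<in> VOb X" "b \<in> VOb X" and k: "k \<in> cell V X a b"
  shows "t b \<cdot> unname (FO F a) (FO F b) (FM F a b \<cdot> k) = unname (FO G a) (FO G b) (FM G a b \<cdot> k) \<cdot> t a"
proof -
  note [simp] = Arr_FM[OF F] Dom_FM[OF F] Cod_FM[OF F] vmap_FO[OF F, simplified]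
    Arr_FM[OF G] Dom_FM[OF G] Cod_FM[OF G] vmap_FO[OF G, simplified]
    HomD[OF hnatural_in[OF t]] cellD[OF k]
  have X: "VHom X a b \<in> Ob V" using ab Dom_in[of "FM F a b"] by simp
  have "t b \<cdot> unname (FO F a) (FO F b) (FM F a b \<cdot> k) =
      (t b \<cdot> ev V (FO F a) (FO F b) \<cdot> (FM F a b \<odot> \<one> (FO F a))) \<cdot> (k \<odot> \<one> (FO F a)) \<cdot> li (FO F a)"
    using ab X by (simp add: unname_def c_simps)
  also have "\<dots> = (ev V (FO G a) (FO G b) \<cdot> (FM G a b \<odot> \<one> (FO G a))) \<cdot>
      (\<one> (VHom X a b) \<odot> t a) \<cdot> (k \<odot> \<one> (FO F a)) \<cdot> li (FO F a)"
    using ab X t by (simp add: hnatural_def) (simp add: c_simps)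
  also have "\<dots> = (ev V (FO G a) (FO G b) \<cdot> (FM G a b \<odot> \<one> (FO G a))) \<cdot>
      (k \<odot> \<one> (FO G a)) \<cdot> (\<one> \<I> \<odot> t a) \<cdot> li (FO F a)"
    using ab X by (simp add: c_simps)
  also have "\<dots> = unname (FO G a) (FO G b) (FM G a b \<cdot> k) \<cdot> t a"
    using ab X li_natural[of "t a" "FO G a"] by (simp add: unname_def c_simps)
  finally show ?thesis .
qed

subsection \<open>Hom functors\<close>

text \<open>For \<open>p = X(a', a)\<close>, \<open>q = X(b, b')\<close> and
  \<open>r = X(a, b)\<close> this brings the factors into the order in which they compose along
  \<open>a' \<rightarrow> a \<rightarrow> b \<rightarrow> b'\<close>. Both braidings in the
  definition of \<open>vhom\<close> are collected in it, so that the other arrows move past them by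
  a single naturality law.\<close>

definition shuffle :: "'o \<Rightarrow> 'o \<Rightarrow> 'o \<Rightarrow> 'm" where
  "shuffle p q r = (\<one> q \<odot> braid V p r) \<cdot> assoc V q p r \<cdot> (braid V p q \<odot> \<one> r)"

lemma
  assumes "p \<in> Ob V" "q \<in> Ob V" "r \<in> Ob V"
  shows Arr_shuffle: "shuffle p q r \<in> Arr V"
    and Dom_shuffle: "Dom V (shuffle p q r) = p \<otimes> q \<otimes> r"
    and Cod_shuffle: "Cod V (shuffle p q r) = q \<otimes> (r \<otimes> p)"
  using assms by (simp_all add: shuffle_def mon_typing)

lemmas shuffle_typing = Arr_shuffle Dom_shuffle Cod_shuffle

lemma shuffle_natural:
  assumes "f \<in> Arr V" "g \<in> Arr V" "h \<in> Arr V" "Cod V f = p" "Cod V g = q" "Cod V h = r"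
  shows "shuffle p q r \<cdot> (f \<odot> g \<odot> h) = (g \<odot> (h \<odot> f)) \<cdot> shuffle (Dom V f) (Dom V g) (Dom V h)"
proof -
  have ob: "p \<in> Ob V" "q \<in> Ob V" "r \<in> Ob V" "Dom V f \<in> Ob V" "Dom V g \<in> Ob V" "Dom V h \<in> Ob V"
    using assms by (auto simp: mon_typing)
  have "shuffle p q r \<cdot> (f \<odot> g \<odot> h) = (\<one> q \<odot> braid V p r) \<cdot> assoc V q p r \<cdot> (g \<odot> f \<odot> h) \<cdot> (braid V (Dom V f) (Dom V g) \<odot> \<one> (Dom V h))"
    using assms ob by (simp add: shuffle_def braid_natural mon_simps)
  also have "\<dots> = (\<one> q \<odot> braid V p r) \<cdot> (g \<odot> (f \<odot> h)) \<cdot> assoc V (Dom V g) (Dom V f) (Dom V h) \<cdot> (braid V (Dom V f) (Dom V g) \<odot> \<one> (Dom V h))"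
    using assms ob by (subst reassoc[OF assoc_natural]) (simp_all add: mon_typing assoc_Cmp)
  also have "\<dots> = (g \<odot> (h \<odot> f)) \<cdot> shuffle (Dom V f) (Dom V g) (Dom V h)"
    using assms ob by (simp add: shuffle_def braid_natural mon_simps)
  finally show ?thesis .
qed

lemma shuffle_li:
  assumes "r \<in> Ob V"
  shows "shuffle \<I> \<I> r \<cdot> (li \<I> \<odot> \<one> r) \<cdot> li r = (\<one> \<I> \<odot> ri r) \<cdot> li r"
proof -
  have "shuffle \<I> \<I> r \<cdot> (li \<I> \<odot> \<one> r) \<cdot> li r = (\<one> \<I> \<odot> braid V \<I> r) \<cdot> (assoc V \<I> \<I> r \<cdot> (ri \<I> \<odot> \<one> r)) \<cdot> li r"
    using assms by (simp add: shuffle_def braid_unit_unit li_ri_unit mon_simps)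
  also have "\<dots> = (\<one> \<I> \<odot> ri r) \<cdot> li r"
    using assms by (subst ri_triangle) (simp_all add: mon_simps braid_li)
  finally show ?thesis .
qed

lemma
  assumes X: "vgraph V X" and ob: "a \<in> VOb X" "b \<in> VOb X" "a' \<in> VOb X" "b' \<in> VOb X"
  shows FM_vhom_in: "FM (vhom V X) (a, b) (a', b') \<in>
      Hom V (VHom X a' a \<otimes> VHom X b b') (ihom V (VHom X a b) (VHom X a' b'))"
    and ev_vhom: "ev V (VHom X a b) (VHom X a' b') \<cdot> (FM (vhom V X) (a, b) (a', b') \<odot> \<one> (VHom X a b)) =
      VCmp X a' b b' \<cdot> (\<one> (VHom X b b') \<odot> VCmp X a' a b) \<cdot> shuffle (VHom X a' a) (VHom X b b') (VHom X a b)"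
proof -
  let ?f = "VCmp X a' b b' \<cdot>
       (\<one> (VHom X b b') \<odot> (VCmp X a' a b \<cdot> braid V (VHom X a' a) (VHom X a b))) \<cdot>
       assoc V (VHom X b b') (VHom X a' a) (VHom X a b) \<cdot>
       (braid V (VHom X a' a) (VHom X b b') \<odot> \<one> (VHom X a b))"
  have f: "?f \<in> Hom V (VHom X a' a \<otimes> VHom X b b' \<otimes> VHom X a b) (VHom X a' b')"
    using assms by (auto intro!: HomI simp: v_typing)
  have F: "FM (vhom V X) (a, b) (a', b') = curry_arr V (VHom X a' a \<otimes> VHom X b b') (VHom X a b) (VHom X a' b') ?f"
    by (simp add: vhom_def)
  have f': "?f = VCmp X a' b b' \<cdot> (\<one> (VHom X b b') \<odot> VCmp X a' a b) \<cdot> shuffle (VHom X a' a) (VHom X b b') (VHom X a b)"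
    using assms by (simp add: shuffle_def v_simps)
  show "FM (vhom V X) (a, b) (a', b') \<in>
      Hom V (VHom X a' a \<otimes> VHom X b b') (ihom V (VHom X a b) (VHom X a' b'))"
    unfolding F by (rule curry_arr(1)[OF _ _ _ f]) (use assms in \<open>auto simp: v_typing\<close>)
  show "ev V (VHom X a b) (VHom X a' b') \<cdot> (FM (vhom V X) (a, b) (a', b') \<odot> \<one> (VHom X a b)) =
      VCmp X a' b b' \<cdot> (\<one> (VHom X b b') \<odot> VCmp X a' a b) \<cdot> shuffle (VHom X a' a) (VHom X b b') (VHom X a b)"
    unfolding F f'[symmetric] by (rule curry_arr(2)[OF _ _ _ f]) (use assms in \<open>auto simp: v_typing\<close>)
qed

lemma vmap_vhom:
  assumes X: "vgraph V X"
  shows "vmap V (vtensor V (vop V X) X) (vself V) (vhom V X)"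
  using X FM_vhom_in[OF X] by (auto simp: vmap_def VHom_Ob)

lemma ev_vhom_Cmp:
  assumes X: "vgraph V X" and ob: "a \<in> VOb X" "b \<in> VOb X" "a' \<in> VOb X" "b' \<in> VOb X"
    and f: "f \<in> Arr V" "Cod V f = VHom X a' a" and g: "g \<in> Arr V" "Cod V g = VHom X b b'"
  shows "ev V (VHom X a b) (VHom X a' b') \<cdot> ((FM (vhom V X) (a, b) (a', b') \<cdot> (f \<odot> g)) \<odot> \<one> (VHom X a b)) =
    VCmp X a' b b' \<cdot> (g \<odot> (VCmp X a' a b \<cdot> (\<one> (VHom X a b) \<odot> f))) \<cdot> shuffle (Dom V f) (Dom V g) (VHom X a b)"
proof -
  note F = HomD[OF FM_vhom_in[OF X ob]]
  have "ev V (VHom X a b) (VHom X a' b') \<cdot> ((FM (vhom V X) (a, b) (a', b') \<cdot> (f \<odot> g)) \<odot> \<one> (VHom X a b)) =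
      ev V (VHom X a b) (VHom X a' b') \<cdot> (FM (vhom V X) (a, b) (a', b') \<odot> \<one> (VHom X a b)) \<cdot> (f \<odot> g \<odot> \<one> (VHom X a b))"
    using X ob f g F by (simp add: c_simps)
  also have "\<dots> = VCmp X a' b b' \<cdot> (\<one> (VHom X b b') \<odot> VCmp X a' a b) \<cdot>
      (shuffle (VHom X a' a) (VHom X b b') (VHom X a b) \<cdot> (f \<odot> g \<odot> \<one> (VHom X a b)))"
    using X ob f g F by (subst reassoc[OF ev_vhom]) (simp_all add: c_simps shuffle_typing)
  also have "\<dots> = VCmp X a' b b' \<cdot> (g \<odot> (VCmp X a' a b \<cdot> (\<one> (VHom X a b) \<odot> f))) \<cdot> shuffle (Dom V f) (Dom V g) (VHom X a b)"
    using X ob f g by (subst shuffle_natural) (simp_all add: c_simps shuffle_typing)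
  finally show ?thesis .
qed

text \<open>Translates a statement about the two-variable hom functor at a pair of cells into the
  one-sided actions, in terms of which orthogonality is expressed.\<close>

lemma unname_vhom:
  assumes X: "vgraph V X" and ob: "a \<in> VOb X" "b \<in> VOb X" "a' \<in> VOb X" "b' \<in> VOb X"
    and u: "u \<in> cell V X a' a" and w: "w \<in> cell V X b b'"
  shows "unname (VHom X a b) (VHom X a' b') (FM (vhom V X) (a, b) (a', b') \<cdot> pair_cell V u w) =
    post_comp V X a' b b' w \<cdot> pre_comp V X b a' a u"
proof -
  let ?r = "VHom X a b"
  note F = HomD[OF FM_vhom_in[OF X ob]] and uw = cellD[OF u] cellD[OF w]
  have "unname ?r (VHom X a' b') (FM (vhom V X) (a, b) (a', b') \<cdot> pair_cell V u w) =
      (ev V ?r (VHom X a' b') \<cdot> ((FM (vhom V X) (a, b) (a', b') \<cdot> (u \<odot> w)) \<odot> \<one> ?r)) \<cdot> (li \<I> \<odot> \<one> ?r) \<cdot> li ?r"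
    using X ob uw F by (simp add: unname_def pair_cell_def c_simps)
  also have "\<dots> = VCmp X a' b b' \<cdot> (w \<odot> (VCmp X a' a b \<cdot> (\<one> ?r \<odot> u))) \<cdot> (shuffle \<I> \<I> ?r \<cdot> (li \<I> \<odot> \<one> ?r) \<cdot> li ?r)"
    using X ob uw by (simp add: ev_vhom_Cmp c_simps shuffle_typing)
  also have "\<dots> = VCmp X a' b b' \<cdot> (w \<odot> pre_comp V X b a' a u) \<cdot> li ?r"
    using X ob uw by (subst shuffle_li) (simp_all add: pre_comp_def c_simps)
  also have "\<dots> = post_comp V X a' b b' w \<cdot> pre_comp V X b a' a u"
    using X ob u w by (simp add: post_Cmp pp_typing v_typing)
  finally show ?thesis .
qed

text \<open>\<open>F\<close> preserves composition, and this is used twice: once at each of the two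
  composites in \<open>a' \<rightarrow> a \<rightarrow> b \<rightarrow> b'\<close>.\<close>

lemma hnatural_functor:
  assumes F: "vfunctor V X Y F" and X: "vgraph V X" and Y: "vgraph V Y"
  shows "hnatural (vtensor V (vop V X) X) (vhom V X) (vfun_comp V (vhom V Y) (vfun_tensor V (vfun_op F) F))
    (\<lambda>(a, b). FM F a b)"
proof -
  note F' = vfunctor_vmap[OF F]
  note [simp] = Arr_FM[OF F'] Dom_FM[OF F'] Cod_FM[OF F'] vmap_FO[OF F']
  have "FM F a' b' \<cdot> ev V (VHom X a b) (VHom X a' b') \<cdot> (FM (vhom V X) (a, b) (a', b') \<odot> \<one> (VHom X a b)) =
      (ev V (VHom Y (FO F a) (FO F b)) (VHom Y (FO F a') (FO F b')) \<cdot>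
        ((FM (vhom V Y) (FO F a, FO F b) (FO F a', FO F b') \<cdot> (FM F a' a \<odot> FM F b b')) \<odot> \<one> (VHom Y (FO F a) (FO F b)))) \<cdot>
      (\<one> (VHom X a' a \<otimes> VHom X b b') \<odot> FM F a b)"
    if ob: "a \<in> VOb X" "b \<in> VOb X" "a' \<in> VOb X" "b' \<in> VOb X" for a b a' b'
  proof -
    have "FM F a' b' \<cdot> ev V (VHom X a b) (VHom X a' b') \<cdot> (FM (vhom V X) (a, b) (a', b') \<odot> \<one> (VHom X a b)) =
        (FM F a' b' \<cdot> VCmp X a' b b') \<cdot> (\<one> (VHom X b b') \<odot> VCmp X a' a b) \<cdot> shuffle (VHom X a' a) (VHom X b b') (VHom X a b)"
      using X ob by (simp add: ev_vhom c_simps shuffle_typing)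
    also have "\<dots> = VCmp Y (FO F a') (FO F b) (FO F b') \<cdot> (FM F b b' \<odot> (FM F a' b \<cdot> VCmp X a' a b)) \<cdot> shuffle (VHom X a' a) (VHom X b b') (VHom X a b)"
      using X Y ob by (simp add: vfunctor.FM_VCmp[OF F] c_simps shuffle_typing)
    also have "\<dots> = VCmp Y (FO F a') (FO F b) (FO F b') \<cdot> (FM F b b' \<odot> (VCmp Y (FO F a') (FO F a) (FO F b) \<cdot> (\<one> (VHom Y (FO F a) (FO F b)) \<odot> FM F a' a))) \<cdot>
        (\<one> (VHom X b b') \<odot> (FM F a b \<odot> \<one> (VHom X a' a))) \<cdot> shuffle (VHom X a' a) (VHom X b b') (VHom X a b)"
      using X Y ob by (simp add: vfunctor.FM_VCmp[OF F] c_simps shuffle_typing)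
    also have "\<dots> = VCmp Y (FO F a') (FO F b) (FO F b') \<cdot> (FM F b b' \<odot> (VCmp Y (FO F a') (FO F a) (FO F b) \<cdot> (\<one> (VHom Y (FO F a) (FO F b)) \<odot> FM F a' a))) \<cdot>
        shuffle (VHom X a' a) (VHom X b b') (VHom Y (FO F a) (FO F b)) \<cdot> (\<one> (VHom X a' a) \<odot> \<one> (VHom X b b') \<odot> FM F a b)"
      using X Y ob by (subst shuffle_natural) (simp_all add: c_simps shuffle_typing)
    also have "\<dots> = (ev V (VHom Y (FO F a) (FO F b)) (VHom Y (FO F a') (FO F b')) \<cdot>
        ((FM (vhom V Y) (FO F a, FO F b) (FO F a', FO F b') \<cdot> (FM F a' a \<odot> FM F b b')) \<odot> \<one> (VHom Y (FO F a) (FO F b)))) \<cdot>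
      (\<one> (VHom X a' a \<otimes> VHom X b b') \<odot> FM F a b)"
      using X Y ob by (simp add: ev_vhom_Cmp c_simps shuffle_typing del: merge merge')
    finally show ?thesis .
  qed
  then show ?thesis
    unfolding hnatural_def using X Y by (auto intro!: HomI)
qed

text \<open>Naturality in the first variable rests on the square of \<open>t\<close> and is isolated
  as \<open>key\<close>; naturality in the second says that composing on the two sides commutes,
  which is \<open>pre_VCmp\<close>.\<close>

lemma hnatural_pre:
  assumes t: "vnatural V X Y F G t" and X: "vgraph V X" and Y: "vcategory V Y"
    and F: "vmap V X Y F" and G: "vmap V X Y G"
  shows "hnatural (vtensor V (vop V X) Y)
    (vfun_comp V (vhom V Y) (vfun_tensor V (vfun_op G) (vfun_id V Y)))
    (vfun_comp V (vhom V Y) (vfun_tensor V (vfun_op F) (vfun_id V Y)))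
    (\<lambda>(a, c). pre_comp V Y c (FO F a) (FO G a) (t a))"
proof -
  note Y' = vcategory_vgraph[OF Y]
  note [simp] = Arr_FM[OF F] Dom_FM[OF F] Cod_FM[OF F] vmap_FO[OF F]
    Arr_FM[OF G] Dom_FM[OF G] Cod_FM[OF G] vmap_FO[OF G]
    pp_typing[OF Y'] vnatural_cell[OF t]
  have "pre_comp V Y c' (FO F a') (FO G a') (t a') \<cdot> ev V (VHom Y (FO G a) c) (VHom Y (FO G a') c') \<cdot>
        ((FM (vhom V Y) (FO G a, c) (FO G a', c') \<cdot> (FM G a' a \<odot> \<one> (VHom Y c c'))) \<odot> \<one> (VHom Y (FO G a) c)) =
      (ev V (VHom Y (FO F a) c) (VHom Y (FO F a') c') \<cdot>
        ((FM (vhom V Y) (FO F a, c) (FO F a', c') \<cdot> (FM F a' a \<odot> \<one> (VHom Y c c'))) \<odot> \<one> (VHom Y (FO F a) c))) \<cdot>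
      (\<one> (VHom X a' a \<otimes> VHom Y c c') \<odot> pre_comp V Y c (FO F a) (FO G a) (t a))"
    if ob: "a \<in> VOb X" "a' \<in> VOb X" "c \<in> VOb Y" "c' \<in> VOb Y" for a a' c c'
  proof -
    let ?q = "VHom Y c c'" and ?r = "VHom Y (FO G a) c" and ?p = "VHom X a' a"
    have XO: "?p \<in> Ob V" using X ob by (simp add: VHom_Ob)
    have "pre_comp V Y c (FO F a') (FO G a') (t a') \<cdot> VCmp Y (FO G a') (FO G a) c \<cdot> (\<one> ?r \<odot> FM G a' a) =
        VCmp Y (FO F a') (FO G a) c \<cdot> (\<one> ?r \<odot> (pre_comp V Y (FO G a) (FO F a') (FO G a') (t a') \<cdot> FM G a' a))"
      using ob Y' XO by (subst reassoc[OF pre_VCmp[OF Y]]) (simp_all add: c_simps)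
    also have "\<dots> = VCmp Y (FO F a') (FO G a) c \<cdot> (\<one> ?r \<odot> (post_comp V Y (FO F a') (FO F a) (FO G a) (t a) \<cdot> FM F a' a))"
      using ob t by (simp add: vnatural_iff[OF Y' F G])
    also have "\<dots> = (VCmp Y (FO F a') (FO G a) c \<cdot> (\<one> ?r \<odot> post_comp V Y (FO F a') (FO F a) (FO G a) (t a))) \<cdot> (\<one> ?r \<odot> FM F a' a)"
      using ob Y' XO by (simp add: c_simps)
    also have "\<dots> = VCmp Y (FO F a') (FO F a) c \<cdot> (pre_comp V Y c (FO F a) (FO G a) (t a) \<odot> FM F a' a)"
      using ob Y' XO by (subst VCmp_pre[OF Y, symmetric]) (simp_all add: c_simps)
    finally have key: "pre_comp V Y c (FO F a') (FO G a') (t a') \<cdot> VCmp Y (FO G a') (FO G a) c \<cdot> (\<one> ?r \<odot> FM G a' a) =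
        VCmp Y (FO F a') (FO F a) c \<cdot> (pre_comp V Y c (FO F a) (FO G a) (t a) \<odot> FM F a' a)" .
    have "pre_comp V Y c' (FO F a') (FO G a') (t a') \<cdot> ev V ?r (VHom Y (FO G a') c') \<cdot>
        ((FM (vhom V Y) (FO G a, c) (FO G a', c') \<cdot> (FM G a' a \<odot> \<one> ?q)) \<odot> \<one> ?r) =
        (pre_comp V Y c' (FO F a') (FO G a') (t a') \<cdot> VCmp Y (FO G a') c c') \<cdot>
        (\<one> ?q \<odot> (VCmp Y (FO G a') (FO G a) c \<cdot> (\<one> ?r \<odot> FM G a' a))) \<cdot> shuffle ?p ?q ?r"
      using ob Y' XO by (simp add: ev_vhom_Cmp c_simps shuffle_typing)
    also have "\<dots> = VCmp Y (FO F a') c c' \<cdot>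
        (\<one> ?q \<odot> (pre_comp V Y c (FO F a') (FO G a') (t a') \<cdot> VCmp Y (FO G a') (FO G a) c \<cdot> (\<one> ?r \<odot> FM G a' a))) \<cdot> shuffle ?p ?q ?r"
      using ob Y' XO by (subst pre_VCmp[OF Y]) (simp_all add: c_simps shuffle_typing)
    also have "\<dots> = VCmp Y (FO F a') c c' \<cdot>
        (\<one> ?q \<odot> (VCmp Y (FO F a') (FO F a) c \<cdot> (\<one> (VHom Y (FO F a) c) \<odot> FM F a' a))) \<cdot>
        (\<one> ?q \<odot> (pre_comp V Y c (FO F a) (FO G a) (t a) \<odot> \<one> ?p)) \<cdot> shuffle ?p ?q ?r"
      unfolding key using ob Y' XO by (simp add: c_simps shuffle_typing)
    also have "\<dots> = VCmp Y (FO F a') c c' \<cdot>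
        (\<one> ?q \<odot> (VCmp Y (FO F a') (FO F a) c \<cdot> (\<one> (VHom Y (FO F a) c) \<odot> FM F a' a))) \<cdot>
        shuffle ?p ?q (VHom Y (FO F a) c) \<cdot> (\<one> ?p \<odot> \<one> ?q \<odot> pre_comp V Y c (FO F a) (FO G a) (t a))"
      using ob Y' XO by (subst shuffle_natural) (simp_all add: c_simps shuffle_typing)
    also have "\<dots> = (ev V (VHom Y (FO F a) c) (VHom Y (FO F a') c') \<cdot>
        ((FM (vhom V Y) (FO F a, c) (FO F a', c') \<cdot> (FM F a' a \<odot> \<one> ?q)) \<odot> \<one> (VHom Y (FO F a) c))) \<cdot>
      (\<one> (?p \<otimes> ?q) \<odot> pre_comp V Y c (FO F a) (FO G a) (t a))"
      using ob Y' XO by (simp add: ev_vhom_Cmp c_simps shuffle_typing del: merge merge')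
    finally show ?thesis .
  qed
  then show ?thesis
    unfolding hnatural_def using Y' by (auto intro!: HomI)
qed

text \<open>The cell \<open>t a'\<close> is first absorbed next to \<open>FM F a a'\<close>, where
  the square of \<open>t\<close> turns it into \<open>t a\<close>; \<open>VCmp_pre\<close> then
  hands \<open>t a\<close> over to the other factor, and \<open>post_VCmp\<close> moves it
  inside.\<close>

lemma hnatural_post:
  assumes t: "vnatural V X Y F G t" and X: "vgraph V X" and Y: "vcategory V Y"
    and F: "vmap V X Y F" and G: "vmap V X Y G"
  shows "hnatural (vtensor V (vop V Y) X)
    (vfun_comp V (vhom V Y) (vfun_tensor V (vfun_id V (vop V Y)) F))
    (vfun_comp V (vhom V Y) (vfun_tensor V (vfun_id V (vop V Y)) G))
    (\<lambda>(c, a). post_comp V Y c (FO F a) (FO G a) (t a))"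
proof -
  note Y' = vcategory_vgraph[OF Y]
  note [simp] = Arr_FM[OF F] Dom_FM[OF F] Cod_FM[OF F] vmap_FO[OF F]
    Arr_FM[OF G] Dom_FM[OF G] Cod_FM[OF G] vmap_FO[OF G]
    pp_typing[OF Y'] vnatural_cell[OF t]
  have "post_comp V Y c' (FO F a') (FO G a') (t a') \<cdot> ev V (VHom Y c (FO F a)) (VHom Y c' (FO F a')) \<cdot>
        ((FM (vhom V Y) (c, FO F a) (c', FO F a') \<cdot> (\<one> (VHom Y c' c) \<odot> FM F a a')) \<odot> \<one> (VHom Y c (FO F a))) =
      (ev V (VHom Y c (FO G a)) (VHom Y c' (FO G a')) \<cdot>
        ((FM (vhom V Y) (c, FO G a) (c', FO G a') \<cdot> (\<one> (VHom Y c' c) \<odot> FM G a a')) \<odot> \<one> (VHom Y c (FO G a)))) \<cdot>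
      (\<one> (VHom Y c' c \<otimes> VHom X a a') \<odot> post_comp V Y c (FO F a) (FO G a) (t a))"
    if ob: "a \<in> VOb X" "a' \<in> VOb X" "c \<in> VOb Y" "c' \<in> VOb Y" for a a' c c'
  proof -
    let ?q = "VHom X a a'" and ?r = "VHom Y c (FO F a)" and ?p = "VHom Y c' c"
    have XO: "?q \<in> Ob V" using X ob by (simp add: VHom_Ob)
    have "post_comp V Y c' (FO F a') (FO G a') (t a') \<cdot> ev V ?r (VHom Y c' (FO F a')) \<cdot>
        ((FM (vhom V Y) (c, FO F a) (c', FO F a') \<cdot> (\<one> ?p \<odot> FM F a a')) \<odot> \<one> ?r) =
        (post_comp V Y c' (FO F a') (FO G a') (t a') \<cdot> VCmp Y c' (FO F a) (FO F a')) \<cdot>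
        (FM F a a' \<odot> VCmp Y c' c (FO F a)) \<cdot> shuffle ?p ?q ?r"
      using ob Y' XO by (simp add: ev_vhom_Cmp c_simps shuffle_typing)
    also have "\<dots> = VCmp Y c' (FO F a) (FO G a') \<cdot>
        ((post_comp V Y (FO F a) (FO F a') (FO G a') (t a') \<cdot> FM F a a') \<odot> VCmp Y c' c (FO F a)) \<cdot> shuffle ?p ?q ?r"
      using ob Y' XO by (subst post_VCmp[OF Y]) (simp_all add: c_simps shuffle_typing)
    also have "\<dots> = VCmp Y c' (FO F a) (FO G a') \<cdot>
        ((pre_comp V Y (FO G a') (FO F a) (FO G a) (t a) \<cdot> FM G a a') \<odot> VCmp Y c' c (FO F a)) \<cdot> shuffle ?p ?q ?r"
      using ob t by (simp add: vnatural_iff[OF Y' F G])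
    also have "\<dots> = (VCmp Y c' (FO F a) (FO G a') \<cdot> (pre_comp V Y (FO G a') (FO F a) (FO G a) (t a) \<odot> \<one> (VHom Y c' (FO F a)))) \<cdot>
        (FM G a a' \<odot> VCmp Y c' c (FO F a)) \<cdot> shuffle ?p ?q ?r"
      using ob Y' XO by (simp add: c_simps shuffle_typing)
    also have "\<dots> = VCmp Y c' (FO G a) (FO G a') \<cdot>
        (FM G a a' \<odot> (post_comp V Y c' (FO F a) (FO G a) (t a) \<cdot> VCmp Y c' c (FO F a))) \<cdot> shuffle ?p ?q ?r"
      using ob Y' XO by (subst VCmp_pre[OF Y]) (simp_all add: c_simps shuffle_typing)
    also have "\<dots> = VCmp Y c' (FO G a) (FO G a') \<cdot> (FM G a a' \<odot> VCmp Y c' c (FO G a)) \<cdot>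
        (\<one> ?q \<odot> (post_comp V Y c (FO F a) (FO G a) (t a) \<odot> \<one> ?p)) \<cdot> shuffle ?p ?q ?r"
      using ob Y' XO by (subst post_VCmp[OF Y]) (simp_all add: c_simps shuffle_typing)
    also have "\<dots> = VCmp Y c' (FO G a) (FO G a') \<cdot> (FM G a a' \<odot> VCmp Y c' c (FO G a)) \<cdot>
        shuffle ?p ?q (VHom Y c (FO G a)) \<cdot> (\<one> ?p \<odot> \<one> ?q \<odot> post_comp V Y c (FO F a) (FO G a) (t a))"
      using ob Y' XO by (subst shuffle_natural) (simp_all add: c_simps shuffle_typing)
    also have "\<dots> = (ev V (VHom Y c (FO G a)) (VHom Y c' (FO G a')) \<cdot>
        ((FM (vhom V Y) (c, FO G a) (c', FO G a') \<cdot> (\<one> ?p \<odot> FM G a a')) \<odot> \<one> (VHom Y c (FO G a)))) \<cdot>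
      (\<one> (?p \<otimes> ?q) \<odot> post_comp V Y c (FO F a) (FO G a) (t a))"
      using ob Y' XO by (simp add: ev_vhom_Cmp c_simps shuffle_typing del: merge merge')
    finally show ?thesis .
  qed
  then show ?thesis
    unfolding hnatural_def using Y' by (auto intro!: HomI)
qed

end

section \<open>Coherence of the reflected composition\<close>

text \<open>Only underlying categories matter here. All 2-cells of a bicategory are collected in one category \<open>B\<close>
  with partial horizontal composition; \<open>S\<close> and \<open>T\<close> are source and target of 1-cells,
  \<open>\<upsilon>\<close> and \<open>\<rho>\<close> the left and right unit isomorphisms.\<close>

locale local_reflection =
  B: category B + C: category C
  for B :: "('b, 'f) cat" (structure) and C :: "('c, 'g) cat"
    and X :: "'x set" and S T :: "'b \<Rightarrow> 'x"
    and Lo :: "'b \<Rightarrow> 'c" and L :: "'f \<Rightarrow> 'g" and Ro :: "'c \<Rightarrow> 'b" and R :: "'g \<Rightarrow> 'f"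
    and \<eta> :: "'b \<Rightarrow> 'f" and \<epsilon> :: "'c \<Rightarrow> 'g"
    and prod_ob :: "'b \<Rightarrow> 'b \<Rightarrow> 'b" (infixr "\<star>" 75) and prod_arr :: "'f \<Rightarrow> 'f \<Rightarrow> 'f" (infixr "\<diamondop>" 75)
    and U :: "'x \<Rightarrow> 'b" and \<alpha> :: "'b \<Rightarrow> 'b \<Rightarrow> 'b \<Rightarrow> 'f" and \<upsilon> :: "'b \<Rightarrow> 'f" and \<rho> :: "'b \<Rightarrow> 'f" +
  assumes S_in: "a \<in> Ob B \<Longrightarrow> S a \<in> X" and T_in: "a \<in> Ob B \<Longrightarrow> T a \<in> X"
    and S_Cod: "f \<in> Arr B \<Longrightarrow> S (Cod B f) = S (Dom B f)"
    and T_Cod: "f \<in> Arr B \<Longrightarrow> T (Cod B f) = T (Dom B f)"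
    and Lo_in: "a \<in> Ob B \<Longrightarrow> Lo a \<in> Ob C"
    and L_in: "f \<in> Hom B a b \<Longrightarrow> L f \<in> Hom C (Lo a) (Lo b)"
    and L_Idn: "a \<in> Ob B \<Longrightarrow> L (\<one> a) = \<one>\<^bsub>C\<^esub> (Lo a)"
    and L_Cmp: "\<lbrakk>f \<in> Hom B a b; g \<in> Hom B b c\<rbrakk> \<Longrightarrow> L (g \<cdot> f) = L g \<cdot>\<^bsub>C\<^esub> L f"
    and Ro_in: "p \<in> Ob C \<Longrightarrow> Ro p \<in> Ob B"
    and R_in: "u \<in> Hom C p q \<Longrightarrow> R u \<in> Hom B (Ro p) (Ro q)"
    and R_Idn: "p \<in> Ob C \<Longrightarrow> R (\<one>\<^bsub>C\<^esub> p) = \<one> (Ro p)"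
    and R_Cmp: "\<lbrakk>u \<in> Hom C p q; v \<in> Hom C q r\<rbrakk> \<Longrightarrow> R (v \<cdot>\<^bsub>C\<^esub> u) = R v \<cdot> R u"
    and R_full: "\<lbrakk>p \<in> Ob C; q \<in> Ob C; f \<in> Hom B (Ro p) (Ro q)\<rbrakk> \<Longrightarrow> \<exists>u\<in>Hom C p q. R u = f"
    and R_faithful: "\<lbrakk>u \<in> Hom C p q; v \<in> Hom C p q; R u = R v\<rbrakk> \<Longrightarrow> u = v"
    and S_RL: "a \<in> Ob B \<Longrightarrow> S (Ro (Lo a)) = S a" and T_RL: "a \<in> Ob B \<Longrightarrow> T (Ro (Lo a)) = T a"
    and \<eta>_in: "a \<in> Ob B \<Longrightarrow> \<eta> a \<in> Hom B a (Ro (Lo a))"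
    and \<eta>_nat: "f \<in> Hom B a b \<Longrightarrow> \<eta> b \<cdot> f = R (L f) \<cdot> \<eta> a"
    and \<epsilon>_in: "p \<in> Ob C \<Longrightarrow> \<epsilon> p \<in> Hom C (Lo (Ro p)) p"
    and \<epsilon>_nat: "u \<in> Hom C p q \<Longrightarrow> \<epsilon> q \<cdot>\<^bsub>C\<^esub> L (R u) = u \<cdot>\<^bsub>C\<^esub> \<epsilon> p"
    and \<epsilon>_L_\<eta>: "a \<in> Ob B \<Longrightarrow> \<epsilon> (Lo a) \<cdot>\<^bsub>C\<^esub> L (\<eta> a) = \<one>\<^bsub>C\<^esub> (Lo a)"
    and R_\<epsilon>_\<eta>: "p \<in> Ob C \<Longrightarrow> R (\<epsilon> p) \<cdot> \<eta> (Ro p) = \<one> (Ro p)"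
    and prod_ob_in: "\<lbrakk>a \<in> Ob B; b \<in> Ob B; S a = T b\<rbrakk> \<Longrightarrow> a \<star> b \<in> Ob B"
    and S_prod: "\<lbrakk>a \<in> Ob B; b \<in> Ob B; S a = T b\<rbrakk> \<Longrightarrow> S (a \<star> b) = S b"
    and T_prod: "\<lbrakk>a \<in> Ob B; b \<in> Ob B; S a = T b\<rbrakk> \<Longrightarrow> T (a \<star> b) = T a"
    and prod_arr_in: "\<lbrakk>f \<in> Hom B a a'; g \<in> Hom B b b'; S a = T b\<rbrakk> \<Longrightarrow> f \<diamondop> g \<in> Hom B (a \<star> b) (a' \<star> b')"
    and prod_Idn: "\<lbrakk>a \<in> Ob B; b \<in> Ob B; S a = T b\<rbrakk> \<Longrightarrow> \<one> a \<diamondop> \<one> b = \<one> (a \<star> b)"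
    and prod_Cmp: "\<lbrakk>f \<in> Hom B a a'; f' \<in> Hom B a' a''; g \<in> Hom B b b'; g' \<in> Hom B b' b''; S a = T b\<rbrakk> \<Longrightarrow>
      (f' \<diamondop> g') \<cdot> (f \<diamondop> g) = (f' \<cdot> f) \<diamondop> (g' \<cdot> g)"
    and U_in: "x \<in> X \<Longrightarrow> U x \<in> Ob B" and S_U: "x \<in> X \<Longrightarrow> S (U x) = x" and T_U: "x \<in> X \<Longrightarrow> T (U x) = x"
    and \<alpha>_in: "\<lbrakk>a \<in> Ob B; b \<in> Ob B; c \<in> Ob B; S a = T b; S b = T c\<rbrakk> \<Longrightarrow>
      \<alpha> a b c \<in> Hom B ((a \<star> b) \<star> c) (a \<star> b \<star> c)"
    and \<alpha>_iso: "\<lbrakk>a \<in> Ob B; b \<in> Ob B; c \<in> Ob B; S a = T b; S b = T c\<rbrakk> \<Longrightarrow> iso B (\<alpha> a b c)"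
    and \<alpha>_nat: "\<lbrakk>f \<in> Hom B a a'; g \<in> Hom B b b'; h \<in> Hom B c c'; S a = T b; S b = T c\<rbrakk> \<Longrightarrow>
      \<alpha> a' b' c' \<cdot> ((f \<diamondop> g) \<diamondop> h) = (f \<diamondop> g \<diamondop> h) \<cdot> \<alpha> a b c"
    and \<upsilon>_in: "a \<in> Ob B \<Longrightarrow> \<upsilon> a \<in> Hom B (U (T a) \<star> a) a"
    and \<upsilon>_iso: "a \<in> Ob B \<Longrightarrow> iso B (\<upsilon> a)"
    and \<upsilon>_nat: "f \<in> Hom B a b \<Longrightarrow> \<upsilon> b \<cdot> (\<one> (U (T a)) \<diamondop> f) = f \<cdot> \<upsilon> a"
    and \<rho>_in: "a \<in> Ob B \<Longrightarrow> \<rho> a \<in> Hom B (a \<star> U (S a)) a"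
    and \<rho>_iso: "a \<in> Ob B \<Longrightarrow> iso B (\<rho> a)"
    and \<rho>_nat: "f \<in> Hom B a b \<Longrightarrow> \<rho> b \<cdot> (f \<diamondop> \<one> (U (S a))) = f \<cdot> \<rho> a"
    and pentagon: "\<lbrakk>a \<in> Ob B; b \<in> Ob B; c \<in> Ob B; d \<in> Ob B; S a = T b; S b = T c; S c = T d\<rbrakk> \<Longrightarrow>
      \<alpha> a b (c \<star> d) \<cdot> \<alpha> (a \<star> b) c d = (\<one> a \<diamondop> \<alpha> b c d) \<cdot> \<alpha> a (b \<star> c) d \<cdot> (\<alpha> a b c \<diamondop> \<one> d)"
    and triangle: "\<lbrakk>a \<in> Ob B; b \<in> Ob B; S a = T b\<rbrakk> \<Longrightarrow>
      (\<one> a \<diamondop> \<upsilon> b) \<cdot> \<alpha> a (U (T b)) b = \<rho> a \<diamondop> \<one> b"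
begin

lemma
  assumes "f \<in> Arr B"
  shows Arr_L: "L f \<in> Arr C" and Dom_L: "Dom C (L f) = Lo (Dom B f)" and Cod_L: "Cod C (L f) = Lo (Cod B f)"
  using L_in[of f "Dom B f" "Cod B f"] assms by (auto simp: Hom_def)

lemma
  assumes "h \<in> Arr C"
  shows Arr_R: "R h \<in> Arr B" and Dom_R: "Dom B (R h) = Ro (Dom C h)" and Cod_R: "Cod B (R h) = Ro (Cod C h)"
  using R_in[of h "Dom C h" "Cod C h"] assms by (auto simp: Hom_def)

lemma
  assumes "f \<in> Arr B" "g \<in> Arr B" "S (Dom B f) = T (Dom B g)"
  shows Arr_prod: "f \<diamondop> g \<in> Arr B" and Dom_prod: "Dom B (f \<diamondop> g) = Dom B f \<star> Dom B g"
    and Cod_prod: "Cod B (f \<diamondop> g) = Cod B f \<star> Cod B g"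
  using prod_arr_in[of f "Dom B f" "Cod B f" g "Dom B g" "Cod B g"] assms by (auto simp: Hom_def)

lemma
  assumes "a \<in> Ob B"
  shows Arr_\<eta>: "\<eta> a \<in> Arr B" and Dom_\<eta>: "Dom B (\<eta> a) = a" and Cod_\<eta>: "Cod B (\<eta> a) = Ro (Lo a)"
    and Arr_\<upsilon>: "\<upsilon> a \<in> Arr B" and Dom_\<upsilon>: "Dom B (\<upsilon> a) = U (T a) \<star> a" and Cod_\<upsilon>: "Cod B (\<upsilon> a) = a"
    and Arr_\<rho>: "\<rho> a \<in> Arr B" and Dom_\<rho>: "Dom B (\<rho> a) = a \<star> U (S a)" and Cod_\<rho>: "Cod B (\<rho> a) = a"
  using \<eta>_in[OF assms] \<upsilon>_in[OF assms] \<rho>_in[OF assms] by (auto simp: Hom_def)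

lemma
  assumes "c \<in> Ob C"
  shows Arr_\<epsilon>: "\<epsilon> c \<in> Arr C" and Dom_\<epsilon>: "Dom C (\<epsilon> c) = Lo (Ro c)" and Cod_\<epsilon>: "Cod C (\<epsilon> c) = c"
  using \<epsilon>_in[OF assms] by (auto simp: Hom_def)

lemma
  assumes "a \<in> Ob B" "b \<in> Ob B" "c \<in> Ob B" "S a = T b" "S b = T c"
  shows Arr_\<alpha>: "\<alpha> a b c \<in> Arr B" and Dom_\<alpha>: "Dom B (\<alpha> a b c) = (a \<star> b) \<star> c"
    and Cod_\<alpha>: "Cod B (\<alpha> a b c) = a \<star> b \<star> c"
  using \<alpha>_in[OF assms] by (auto simp: Hom_def)

lemmas ord_typing = B.typing C.typing Lo_in Arr_L Dom_L Cod_L Ro_in Arr_R Dom_R Cod_R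
  S_in T_in S_RL T_RL S_prod T_prod S_U T_U U_in prod_ob_in Arr_prod Dom_prod Cod_prod
  Arr_\<eta> Dom_\<eta> Cod_\<eta> Arr_\<upsilon> Dom_\<upsilon> Cod_\<upsilon> Arr_\<rho> Dom_\<rho> Cod_\<rho> Arr_\<epsilon> Dom_\<epsilon> Cod_\<epsilon> Arr_\<alpha> Dom_\<alpha> Cod_\<alpha>

lemma L_merge: "\<lbrakk>g \<in> Arr B; into B (Dom B g) f\<rbrakk> \<Longrightarrow> L g \<cdot>\<^bsub>C\<^esub> L f = L (g \<cdot> f)"
  using L_Cmp[of f "Dom B f" "Dom B g" g "Cod B g"] by (auto simp: into_def Hom_def)

lemma R_merge: "\<lbrakk>g \<in> Arr C; into C (Dom C g) f\<rbrakk> \<Longrightarrow> R g \<cdot> R f = R (g \<cdot>\<^bsub>C\<^esub> f)"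
  using R_Cmp[of f "Dom C f" "Dom C g" g "Cod C g"] by (auto simp: into_def Hom_def)

lemma prod_merge:
  "\<lbrakk>f' \<in> Arr B; into B (Dom B f') f; g' \<in> Arr B; into B (Dom B g') g; S (Dom B f) = T (Dom B g)\<rbrakk> \<Longrightarrow>
     (f' \<diamondop> g') \<cdot> (f \<diamondop> g) = (f' \<cdot> f) \<diamondop> (g' \<cdot> g)"
  using prod_Cmp[of f "Dom B f" "Dom B f'" f' "Cod B f'" g "Dom B g" "Dom B g'" g' "Cod B g'"]
  by (auto simp: into_def Hom_def)

lemma prod_merge':
  "\<lbrakk>f' \<in> Arr B; into B (Dom B f') f; g' \<in> Arr B; into B (Dom B g') g; S (Dom B f) = T (Dom B g);
     into B (Dom B f \<star> Dom B g) r; S (Dom B f') = T (Dom B g')\<rbrakk> \<Longrightarrow>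
     (f' \<diamondop> g') \<cdot> (f \<diamondop> g) \<cdot> r = ((f' \<cdot> f) \<diamondop> (g' \<cdot> g)) \<cdot> r"
  by (rule B.reassoc[OF prod_merge]) (auto simp: into_def Arr_prod Dom_prod Cod_prod)

lemmas ord_simps = ord_typing B.assoc_Cmp B.Idn_left B.Idn_right C.assoc_Cmp C.Idn_left C.Idn_right
  L_merge L_Idn R_Idn prod_merge prod_merge' prod_Idn

lemma \<eta>_natural: "\<lbrakk>f \<in> Arr B; Cod B f = b\<rbrakk> \<Longrightarrow> \<eta> b \<cdot> f = R (L f) \<cdot> \<eta> (Dom B f)"
  using \<eta>_nat[of f "Dom B f" b] by (simp add: Hom_def)

lemma \<epsilon>_natural: "\<lbrakk>h \<in> Arr C; Cod C h = d\<rbrakk> \<Longrightarrow> \<epsilon> d \<cdot>\<^bsub>C\<^esub> L (R h) = h \<cdot>\<^bsub>C\<^esub> \<epsilon> (Dom C h)"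
  using \<epsilon>_nat[of h "Dom C h" d] by (simp add: Hom_def)

lemma \<alpha>_natural:
  "\<lbrakk>f \<in> Arr B; g \<in> Arr B; h \<in> Arr B; Cod B f = a; Cod B g = b; Cod B h = c;
    S (Dom B f) = T (Dom B g); S (Dom B g) = T (Dom B h)\<rbrakk> \<Longrightarrow>
   \<alpha> a b c \<cdot> ((f \<diamondop> g) \<diamondop> h) = (f \<diamondop> g \<diamondop> h) \<cdot> \<alpha> (Dom B f) (Dom B g) (Dom B h)"
  using \<alpha>_nat[of f "Dom B f" a g "Dom B g" b h "Dom B h" c] by (simp add: Hom_def)

lemma \<upsilon>_natural: "\<lbrakk>f \<in> Arr B; Cod B f = b; T (Dom B f) = x\<rbrakk> \<Longrightarrow> \<upsilon> b \<cdot> (\<one> (U x) \<diamondop> f) = f \<cdot> \<upsilon> (Dom B f)"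
  using \<upsilon>_nat[of f "Dom B f" b] by (simp add: Hom_def)

lemma \<rho>_natural: "\<lbrakk>f \<in> Arr B; Cod B f = b; S (Dom B f) = x\<rbrakk> \<Longrightarrow> \<rho> b \<cdot> (f \<diamondop> \<one> (U x)) = f \<cdot> \<rho> (Dom B f)"
  using \<rho>_nat[of f "Dom B f" b] by (simp add: Hom_def)

lemma iso_L:
  assumes "iso B f"
  shows "iso C (L f)"
  by (rule C.isoI[of _ "Lo (Dom B f)" "Lo (Cod B f)" "L (inv_arr B f)"])
    (use assms in \<open>auto intro!: HomI simp: B.inv_simps ord_simps\<close>)

lemma iso_R:
  assumes "iso C f"
  shows "iso B (R f)"
  by (rule B.isoI[of _ "Ro (Dom C f)" "Ro (Cod C f)" "R (inv_arr C f)"])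
    (use assms in \<open>auto intro!: HomI simp: C.inv_simps ord_simps R_merge\<close>)

lemma iso_prod:
  assumes "iso B f" "iso B g" "S (Dom B f) = T (Dom B g)"
  shows "iso B (f \<diamondop> g)"
proof -
  have "S (Cod B f) = T (Cod B g)" using assms by (simp add: S_Cod T_Cod B.iso_Arr)
  then show ?thesis
    by (intro B.isoI[of _ "Dom B f \<star> Dom B g" "Cod B f \<star> Cod B g" "inv_arr B f \<diamondop> inv_arr B g"])
      (use assms in \<open>auto intro!: HomI simp: B.inv_simps ord_simps\<close>)
qed

text \<open>Fullness provides an arrow \<open>h\<close> lying over the unit at \<open>Ro c\<close>.
  That it is a right inverse is checked after applying the faithful \<open>R\<close>; that it is a
  left inverse follows from naturality of \<open>\<epsilon>\<close> at \<open>h\<close> and the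
  other triangle identity.\<close>

lemma iso_\<epsilon>:
  assumes c: "c \<in> Ob C"
  shows "iso C (\<epsilon> c)"
proof -
  obtain h where h: "h \<in> Hom C c (Lo (Ro c))" "R h = \<eta> (Ro c)"
    using R_full[of c "Lo (Ro c)" "\<eta> (Ro c)"] c by (auto simp: ord_typing \<eta>_in)
  note h' = HomD[OF h(1)]
  have 1: "\<epsilon> c \<cdot>\<^bsub>C\<^esub> h = \<one>\<^bsub>C\<^esub> c"
    by (rule R_faithful[of _ c c])
      (use c h h' in \<open>auto intro!: HomI simp: ord_simps R_merge[symmetric] R_\<epsilon>_\<eta>\<close>)
  have "h \<cdot>\<^bsub>C\<^esub> \<epsilon> c = \<epsilon> (Lo (Ro c)) \<cdot>\<^bsub>C\<^esub> L (R h)"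
    using c h' by (simp add: \<epsilon>_natural)
  also have "\<dots> = \<one>\<^bsub>C\<^esub> (Lo (Ro c))"
    using c h(2) by (simp add: \<epsilon>_L_\<eta> ord_typing)
  finally show ?thesis
    using c h(1) 1 by (intro C.isoI[of _ "Lo (Ro c)" c h]) (auto simp: \<epsilon>_in)
qed

lemma iso_\<eta>_R:
  assumes c: "c \<in> Ob C"
  shows "iso B (\<eta> (Ro c))"
  by (rule B.iso_cancel_left[OF iso_R[OF iso_\<epsilon>[OF c]]])
    (use c in \<open>simp_all add: R_\<epsilon>_\<eta> B.iso_Idn ord_typing\<close>)

text \<open>At a reflected object the unit is itself invertible, so there its whiskerings cause no
  loss. Using the hypothesis at \<open>Ro (Lo a)\<close> and \<open>b\<close> shows that
  \<open>L\<close> inverts \<open>\<one> \<diamondop> \<eta> b\<close> over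
  \<open>Ro (Lo a)\<close>; this map cancels from the hypothesis at \<open>a\<close> and
  \<open>b\<close> and leaves \<open>\<eta> a \<diamondop> \<one>\<close>. The other half is
  symmetric.\<close>

lemma iso_whisker:
  assumes iso: "\<And>a b. \<lbrakk>a \<in> Ob B; b \<in> Ob B; S a = T b\<rbrakk> \<Longrightarrow> iso C (L (\<eta> a \<diamondop> \<eta> b))"
    and ab: "a \<in> Ob B" "b \<in> Ob B" "S a = T b"
  shows "iso C (L (\<eta> a \<diamondop> \<one> b))" "iso C (L (\<one> a \<diamondop> \<eta> b))"
proof -
  have i: "iso C (L (\<eta> (Ro (Lo a)) \<diamondop> \<one> (Ro (Lo b))))" "iso C (L (\<one> (Ro (Lo a)) \<diamondop> \<eta> (Ro (Lo b))))"
    using ab by (intro iso_L iso_prod iso_\<eta>_R B.iso_Idn; simp add: ord_typing)+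
  have "L (\<eta> (Ro (Lo a)) \<diamondop> \<one> (Ro (Lo b))) \<cdot>\<^bsub>C\<^esub> L (\<one> (Ro (Lo a)) \<diamondop> \<eta> b) = L (\<eta> (Ro (Lo a)) \<diamondop> \<eta> b)"
    using ab by (simp add: ord_simps)
  then have 1: "iso C (L (\<one> (Ro (Lo a)) \<diamondop> \<eta> b))"
    using ab by - (rule C.iso_cancel_left[OF i(1)], auto simp: ord_typing intro!: iso)
  have "L (\<one> (Ro (Lo a)) \<diamondop> \<eta> b) \<cdot>\<^bsub>C\<^esub> L (\<eta> a \<diamondop> \<one> b) = L (\<eta> a \<diamondop> \<eta> b)"
    using ab by (simp add: ord_simps)
  then show "iso C (L (\<eta> a \<diamondop> \<one> b))"
    using ab 1 by - (rule C.iso_cancel_left[OF 1], auto simp: ord_typing intro!: iso)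
  have "L (\<one> (Ro (Lo a)) \<diamondop> \<eta> (Ro (Lo b))) \<cdot>\<^bsub>C\<^esub> L (\<eta> a \<diamondop> \<one> (Ro (Lo b))) = L (\<eta> a \<diamondop> \<eta> (Ro (Lo b)))"
    using ab by (simp add: ord_simps)
  then have 2: "iso C (L (\<eta> a \<diamondop> \<one> (Ro (Lo b))))"
    using ab by - (rule C.iso_cancel_left[OF i(2)], auto simp: ord_typing intro!: iso)
  have "L (\<eta> a \<diamondop> \<one> (Ro (Lo b))) \<cdot>\<^bsub>C\<^esub> L (\<one> a \<diamondop> \<eta> b) = L (\<eta> a \<diamondop> \<eta> b)"
    using ab by (simp add: ord_simps)
  then show "iso C (L (\<one> a \<diamondop> \<eta> b))"
    using ab 2 by - (rule C.iso_cancel_left[OF 2], auto simp: ord_typing intro!: iso)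
qed

end

locale compatible_reflection = local_reflection +
  assumes iso_left: "\<lbrakk>a \<in> Ob B; b \<in> Ob B; S a = T b\<rbrakk> \<Longrightarrow> iso C (L (\<eta> a \<diamondop> \<one> b))"
    and iso_right: "\<lbrakk>a \<in> Ob B; b \<in> Ob B; S a = T b\<rbrakk> \<Longrightarrow> iso C (L (\<one> a \<diamondop> \<eta> b))"
begin

section \<open>Constraints and comparison cells of the reflected product\<close>

definition tens where "tens c d = Lo (Ro c \<star> Ro d)"

definition tens_arr where "tens_arr h k = L (R h \<diamondop> R k)"

definition \<alpha>\<^sub>C where
  "\<alpha>\<^sub>C c d e = L ((\<one> (Ro c) \<diamondop> \<eta> (Ro d \<star> Ro e)) \<cdot> \<alpha> (Ro c) (Ro d) (Ro e)) \<cdot>\<^bsub>C\<^esub>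
     inv_arr C (L (\<eta> (Ro c \<star> Ro d) \<diamondop> \<one> (Ro e)))"

definition \<upsilon>\<^sub>C where
  "\<upsilon>\<^sub>C c = \<epsilon> c \<cdot>\<^bsub>C\<^esub> L (\<upsilon> (Ro c)) \<cdot>\<^bsub>C\<^esub> inv_arr C (L (\<eta> (U (T (Ro c))) \<diamondop> \<one> (Ro c)))"

definition \<rho>\<^sub>C where
  "\<rho>\<^sub>C c = \<epsilon> c \<cdot>\<^bsub>C\<^esub> L (\<rho> (Ro c)) \<cdot>\<^bsub>C\<^esub> inv_arr C (L (\<one> (Ro c) \<diamondop> \<eta> (U (S (Ro c)))))"

text \<open>A lax comparison has to run from the product of the reflections to the reflection of the
  product, against the direction of the unit; hence the inverse.\<close>

definition \<phi> where
  "\<phi> a b = inv_arr C (L (\<eta> a \<diamondop> \<eta> b))"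

lemma iso_both:
  assumes "a \<in> Ob B" "b \<in> Ob B" "S a = T b"
  shows "iso C (L (\<eta> a \<diamondop> \<eta> b))"
proof -
  have "L (\<eta> a \<diamondop> \<one> (Ro (Lo b))) \<cdot>\<^bsub>C\<^esub> L (\<one> a \<diamondop> \<eta> b) = L (\<eta> a \<diamondop> \<eta> b)"
    using assms by (simp add: ord_simps)
  moreover have "iso C (L (\<eta> a \<diamondop> \<one> (Ro (Lo b))) \<cdot>\<^bsub>C\<^esub> L (\<one> a \<diamondop> \<eta> b))"
    using assms by (intro C.iso_Cmp iso_left iso_right) (auto simp: ord_typing)
  ultimately show ?thesis by simp
qed

text \<open>The cells cancelled in the coherence proofs contain nested units. Since
  \<open>\<eta> \<cdot> u = R (L u) \<cdot> \<eta>\<close>, such a cell differs from one with a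
  single unit by a whiskering of the invertible \<open>R (L u)\<close>.\<close>

lemma iso_lift:
  assumes u: "u \<in> Arr B" "iso C (L u)" and v: "v \<in> Arr B" "S (Dom B u) = T (Dom B v)"
    and iso: "iso C (L (\<eta> (Dom B u) \<diamondop> v))"
  shows "iso C (L ((\<eta> (Cod B u) \<cdot> u) \<diamondop> v))"
proof -
  have "L (R (L u) \<diamondop> \<one> (Cod B v)) \<cdot>\<^bsub>C\<^esub> L (\<eta> (Dom B u) \<diamondop> v) = L ((\<eta> (Cod B u) \<cdot> u) \<diamondop> v)"
    using u v by (simp add: ord_simps \<eta>_natural T_Cod)
  moreover have "iso C (L (R (L u) \<diamondop> \<one> (Cod B v)))"
    by (rule iso_L[OF iso_prod[OF iso_R[OF u(2)] B.iso_Idn]]) (use u v in \<open>simp_all add: ord_typing T_Cod\<close>)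
  then have "iso C (L (R (L u) \<diamondop> \<one> (Cod B v)) \<cdot>\<^bsub>C\<^esub> L (\<eta> (Dom B u) \<diamondop> v))"
    by (rule C.iso_Cmp[OF _ iso]) (use u v in \<open>simp add: ord_typing T_Cod\<close>)
  ultimately show ?thesis by simp
qed

context
  fixes c d e
  assumes cde: "c \<in> Ob C" "d \<in> Ob C" "e \<in> Ob C" "S (Ro c) = T (Ro d)" "S (Ro d) = T (Ro e)"
begin

lemma \<alpha>\<^sub>C_in: "\<alpha>\<^sub>C c d e \<in> Hom C (tens (tens c d) e) (tens c (tens d e))"
  using cde iso_left[of "Ro c \<star> Ro d" "Ro e"]
  by (auto intro!: HomI simp: \<alpha>\<^sub>C_def tens_def ord_typing C.inv_simps)

text \<open>The defining equation of the associator with arrows \<open>u\<close> and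
  \<open>v\<close> already absorbed, because in a coherence calculation the units occur merged with
  further cells under one \<open>L\<close>.\<close>

lemma \<alpha>\<^sub>C_\<eta>:
  assumes "u \<in> Arr B" "Cod B u = Ro c \<star> Ro d" "v \<in> Arr B" "Cod B v = Ro e" "S (Dom B u) = T (Dom B v)"
  shows "\<alpha>\<^sub>C c d e \<cdot>\<^bsub>C\<^esub> L ((\<eta> (Ro c \<star> Ro d) \<cdot> u) \<diamondop> v) =
    L ((\<one> (Ro c) \<diamondop> \<eta> (Ro d \<star> Ro e)) \<cdot> \<alpha> (Ro c) (Ro d) (Ro e) \<cdot> (u \<diamondop> v))"
proof -
  have eq: "L ((\<eta> (Ro c \<star> Ro d) \<cdot> u) \<diamondop> v) = L (\<eta> (Ro c \<star> Ro d) \<diamondop> \<one> (Ro e)) \<cdot>\<^bsub>C\<^esub> L (u \<diamondop> v)"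
    using cde assms by (simp add: ord_simps)
  show ?thesis
    unfolding eq \<alpha>\<^sub>C_def using cde assms iso_left[of "Ro c \<star> Ro d" "Ro e"]
    by (simp add: ord_typing C.inv_simps C.assoc_Cmp) (simp add: ord_typing B.assoc_Cmp L_merge)
qed

lemma \<alpha>\<^sub>C_left: "\<alpha>\<^sub>C c d e \<cdot>\<^bsub>C\<^esub> L (\<eta> (Ro c \<star> Ro d) \<diamondop> \<one> (Ro e)) =
      L (\<one> (Ro c) \<diamondop> \<eta> (Ro d \<star> Ro e)) \<cdot>\<^bsub>C\<^esub> L (\<alpha> (Ro c) (Ro d) (Ro e))"
  using \<alpha>\<^sub>C_\<eta>[of "\<one> (Ro c \<star> Ro d)" "\<one> (Ro e)"] cde by (simp add: ord_simps)

text \<open>In the pentagon an associator of \<open>C\<close> also occurs as a factor of a product,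
  hence under \<open>R\<close>. Naturality of the unit,
  \<open>\<eta> \<cdot> f = R (L f) \<cdot> \<eta>\<close>, reads off its effect there from its
  effect under \<open>L\<close>.\<close>

lemma R_\<alpha>\<^sub>C:
  "R (\<alpha>\<^sub>C c d e) \<cdot> \<eta> (Ro (Lo (Ro c \<star> Ro d)) \<star> Ro e) \<cdot> (\<eta> (Ro c \<star> Ro d) \<diamondop> \<one> (Ro e)) =
    \<eta> (Ro c \<star> Ro (Lo (Ro d \<star> Ro e))) \<cdot> (\<one> (Ro c) \<diamondop> \<eta> (Ro d \<star> Ro e)) \<cdot> \<alpha> (Ro c) (Ro d) (Ro e)"
proof -
  note a = HomD[OF \<alpha>\<^sub>C_in, unfolded tens_def]
  have *: "\<alpha>\<^sub>C c d e \<cdot>\<^bsub>C\<^esub> L (\<eta> (Ro c \<star> Ro d) \<diamondop> \<one> (Ro e)) =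
      L ((\<one> (Ro c) \<diamondop> \<eta> (Ro d \<star> Ro e)) \<cdot> \<alpha> (Ro c) (Ro d) (Ro e))"
    using \<alpha>\<^sub>C_left cde by (simp add: ord_typing L_merge)
  have "R (\<alpha>\<^sub>C c d e) \<cdot> (\<eta> (Ro (Lo (Ro c \<star> Ro d)) \<star> Ro e) \<cdot> (\<eta> (Ro c \<star> Ro d) \<diamondop> \<one> (Ro e))) =
      R (\<alpha>\<^sub>C c d e \<cdot>\<^bsub>C\<^esub> L (\<eta> (Ro c \<star> Ro d) \<diamondop> \<one> (Ro e))) \<cdot> \<eta> ((Ro c \<star> Ro d) \<star> Ro e)"
    using cde a by (subst \<eta>_natural) (simp_all add: ord_typing R_merge[symmetric] B.assoc_Cmp)
  also have "\<dots> = \<eta> (Ro c \<star> Ro (Lo (Ro d \<star> Ro e))) \<cdot> (\<one> (Ro c) \<diamondop> \<eta> (Ro d \<star> Ro e)) \<cdot> \<alpha> (Ro c) (Ro d) (Ro e)"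
    unfolding * using cde by (subst \<eta>_natural) (simp_all add: ord_typing)
  finally show ?thesis using cde a by (simp add: ord_typing B.assoc_Cmp)
qed

lemma iso_\<alpha>\<^sub>C: "iso C (\<alpha>\<^sub>C c d e)"
proof -
  have "iso C (L (\<one> (Ro c) \<diamondop> \<eta> (Ro d \<star> Ro e)) \<cdot>\<^bsub>C\<^esub> L (\<alpha> (Ro c) (Ro d) (Ro e)))"
    using cde by (intro C.iso_Cmp iso_right iso_L[OF \<alpha>_iso]) (simp_all add: ord_typing)
  then have "iso C (L ((\<one> (Ro c) \<diamondop> \<eta> (Ro d \<star> Ro e)) \<cdot> \<alpha> (Ro c) (Ro d) (Ro e)))"
    using cde by (simp add: ord_typing L_merge)
  then show ?thesis
    unfolding \<alpha>\<^sub>C_def using cde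
    by (intro C.iso_Cmp C.iso_inv iso_left) (simp_all add: ord_typing C.inv_simps iso_left)
qed

end

context
  fixes c
  assumes c: "c \<in> Ob C"
begin

lemma \<upsilon>\<^sub>C_in: "\<upsilon>\<^sub>C c \<in> Hom C (tens (Lo (U (T (Ro c)))) c) c"
  using c iso_left[of "U (T (Ro c))" "Ro c"]
  by (auto intro!: HomI simp: \<upsilon>\<^sub>C_def tens_def ord_typing C.inv_simps)

lemma \<rho>\<^sub>C_in: "\<rho>\<^sub>C c \<in> Hom C (tens c (Lo (U (S (Ro c))))) c"
  using c iso_right[of "Ro c" "U (S (Ro c))"]
  by (auto intro!: HomI simp: \<rho>\<^sub>C_def tens_def ord_typing C.inv_simps)

lemma \<upsilon>\<^sub>C_\<eta>: "\<upsilon>\<^sub>C c \<cdot>\<^bsub>C\<^esub> L (\<eta> (U (T (Ro c))) \<diamondop> \<one> (Ro c)) = \<epsilon> c \<cdot>\<^bsub>C\<^esub> L (\<upsilon> (Ro c))"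
  using c iso_left[of "U (T (Ro c))" "Ro c"]
  by (simp add: \<upsilon>\<^sub>C_def ord_typing C.inv_simps C.assoc_Cmp C.Idn_right)

lemma \<rho>\<^sub>C_\<eta>: "\<rho>\<^sub>C c \<cdot>\<^bsub>C\<^esub> L (\<one> (Ro c) \<diamondop> \<eta> (U (S (Ro c)))) = \<epsilon> c \<cdot>\<^bsub>C\<^esub> L (\<rho> (Ro c))"
  using c iso_right[of "Ro c" "U (S (Ro c))"]
  by (simp add: \<rho>\<^sub>C_def ord_typing C.inv_simps C.assoc_Cmp C.Idn_right)

lemma R_\<epsilon>_cancel: "\<lbrakk>f \<in> Arr B; Cod B f = Ro c\<rbrakk> \<Longrightarrow> R (\<epsilon> c) \<cdot> \<eta> (Ro c) \<cdot> f = f"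
  using c by (subst B.reassoc[OF R_\<epsilon>_\<eta>]) (auto simp: ord_simps)

text \<open>The counit built into \<open>\<upsilon>\<^sub>C\<close> meets the unit produced by
  naturality, and the triangle identity removes both; under the embedding only the unit constraint
  of \<open>B\<close> is left.\<close>

lemma R_\<upsilon>\<^sub>C: "R (\<upsilon>\<^sub>C c) \<cdot> \<eta> (Ro (Lo (U (T (Ro c)))) \<star> Ro c) \<cdot> (\<eta> (U (T (Ro c))) \<diamondop> \<one> (Ro c)) = \<upsilon> (Ro c)"
proof -
  note a = HomD[OF \<upsilon>\<^sub>C_in, unfolded tens_def]
  have "R (\<upsilon>\<^sub>C c) \<cdot> (\<eta> (Ro (Lo (U (T (Ro c)))) \<star> Ro c) \<cdot> (\<eta> (U (T (Ro c))) \<diamondop> \<one> (Ro c))) =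
      R (\<upsilon>\<^sub>C c \<cdot>\<^bsub>C\<^esub> L (\<eta> (U (T (Ro c))) \<diamondop> \<one> (Ro c))) \<cdot> \<eta> (U (T (Ro c)) \<star> Ro c)"
    using c a by (subst \<eta>_natural) (simp_all add: ord_typing R_merge[symmetric] B.assoc_Cmp)
  also have "\<dots> = R (\<epsilon> c) \<cdot> \<eta> (Ro c) \<cdot> \<upsilon> (Ro c)"
    unfolding \<upsilon>\<^sub>C_\<eta> using c by (simp add: ord_typing R_merge[symmetric] B.assoc_Cmp \<eta>_natural)
  also have "\<dots> = \<upsilon> (Ro c)" using c by (simp add: R_\<epsilon>_cancel ord_typing)
  finally show ?thesis using c a by (simp add: ord_typing B.assoc_Cmp)
qed

lemma R_\<rho>\<^sub>C: "R (\<rho>\<^sub>C c) \<cdot> \<eta> (Ro c \<star> Ro (Lo (U (S (Ro c))))) \<cdot> (\<one> (Ro c) \<diamondop> \<eta> (U (S (Ro c)))) = \<rho> (Ro c)"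
proof -
  note a = HomD[OF \<rho>\<^sub>C_in, unfolded tens_def]
  have "R (\<rho>\<^sub>C c) \<cdot> (\<eta> (Ro c \<star> Ro (Lo (U (S (Ro c))))) \<cdot> (\<one> (Ro c) \<diamondop> \<eta> (U (S (Ro c))))) =
      R (\<rho>\<^sub>C c \<cdot>\<^bsub>C\<^esub> L (\<one> (Ro c) \<diamondop> \<eta> (U (S (Ro c))))) \<cdot> \<eta> (Ro c \<star> U (S (Ro c)))"
    using c a by (subst \<eta>_natural) (simp_all add: ord_typing R_merge[symmetric] B.assoc_Cmp)
  also have "\<dots> = R (\<epsilon> c) \<cdot> \<eta> (Ro c) \<cdot> \<rho> (Ro c)"
    unfolding \<rho>\<^sub>C_\<eta> using c by (simp add: ord_typing R_merge[symmetric] B.assoc_Cmp \<eta>_natural)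
  also have "\<dots> = \<rho> (Ro c)" using c by (simp add: R_\<epsilon>_cancel ord_typing)
  finally show ?thesis using c a by (simp add: ord_typing B.assoc_Cmp)
qed

lemma iso_\<upsilon>\<^sub>C: "iso C (\<upsilon>\<^sub>C c)"
  unfolding \<upsilon>\<^sub>C_def using c iso_left[of "U (T (Ro c))" "Ro c"]
  by (intro C.iso_Cmp[OF iso_\<epsilon> C.iso_Cmp[OF iso_L[OF \<upsilon>_iso] C.iso_inv]]) (auto simp: ord_typing C.inv_simps)

lemma iso_\<rho>\<^sub>C: "iso C (\<rho>\<^sub>C c)"
  unfolding \<rho>\<^sub>C_def using c iso_right[of "Ro c" "U (S (Ro c))"]
  by (intro C.iso_Cmp[OF iso_\<epsilon> C.iso_Cmp[OF iso_L[OF \<rho>_iso] C.iso_inv]]) (auto simp: ord_typing C.inv_simps)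

end

text \<open>Both sides start at a product bracketed to the left with reflections inside. Once the
  invertible \<open>L ?s\<close> is put in front, each associator of \<open>C\<close> turns into one
  of \<open>B\<close> followed by units further to the right. Both paths end with the same units,
  and what precedes them is the pentagon of \<open>B\<close>.\<close>

lemma pentagon\<^sub>C:
  assumes "a \<in> Ob C" "b \<in> Ob C" "c \<in> Ob C" "d \<in> Ob C"
    and "S (Ro a) = T (Ro b)" "S (Ro b) = T (Ro c)" "S (Ro c) = T (Ro d)"
  shows "\<alpha>\<^sub>C a b (tens c d) \<cdot>\<^bsub>C\<^esub> \<alpha>\<^sub>C (tens a b) c d =
    tens_arr (\<one>\<^bsub>C\<^esub> a) (\<alpha>\<^sub>C b c d) \<cdot>\<^bsub>C\<^esub> \<alpha>\<^sub>C a (tens b c) d \<cdot>\<^bsub>C\<^esub> tens_arr (\<alpha>\<^sub>C a b c) (\<one>\<^bsub>C\<^esub> d)"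
proof -
  let ?a = "Ro a" and ?b = "Ro b" and ?c = "Ro c" and ?d = "Ro d"
  \<comment> \<open>The path from the unreflected threefold product into the common source: a unit
    at the product of \<open>?a\<close> and \<open>?b\<close>, then one at the product of its
    reflection with \<open>?c\<close>. \<open>L\<close> inverts it by
    \<open>iso_lift\<close>.\<close>
  let ?s = "(\<eta> (Ro (Lo (?a \<star> ?b)) \<star> ?c) \<cdot> (\<eta> (?a \<star> ?b) \<diamondop> \<one> ?c)) \<diamondop> \<one> ?d"
  note al = HomD[OF \<alpha>\<^sub>C_in, unfolded tens_def]
  have ob: "tens a b \<in> Ob C" "tens b c \<in> Ob C" "tens c d \<in> Ob C"
    using assms by (simp_all add: tens_def ord_typing)
  have s: "iso C (L ?s)"
    using assms iso_lift[of "\<eta> (?a \<star> ?b) \<diamondop> \<one> ?c" "\<one> ?d"]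
    by (simp add: ord_typing iso_left)
  have l1: "\<alpha>\<^sub>C (tens a b) c d \<cdot>\<^bsub>C\<^esub> L ?s = L ((\<eta> (?a \<star> ?b) \<diamondop> \<eta> (?c \<star> ?d)) \<cdot> \<alpha> (?a \<star> ?b) ?c ?d)"
    using assms ob by (simp add: tens_def \<alpha>\<^sub>C_\<eta> ord_simps \<alpha>_natural)
  have "\<alpha>\<^sub>C a b (tens c d) \<cdot>\<^bsub>C\<^esub> L (\<eta> (?a \<star> ?b) \<diamondop> \<eta> (?c \<star> ?d)) =
      L ((\<one> ?a \<diamondop> (\<eta> (?b \<star> Ro (Lo (?c \<star> ?d))) \<cdot> (\<one> ?b \<diamondop> \<eta> (?c \<star> ?d)))) \<cdot> \<alpha> ?a ?b (?c \<star> ?d))"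
    using assms ob \<alpha>\<^sub>C_\<eta>[of a b "tens c d" "\<one> (?a \<star> ?b)" "\<eta> (?c \<star> ?d)"]
      \<alpha>_natural[of "\<one> ?a" "\<one> ?b" "\<eta> (?c \<star> ?d)" ?a ?b "Ro (Lo (?c \<star> ?d))"]
    by (simp add: tens_def ord_simps)
  note l2 = C.reassoc[OF this]
  have lhs: "(\<alpha>\<^sub>C a b (tens c d) \<cdot>\<^bsub>C\<^esub> \<alpha>\<^sub>C (tens a b) c d) \<cdot>\<^bsub>C\<^esub> L ?s =
      L ((\<one> ?a \<diamondop> (\<eta> (?b \<star> Ro (Lo (?c \<star> ?d))) \<cdot> (\<one> ?b \<diamondop> \<eta> (?c \<star> ?d)))) \<cdot>
        \<alpha> ?a ?b (?c \<star> ?d) \<cdot> \<alpha> (?a \<star> ?b) ?c ?d)"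
    using assms ob l1 by (simp add: tens_def ord_typing al C.assoc_Cmp B.assoc_Cmp L_merge[symmetric] l2[unfolded tens_def])
  have r1: "tens_arr (\<alpha>\<^sub>C a b c) (\<one>\<^bsub>C\<^esub> d) \<cdot>\<^bsub>C\<^esub> L ?s =
      L ((\<eta> (?a \<star> Ro (Lo (?b \<star> ?c))) \<cdot> ((\<one> ?a \<diamondop> \<eta> (?b \<star> ?c)) \<cdot> \<alpha> ?a ?b ?c)) \<diamondop> \<one> ?d)"
    using assms by (simp add: tens_arr_def ord_simps al R_\<alpha>\<^sub>C)
  have r2: "\<alpha>\<^sub>C a (tens b c) d \<cdot>\<^bsub>C\<^esub> L ((\<eta> (?a \<star> Ro (Lo (?b \<star> ?c))) \<cdot> ((\<one> ?a \<diamondop> \<eta> (?b \<star> ?c)) \<cdot> \<alpha> ?a ?b ?c)) \<diamondop> \<one> ?d) =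
      L ((\<one> ?a \<diamondop> (\<eta> (Ro (Lo (?b \<star> ?c)) \<star> ?d) \<cdot> (\<eta> (?b \<star> ?c) \<diamondop> \<one> ?d))) \<cdot> \<alpha> ?a (?b \<star> ?c) ?d \<cdot> (\<alpha> ?a ?b ?c \<diamondop> \<one> ?d))"
  proof -
    have "((\<one> ?a \<diamondop> \<eta> (?b \<star> ?c)) \<cdot> \<alpha> ?a ?b ?c) \<diamondop> \<one> ?d = ((\<one> ?a \<diamondop> \<eta> (?b \<star> ?c)) \<diamondop> \<one> ?d) \<cdot> (\<alpha> ?a ?b ?c \<diamondop> \<one> ?d)"
      using assms by (simp add: ord_simps)
    then show ?thesis
      using assms ob B.reassoc[OF \<alpha>_natural[of "\<one> ?a" "\<eta> (?b \<star> ?c)" "\<one> ?d" ?a "Ro (Lo (?b \<star> ?c))" ?d]]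
        \<alpha>\<^sub>C_\<eta>[of a "tens b c" d "(\<one> ?a \<diamondop> \<eta> (?b \<star> ?c)) \<cdot> \<alpha> ?a ?b ?c" "\<one> ?d"]
      by (simp add: tens_def ord_simps del: prod_merge)
  qed
  have r3: "tens_arr (\<one>\<^bsub>C\<^esub> a) (\<alpha>\<^sub>C b c d) \<cdot>\<^bsub>C\<^esub> L (\<one> ?a \<diamondop> (\<eta> (Ro (Lo (?b \<star> ?c)) \<star> ?d) \<cdot> (\<eta> (?b \<star> ?c) \<diamondop> \<one> ?d))) =
      L (\<one> ?a \<diamondop> (\<eta> (?b \<star> Ro (Lo (?c \<star> ?d))) \<cdot> (\<one> ?b \<diamondop> \<eta> (?c \<star> ?d)) \<cdot> \<alpha> ?b ?c ?d))"
    using assms by (simp add: tens_arr_def ord_simps al R_\<alpha>\<^sub>C)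
  have ta: "tens_arr (\<one>\<^bsub>C\<^esub> a) (\<alpha>\<^sub>C b c d) \<in> Hom C (tens a (tens (tens b c) d)) (tens a (tens b (tens c d)))"
    "tens_arr (\<alpha>\<^sub>C a b c) (\<one>\<^bsub>C\<^esub> d) \<in> Hom C (tens (tens (tens a b) c) d) (tens (tens a (tens b c)) d)"
    using assms by (auto intro!: HomI simp: tens_arr_def tens_def ord_typing al)
  note ta' = HomD[OF ta(1), unfolded tens_def] HomD[OF ta(2), unfolded tens_def]
  have "(tens_arr (\<one>\<^bsub>C\<^esub> a) (\<alpha>\<^sub>C b c d) \<cdot>\<^bsub>C\<^esub> \<alpha>\<^sub>C a (tens b c) d \<cdot>\<^bsub>C\<^esub> tens_arr (\<alpha>\<^sub>C a b c) (\<one>\<^bsub>C\<^esub> d)) \<cdot>\<^bsub>C\<^esub> L ?s =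
      tens_arr (\<one>\<^bsub>C\<^esub> a) (\<alpha>\<^sub>C b c d) \<cdot>\<^bsub>C\<^esub> L (\<one> ?a \<diamondop> (\<eta> (Ro (Lo (?b \<star> ?c)) \<star> ?d) \<cdot> (\<eta> (?b \<star> ?c) \<diamondop> \<one> ?d))) \<cdot>\<^bsub>C\<^esub>
        L (\<alpha> ?a (?b \<star> ?c) ?d \<cdot> (\<alpha> ?a ?b ?c \<diamondop> \<one> ?d))"
    using assms ob ta' r1 r2 by (simp add: tens_def ord_typing al C.assoc_Cmp L_merge)
  also have "\<dots> = L ((\<one> ?a \<diamondop> (\<eta> (?b \<star> Ro (Lo (?c \<star> ?d))) \<cdot> (\<one> ?b \<diamondop> \<eta> (?c \<star> ?d)))) \<cdot>
      (\<one> ?a \<diamondop> \<alpha> ?b ?c ?d) \<cdot> \<alpha> ?a (?b \<star> ?c) ?d \<cdot> (\<alpha> ?a ?b ?c \<diamondop> \<one> ?d))"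
    using assms ob ta' by (subst C.reassoc[OF r3]) (simp_all add: ord_simps)
  also have "\<dots> = (\<alpha>\<^sub>C a b (tens c d) \<cdot>\<^bsub>C\<^esub> \<alpha>\<^sub>C (tens a b) c d) \<cdot>\<^bsub>C\<^esub> L ?s"
    unfolding lhs using assms pentagon[of ?a ?b ?c ?d] by (simp add: ord_typing)
  finally have "(\<alpha>\<^sub>C a b (tens c d) \<cdot>\<^bsub>C\<^esub> \<alpha>\<^sub>C (tens a b) c d) \<cdot>\<^bsub>C\<^esub> L ?s =
      (tens_arr (\<one>\<^bsub>C\<^esub> a) (\<alpha>\<^sub>C b c d) \<cdot>\<^bsub>C\<^esub> \<alpha>\<^sub>C a (tens b c) d \<cdot>\<^bsub>C\<^esub> tens_arr (\<alpha>\<^sub>C a b c) (\<one>\<^bsub>C\<^esub> d)) \<cdot>\<^bsub>C\<^esub> L ?s"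
    by (rule sym)
  then show ?thesis
    by (rule C.epi_cancel[OF s]) (use assms ob ta' in \<open>auto simp: tens_def ord_typing al\<close>)
qed

lemma triangle\<^sub>C:
  assumes "a \<in> Ob C" "b \<in> Ob C" "S (Ro a) = T (Ro b)"
  shows "tens_arr (\<one>\<^bsub>C\<^esub> a) (\<upsilon>\<^sub>C b) \<cdot>\<^bsub>C\<^esub> \<alpha>\<^sub>C a (Lo (U (T (Ro b)))) b = tens_arr (\<rho>\<^sub>C a) (\<one>\<^bsub>C\<^esub> b)"
proof -
  let ?a = "Ro a" and ?b = "Ro b" and ?u = "U (T (Ro b))"
  let ?s = "(\<eta> (?a \<star> Ro (Lo ?u)) \<cdot> (\<one> ?a \<diamondop> \<eta> ?u)) \<diamondop> \<one> ?b"
  have ob: "Lo ?u \<in> Ob C" "T (Ro (Lo ?u)) = T ?b" "S (Ro (Lo ?u)) = T ?b"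
    using assms by (simp_all add: ord_typing)
  note al = HomD[OF \<alpha>\<^sub>C_in, unfolded tens_def] HomD[OF \<upsilon>\<^sub>C_in, unfolded tens_def] HomD[OF \<rho>\<^sub>C_in, unfolded tens_def]
  have s: "iso C (L ?s)"
    using assms iso_lift[of "\<one> ?a \<diamondop> \<eta> ?u" "\<one> ?b"]
    by (simp add: ord_typing iso_left iso_right)
  have a1: "\<alpha>\<^sub>C a (Lo ?u) b \<cdot>\<^bsub>C\<^esub> L ?s = L ((\<one> ?a \<diamondop> (\<eta> (Ro (Lo ?u) \<star> ?b) \<cdot> (\<eta> ?u \<diamondop> \<one> ?b))) \<cdot> \<alpha> ?a ?u ?b)"
    using assms ob by (simp add: \<alpha>\<^sub>C_\<eta> ord_simps \<alpha>_natural)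
  have "tens_arr (\<one>\<^bsub>C\<^esub> a) (\<upsilon>\<^sub>C b) \<cdot>\<^bsub>C\<^esub> L ((\<one> ?a \<diamondop> (\<eta> (Ro (Lo ?u) \<star> ?b) \<cdot> (\<eta> ?u \<diamondop> \<one> ?b))) \<cdot> \<alpha> ?a ?u ?b) =
      L ((\<one> ?a \<diamondop> \<upsilon> ?b) \<cdot> \<alpha> ?a ?u ?b)"
    using assms ob by (simp add: tens_arr_def ord_simps al R_\<upsilon>\<^sub>C)
  also have "\<dots> = tens_arr (\<rho>\<^sub>C a) (\<one>\<^bsub>C\<^esub> b) \<cdot>\<^bsub>C\<^esub> L ?s"
    using assms ob R_\<rho>\<^sub>C[of a] al(7-9)[of a] by (simp add: triangle tens_arr_def ord_simps)
  finally have "(tens_arr (\<one>\<^bsub>C\<^esub> a) (\<upsilon>\<^sub>C b) \<cdot>\<^bsub>C\<^esub> \<alpha>\<^sub>C a (Lo ?u) b) \<cdot>\<^bsub>C\<^esub> L ?s = tens_arr (\<rho>\<^sub>C a) (\<one>\<^bsub>C\<^esub> b) \<cdot>\<^bsub>C\<^esub> L ?s"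
    using assms ob a1 by (simp add: tens_arr_def ord_typing al C.assoc_Cmp)
  then show ?thesis
    by (rule C.epi_cancel[OF s]) (use assms ob al(7-9)[of a] in \<open>auto simp: tens_arr_def tens_def ord_typing al\<close>)
qed

section \<open>Coherence of the comparison cells\<close>

lemma
  assumes "a \<in> Ob B" "b \<in> Ob B" "S a = T b"
  shows \<phi>_in: "\<phi> a b \<in> Hom C (tens (Lo a) (Lo b)) (Lo (a \<star> b))"
    and \<phi>_\<eta>: "\<phi> a b \<cdot>\<^bsub>C\<^esub> L (\<eta> a \<diamondop> \<eta> b) = \<one>\<^bsub>C\<^esub> (Lo (a \<star> b))"
    and iso_\<phi>: "iso C (\<phi> a b)"
  using assms iso_both[OF assms]
  by (auto intro!: HomI C.iso_inv simp: \<phi>_def tens_def ord_typing C.inv_simps)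

lemma R_\<phi>:
  assumes "a \<in> Ob B" "b \<in> Ob B" "S a = T b"
  shows "R (\<phi> a b) \<cdot> \<eta> (Ro (Lo a) \<star> Ro (Lo b)) \<cdot> (\<eta> a \<diamondop> \<eta> b) = \<eta> (a \<star> b)"
proof -
  note a = HomD[OF \<phi>_in[OF assms], unfolded tens_def]
  have "R (\<phi> a b) \<cdot> (\<eta> (Ro (Lo a) \<star> Ro (Lo b)) \<cdot> (\<eta> a \<diamondop> \<eta> b)) =
      R (\<phi> a b \<cdot>\<^bsub>C\<^esub> L (\<eta> a \<diamondop> \<eta> b)) \<cdot> \<eta> (a \<star> b)"
    using assms a by (subst \<eta>_natural) (simp_all add: ord_typing R_merge[symmetric] B.assoc_Cmp)
  also have "\<dots> = \<eta> (a \<star> b)"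
    using assms by (simp add: \<phi>_\<eta> ord_simps)
  finally show ?thesis using assms a by (simp add: ord_typing B.assoc_Cmp)
qed

lemma \<phi>_assoc:
  assumes "a \<in> Ob B" "b \<in> Ob B" "c \<in> Ob B" "S a = T b" "S b = T c"
  shows "\<phi> a (b \<star> c) \<cdot>\<^bsub>C\<^esub> tens_arr (\<one>\<^bsub>C\<^esub> (Lo a)) (\<phi> b c) \<cdot>\<^bsub>C\<^esub> \<alpha>\<^sub>C (Lo a) (Lo b) (Lo c) =
    L (\<alpha> a b c) \<cdot>\<^bsub>C\<^esub> \<phi> (a \<star> b) c \<cdot>\<^bsub>C\<^esub> tens_arr (\<phi> a b) (\<one>\<^bsub>C\<^esub> (Lo c))"
proof -
  let ?a = "Ro (Lo a)" and ?b = "Ro (Lo b)" and ?c = "Ro (Lo c)"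
  let ?s = "(\<eta> (?a \<star> ?b) \<cdot> (\<eta> a \<diamondop> \<eta> b)) \<diamondop> \<eta> c"
  have ob: "Lo a \<in> Ob C" "Lo b \<in> Ob C" "Lo c \<in> Ob C" "S ?a = T ?b" "S ?b = T ?c"
    using assms by (simp_all add: ord_typing)
  note al = HomD[OF \<alpha>\<^sub>C_in, unfolded tens_def] HomD[OF \<phi>_in, unfolded tens_def]
  have s: "iso C (L ?s)"
    using assms iso_lift[of "\<eta> a \<diamondop> \<eta> b" "\<eta> c"] by (simp add: ord_typing iso_both)
  have 1: "\<alpha>\<^sub>C (Lo a) (Lo b) (Lo c) \<cdot>\<^bsub>C\<^esub> L ?s = L ((\<eta> a \<diamondop> (\<eta> (?b \<star> ?c) \<cdot> (\<eta> b \<diamondop> \<eta> c))) \<cdot> \<alpha> a b c)"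
    using assms ob by (simp add: \<alpha>\<^sub>C_\<eta> ord_simps \<alpha>_natural)
  have 2: "tens_arr (\<one>\<^bsub>C\<^esub> (Lo a)) (\<phi> b c) \<cdot>\<^bsub>C\<^esub> L ((\<eta> a \<diamondop> (\<eta> (?b \<star> ?c) \<cdot> (\<eta> b \<diamondop> \<eta> c))) \<cdot> \<alpha> a b c) =
      L (\<eta> a \<diamondop> \<eta> (b \<star> c)) \<cdot>\<^bsub>C\<^esub> L (\<alpha> a b c)"
    using assms by (simp add: tens_arr_def ord_simps al R_\<phi>)
  have 3: "tens_arr (\<phi> a b) (\<one>\<^bsub>C\<^esub> (Lo c)) \<cdot>\<^bsub>C\<^esub> L ?s = L (\<eta> (a \<star> b) \<diamondop> \<eta> c)"
    using assms by (simp add: tens_arr_def ord_simps al R_\<phi>)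
  have "\<phi> a (b \<star> c) \<cdot>\<^bsub>C\<^esub> L (\<eta> a \<diamondop> \<eta> (b \<star> c)) \<cdot>\<^bsub>C\<^esub> L (\<alpha> a b c) = L (\<alpha> a b c)"
    using assms by (subst C.reassoc[OF \<phi>_\<eta>]) (simp_all add: ord_typing al C.Idn_left)
  then have "(\<phi> a (b \<star> c) \<cdot>\<^bsub>C\<^esub> tens_arr (\<one>\<^bsub>C\<^esub> (Lo a)) (\<phi> b c) \<cdot>\<^bsub>C\<^esub> \<alpha>\<^sub>C (Lo a) (Lo b) (Lo c)) \<cdot>\<^bsub>C\<^esub> L ?s = L (\<alpha> a b c)"
    using assms ob 1 2 by (simp add: tens_arr_def ord_typing al C.assoc_Cmp)
  also have "\<dots> = (L (\<alpha> a b c) \<cdot>\<^bsub>C\<^esub> \<phi> (a \<star> b) c \<cdot>\<^bsub>C\<^esub> tens_arr (\<phi> a b) (\<one>\<^bsub>C\<^esub> (Lo c))) \<cdot>\<^bsub>C\<^esub> L ?s"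
    using assms ob 3 by (simp add: tens_arr_def ord_typing al C.assoc_Cmp \<phi>_\<eta> C.Idn_right)
  finally show ?thesis
    by (rule C.epi_cancel[OF s]) (use assms ob in \<open>auto simp: tens_arr_def ord_typing al\<close>)
qed

text \<open>The product of identities stands for whiskering with the comparison of units, an
  identity because the unit of \<open>C\<close> is the reflected unit of \<open>B\<close>.
  Cancelling the inverted \<open>\<eta> \<diamondop> \<eta>\<close> leaves naturality of
  \<open>\<upsilon>\<close> at \<open>\<eta> a\<close> and a triangle identity.\<close>

lemma \<phi>_lunit:
  assumes a: "a \<in> Ob B"
  shows "L (\<upsilon> a) \<cdot>\<^bsub>C\<^esub> \<phi> (U (T a)) a \<cdot>\<^bsub>C\<^esub> tens_arr (\<one>\<^bsub>C\<^esub> (Lo (U (T a)))) (\<one>\<^bsub>C\<^esub> (Lo a)) = \<upsilon>\<^sub>C (Lo a)"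
proof -
  let ?u = "U (T a)"
  have ob: "?u \<in> Ob B" "S ?u = T a" "T ?u = T a" using a by (simp_all add: ord_typing)
  note al = HomD[OF \<phi>_in, unfolded tens_def] HomD[OF \<upsilon>\<^sub>C_in, unfolded tens_def]
  have l: "\<upsilon>\<^sub>C (Lo a) \<in> Arr C" "Dom C (\<upsilon>\<^sub>C (Lo a)) = Lo (Ro (Lo ?u) \<star> Ro (Lo a))" "Cod C (\<upsilon>\<^sub>C (Lo a)) = Lo a"
    using al(4-6)[of "Lo a"] a by (simp_all add: ord_typing)
  have e: "\<upsilon>\<^sub>C (Lo a) \<cdot>\<^bsub>C\<^esub> L (\<eta> ?u \<diamondop> \<one> (Ro (Lo a))) = \<epsilon> (Lo a) \<cdot>\<^bsub>C\<^esub> L (\<upsilon> (Ro (Lo a)))"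
    using \<upsilon>\<^sub>C_\<eta>[of "Lo a"] a by (simp add: ord_typing)
  have "\<upsilon>\<^sub>C (Lo a) \<cdot>\<^bsub>C\<^esub> L (\<eta> ?u \<diamondop> \<eta> a) = \<upsilon>\<^sub>C (Lo a) \<cdot>\<^bsub>C\<^esub> L (\<eta> ?u \<diamondop> \<one> (Ro (Lo a))) \<cdot>\<^bsub>C\<^esub> L (\<one> ?u \<diamondop> \<eta> a)"
    using a ob by (simp add: ord_simps)
  also have "\<dots> = \<epsilon> (Lo a) \<cdot>\<^bsub>C\<^esub> L (\<upsilon> (Ro (Lo a)) \<cdot> (\<one> ?u \<diamondop> \<eta> a))"
    using a ob l by (subst C.reassoc[OF e]) (simp_all add: ord_typing C.assoc_Cmp L_merge)
  also have "\<dots> = \<epsilon> (Lo a) \<cdot>\<^bsub>C\<^esub> L (\<eta> a) \<cdot>\<^bsub>C\<^esub> L (\<upsilon> a)"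
    using a by (simp add: \<upsilon>_natural ord_typing L_merge)
  also have "\<dots> = L (\<upsilon> a)"
    using a by (subst C.reassoc[OF \<epsilon>_L_\<eta>]) (simp_all add: ord_typing C.Idn_left)
  finally have *: "\<upsilon>\<^sub>C (Lo a) \<cdot>\<^bsub>C\<^esub> L (\<eta> ?u \<diamondop> \<eta> a) = L (\<upsilon> a)" .
  have "L (\<upsilon> a) \<cdot>\<^bsub>C\<^esub> \<phi> ?u a = \<upsilon>\<^sub>C (Lo a)"
    by (rule C.epi_cancel[OF iso_both[of ?u a]])
      (use a ob l in \<open>auto simp: * ord_typing al C.assoc_Cmp \<phi>_\<eta> C.Idn_right\<close>)
  then show ?thesis
    using a ob by (simp add: tens_arr_def ord_simps al)
qed

lemma \<phi>_runit:
  assumes a: "a \<in> Ob B"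
  shows "L (\<rho> a) \<cdot>\<^bsub>C\<^esub> \<phi> a (U (S a)) \<cdot>\<^bsub>C\<^esub> tens_arr (\<one>\<^bsub>C\<^esub> (Lo a)) (\<one>\<^bsub>C\<^esub> (Lo (U (S a)))) = \<rho>\<^sub>C (Lo a)"
proof -
  let ?u = "U (S a)"
  have ob: "?u \<in> Ob B" "S ?u = S a" "T ?u = S a" using a by (simp_all add: ord_typing)
  note al = HomD[OF \<phi>_in, unfolded tens_def] HomD[OF \<rho>\<^sub>C_in, unfolded tens_def]
  have l: "\<rho>\<^sub>C (Lo a) \<in> Arr C" "Dom C (\<rho>\<^sub>C (Lo a)) = Lo (Ro (Lo a) \<star> Ro (Lo ?u))" "Cod C (\<rho>\<^sub>C (Lo a)) = Lo a"
    using al(4-6)[of "Lo a"] a by (simp_all add: ord_typing)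
  have e: "\<rho>\<^sub>C (Lo a) \<cdot>\<^bsub>C\<^esub> L (\<one> (Ro (Lo a)) \<diamondop> \<eta> ?u) = \<epsilon> (Lo a) \<cdot>\<^bsub>C\<^esub> L (\<rho> (Ro (Lo a)))"
    using \<rho>\<^sub>C_\<eta>[of "Lo a"] a by (simp add: ord_typing)
  have "\<rho>\<^sub>C (Lo a) \<cdot>\<^bsub>C\<^esub> L (\<eta> a \<diamondop> \<eta> ?u) = \<rho>\<^sub>C (Lo a) \<cdot>\<^bsub>C\<^esub> L (\<one> (Ro (Lo a)) \<diamondop> \<eta> ?u) \<cdot>\<^bsub>C\<^esub> L (\<eta> a \<diamondop> \<one> ?u)"
    using a ob by (simp add: ord_simps)
  also have "\<dots> = \<epsilon> (Lo a) \<cdot>\<^bsub>C\<^esub> L (\<rho> (Ro (Lo a)) \<cdot> (\<eta> a \<diamondop> \<one> ?u))"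
    using a ob l by (subst C.reassoc[OF e]) (simp_all add: ord_typing C.assoc_Cmp L_merge)
  also have "\<dots> = \<epsilon> (Lo a) \<cdot>\<^bsub>C\<^esub> L (\<eta> a) \<cdot>\<^bsub>C\<^esub> L (\<rho> a)"
    using a by (simp add: \<rho>_natural ord_typing L_merge)
  also have "\<dots> = L (\<rho> a)"
    using a by (subst C.reassoc[OF \<epsilon>_L_\<eta>]) (simp_all add: ord_typing C.Idn_left)
  finally have *: "\<rho>\<^sub>C (Lo a) \<cdot>\<^bsub>C\<^esub> L (\<eta> a \<diamondop> \<eta> ?u) = L (\<rho> a)" .
  have "L (\<rho> a) \<cdot>\<^bsub>C\<^esub> \<phi> a ?u = \<rho>\<^sub>C (Lo a)"
    by (rule C.epi_cancel[OF iso_both[of a ?u]])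
      (use a ob l in \<open>auto simp: * ord_typing al C.assoc_Cmp \<phi>_\<eta> C.Idn_right\<close>)
  then show ?thesis
    using a ob by (simp add: tens_arr_def ord_simps al)
qed

end

section \<open>Enriched reflections\<close>

context symmetric_monoidal_closed_category
begin

text \<open>The enriched square evaluated at a single cell
  \<open>\<I> \<rightarrow> X(a, b)\<close>. This is the passage to underlying categories through
  which the ordinary naturality laws of the reflection and of the constraints are obtained.\<close>

lemma vnatural_cells:
  assumes t: "vnatural V X Y F G t" and Y: "vgraph V Y" and F: "vmap V X Y F" and G: "vmap V X Y G"
    and ab: "a \<in> VOb X" "b \<in> VOb X" and f: "f \<in> cell V X a b"
  shows "cell_comp V Y (FO F a) (FO F b) (FO G b) (t b) (map_cell V F a b f) =
    cell_comp V Y (FO F a) (FO G a) (FO G b) (map_cell V G a b f) (t a)"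
proof -
  note [simp] = Arr_FM[OF F] Dom_FM[OF F] Cod_FM[OF F] vmap_FO[OF F]
    Arr_FM[OF G] Dom_FM[OF G] Cod_FM[OF G] vmap_FO[OF G]
    pp_typing[OF Y] vnatural_cell[OF t] cellD[OF f] map_cell_cell[OF F] map_cell_cell[OF G]
  have "post_comp V Y (FO F a) (FO F b) (FO G b) (t b) \<cdot> FM F a b =
      pre_comp V Y (FO G b) (FO F a) (FO G a) (t a) \<cdot> FM G a b"
    using t ab by (simp add: vnatural_iff[OF Y F G])
  from reassoc[OF this, of f]
  have "post_comp V Y (FO F a) (FO F b) (FO G b) (t b) \<cdot> map_cell V F a b f =
      pre_comp V Y (FO G b) (FO F a) (FO G a) (t a) \<cdot> map_cell V G a b f"
    using ab Y by (simp add: map_cell_def v_simps)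
  then show ?thesis
    using ab Y f by (simp add: post_cell pre_cell)
qed

text \<open>On arrows out of \<open>\<I>\<close> an invertible \<open>pre_comp\<close> is a
  bijection: orthogonality of \<open>d\<close> to \<open>f\<close> in the usual sense of unique
  extension along \<open>f\<close>.\<close>

lemma cell_factor:
  assumes X: "vgraph V X" and ob: "a \<in> VOb X" "b \<in> VOb X" "d \<in> VOb X" and f: "f \<in> cell V X a b"
    and iso: "iso V (pre_comp V X d a b f)"
  shows cell_factor_ex: "g \<in> cell V X a d \<Longrightarrow> \<exists>h\<in>cell V X b d. cell_comp V X a b d h f = g"
    and cell_factor_unique: "\<lbrakk>h \<in> cell V X b d; k \<in> cell V X b d;
      cell_comp V X a b d h f = cell_comp V X a b d k f\<rbrakk> \<Longrightarrow> h = k"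
proof -
  note t = pp_typing[OF X ob f]
  show "\<exists>h\<in>cell V X b d. cell_comp V X a b d h f = g" if g: "g \<in> cell V X a d"
  proof (rule bexI[of _ "inv_arr V (pre_comp V X d a b f) \<cdot> g"])
    show m: "inv_arr V (pre_comp V X d a b f) \<cdot> g \<in> cell V X b d"
      using cellD[OF g] iso t by (intro cellI) (simp_all add: inv_simps typing)
    show "cell_comp V X a b d (inv_arr V (pre_comp V X d a b f) \<cdot> g) f = g"
      using pre_cell[OF X ob f m] cellD[OF g] iso t by (simp add: inv_simps typing)
  qed
  show "h = k" if hk: "h \<in> cell V X b d" "k \<in> cell V X b d"
    "cell_comp V X a b d h f = cell_comp V X a b d k f"
    by (rule mono_cancel[OF iso])
      (use hk X ob f t cellD[OF hk(1)] cellD[OF hk(2)] in \<open>simp_all add: pre_cell typing\<close>)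
qed

lemma vmap_id: "vgraph V Z \<Longrightarrow> vmap V Z Z (vfun_id V Z)"
  by (rule vfunctor_vmap[OF vfunctor_id])

context
  fixes X :: "('a, 'o, 'm) vcat" and Y :: "('b, 'o, 'm) vcat" and L R \<eta> \<epsilon>
  assumes X: "vcategory V X" and Y: "vcategory V Y"
    and adj: "vadjunction V X Y L R \<eta> \<epsilon>" and ff: "fully_faithful V Y R"
begin

lemmas adj_L = vadjunction.axioms(1)[OF adj] and adj_R = vadjunction.axioms(2)[OF adj]
  and adj_unit = vadjunction.axioms(3)[OF adj] and adj_counit = vadjunction.axioms(4)[OF adj]

lemmas adj_map = vfunctor_vmap[OF adj_L] vfunctor_vmap[OF adj_R]
lemmas adj_graph = vcategory_vgraph[OF X] vcategory_vgraph[OF Y]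

lemmas adj_typing = Arr_FM[OF adj_map(1)] Dom_FM[OF adj_map(1)] Cod_FM[OF adj_map(1)] vmap_FO[OF adj_map(1)]
    Arr_FM[OF adj_map(2)] Dom_FM[OF adj_map(2)] Cod_FM[OF adj_map(2)] vmap_FO[OF adj_map(2)]
    pp_typing[OF adj_graph(1)] pp_typing[OF adj_graph(2)]
    map_cell_cell[OF adj_map(1)] map_cell_cell[OF adj_map(2)]

lemmas unit_map = vmap_id[OF adj_graph(1)] vmap_comp[OF adj_map]
lemmas counit_map = vmap_comp[OF adj_map(2,1)] vmap_id[OF adj_graph(2)]

lemma unit_cell: "a \<in> VOb X \<Longrightarrow> \<eta> a \<in> cell V X a (FO R (FO L a))"
  using vnatural_cell[OF adj_unit] by simp

lemma counit_cell: "c \<in> VOb Y \<Longrightarrow> \<epsilon> c \<in> cell V Y (FO L (FO R c)) c"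
  using vnatural_cell[OF adj_counit] by simp

lemma unit_natural:
  assumes "a \<in> VOb X" "b \<in> VOb X" "f \<in> cell V X a b"
  shows "cell_comp V X a b (FO R (FO L b)) (\<eta> b) f =
    cell_comp V X a (FO R (FO L a)) (FO R (FO L b)) (map_cell V R (FO L a) (FO L b) (map_cell V L a b f)) (\<eta> a)"
  using vnatural_cells[OF adj_unit adj_graph(1) unit_map assms] cellD[OF assms(3)] assms adj_graph
  by (simp add: map_cell_def adj_typing v_simps)

lemma counit_natural:
  assumes "a \<in> VOb Y" "b \<in> VOb Y" "f \<in> cell V Y a b"
  shows "cell_comp V Y (FO L (FO R a)) (FO L (FO R b)) b (\<epsilon> b) (map_cell V L (FO R a) (FO R b) (map_cell V R a b f)) =
    cell_comp V Y (FO L (FO R a)) a b f (\<epsilon> a)"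
  using vnatural_cells[OF adj_counit adj_graph(2) counit_map assms] cellD[OF assms(3)] assms adj_graph
  by (simp add: map_cell_def adj_typing v_simps)

text \<open>The adjunction is given by unit, counit and triangle identities, while the arguments
  need the isomorphism of hom-objects. Its inverse applies \<open>L\<close> and then composes with
  the counit; functoriality and naturality bring the two cells together, where a triangle identity
  applies.\<close>

lemma iso_transpose:
  assumes b: "b \<in> VOb X" and c: "c \<in> VOb Y"
  shows "iso V (pre_comp V X (FO R c) b (FO R (FO L b)) (\<eta> b) \<cdot> FM R (FO L b) c)"
proof (rule isoI[of _ "VHom Y (FO L b) c" "VHom X b (FO R c)"
      "post_comp V Y (FO L b) (FO L (FO R c)) c (\<epsilon> c) \<cdot> FM L b (FO R c)"])
  let ?Lb = "FO L b" and ?Rc = "FO R c"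
  note [simp] = adj_typing unit_cell counit_cell
  note xy = adj_graph
  show "pre_comp V X ?Rc b (FO R ?Lb) (\<eta> b) \<cdot> FM R ?Lb c \<in> Hom V (VHom Y ?Lb c) (VHom X b ?Rc)"
    "post_comp V Y ?Lb (FO L ?Rc) c (\<epsilon> c) \<cdot> FM L b ?Rc \<in> Hom V (VHom X b ?Rc) (VHom Y ?Lb c)"
    using b c xy by (auto intro!: HomI simp: v_typing)
  have "(post_comp V Y ?Lb (FO L ?Rc) c (\<epsilon> c) \<cdot> FM L b ?Rc) \<cdot> pre_comp V X ?Rc b (FO R ?Lb) (\<eta> b) \<cdot> FM R ?Lb c =
      post_comp V Y ?Lb (FO L ?Rc) c (\<epsilon> c) \<cdot> (FM L b ?Rc \<cdot> pre_comp V X ?Rc b (FO R ?Lb) (\<eta> b)) \<cdot> FM R ?Lb c"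
    using b c xy by (simp add: typing assoc_Cmp)
  also have "\<dots> = (post_comp V Y ?Lb (FO L ?Rc) c (\<epsilon> c) \<cdot> pre_comp V Y (FO L ?Rc) ?Lb (FO L (FO R ?Lb)) (map_cell V L b (FO R ?Lb) (\<eta> b))) \<cdot>
      FM L (FO R ?Lb) ?Rc \<cdot> FM R ?Lb c"
    using b c xy by (simp add: FM_pre[OF adj_L] typing assoc_Cmp)
  also have "\<dots> = pre_comp V Y c ?Lb (FO L (FO R ?Lb)) (map_cell V L b (FO R ?Lb) (\<eta> b)) \<cdot>
      (post_comp V Y (FO L (FO R ?Lb)) (FO L ?Rc) c (\<epsilon> c) \<cdot> FM L (FO R ?Lb) ?Rc \<cdot> FM R ?Lb c)"
    using b c xy by (simp add: post_pre[OF Y] typing assoc_Cmp)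
  \<comment> \<open>Naturality of the counit: acting by \<open>R\<close>, then by \<open>L\<close>,
    then by the counit at the target equals acting by the counit at the source.\<close>
  also have "post_comp V Y (FO L (FO R ?Lb)) (FO L ?Rc) c (\<epsilon> c) \<cdot> FM L (FO R ?Lb) ?Rc \<cdot> FM R ?Lb c =
      pre_comp V Y c (FO L (FO R ?Lb)) ?Lb (\<epsilon> ?Lb)"
    using b c xy adj_counit by (simp add: vnatural_iff[OF adj_graph(2) counit_map] v_simps)
  also have "pre_comp V Y c ?Lb (FO L (FO R ?Lb)) (map_cell V L b (FO R ?Lb) (\<eta> b)) \<cdot> \<dots> = \<one> (VHom Y ?Lb c)"
    using b c xy by (simp add: pre_cell_comp[OF Y, symmetric] vadjunction.triangle_left[OF adj] pre_VId[OF Y])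
  finally show "(post_comp V Y ?Lb (FO L ?Rc) c (\<epsilon> c) \<cdot> FM L b ?Rc) \<cdot> pre_comp V X ?Rc b (FO R ?Lb) (\<eta> b) \<cdot> FM R ?Lb c =
      \<one> (VHom Y ?Lb c)" .
  have "(pre_comp V X ?Rc b (FO R ?Lb) (\<eta> b) \<cdot> FM R ?Lb c) \<cdot> post_comp V Y ?Lb (FO L ?Rc) c (\<epsilon> c) \<cdot> FM L b ?Rc =
      pre_comp V X ?Rc b (FO R ?Lb) (\<eta> b) \<cdot> (FM R ?Lb c \<cdot> post_comp V Y ?Lb (FO L ?Rc) c (\<epsilon> c)) \<cdot> FM L b ?Rc"
    using b c xy by (simp add: typing assoc_Cmp)
  also have "\<dots> = (pre_comp V X ?Rc b (FO R ?Lb) (\<eta> b) \<cdot> post_comp V X (FO R ?Lb) (FO R (FO L ?Rc)) ?Rc (map_cell V R (FO L ?Rc) c (\<epsilon> c))) \<cdot>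
      FM R ?Lb (FO L ?Rc) \<cdot> FM L b ?Rc"
    using b c xy by (simp add: FM_post[OF adj_R] typing assoc_Cmp)
  also have "\<dots> = post_comp V X b (FO R (FO L ?Rc)) ?Rc (map_cell V R (FO L ?Rc) c (\<epsilon> c)) \<cdot>
      (pre_comp V X (FO R (FO L ?Rc)) b (FO R ?Lb) (\<eta> b) \<cdot> FM R ?Lb (FO L ?Rc) \<cdot> FM L b ?Rc)"
    using b c xy by (simp add: post_pre[OF X, symmetric] typing assoc_Cmp)
  also have "pre_comp V X (FO R (FO L ?Rc)) b (FO R ?Lb) (\<eta> b) \<cdot> FM R ?Lb (FO L ?Rc) \<cdot> FM L b ?Rc =
      post_comp V X b ?Rc (FO R (FO L ?Rc)) (\<eta> ?Rc)"
    using b c xy adj_unit by (simp add: vnatural_iff[OF adj_graph(1) unit_map] v_simps)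
  also have "post_comp V X b (FO R (FO L ?Rc)) ?Rc (map_cell V R (FO L ?Rc) c (\<epsilon> c)) \<cdot> \<dots> = \<one> (VHom X b ?Rc)"
    using b c xy by (simp add: post_cell_comp[OF X, symmetric] vadjunction.triangle_right[OF adj] post_VId[OF X])
  finally show "(pre_comp V X ?Rc b (FO R ?Lb) (\<eta> b) \<cdot> FM R ?Lb c) \<cdot> post_comp V Y ?Lb (FO L ?Rc) c (\<epsilon> c) \<cdot> FM L b ?Rc =
      \<one> (VHom X b ?Rc)" .
qed

text \<open>Transposition is the action of \<open>R\<close> followed by precomposition with the
  unit. Full faithfulness makes the first factor invertible, so the second is as well: embedded
  objects are orthogonal to every unit.\<close>

lemma iso_pre_unit:
  assumes b: "b \<in> VOb X" and c: "c \<in> VOb Y"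
  shows "iso V (pre_comp V X (FO R c) b (FO R (FO L b)) (\<eta> b))"
  by (rule iso_cancel_right[OF _ iso_transpose[OF assms]])
    (use ff b c adj_graph in \<open>simp_all add: fully_faithful_def adj_typing unit_cell\<close>)

text \<open>Transposition is natural in \<open>b\<close>, by naturality of the unit, and so forms a
  square with invertible sides between the two actions.\<close>

lemma iso_pre_L_iff:
  assumes b: "b \<in> VOb X" "b' \<in> VOb X" and c: "c \<in> VOb Y" and u: "u \<in> cell V X b b'"
  shows "iso V (pre_comp V Y c (FO L b) (FO L b') (map_cell V L b b' u)) \<longleftrightarrow>
    iso V (pre_comp V X (FO R c) b b' u)"
proof (rule iso_square[OF _ iso_transpose[OF b(1) c] iso_transpose[OF b(2) c]])
  let ?Lu = "map_cell V L b b' u" and ?Rc = "FO R c"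
  note [simp] = adj_typing unit_cell counit_cell
  note xy = adj_graph
  have "(pre_comp V X ?Rc b (FO R (FO L b)) (\<eta> b) \<cdot> FM R (FO L b) c) \<cdot> pre_comp V Y c (FO L b) (FO L b') ?Lu =
      pre_comp V X ?Rc b (FO R (FO L b)) (\<eta> b) \<cdot> pre_comp V X ?Rc (FO R (FO L b)) (FO R (FO L b')) (map_cell V R (FO L b) (FO L b') ?Lu) \<cdot> FM R (FO L b') c"
    using b c u xy by (simp add: FM_pre[OF adj_R] typing assoc_Cmp)
  also have "\<dots> = pre_comp V X ?Rc b (FO R (FO L b')) (cell_comp V X b b' (FO R (FO L b')) (\<eta> b') u) \<cdot> FM R (FO L b') c"
    using b c u xy by (simp add: unit_natural pre_cell_comp[OF X] typing assoc_Cmp)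
  also have "\<dots> = pre_comp V X ?Rc b b' u \<cdot> pre_comp V X ?Rc b' (FO R (FO L b')) (\<eta> b') \<cdot> FM R (FO L b') c"
    using b c u xy by (simp add: pre_cell_comp[OF X] typing assoc_Cmp)
  finally show "(pre_comp V X ?Rc b (FO R (FO L b)) (\<eta> b) \<cdot> FM R (FO L b) c) \<cdot> pre_comp V Y c (FO L b) (FO L b') ?Lu =
      pre_comp V X ?Rc b b' u \<cdot> pre_comp V X ?Rc b' (FO R (FO L b')) (\<eta> b') \<cdot> FM R (FO L b') c" .
qed (use b c u adj_graph in \<open>simp_all add: adj_typing unit_cell typing\<close>)

text \<open>Such a \<open>q\<close> is isomorphic to the embedded object
  \<open>FO R (FO L q)\<close>, and orthogonality is invariant under isomorphism of the object being
  mapped into.\<close>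

lemma iso_pre_unit_local:
  assumes b: "b \<in> VOb X" and q: "q \<in> VOb X" and iso: "cell_iso V X q (FO R (FO L q)) (\<eta> q)"
  shows "iso V (pre_comp V X q b (FO R (FO L b)) (\<eta> b))"
proof -
  note [simp] = adj_typing unit_cell
  note xy = adj_graph
  have "iso V (pre_comp V X q b (FO R (FO L b)) (\<eta> b)) \<longleftrightarrow>
      iso V (pre_comp V X (FO R (FO L q)) b (FO R (FO L b)) (\<eta> b))"
    by (rule iso_square[of "post_comp V X b q (FO R (FO L q)) (\<eta> q)" _ _ "post_comp V X (FO R (FO L b)) q (FO R (FO L q)) (\<eta> q)"])
      (use b q xy iso in \<open>simp_all add: post_pre[OF X] typing iso_post[OF X]\<close>)
  then show ?thesis using b q by (simp add: iso_pre_unit)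
qed

text \<open>An object orthogonal to its own unit is local: extending the identity along the unit
  gives a retraction \<open>r\<close>, and the composite in the other order is the identity because
  both restrict to the unit and extensions into embedded objects are unique.\<close>

lemma cell_iso_unit:
  assumes q: "q \<in> VOb X" and iso: "iso V (pre_comp V X q q (FO R (FO L q)) (\<eta> q))"
  shows "cell_iso V X q (FO R (FO L q)) (\<eta> q)"
proof -
  let ?q = "FO R (FO L q)"
  have ob: "?q \<in> VOb X" "FO L q \<in> VOb Y" using q by (simp_all add: adj_typing)
  note [simp] = unit_cell[OF q] VId_cell[OF adj_graph(1)]
  obtain r where r: "r \<in> cell V X ?q q" "cell_comp V X q ?q q r (\<eta> q) = VId X q"
    using cell_factor_ex[OF adj_graph(1) q ob(1) q unit_cell[OF q] iso, of "VId X q"] q by auto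
  have "cell_comp V X ?q q ?q (\<eta> q) r = VId X ?q"
  proof (rule cell_factor_unique[OF adj_graph(1) q ob(1) ob(1) unit_cell[OF q] iso_pre_unit[OF q ob(2)]])
    show "cell_comp V X q ?q ?q (cell_comp V X ?q q ?q (\<eta> q) r) (\<eta> q) =
        cell_comp V X q ?q ?q (VId X ?q) (\<eta> q)"
      using q ob r by (simp add: cell_comp_assoc[OF X] cell_comp_VId_left[OF X] cell_comp_VId_right[OF X])
  qed (use q ob r adj_graph in \<open>simp_all add: cell_comp_cell\<close>)
  then show ?thesis using r by (auto simp: cell_iso_def)
qed

end

lemma assoc_pair:
  assumes "u \<in> cell V X a a'" "v \<in> cell V Y b b'" "w \<in> cell V Z c c'"
  shows "assoc V (VHom X a a') (VHom Y b b') (VHom Z c c') \<cdot> pair_cell V (pair_cell V u v) w =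
    pair_cell V u (pair_cell V v w)"
proof -
  note t = cellD[OF assms(1)] cellD[OF assms(2)] cellD[OF assms(3)]
  have ob: "VHom X a a' \<in> Ob V" "VHom Y b b' \<in> Ob V" "VHom Z c c' \<in> Ob V"
    using t Cod_in by metis+
  have "assoc V (VHom X a a') (VHom Y b b') (VHom Z c c') \<cdot> pair_cell V (pair_cell V u v) w =
      (assoc V (VHom X a a') (VHom Y b b') (VHom Z c c') \<cdot> (u \<odot> v \<odot> w)) \<cdot> (ri \<I> \<odot> \<one> \<I>) \<cdot> li \<I>"
    using t ob by (simp add: pair_cell_def li_ri_unit mon_simps)
  also have "\<dots> = (u \<odot> (v \<odot> w)) \<cdot> (assoc V \<I> \<I> \<I> \<cdot> (ri \<I> \<odot> \<one> \<I>)) \<cdot> li \<I>"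
    using t ob by (subst assoc_natural) (simp_all add: mon_typing assoc_Cmp)
  also have "\<dots> = pair_cell V u (pair_cell V v w)"
    using t ob by (subst ri_triangle) (simp_all add: pair_cell_def mon_simps)
  finally show ?thesis .
qed

lemma braid_pair:
  assumes "u \<in> cell V X a a'" "v \<in> cell V Y b b'"
  shows "braid V (VHom X a a') (VHom Y b b') \<cdot> pair_cell V u v = pair_cell V v u"
proof -
  note t = cellD[OF assms(1)] cellD[OF assms(2)]
  have ob: "VHom X a a' \<in> Ob V" "VHom Y b b' \<in> Ob V"
    using t Cod_in by metis+
  then show ?thesis
    using t by (simp add: pair_cell_def reassoc[OF braid_natural] braid_unit_unit mon_simps)
qed

end

section \<open>Residuation in a biclosed bicategory\<close>

locale enriched_biclosed_bicategory =
  symmetric_monoidal_closed_category V + biclosed_bicategory V B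
  for V :: "('o, 'm) smc" (structure) and B :: "('x, 'b, 'o, 'm) biclosed_bicat"
begin

abbreviation "lres x y z f g h \<equiv>
  unname (VHom (BHom B x z) (hcomp B x y z f g) h) (VHom (BHom B x y) g (ldiv B x y z f h)) (LIso B x y z ((f, g), h))"

abbreviation "rres x y z f g h \<equiv>
  unname (VHom (BHom B x z) (hcomp B x y z f g) h) (VHom (BHom B y z) f (rdiv B x y z h g)) (RIso B x y z ((f, g), h))"

abbreviation "hom_of_comp x y z \<equiv> vfun_comp V (vhom V (BHom B x z))
          (vfun_tensor V (vfun_op (BCmp B x y z)) (vfun_id V (BHom B x z)))"

abbreviation "hom_to_ldiv x y z \<equiv> vfun_comp V (vhom V (BHom B x y))
          (vfun_comp V (vfun_tensor V (vfun_id V (vop V (BHom B x y))) (LDiv B x y z))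
            (vfun_comp V (vfun_assoc V (vop V (BHom B x y)) (vop V (BHom B y z)) (BHom B x z))
              (vfun_tensor V (vfun_swap V (vop V (BHom B y z)) (vop V (BHom B x y)))
                (vfun_id V (BHom B x z)))))"

abbreviation "hom_to_rdiv x y z \<equiv> vfun_comp V (vhom V (BHom B y z))
          (vfun_comp V (vfun_tensor V (vfun_id V (vop V (BHom B y z))) (RDiv B x y z))
            (vfun_comp V (vfun_tensor V (vfun_id V (vop V (BHom B y z)))
                (vfun_swap V (vop V (BHom B x y)) (BHom B x z)))
              (vfun_assoc V (vop V (BHom B y z)) (vop V (BHom B x y)) (BHom B x z))))"

abbreviation "triples x y z \<equiv>
  vtensor V (vtensor V (vop V (BHom B y z)) (vop V (BHom B x y))) (BHom B x z)"

lemma BHom_vgraph: "\<lbrakk>x \<in> BOb B; y \<in> BOb B\<rbrakk> \<Longrightarrow> vgraph V (BHom B x y)"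
  by (rule vcategory_vgraph[OF BHom_vcategory])

context
  fixes x y z
  assumes xyz: "x \<in> BOb B" "y \<in> BOb B" "z \<in> BOb B"
begin

lemmas BCmp_vmap = vfunctor_vmap[OF BCmp_vfunctor[OF xyz]]
lemmas LDiv_vmap = vfunctor_vmap[OF LDiv_vfunctor[OF xyz]]
lemmas RDiv_vmap = vfunctor_vmap[OF RDiv_vfunctor[OF xyz]]

lemma hcomp_in: "\<lbrakk>f \<in> VOb (BHom B y z); g \<in> VOb (BHom B x y)\<rbrakk> \<Longrightarrow> hcomp B x y z f g \<in> VOb (BHom B x z)"
  and ldiv_in: "\<lbrakk>f \<in> VOb (BHom B y z); h \<in> VOb (BHom B x z)\<rbrakk> \<Longrightarrow> ldiv B x y z f h \<in> VOb (BHom B x y)"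
  and rdiv_in: "\<lbrakk>h \<in> VOb (BHom B x z); g \<in> VOb (BHom B x y)\<rbrakk> \<Longrightarrow> rdiv B x y z h g \<in> VOb (BHom B y z)"
  using vmap_FO[OF BCmp_vmap] vmap_FO[OF LDiv_vmap] vmap_FO[OF RDiv_vmap] by auto

lemmas BHom_vgraphs = BHom_vgraph[OF xyz(1,2)] BHom_vgraph[OF xyz(2,3)] BHom_vgraph[OF xyz(1,3)]

lemma FM_BCmp:
  assumes "f \<in> VOb (BHom B y z)" "f' \<in> VOb (BHom B y z)" "g \<in> VOb (BHom B x y)" "g' \<in> VOb (BHom B x y)"
  shows Arr_BCmp: "FM (BCmp B x y z) (f, g) (f', g') \<in> Arr V"
    and Dom_BCmp: "Dom V (FM (BCmp B x y z) (f, g) (f', g')) = VHom (BHom B y z) f f' \<otimes> VHom (BHom B x y) g g'"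
    and Cod_BCmp: "Cod V (FM (BCmp B x y z) (f, g) (f', g')) = VHom (BHom B x z) (hcomp B x y z f g) (hcomp B x y z f' g')"
  using assms Arr_FM[OF BCmp_vmap] Dom_FM[OF BCmp_vmap] Cod_FM[OF BCmp_vmap] by auto

lemma FM_LDiv:
  assumes "f \<in> VOb (BHom B y z)" "f' \<in> VOb (BHom B y z)" "h \<in> VOb (BHom B x z)" "h' \<in> VOb (BHom B x z)"
  shows Arr_LDiv: "FM (LDiv B x y z) (f, h) (f', h') \<in> Arr V"
    and Dom_LDiv: "Dom V (FM (LDiv B x y z) (f, h) (f', h')) = VHom (BHom B y z) f' f \<otimes> VHom (BHom B x z) h h'"
    and Cod_LDiv: "Cod V (FM (LDiv B x y z) (f, h) (f', h')) = VHom (BHom B x y) (ldiv B x y z f h) (ldiv B x y z f' h')"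
  using assms Arr_FM[OF LDiv_vmap] Dom_FM[OF LDiv_vmap] Cod_FM[OF LDiv_vmap] by auto

lemma FM_RDiv:
  assumes "g \<in> VOb (BHom B x y)" "g' \<in> VOb (BHom B x y)" "h \<in> VOb (BHom B x z)" "h' \<in> VOb (BHom B x z)"
  shows Arr_RDiv: "FM (RDiv B x y z) (h, g) (h', g') \<in> Arr V"
    and Dom_RDiv: "Dom V (FM (RDiv B x y z) (h, g) (h', g')) = VHom (BHom B x z) h h' \<otimes> VHom (BHom B x y) g' g"
    and Cod_RDiv: "Cod V (FM (RDiv B x y z) (h, g) (h', g')) = VHom (BHom B y z) (rdiv B x y z h g) (rdiv B x y z h' g')"
  using assms Arr_FM[OF RDiv_vmap] Dom_FM[OF RDiv_vmap] Cod_FM[OF RDiv_vmap] by auto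

lemmas res_typing = hcomp_in ldiv_in rdiv_in Arr_BCmp Dom_BCmp Cod_BCmp Arr_LDiv Dom_LDiv Cod_LDiv
  Arr_RDiv Dom_RDiv Cod_RDiv

lemma vmap_hom_of_comp: "vmap V (triples x y z) (vself V) (hom_of_comp x y z)"
  and vmap_hom_to_ldiv: "vmap V (triples x y z) (vself V) (hom_to_ldiv x y z)"
  and vmap_hom_to_rdiv: "vmap V (triples x y z) (vself V) (hom_to_rdiv x y z)"
  using BHom_vgraphs
  by (auto simp: vmap_def res_typing v_typing HomD[OF FM_vhom_in] ihom_in intro!: HomI)

text \<open>\<open>LIso\<close> and \<open>RIso\<close> are cells of \<open>vself V\<close>. They
  are replaced by the arrows of \<open>V\<close> that they name, whose invertibility can be fed into
  \<open>iso_square\<close>.\<close>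

lemma
  shows hnatural_lres: "hnatural (triples x y z) (hom_of_comp x y z) (hom_to_ldiv x y z) (\<lambda>((f, g), h). lres x y z f g h)"
    and hnatural_rres: "hnatural (triples x y z) (hom_of_comp x y z) (hom_to_rdiv x y z) (\<lambda>((f, g), h). rres x y z f g h)"
proof -
  note L = LIso_natural[OF xyz] and R = RIso_natural[OF xyz]
  note Ln = vnatural_iso.axioms(1)[OF L] and Rn = vnatural_iso.axioms(1)[OF R]
  have l: "LIso B x y z ((f, g), h) \<in> Hom V \<I> (ihom V (VHom (BHom B x z) (hcomp B x y z f g) h) (VHom (BHom B x y) g (ldiv B x y z f h)))"
    "RIso B x y z ((f, g), h) \<in> Hom V \<I> (ihom V (VHom (BHom B x z) (hcomp B x y z f g) h) (VHom (BHom B y z) f (rdiv B x y z h g)))"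
    if "f \<in> VOb (BHom B y z)" "g \<in> VOb (BHom B x y)" "h \<in> VOb (BHom B x z)" for f g h
    using vnatural_cell[OF Ln, of "((f, g), h)"] vnatural_cell[OF Rn, of "((f, g), h)"] that by (auto simp: cell_def)
  note ob = VHom_Ob[OF BHom_vgraphs(1)] VHom_Ob[OF BHom_vgraphs(2)] VHom_Ob[OF BHom_vgraphs(3)] res_typing
  have "vnatural V (triples x y z) (vself V) (hom_of_comp x y z) (hom_to_ldiv x y z)
      (\<lambda>a. name (FO (hom_of_comp x y z) a) (FO (hom_to_ldiv x y z) a) ((\<lambda>((f, g), h). lres x y z f g h) a))"
    by (rule vnatural_cong[OF Ln]) (auto simp: name_unname[OF l(1)] ob)
  then show "hnatural (triples x y z) (hom_of_comp x y z) (hom_to_ldiv x y z) (\<lambda>((f, g), h). lres x y z f g h)"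
    by (subst (asm) vnatural_hnatural[OF vmap_hom_of_comp vmap_hom_to_ldiv]) (auto simp: unname_in[OF l(1)] ob)
  have "vnatural V (triples x y z) (vself V) (hom_of_comp x y z) (hom_to_rdiv x y z)
      (\<lambda>a. name (FO (hom_of_comp x y z) a) (FO (hom_to_rdiv x y z) a) ((\<lambda>((f, g), h). rres x y z f g h) a))"
    by (rule vnatural_cong[OF Rn]) (auto simp: name_unname[OF l(2)] ob)
  then show "hnatural (triples x y z) (hom_of_comp x y z) (hom_to_rdiv x y z) (\<lambda>((f, g), h). rres x y z f g h)"
    by (subst (asm) vnatural_hnatural[OF vmap_hom_of_comp vmap_hom_to_rdiv]) (auto simp: unname_in[OF l(2)] ob)
qed

lemma
  assumes fgh: "f \<in> VOb (BHom B y z)" "g \<in> VOb (BHom B x y)" "h \<in> VOb (BHom B x z)"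
  shows lres_in: "lres x y z f g h \<in> Hom V (VHom (BHom B x z) (hcomp B x y z f g) h) (VHom (BHom B x y) g (ldiv B x y z f h))"
    and rres_in: "rres x y z f g h \<in> Hom V (VHom (BHom B x z) (hcomp B x y z f g) h) (VHom (BHom B y z) f (rdiv B x y z h g))"
    and iso_lres: "iso V (lres x y z f g h)" and iso_rres: "iso V (rres x y z f g h)"
proof -
  show l: "lres x y z f g h \<in> Hom V (VHom (BHom B x z) (hcomp B x y z f g) h) (VHom (BHom B x y) g (ldiv B x y z f h))"
    using hnatural_in[OF hnatural_lres, of "((f, g), h)"] fgh by simp
  show r: "rres x y z f g h \<in> Hom V (VHom (BHom B x z) (hcomp B x y z f g) h) (VHom (BHom B y z) f (rdiv B x y z h g))"
    using hnatural_in[OF hnatural_rres, of "((f, g), h)"] fgh by simp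
  note ob = VHom_Ob[OF BHom_vgraphs(1)] VHom_Ob[OF BHom_vgraphs(2)] VHom_Ob[OF BHom_vgraphs(3)] res_typing
  have c: "LIso B x y z ((f, g), h) \<in> Hom V \<I> (ihom V (VHom (BHom B x z) (hcomp B x y z f g) h) (VHom (BHom B x y) g (ldiv B x y z f h)))"
    "RIso B x y z ((f, g), h) \<in> Hom V \<I> (ihom V (VHom (BHom B x z) (hcomp B x y z f g) h) (VHom (BHom B y z) f (rdiv B x y z h g)))"
    using vnatural_cell[OF vnatural_iso.axioms(1)[OF LIso_natural[OF xyz]], of "((f, g), h)"]
      vnatural_cell[OF vnatural_iso.axioms(1)[OF RIso_natural[OF xyz]], of "((f, g), h)"] fgh by (auto simp: cell_def)
  show "iso V (lres x y z f g h)"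
    using vnatural_iso.component_iso[OF LIso_natural[OF xyz], of "((f, g), h)"] fgh
    by (subst cell_iso_name[OF l, symmetric]) (simp add: name_unname[OF c(1)] ob)
  show "iso V (rres x y z f g h)"
    using vnatural_iso.component_iso[OF RIso_natural[OF xyz], of "((f, g), h)"] fgh
    by (subst cell_iso_name[OF r, symmetric]) (simp add: name_unname[OF c(2)] ob)
qed

context
  fixes f f' g g' h u v
  assumes ob: "f \<in> VOb (BHom B y z)" "f' \<in> VOb (BHom B y z)" "g \<in> VOb (BHom B x y)" "g' \<in> VOb (BHom B x y)"
      "h \<in> VOb (BHom B x z)"
    and uv: "u \<in> cell V (BHom B y z) f f'" "v \<in> cell V (BHom B x y) g g'"
begin

text \<open>Residuation is natural in three variables at once; here it is evaluated at the one cell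
  \<open>?k\<close> consisting of \<open>u\<close>, \<open>v\<close> and the identity of
  \<open>h\<close>. The facts \<open>p\<close>, \<open>q\<close> and \<open>r\<close> compute how
  the three functors between which it runs act on \<open>?k\<close>.\<close>

lemma res_natural:
  defines "fg \<equiv> hcomp B x y z f g" and "fg' \<equiv> hcomp B x y z f' g'"
  defines "c \<equiv> pre_comp V (BHom B x z) h fg fg' (map_cell2 V (BCmp B x y z) f f' g g' u v)"
  shows lres_natural: "lres x y z f g h \<cdot> c =
      (post_comp V (BHom B x y) g (ldiv B x y z f' h) (ldiv B x y z f h)
         (map_cell2 V (LDiv B x y z) f' f h h u (VId (BHom B x z) h)) \<cdot>
       pre_comp V (BHom B x y) (ldiv B x y z f' h) g g' v) \<cdot> lres x y z f' g' h"
    and rres_natural: "rres x y z f g h \<cdot> c =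
      (post_comp V (BHom B y z) f (rdiv B x y z h g') (rdiv B x y z h g)
         (map_cell2 V (RDiv B x y z) h h g' g (VId (BHom B x z) h) v) \<cdot>
       pre_comp V (BHom B y z) (rdiv B x y z h g') f f' u) \<cdot> rres x y z f' g' h"
proof -
  let ?i = "VId (BHom B x z) h"
  let ?k = "pair_cell V (pair_cell V u v) ?i"
  note XY = BHom_vgraphs
  have i: "?i \<in> cell V (BHom B x z) h h" using ob XY by (simp add: VId_cell)
  \<comment> \<open>The variables \<open>f\<close> and \<open>g\<close> are contravariant, so the
    cells are read in the opposite categories, with primed and unprimed objects exchanged.\<close>
  have uv': "u \<in> cell V (vop V (BHom B y z)) f' f" "v \<in> cell V (vop V (BHom B x y)) g' g"
    using uv by (simp_all add: cell_def)
  have uv1: "pair_cell V u v \<in> cell V (vtensor V (vop V (BHom B y z)) (vop V (BHom B x y))) (f', g') (f, g)"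
    by (rule pair_cell_cell[OF uv'])
  have k: "?k \<in> cell V (triples x y z) ((f', g'), h) ((f, g), h)"
    by (rule pair_cell_cell[OF uv1 i])
  have m: "map_cell2 V (BCmp B x y z) f f' g g' u v \<in> cell V (BHom B x z) fg fg'"
    using map_cell2_cell[OF BCmp_vmap] ob uv by (simp add: fg_def fg'_def)
  have li: "map_cell2 V (LDiv B x y z) f' f h h u ?i \<in> cell V (BHom B x y) (ldiv B x y z f' h) (ldiv B x y z f h)"
    using map_cell2_cell[OF LDiv_vmap] ob uv'(1) i by simp
  have ri: "map_cell2 V (RDiv B x y z) h h g' g ?i v \<in> cell V (BHom B y z) (rdiv B x y z h g') (rdiv B x y z h g)"
    using map_cell2_cell[OF RDiv_vmap] ob uv'(2) i by simp
  have fgob: "fg \<in> VOb (BHom B x z)" "fg' \<in> VOb (BHom B x z)" using ob by (simp_all add: fg_def fg'_def hcomp_in)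
  note t = cellD[OF uv(1)] cellD[OF uv(2)] cellD[OF i] cellD[OF m] cellD[OF li] cellD[OF ri] cellD[OF uv1] cellD[OF k]
  have p: "unname (VHom (BHom B x z) fg' h) (VHom (BHom B x z) fg h) (FM (hom_of_comp x y z) ((f', g'), h) ((f, g), h) \<cdot> ?k) = c"
  proof -
    have "FM (hom_of_comp x y z) ((f', g'), h) ((f, g), h) \<cdot> ?k =
        FM (vhom V (BHom B x z)) (fg', h) (fg, h) \<cdot> ((FM (BCmp B x y z) (f, g) (f', g') \<odot> \<one> (VHom (BHom B x z) h h)) \<cdot> ?k)"
      using ob XY t fgob by (simp add: fg_def[symmetric] fg'_def[symmetric] HomD[OF FM_vhom_in] res_typing v_typing assoc_Cmp)
    also have "\<dots> = FM (vhom V (BHom B x z)) (fg', h) (fg, h) \<cdot> pair_cell V (map_cell2 V (BCmp B x y z) f f' g g' u v) ?i"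
      using ob XY t by (subst pair_cell_tensor[OF uv1 i]) (simp_all add: res_typing v_simps map_cell2_def map_cell_def)
    finally show ?thesis
      using ob XY fgob i m by (simp add: unname_vhom c_def post_VId[OF BHom_vcategory] xyz pp_typing v_simps)
  qed
  have q: "unname (VHom (BHom B x y) g' (ldiv B x y z f' h)) (VHom (BHom B x y) g (ldiv B x y z f h))
      (FM (hom_to_ldiv x y z) ((f', g'), h) ((f, g), h) \<cdot> ?k) =
      post_comp V (BHom B x y) g (ldiv B x y z f' h) (ldiv B x y z f h) (map_cell2 V (LDiv B x y z) f' f h h u ?i) \<cdot>
       pre_comp V (BHom B x y) (ldiv B x y z f' h) g g' v"
  proof -
    have vu: "pair_cell V v u \<in> cell V (vtensor V (vop V (BHom B x y)) (vop V (BHom B y z))) (g', f') (g, f)"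
      "pair_cell V u ?i \<in> cell V (vtensor V (vop V (BHom B y z)) (BHom B x z)) (f', h) (f, h)"
      by (rule pair_cell_cell[OF uv'(2,1)], rule pair_cell_cell[OF uv'(1) i])
    note vu3 = pair_cell_cell[OF vu(1) i] and vu4 = pair_cell_cell[OF uv'(2) vu(2)]
    note t' = cellD[OF vu(1)] cellD[OF vu(2)] cellD[OF vu3] cellD[OF vu4]
    have 1: "(braid V (VHom (BHom B y z) f f') (VHom (BHom B x y) g g') \<odot> \<one> (VHom (BHom B x z) h h)) \<cdot> ?k = pair_cell V (pair_cell V v u) ?i"
      using ob XY t braid_pair[OF uv'] by (subst pair_cell_tensor[OF uv1 i]) (simp_all add: v_simps)
    have 2: "assoc V (VHom (BHom B x y) g g') (VHom (BHom B y z) f f') (VHom (BHom B x z) h h) \<cdot> pair_cell V (pair_cell V v u) ?i =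
        pair_cell V v (pair_cell V u ?i)"
      using assoc_pair[OF uv'(2,1) i] by simp
    have "FM (hom_to_ldiv x y z) ((f', g'), h) ((f, g), h) \<cdot> ?k =
        FM (vhom V (BHom B x y)) (g', ldiv B x y z f' h) (g, ldiv B x y z f h) \<cdot>
        (\<one> (VHom (BHom B x y) g g') \<odot> FM (LDiv B x y z) (f', h) (f, h)) \<cdot>
        assoc V (VHom (BHom B x y) g g') (VHom (BHom B y z) f f') (VHom (BHom B x z) h h) \<cdot>
        (braid V (VHom (BHom B y z) f f') (VHom (BHom B x y) g g') \<odot> \<one> (VHom (BHom B x z) h h)) \<cdot> ?k"
      using ob XY t by (simp add: HomD[OF FM_vhom_in] res_typing v_typing assoc_Cmp)
    also have "\<dots> = FM (vhom V (BHom B x y)) (g', ldiv B x y z f' h) (g, ldiv B x y z f h) \<cdot>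
        ((\<one> (VHom (BHom B x y) g g') \<odot> FM (LDiv B x y z) (f', h) (f, h)) \<cdot> pair_cell V v (pair_cell V u ?i))"
      by (simp only: 1 2)
    also have "\<dots> = FM (vhom V (BHom B x y)) (g', ldiv B x y z f' h) (g, ldiv B x y z f h) \<cdot>
        pair_cell V v (map_cell2 V (LDiv B x y z) f' f h h u ?i)"
      using ob XY t t' by (subst pair_cell_tensor[OF uv'(2) vu(2)]) (simp_all add: res_typing v_simps map_cell2_def map_cell_def)
    finally show ?thesis
      using ob XY uv li by (simp add: unname_vhom ldiv_in)
  qed
  have r: "unname (VHom (BHom B y z) f' (rdiv B x y z h g')) (VHom (BHom B y z) f (rdiv B x y z h g))
      (FM (hom_to_rdiv x y z) ((f', g'), h) ((f, g), h) \<cdot> ?k) =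
      post_comp V (BHom B y z) f (rdiv B x y z h g') (rdiv B x y z h g) (map_cell2 V (RDiv B x y z) h h g' g ?i v) \<cdot>
       pre_comp V (BHom B y z) (rdiv B x y z h g') f f' u"
  proof -
    have vu: "pair_cell V v ?i \<in> cell V (vtensor V (vop V (BHom B x y)) (BHom B x z)) (g', h) (g, h)"
      "pair_cell V ?i v \<in> cell V (vtensor V (BHom B x z) (vop V (BHom B x y))) (h, g') (h, g)"
      by (rule pair_cell_cell[OF uv'(2) i], rule pair_cell_cell[OF i uv'(2)])
    note vu3 = pair_cell_cell[OF uv'(1) vu(1)] and vu4 = pair_cell_cell[OF uv'(1) vu(2)]
    note t' = cellD[OF vu(1)] cellD[OF vu(2)] cellD[OF vu3] cellD[OF vu4]
    have 1: "assoc V (VHom (BHom B y z) f f') (VHom (BHom B x y) g g') (VHom (BHom B x z) h h) \<cdot> ?k = pair_cell V u (pair_cell V v ?i)"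
      using assoc_pair[OF uv' i] by simp
    have 2: "(\<one> (VHom (BHom B y z) f f') \<odot> braid V (VHom (BHom B x y) g g') (VHom (BHom B x z) h h)) \<cdot> pair_cell V u (pair_cell V v ?i) =
        pair_cell V u (pair_cell V ?i v)"
      using ob XY t t' braid_pair[OF uv'(2) i] by (subst pair_cell_tensor[OF uv'(1) vu(1)]) (simp_all add: v_simps)
    have "FM (hom_to_rdiv x y z) ((f', g'), h) ((f, g), h) \<cdot> ?k =
        FM (vhom V (BHom B y z)) (f', rdiv B x y z h g') (f, rdiv B x y z h g) \<cdot>
        (\<one> (VHom (BHom B y z) f f') \<odot> FM (RDiv B x y z) (h, g') (h, g)) \<cdot>
        (\<one> (VHom (BHom B y z) f f') \<odot> braid V (VHom (BHom B x y) g g') (VHom (BHom B x z) h h)) \<cdot>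
        assoc V (VHom (BHom B y z) f f') (VHom (BHom B x y) g g') (VHom (BHom B x z) h h) \<cdot> ?k"
      using ob XY t by (simp add: HomD[OF FM_vhom_in] res_typing v_typing assoc_Cmp)
    also have "\<dots> = FM (vhom V (BHom B y z)) (f', rdiv B x y z h g') (f, rdiv B x y z h g) \<cdot>
        ((\<one> (VHom (BHom B y z) f f') \<odot> FM (RDiv B x y z) (h, g') (h, g)) \<cdot> pair_cell V u (pair_cell V ?i v))"
      by (simp only: 1 2)
    also have "\<dots> = FM (vhom V (BHom B y z)) (f', rdiv B x y z h g') (f, rdiv B x y z h g) \<cdot>
        pair_cell V u (map_cell2 V (RDiv B x y z) h h g' g ?i v)"
      using ob XY t t' by (subst pair_cell_tensor[OF uv'(1) vu(2)]) (simp_all add: res_typing v_simps map_cell2_def map_cell_def)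
    finally show ?thesis
      using ob XY uv ri by (simp add: unname_vhom rdiv_in)
  qed
  have "((f', g'), h) \<in> VOb (triples x y z)" "((f, g), h) \<in> VOb (triples x y z)" using ob by simp_all
  note hnatural_cell[OF hnatural_lres vmap_hom_of_comp vmap_hom_to_ldiv this k]
    hnatural_cell[OF hnatural_rres vmap_hom_of_comp vmap_hom_to_rdiv this k]
  then show "lres x y z f g h \<cdot> c =
      (post_comp V (BHom B x y) g (ldiv B x y z f' h) (ldiv B x y z f h)
         (map_cell2 V (LDiv B x y z) f' f h h u ?i) \<cdot>
       pre_comp V (BHom B x y) (ldiv B x y z f' h) g g' v) \<cdot> lres x y z f' g' h"
    "rres x y z f g h \<cdot> c =
      (post_comp V (BHom B y z) f (rdiv B x y z h g') (rdiv B x y z h g)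
         (map_cell2 V (RDiv B x y z) h h g' g ?i v) \<cdot>
       pre_comp V (BHom B y z) (rdiv B x y z h g') f f' u) \<cdot> rres x y z f' g' h"
    using p q r by (simp_all add: fg_def fg'_def)
qed

end

context
  fixes f g h
  assumes ob: "f \<in> VOb (BHom B y z)" "g \<in> VOb (BHom B x y)" "h \<in> VOb (BHom B x z)"
begin

text \<open>With \<open>v\<close> an identity one of the two actions in each square of
  \<open>res_natural\<close> is trivial. Precomposing with \<open>u\<close> whiskered by
  \<open>g\<close> can thus be read either as a cell between left quotients acting on maps out of
  \<open>g\<close>, or as \<open>u\<close> acting on maps into a right quotient. The first reading
  varies \<open>g\<close> freely, the second involves only one quotient.\<close>

lemma
  assumes f': "f' \<in> VOb (BHom B y z)" and u: "u \<in> cell V (BHom B y z) f f'"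
  shows iso_pre_left_iff_ldiv:
      "iso V (pre_comp V (BHom B x z) h (hcomp B x y z f g) (hcomp B x y z f' g)
         (map_cell2 V (BCmp B x y z) f f' g g u (VId (BHom B x y) g))) \<longleftrightarrow>
       iso V (post_comp V (BHom B x y) g (ldiv B x y z f' h) (ldiv B x y z f h)
         (map_cell2 V (LDiv B x y z) f' f h h u (VId (BHom B x z) h)))"
    and iso_pre_left_iff_rdiv:
      "iso V (pre_comp V (BHom B x z) h (hcomp B x y z f g) (hcomp B x y z f' g)
         (map_cell2 V (BCmp B x y z) f f' g g u (VId (BHom B x y) g))) \<longleftrightarrow>
       iso V (pre_comp V (BHom B y z) (rdiv B x y z h g) f f' u)"
proof -
  note XY = BHom_vgraphs
  have i: "VId (BHom B x y) g \<in> cell V (BHom B x y) g g" "VId (BHom B x z) h \<in> cell V (BHom B x z) h h"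
    using ob XY by (simp_all add: VId_cell)
  have u': "u \<in> cell V (vop V (BHom B y z)) f' f" using u by (simp add: cell_def)
  have m: "map_cell2 V (BCmp B x y z) f f' g g u (VId (BHom B x y) g) \<in> cell V (BHom B x z) (hcomp B x y z f g) (hcomp B x y z f' g)"
    by (rule map_cell2_cell[OF BCmp_vmap]) (use ob f' u i in auto)
  have l: "map_cell2 V (LDiv B x y z) f' f h h u (VId (BHom B x z) h) \<in> cell V (BHom B x y) (ldiv B x y z f' h) (ldiv B x y z f h)"
    by (rule map_cell2_cell[OF LDiv_vmap]) (use ob f' u' i in auto)
  have r: "map_cell2 V (RDiv B x y z) h h g g (VId (BHom B x z) h) (VId (BHom B x y) g) = VId (BHom B y z) (rdiv B x y z h g)"
    using map_cell2_VId[OF RDiv_vfunctor[OF xyz], of h g] ob by simp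
  note [simp] = pp_typing[OF XY(1)] pp_typing[OF XY(2)] pp_typing[OF XY(3)] res_typing
    HomD[OF lres_in] HomD[OF rres_in]
  show "iso V (pre_comp V (BHom B x z) h (hcomp B x y z f g) (hcomp B x y z f' g)
         (map_cell2 V (BCmp B x y z) f f' g g u (VId (BHom B x y) g))) \<longleftrightarrow>
       iso V (post_comp V (BHom B x y) g (ldiv B x y z f' h) (ldiv B x y z f h)
         (map_cell2 V (LDiv B x y z) f' f h h u (VId (BHom B x z) h)))"
    by (rule iso_square[OF _ iso_lres[OF ob] iso_lres[OF f' ob(2,3)]])
      (use ob f' u i m l XY lres_natural[OF ob(1) f' ob(2,2,3) u i(1)] in
        \<open>simp_all add: pre_VId[OF BHom_vcategory] xyz v_simps\<close>)
  show "iso V (pre_comp V (BHom B x z) h (hcomp B x y z f g) (hcomp B x y z f' g)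
         (map_cell2 V (BCmp B x y z) f f' g g u (VId (BHom B x y) g))) \<longleftrightarrow>
       iso V (pre_comp V (BHom B y z) (rdiv B x y z h g) f f' u)"
    by (rule iso_square[OF _ iso_rres[OF ob] iso_rres[OF f' ob(2,3)]])
      (use ob f' u i m r XY rres_natural[OF ob(1) f' ob(2,2,3) u i(1)] in
        \<open>simp_all add: post_VId[OF BHom_vcategory] xyz v_simps\<close>)
qed

lemma
  assumes g': "g' \<in> VOb (BHom B x y)" and v: "v \<in> cell V (BHom B x y) g g'"
  shows iso_pre_right_iff_rdiv:
      "iso V (pre_comp V (BHom B x z) h (hcomp B x y z f g) (hcomp B x y z f g')
         (map_cell2 V (BCmp B x y z) f f g g' (VId (BHom B y z) f) v)) \<longleftrightarrow>
       iso V (post_comp V (BHom B y z) f (rdiv B x y z h g') (rdiv B x y z h g)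
         (map_cell2 V (RDiv B x y z) h h g' g (VId (BHom B x z) h) v))"
    and iso_pre_right_iff_ldiv:
      "iso V (pre_comp V (BHom B x z) h (hcomp B x y z f g) (hcomp B x y z f g')
         (map_cell2 V (BCmp B x y z) f f g g' (VId (BHom B y z) f) v)) \<longleftrightarrow>
       iso V (pre_comp V (BHom B x y) (ldiv B x y z f h) g g' v)"
proof -
  note XY = BHom_vgraphs
  have i: "VId (BHom B y z) f \<in> cell V (BHom B y z) f f" "VId (BHom B x z) h \<in> cell V (BHom B x z) h h"
    using ob XY by (simp_all add: VId_cell)
  have v': "v \<in> cell V (vop V (BHom B x y)) g' g" using v by (simp add: cell_def)
  have m: "map_cell2 V (BCmp B x y z) f f g g' (VId (BHom B y z) f) v \<in> cell V (BHom B x z) (hcomp B x y z f g) (hcomp B x y z f g')"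
    by (rule map_cell2_cell[OF BCmp_vmap]) (use ob g' v i in auto)
  have l: "map_cell2 V (RDiv B x y z) h h g' g (VId (BHom B x z) h) v \<in> cell V (BHom B y z) (rdiv B x y z h g') (rdiv B x y z h g)"
    by (rule map_cell2_cell[OF RDiv_vmap]) (use ob g' v' i in auto)
  have r: "map_cell2 V (LDiv B x y z) f f h h (VId (BHom B y z) f) (VId (BHom B x z) h) = VId (BHom B x y) (ldiv B x y z f h)"
    using map_cell2_VId[OF LDiv_vfunctor[OF xyz], of f h] ob by simp
  note [simp] = pp_typing[OF XY(1)] pp_typing[OF XY(2)] pp_typing[OF XY(3)] res_typing
    HomD[OF lres_in] HomD[OF rres_in]
  show "iso V (pre_comp V (BHom B x z) h (hcomp B x y z f g) (hcomp B x y z f g')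
         (map_cell2 V (BCmp B x y z) f f g g' (VId (BHom B y z) f) v)) \<longleftrightarrow>
       iso V (post_comp V (BHom B y z) f (rdiv B x y z h g') (rdiv B x y z h g)
         (map_cell2 V (RDiv B x y z) h h g' g (VId (BHom B x z) h) v))"
    by (rule iso_square[OF _ iso_rres[OF ob] iso_rres[OF ob(1) g' ob(3)]])
      (use ob g' v i m l XY rres_natural[OF ob(1,1,2) g' ob(3) i(1) v] in
        \<open>simp_all add: pre_VId[OF BHom_vcategory] xyz v_simps\<close>)
  show "iso V (pre_comp V (BHom B x z) h (hcomp B x y z f g) (hcomp B x y z f g')
         (map_cell2 V (BCmp B x y z) f f g g' (VId (BHom B y z) f) v)) \<longleftrightarrow>
       iso V (pre_comp V (BHom B x y) (ldiv B x y z f h) g g' v)"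
    by (rule iso_square[OF _ iso_lres[OF ob] iso_lres[OF ob(1) g' ob(3)]])
      (use ob g' v i m r XY lres_natural[OF ob(1,1,2) g' ob(3) i(1) v] in
        \<open>simp_all add: post_VId[OF BHom_vcategory] xyz v_simps\<close>)
qed

end

end

end

section \<open>The category of all 2-cells\<close>

text \<open>A cell does not determine its source and target, so an arrow records them together with
  the pair of objects over which it lies.\<close>

definition tot :: "('o, 'm) smc \<Rightarrow> 'x set \<Rightarrow> ('x \<Rightarrow> 'x \<Rightarrow> ('a, 'o, 'm) vcat) \<Rightarrow> ('x \<times> 'x \<times> 'a, 'x \<times> 'x \<times> 'a \<times> 'm \<times> 'a) cat" where
  "tot V S X =
     \<lparr>Ob = {(x, y, a). x \<in> S \<and> y \<in> S \<and> a \<in> VOb (X x y)},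
      Arr = {(x, y, a, f, b). x \<in> S \<and> y \<in> S \<and> a \<in> VOb (X x y) \<and> b \<in> VOb (X x y) \<and> f \<in> cell V (X x y) a b},
      Dom = \<lambda>(x, y, a, f, b). (x, y, a),
      Cod = \<lambda>(x, y, a, f, b). (x, y, b),
      Idn = \<lambda>(x, y, a). (x, y, a, VId (X x y) a, a),
      Cmp = \<lambda>(x, y, b, g, c) (_, _, a, f, _). (x, y, a, cell_comp V (X x y) a b c g f, c)\<rparr>"

fun tot_ob :: "('x \<Rightarrow> 'x \<Rightarrow> ('a, 'b, 'm) vfun) \<Rightarrow> 'x \<times> 'x \<times> 'a \<Rightarrow> 'x \<times> 'x \<times> 'b" where
  "tot_ob F (x, y, a) = (x, y, FO (F x y) a)"

fun tot_map :: "('o, 'm) smc \<Rightarrow> ('x \<Rightarrow> 'x \<Rightarrow> ('a, 'b, 'm) vfun) \<Rightarrow>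
    'x \<times> 'x \<times> 'a \<times> 'm \<times> 'a \<Rightarrow> 'x \<times> 'x \<times> 'b \<times> 'm \<times> 'b" where
  "tot_map V F (x, y, a, f, b) = (x, y, FO (F x y) a, map_cell V (F x y) a b f, FO (F x y) b)"

fun tot_prod_ob :: "('x, 'b, 'o, 'm, 'r) bicat_scheme \<Rightarrow> 'x \<times> 'x \<times> 'b \<Rightarrow> 'x \<times> 'x \<times> 'b \<Rightarrow> 'x \<times> 'x \<times> 'b" where
  "tot_prod_ob B (y, z, f) (x, _, g) = (x, z, hcomp B x y z f g)"

fun tot_prod :: "('o, 'm) smc \<Rightarrow> ('x, 'b, 'o, 'm, 'r) bicat_scheme \<Rightarrow>
    'x \<times> 'x \<times> 'b \<times> 'm \<times> 'b \<Rightarrow> 'x \<times> 'x \<times> 'b \<times> 'm \<times> 'b \<Rightarrow> 'x \<times> 'x \<times> 'b \<times> 'm \<times> 'b" where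
  "tot_prod V B (y, z, f, u, f') (x, _, g, v, g') =
     (x, z, hcomp B x y z f g, map_cell2 V (BCmp B x y z) f f' g g' u v, hcomp B x y z f' g')"

fun tot_assoc :: "('x, 'b, 'o, 'm, 'r) bicat_scheme \<Rightarrow> 'x \<times> 'x \<times> 'b \<Rightarrow> 'x \<times> 'x \<times> 'b \<Rightarrow> 'x \<times> 'x \<times> 'b \<Rightarrow>
    'x \<times> 'x \<times> 'b \<times> 'm \<times> 'b" where
  "tot_assoc B (y, z, f) (x, _, g) (w, _, h) =
     (w, z, hcomp B w x z (hcomp B x y z f g) h, BAssoc B w x y z ((f, g), h), hcomp B w y z f (hcomp B w x y g h))"

fun tot_lunit :: "('x, 'b, 'o, 'm, 'r) bicat_scheme \<Rightarrow> 'x \<times> 'x \<times> 'b \<Rightarrow> 'x \<times> 'x \<times> 'b \<times> 'm \<times> 'b" where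
  "tot_lunit B (x, y, f) = (x, y, hcomp B x y y (BId B y) f, BLunit B x y f, f)"

fun tot_runit :: "('x, 'b, 'o, 'm, 'r) bicat_scheme \<Rightarrow> 'x \<times> 'x \<times> 'b \<Rightarrow> 'x \<times> 'x \<times> 'b \<times> 'm \<times> 'b" where
  "tot_runit B (x, y, f) = (x, y, hcomp B x x y f (BId B x), BRunit B x y f, f)"

fun tot_unit :: "('x \<Rightarrow> 'x \<Rightarrow> ('c, 'b, 'm) vfun) \<Rightarrow> ('x \<Rightarrow> 'x \<Rightarrow> ('b, 'c, 'm) vfun) \<Rightarrow> ('x \<Rightarrow> 'x \<Rightarrow> 'b \<Rightarrow> 'm) \<Rightarrow>
    'x \<times> 'x \<times> 'b \<Rightarrow> 'x \<times> 'x \<times> 'b \<times> 'm \<times> 'b" where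
  "tot_unit R L \<eta> (x, y, b) = (x, y, b, \<eta> x y b, reflection R L x y b)"

fun tot_counit :: "('x \<Rightarrow> 'x \<Rightarrow> ('c, 'b, 'm) vfun) \<Rightarrow> ('x \<Rightarrow> 'x \<Rightarrow> ('b, 'c, 'm) vfun) \<Rightarrow> ('x \<Rightarrow> 'x \<Rightarrow> 'c \<Rightarrow> 'm) \<Rightarrow>
    'x \<times> 'x \<times> 'c \<Rightarrow> 'x \<times> 'x \<times> 'c \<times> 'm \<times> 'c" where
  "tot_counit R L \<epsilon> (x, y, c) = (x, y, FO (L x y) (FO (R x y) c), \<epsilon> x y c, c)"

lemma tot_simps [simp]:
  "(x, y, a) \<in> Ob (tot V S X) \<longleftrightarrow> x \<in> S \<and> y \<in> S \<and> a \<in> VOb (X x y)"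
  "(x, y, a, f, b) \<in> Arr (tot V S X) \<longleftrightarrow> x \<in> S \<and> y \<in> S \<and> a \<in> VOb (X x y) \<and> b \<in> VOb (X x y) \<and> f \<in> cell V (X x y) a b"
  "Dom (tot V S X) (x, y, a, f, b) = (x, y, a)" "Cod (tot V S X) (x, y, a, f, b) = (x, y, b)"
  "\<one>\<^bsub>tot V S X\<^esub> (x, y, a) = (x, y, a, VId (X x y) a, a)"
  "(x, y, b, g, c) \<cdot>\<^bsub>tot V S X\<^esub> (x', y', a, f, b') = (x, y, a, cell_comp V (X x y) a b c g f, c)"
  by (simp_all add: tot_def)

lemma Hom_tot: "(x, y, a, f, b) \<in> Hom (tot V S X) p q \<longleftrightarrow> p = (x, y, a) \<and> q = (x, y, b) \<and> x \<in> S \<and> y \<in> S \<and>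
    a \<in> VOb (X x y) \<and> b \<in> VOb (X x y) \<and> f \<in> cell V (X x y) a b"
  by (auto simp: Hom_def)

lemma Hom_totE:
  assumes "h \<in> Hom (tot V S X) p q"
  obtains x y a f b where "h = (x, y, a, f, b)" "p = (x, y, a)" "q = (x, y, b)" "x \<in> S" "y \<in> S"
    "a \<in> VOb (X x y)" "b \<in> VOb (X x y)" "f \<in> cell V (X x y) a b"
  using assms by (cases h) (auto simp: Hom_tot)

lemma Ob_totE:
  assumes "p \<in> Ob (tot V S X)"
  obtains x y a where "p = (x, y, a)" "x \<in> S" "y \<in> S" "a \<in> VOb (X x y)"
  using assms by (cases p) auto

lemma Arr_totE:
  assumes "h \<in> Arr (tot V S X)"
  obtains x y a f b where "h = (x, y, a, f, b)" "x \<in> S" "y \<in> S"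
    "a \<in> VOb (X x y)" "b \<in> VOb (X x y)" "f \<in> cell V (X x y) a b"
  using assms by (cases h) auto

lemma iso_tot:
  "iso (tot V S X) (x, y, a, f, b) \<longleftrightarrow>
    x \<in> S \<and> y \<in> S \<and> a \<in> VOb (X x y) \<and> b \<in> VOb (X x y) \<and> cell_iso V (X x y) a b f"
  by (auto simp: iso_def inverse_arrows_def cell_iso_def Hom_tot)

context symmetric_monoidal_closed_category
begin

lemma category_tot:
  assumes "\<And>x y. \<lbrakk>x \<in> S; y \<in> S\<rbrakk> \<Longrightarrow> vcategory V (X x y)"
  shows "category (tot V S X)"
  by unfold_locales
    (use assms vcategory_vgraph[OF assms] in \<open>auto elim!: Hom_totE Arr_totE Ob_totE simp: Hom_tot VId_cell cell_comp_cell
      cell_comp_VId_left cell_comp_VId_right cell_comp_assoc\<close>)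

lemma vmap_assoc:
  assumes "vgraph V X" "vgraph V Y" "vgraph V Z"
  shows "vmap V (vtensor V (vtensor V X Y) Z) (vtensor V X (vtensor V Y Z)) (vfun_assoc V X Y Z)"
  using assms by (auto simp: vmap_def v_typing intro!: HomI)

lemma vmap_op: "vmap V X Y F \<Longrightarrow> vmap V (vop V X) (vop V Y) (vfun_op F)"
  by (simp add: vmap_def)

lemma map_cell_fix_left:
  assumes "vgraph V X" "vgraph V Y" "vmap V (vtensor V X Y) Z F" "a \<in> VOb X" "b \<in> VOb Y" "b' \<in> VOb Y" "f \<in> cell V Y b b'"
  shows "map_cell V (vfun_fix_left V X Y F a) b b' f = map_cell2 V F a a b b' (VId X a) f"
proof -
  note f = cellD[OF assms(7)]
  have "(VId X a \<odot> \<one> (VHom Y b b')) \<cdot> li (VHom Y b b') \<cdot> f = pair_cell V (VId X a) f"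
    using assms f by (simp add: li_natural pair_cell_def v_simps)
  then show ?thesis
    using assms f Arr_FM[OF assms(3), of "(a, b)" "(a, b')"] Dom_FM[OF assms(3), of "(a, b)" "(a, b')"]
    by (simp add: map_cell_def map_cell2_def vfun_fix_left_def v_typing assoc_Cmp)
qed

lemma map_cell_fix_right:
  assumes "vgraph V X" "vgraph V Y" "vmap V (vtensor V X Y) Z F" "a \<in> VOb X" "a' \<in> VOb X" "b \<in> VOb Y" "f \<in> cell V X a a'"
  shows "map_cell V (vfun_fix_right V X Y F b) a a' f = map_cell2 V F a a' b b f (VId Y b)"
proof -
  note f = cellD[OF assms(7)]
  have "(\<one> (VHom X a a') \<odot> VId Y b) \<cdot> ri (VHom X a a') \<cdot> f = pair_cell V f (VId Y b)"
    using assms f by (simp add: ri_natural pair_cell_def li_ri_unit v_simps)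
  then show ?thesis
    using assms f Arr_FM[OF assms(3), of "(a, b)" "(a', b)"] Dom_FM[OF assms(3), of "(a, b)" "(a', b)"]
    by (simp add: map_cell_def map_cell2_def vfun_fix_right_def v_typing assoc_Cmp)
qed

end

section \<open>Horizontal composition and constraints on the level of cells\<close>

context enriched_biclosed_bicategory
begin

lemma hcomp_cell:
  assumes "x \<in> BOb B" "y \<in> BOb B" "z \<in> BOb B" "f \<in> VOb (BHom B y z)" "f' \<in> VOb (BHom B y z)" "g \<in> VOb (BHom B x y)" "g' \<in> VOb (BHom B x y)"
    and "u \<in> cell V (BHom B y z) f f'" "v \<in> cell V (BHom B x y) g g'"
  shows "map_cell2 V (BCmp B x y z) f f' g g' u v \<in> cell V (BHom B x z) (hcomp B x y z f g) (hcomp B x y z f' g')"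
  by (rule map_cell2_cell[OF BCmp_vmap[OF assms(1-3)]]) (use assms in auto)

lemma hcomp_comp:
  assumes "x \<in> BOb B" "y \<in> BOb B" "z \<in> BOb B" "f \<in> VOb (BHom B y z)" "f' \<in> VOb (BHom B y z)" "f'' \<in> VOb (BHom B y z)"
    "g \<in> VOb (BHom B x y)" "g' \<in> VOb (BHom B x y)" "g'' \<in> VOb (BHom B x y)"
    and "u \<in> cell V (BHom B y z) f f'" "u' \<in> cell V (BHom B y z) f' f''" "v \<in> cell V (BHom B x y) g g'" "v' \<in> cell V (BHom B x y) g' g''"
  shows "cell_comp V (BHom B x z) (hcomp B x y z f g) (hcomp B x y z f' g') (hcomp B x y z f'' g'')
      (map_cell2 V (BCmp B x y z) f' f'' g' g'' u' v') (map_cell2 V (BCmp B x y z) f f' g g' u v) =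
    map_cell2 V (BCmp B x y z) f f'' g g'' (cell_comp V (BHom B y z) f f' f'' u' u) (cell_comp V (BHom B x y) g g' g'' v' v)"
  by (rule map_cell2_comp[OF BCmp_vfunctor, symmetric]) (use assms BHom_vgraph in auto)

lemma hcomp_VId:
  assumes "x \<in> BOb B" "y \<in> BOb B" "z \<in> BOb B" "f \<in> VOb (BHom B y z)" "g \<in> VOb (BHom B x y)"
  shows "map_cell2 V (BCmp B x y z) f f g g (VId (BHom B y z) f) (VId (BHom B x y) g) = VId (BHom B x z) (hcomp B x y z f g)"
  by (rule map_cell2_VId[OF BCmp_vfunctor]) (use assms in auto)

context
  fixes w x y z
  assumes wxyz: "w \<in> BOb B" "x \<in> BOb B" "y \<in> BOb B" "z \<in> BOb B"
begin

abbreviation "assoc_source \<equiv> vfun_comp V (BCmp B w x z) (vfun_tensor V (BCmp B x y z) (vfun_id V (BHom B w x)))"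
abbreviation "assoc_target \<equiv> vfun_comp V (BCmp B w y z)
           (vfun_comp V (vfun_tensor V (vfun_id V (BHom B y z)) (BCmp B w x y))
             (vfun_assoc V (BHom B y z) (BHom B x y) (BHom B w x)))"

lemma BAssoc_vnatural: "vnatural V (vtensor V (vtensor V (BHom B y z) (BHom B x y)) (BHom B w x)) (BHom B w z)
    assoc_source assoc_target (BAssoc B w x y z)"
  by (rule vnatural_iso.axioms(1)[OF BAssoc_natural]) (use wxyz in auto)

lemma assoc_vmap:
  "vmap V (vtensor V (vtensor V (BHom B y z) (BHom B x y)) (BHom B w x)) (BHom B w z) assoc_source"
  "vmap V (vtensor V (vtensor V (BHom B y z) (BHom B x y)) (BHom B w x)) (BHom B w z) assoc_target"
  using wxyz by (auto intro!: vmap_comp[OF _ BCmp_vmap] vmap_comp[OF vmap_assoc] vmap_tensor vmap_id BCmp_vmap BHom_vgraph)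

lemma BAssoc_iso:
  assumes "f \<in> VOb (BHom B y z)" "g \<in> VOb (BHom B x y)" "h \<in> VOb (BHom B w x)"
  shows "cell_iso V (BHom B w z) (hcomp B w x z (hcomp B x y z f g) h) (hcomp B w y z f (hcomp B w x y g h))
    (BAssoc B w x y z ((f, g), h))"
  using vnatural_iso.component_iso[OF BAssoc_natural[OF wxyz], of "((f, g), h)"] assms by simp

text \<open>Enriched naturality at the cell made of \<open>u\<close>, \<open>v\<close> and
  \<open>t\<close>; facts \<open>1\<close> and \<open>2\<close> identify its images under the two
  bracketings, the second by moving the nested pair through the associator of
  \<open>V\<close>.\<close>

lemma BAssoc_nat:
  assumes ob: "f \<in> VOb (BHom B y z)" "g \<in> VOb (BHom B x y)" "h \<in> VOb (BHom B w x)"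
      "f' \<in> VOb (BHom B y z)" "g' \<in> VOb (BHom B x y)" "h' \<in> VOb (BHom B w x)"
    and c: "u \<in> cell V (BHom B y z) f f'" "v \<in> cell V (BHom B x y) g g'" "t \<in> cell V (BHom B w x) h h'"
  shows "cell_comp V (BHom B w z) (hcomp B w x z (hcomp B x y z f g) h) (hcomp B w x z (hcomp B x y z f' g') h')
      (hcomp B w y z f' (hcomp B w x y g' h')) (BAssoc B w x y z ((f', g'), h'))
      (map_cell2 V (BCmp B w x z) (hcomp B x y z f g) (hcomp B x y z f' g') h h' (map_cell2 V (BCmp B x y z) f f' g g' u v) t) =
    cell_comp V (BHom B w z) (hcomp B w x z (hcomp B x y z f g) h) (hcomp B w y z f (hcomp B w x y g h))
      (hcomp B w y z f' (hcomp B w x y g' h'))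
      (map_cell2 V (BCmp B w y z) f f' (hcomp B w x y g h) (hcomp B w x y g' h') u (map_cell2 V (BCmp B w x y) g g' h h' v t))
      (BAssoc B w x y z ((f, g), h))"
proof -
  let ?k = "pair_cell V (pair_cell V u v) t"
  note uv = pair_cell_cell[OF c(1,2)] and vt = pair_cell_cell[OF c(2,3)]
  note k = pair_cell_cell[OF uv c(3)] and k' = pair_cell_cell[OF c(1) vt]
  note m = hcomp_cell[OF wxyz(2-4) ob(1,4,2,5) c(1,2)] and m' = hcomp_cell[OF wxyz(1-3) ob(2,5,3,6) c(2,3)]
  note t = cellD[OF uv] cellD[OF k] cellD[OF k'] cellD[OF c(1)] cellD[OF c(3)] cellD[OF m] cellD[OF m'] cellD[OF vt]
  note [simp] = res_typing wxyz BHom_vgraph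
  have "(FM (BCmp B x y z) (f, g) (f', g') \<odot> \<one> (VHom (BHom B w x) h h')) \<cdot> ?k =
      pair_cell V (map_cell2 V (BCmp B x y z) f f' g g' u v) t"
    using ob t by (subst pair_cell_tensor[OF uv c(3)]) (simp_all add: v_simps map_cell2_def map_cell_def)
  then have 1: "map_cell V assoc_source ((f, g), h) ((f', g'), h') ?k =
      map_cell2 V (BCmp B w x z) (hcomp B x y z f g) (hcomp B x y z f' g') h h' (map_cell2 V (BCmp B x y z) f f' g g' u v) t"
    using ob t by (simp add: map_cell_def map_cell2_def[of V "BCmp B w x z"] v_typing assoc_Cmp)
  have "(\<one> (VHom (BHom B y z) f f') \<odot> FM (BCmp B w x y) (g, h) (g', h')) \<cdot>
      assoc V (VHom (BHom B y z) f f') (VHom (BHom B x y) g g') (VHom (BHom B w x) h h') \<cdot> ?k =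
      pair_cell V u (map_cell2 V (BCmp B w x y) g g' h h' v t)"
    unfolding assoc_pair[OF c]
    using ob t by (subst pair_cell_tensor[OF c(1) vt]) (simp_all add: v_simps map_cell2_def map_cell_def)
  then have 2: "map_cell V assoc_target ((f, g), h) ((f', g'), h') ?k =
      map_cell2 V (BCmp B w y z) f f' (hcomp B w x y g h) (hcomp B w x y g' h') u (map_cell2 V (BCmp B w x y) g g' h h' v t)"
    using ob t by (simp add: map_cell_def map_cell2_def[of V "BCmp B w y z"] v_typing assoc_Cmp)
  show ?thesis
    using vnatural_cells[OF BAssoc_vnatural _ assoc_vmap _ _ k] ob by (simp add: 1 2)
qed

end

context
  fixes x y
  assumes xy: "x \<in> BOb B" "y \<in> BOb B"
begin

lemma BLunit_vnatural: "vnatural V (BHom B x y) (BHom B x y)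
      (vfun_fix_left V (BHom B y y) (BHom B x y) (BCmp B x y y) (BId B y)) (vfun_id V (BHom B x y)) (BLunit B x y)"
  and BRunit_vnatural: "vnatural V (BHom B x y) (BHom B x y)
      (vfun_fix_right V (BHom B x y) (BHom B x x) (BCmp B x x y) (BId B x)) (vfun_id V (BHom B x y)) (BRunit B x y)"
  by (rule vnatural_iso.axioms(1)[OF BLunit_natural[OF xy]] vnatural_iso.axioms(1)[OF BRunit_natural[OF xy]])+

lemma unit_vmap:
  "vmap V (BHom B x y) (BHom B x y) (vfun_fix_left V (BHom B y y) (BHom B x y) (BCmp B x y y) (BId B y))"
  "vmap V (BHom B x y) (BHom B x y) (vfun_fix_right V (BHom B x y) (BHom B x x) (BCmp B x x y) (BId B x))"
  unfolding vfun_fix_left_eq vfun_fix_right_eq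
  using xy by (auto intro!: vmap_comp[OF _ BCmp_vmap] vmap_pair_left vmap_pair_right BHom_vgraph BId_in)

lemma BLunit_iso: "f \<in> VOb (BHom B x y) \<Longrightarrow> cell_iso V (BHom B x y) (hcomp B x y y (BId B y) f) f (BLunit B x y f)"
  using vnatural_iso.component_iso[OF BLunit_natural[OF xy], of f] by (simp add: vfun_fix_left_def)

lemma BRunit_iso: "f \<in> VOb (BHom B x y) \<Longrightarrow> cell_iso V (BHom B x y) (hcomp B x x y f (BId B x)) f (BRunit B x y f)"
  using vnatural_iso.component_iso[OF BRunit_natural[OF xy], of f] by (simp add: vfun_fix_right_def)

lemma
  assumes ob: "f \<in> VOb (BHom B x y)" "f' \<in> VOb (BHom B x y)" and u: "u \<in> cell V (BHom B x y) f f'"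
  shows BLunit_nat: "cell_comp V (BHom B x y) (hcomp B x y y (BId B y) f) (hcomp B x y y (BId B y) f') f' (BLunit B x y f')
      (map_cell2 V (BCmp B x y y) (BId B y) (BId B y) f f' (VId (BHom B y y) (BId B y)) u) =
      cell_comp V (BHom B x y) (hcomp B x y y (BId B y) f) f f' u (BLunit B x y f)"
    and BRunit_nat: "cell_comp V (BHom B x y) (hcomp B x x y f (BId B x)) (hcomp B x x y f' (BId B x)) f' (BRunit B x y f')
      (map_cell2 V (BCmp B x x y) f f' (BId B x) (BId B x) u (VId (BHom B x x) (BId B x))) =
      cell_comp V (BHom B x y) (hcomp B x x y f (BId B x)) f f' u (BRunit B x y f)"
proof -
  have i: "map_cell V (vfun_id V (BHom B x y)) f f' u = u"
    using cellD[OF u] by (simp add: map_cell_def mon_simps)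
  have "vmap V (BHom B x y) (BHom B x y) (vfun_id V (BHom B x y))"
    using xy by (simp add: vmap_id BHom_vgraph)
  note vnatural_cells[OF BLunit_vnatural BHom_vgraph[OF xy] unit_vmap(1) this ob u]
    vnatural_cells[OF BRunit_vnatural BHom_vgraph[OF xy] unit_vmap(2) this ob u]
  then show "cell_comp V (BHom B x y) (hcomp B x y y (BId B y) f) (hcomp B x y y (BId B y) f') f' (BLunit B x y f')
      (map_cell2 V (BCmp B x y y) (BId B y) (BId B y) f f' (VId (BHom B y y) (BId B y)) u) =
      cell_comp V (BHom B x y) (hcomp B x y y (BId B y) f) f f' u (BLunit B x y f)"
    "cell_comp V (BHom B x y) (hcomp B x x y f (BId B x)) (hcomp B x x y f' (BId B x)) f' (BRunit B x y f')
      (map_cell2 V (BCmp B x x y) f f' (BId B x) (BId B x) u (VId (BHom B x x) (BId B x))) =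
      cell_comp V (BHom B x y) (hcomp B x x y f (BId B x)) f f' u (BRunit B x y f)"
    using xy ob u i by (simp_all add: map_cell_fix_left[OF _ _ BCmp_vmap] map_cell_fix_right[OF _ _ BCmp_vmap] BHom_vgraph BId_in)
      (simp_all add: vfun_fix_left_def vfun_fix_right_def)
qed

end

end

section \<open>Local reflections of a biclosed bicategory\<close>

locale locally_reflective = enriched_biclosed_bicategory V B
  for V :: "('o, 'm) smc" (structure) and B :: "('x, 'b, 'o, 'm) biclosed_bicat" +
  fixes C :: "'x \<Rightarrow> 'x \<Rightarrow> ('c, 'o, 'm) vcat"
    and \<theta> :: "'x \<Rightarrow> 'x \<Rightarrow> ('c, 'b, 'm) vfun"
    and \<psi> :: "'x \<Rightarrow> 'x \<Rightarrow> ('b, 'c, 'm) vfun"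
    and \<eta> :: "'x \<Rightarrow> 'x \<Rightarrow> 'b \<Rightarrow> 'm"
    and \<epsilon> :: "'x \<Rightarrow> 'x \<Rightarrow> 'c \<Rightarrow> 'm"
  assumes C_vcategory: "\<lbrakk>x \<in> BOb B; y \<in> BOb B\<rbrakk> \<Longrightarrow> vcategory V (C x y)"
    and \<theta>_ff: "\<lbrakk>x \<in> BOb B; y \<in> BOb B\<rbrakk> \<Longrightarrow> fully_faithful V (C x y) (\<theta> x y)"
    and adjunction: "\<lbrakk>x \<in> BOb B; y \<in> BOb B\<rbrakk> \<Longrightarrow>
           vadjunction V (BHom B x y) (C x y) (\<psi> x y) (\<theta> x y) (\<eta> x y) (\<epsilon> x y)"
begin

abbreviation "T \<equiv> reflection \<theta> \<psi>"

lemma C_vgraph: "\<lbrakk>x \<in> BOb B; y \<in> BOb B\<rbrakk> \<Longrightarrow> vgraph V (C x y)"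
  by (rule vcategory_vgraph[OF C_vcategory])

context
  fixes x y
  assumes xy: "x \<in> BOb B" "y \<in> BOb B"
begin

lemmas hyps = BHom_vcategory[OF xy] C_vcategory[OF xy] adjunction[OF xy] \<theta>_ff[OF xy]

lemmas \<psi>_vfunctor = vadjunction.axioms(1)[OF adjunction[OF xy]]
  and \<theta>_vfunctor = vadjunction.axioms(2)[OF adjunction[OF xy]]
  and \<eta>_vnatural = vadjunction.axioms(3)[OF adjunction[OF xy]]
  and \<epsilon>_vnatural = vadjunction.axioms(4)[OF adjunction[OF xy]]

lemmas \<psi>_vmap = vfunctor_vmap[OF \<psi>_vfunctor] and \<theta>_vmap = vfunctor_vmap[OF \<theta>_vfunctor]

lemma \<psi>_in: "b \<in> VOb (BHom B x y) \<Longrightarrow> FO (\<psi> x y) b \<in> VOb (C x y)"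
  and \<theta>_in: "c \<in> VOb (C x y) \<Longrightarrow> FO (\<theta> x y) c \<in> VOb (BHom B x y)"
  by (rule vmap_FO[OF \<psi>_vmap] vmap_FO[OF \<theta>_vmap]; assumption)+

lemmas \<eta>_cell = unit_cell[OF hyps] and \<epsilon>_cell = counit_cell[OF hyps]
  and \<psi>_cell = map_cell_cell[OF \<psi>_vmap] and \<theta>_cell = map_cell_cell[OF \<theta>_vmap]

lemma
  assumes "c \<in> VOb (C x y)" "d \<in> VOb (C x y)"
  shows \<theta>_full: "f \<in> cell V (BHom B x y) (FO (\<theta> x y) c) (FO (\<theta> x y) d) \<Longrightarrow>
      \<exists>g\<in>cell V (C x y) c d. map_cell V (\<theta> x y) c d g = f"
    and \<theta>_faithful: "\<lbrakk>g \<in> cell V (C x y) c d; g' \<in> cell V (C x y) c d;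
      map_cell V (\<theta> x y) c d g = map_cell V (\<theta> x y) c d g'\<rbrakk> \<Longrightarrow> g = g'"
proof -
  have i: "iso V (FM (\<theta> x y) c d)" using assms \<theta>_ff[OF xy] by (simp add: fully_faithful_def)
  note t = Arr_FM[OF \<theta>_vmap assms] Dom_FM[OF \<theta>_vmap assms] Cod_FM[OF \<theta>_vmap assms]
  show "\<exists>g\<in>cell V (C x y) c d. map_cell V (\<theta> x y) c d g = f"
    if "f \<in> cell V (BHom B x y) (FO (\<theta> x y) c) (FO (\<theta> x y) d)"
    by (rule bexI[of _ "inv_arr V (FM (\<theta> x y) c d) \<cdot> f"])
      (use i t cellD[OF that] in \<open>auto intro!: cellI simp: map_cell_def inv_simps typing\<close>)
  show "g = g'" if "g \<in> cell V (C x y) c d" "g' \<in> cell V (C x y) c d"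
    "map_cell V (\<theta> x y) c d g = map_cell V (\<theta> x y) c d g'"
    by (rule mono_cancel[OF i])
      (use that t cellD[OF that(1)] cellD[OF that(2)] in \<open>simp_all add: map_cell_def typing\<close>)
qed

end

lemmas loc_typing = \<psi>_in \<theta>_in \<eta>_cell \<epsilon>_cell \<psi>_cell \<theta>_cell hcomp_in hcomp_cell BHom_vgraph C_vgraph
  cell_comp_cell VId_cell BId_in cell_iso_cell[OF BAssoc_iso] cell_iso_cell[OF BLunit_iso] cell_iso_cell[OF BRunit_iso]

abbreviation totB where "totB \<equiv> tot V (BOb B) (BHom B)"
abbreviation totC where "totC \<equiv> tot V (BOb B) C"

text \<open>The two projections give the source and the target of a 1-cell; horizontal composites
  are meaningful only where these match. In this form all coherence equations proved for ordinary
  categories become available.\<close>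

sublocale total: local_reflection totB totC "BOb B" fst "\<lambda>p. fst (snd p)"
  "tot_ob \<psi>" "tot_map V \<psi>" "tot_ob \<theta>" "tot_map V \<theta>" "tot_unit \<theta> \<psi> \<eta>" "tot_counit \<theta> \<psi> \<epsilon>"
  "tot_prod_ob B" "tot_prod V B" "\<lambda>x. (x, x, BId B x)" "tot_assoc B" "tot_lunit B" "tot_runit B"
proof (intro local_reflection.intro local_reflection_axioms.intro)
  note [elim!] = Hom_totE Ob_totE Arr_totE
  note [simp] = Hom_tot iso_tot loc_typing
  show "category totB" "category totC"
    by (rule category_tot, rule BHom_vcategory, assumption+, rule category_tot, rule C_vcategory)
  show "tot_map V \<psi> (g \<cdot>\<^bsub>totB\<^esub> f) = tot_map V \<psi> g \<cdot>\<^bsub>totC\<^esub> tot_map V \<psi> f"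
    if "f \<in> Hom totB a b" "g \<in> Hom totB b c" for f g a b c
    using that by (auto simp: map_cell_comp[OF \<psi>_vfunctor])
  show "tot_map V \<theta> (v \<cdot>\<^bsub>totC\<^esub> u) = tot_map V \<theta> v \<cdot>\<^bsub>totB\<^esub> tot_map V \<theta> u"
    if "u \<in> Hom totC p q" "v \<in> Hom totC q r" for u v p q r
    using that by (auto simp: map_cell_comp[OF \<theta>_vfunctor])
  show "tot_map V \<psi> (\<one>\<^bsub>totB\<^esub> a) = \<one>\<^bsub>totC\<^esub> (tot_ob \<psi> a)"
    if "a \<in> Ob totB" for a
    using that by (auto simp: map_cell_VId[OF \<psi>_vfunctor])
  show "tot_map V \<theta> (\<one>\<^bsub>totC\<^esub> a) = \<one>\<^bsub>totB\<^esub> (tot_ob \<theta> a)"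
    if "a \<in> Ob totC" for a
    using that by (auto simp: map_cell_VId[OF \<theta>_vfunctor])
  show "\<exists>u\<in>Hom totC p q. tot_map V \<theta> u = f"
    if hyp: "p \<in> Ob totC" "q \<in> Ob totC"
      "f \<in> Hom totB (tot_ob \<theta> p) (tot_ob \<theta> q)" for p q f
  proof -
    obtain x y c where p: "p = (x, y, c)" "x \<in> BOb B" "y \<in> BOb B" "c \<in> VOb (C x y)"
      using hyp(1) by (rule Ob_totE)
    obtain x2 y2 d where q: "q = (x2, y2, d)" by (cases q)
    obtain x1 y1 a1 h b1 where f: "f = (x1, y1, a1, h, b1)" by (cases f)
    \<comment> \<open>The endpoints of \<open>f\<close> force \<open>p\<close> and \<open>q\<close>
      to lie over the same pair of objects, where fullness of \<open>\<theta> x y\<close>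
      applies.\<close>
    have *: "x1 = x" "y1 = y" "a1 = FO (\<theta> x y) c" "x2 = x" "y2 = y" "b1 = FO (\<theta> x y) d" "d \<in> VOb (C x y)"
      "h \<in> cell V (BHom B x y) (FO (\<theta> x y) c) (FO (\<theta> x y) d)"
      using hyp(2,3) by (auto simp only: p(1) f q Hom_tot tot_simps tot_ob.simps prod.inject)
    obtain g where "g \<in> cell V (C x y) c d" "map_cell V (\<theta> x y) c d g = h"
      using \<theta>_full[OF p(2-4) *(7,8)] by blast
    then show ?thesis
      using p * by (intro bexI[of _ "(x, y, c, g, d)"]) (simp_all add: f q)
  qed
  show "u = v" if "u \<in> Hom totC p q" "v \<in> Hom totC p q" "tot_map V \<theta> u = tot_map V \<theta> v" for u v p q
    using that by (auto dest: \<theta>_faithful[rotated -1])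
  show "tot_unit \<theta> \<psi> \<eta> b \<cdot>\<^bsub>totB\<^esub> f =
      tot_map V \<theta> (tot_map V \<psi> f) \<cdot>\<^bsub>totB\<^esub> tot_unit \<theta> \<psi> \<eta> a"
    if "f \<in> Hom totB a b" for f a b
    using that by (auto simp: unit_natural[OF hyps])
  show "tot_counit \<theta> \<psi> \<epsilon> q \<cdot>\<^bsub>totC\<^esub> tot_map V \<psi> (tot_map V \<theta> u) = u \<cdot>\<^bsub>totC\<^esub> tot_counit \<theta> \<psi> \<epsilon> p"
    if "u \<in> Hom totC p q" for u p q
    using that by (auto simp: counit_natural[OF hyps])
  show "tot_counit \<theta> \<psi> \<epsilon> (tot_ob \<psi> a) \<cdot>\<^bsub>totC\<^esub> tot_map V \<psi> (tot_unit \<theta> \<psi> \<eta> a) = \<one>\<^bsub>totC\<^esub> (tot_ob \<psi> a)"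
    if "a \<in> Ob totB" for a
    using that by (auto simp: vadjunction.triangle_left[OF adjunction])
  show "tot_map V \<theta> (tot_counit \<theta> \<psi> \<epsilon> p) \<cdot>\<^bsub>totB\<^esub> tot_unit \<theta> \<psi> \<eta> (tot_ob \<theta> p) = \<one>\<^bsub>totB\<^esub> (tot_ob \<theta> p)"
    if "p \<in> Ob totC" for p
    using that by (auto simp: vadjunction.triangle_right[OF adjunction])
  show "tot_prod V B (\<one>\<^bsub>totB\<^esub> a) (\<one>\<^bsub>totB\<^esub> b) = \<one>\<^bsub>totB\<^esub> (tot_prod_ob B a b)"
    if "a \<in> Ob totB" "b \<in> Ob totB" "fst a = fst (snd b)" for a b
    using that by (auto simp: hcomp_VId)
  show "tot_prod V B f' g' \<cdot>\<^bsub>totB\<^esub> tot_prod V B f g =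
      tot_prod V B (f' \<cdot>\<^bsub>totB\<^esub> f) (g' \<cdot>\<^bsub>totB\<^esub> g)"
    if "f \<in> Hom totB a a'" "f' \<in> Hom totB a' a''"
      "g \<in> Hom totB b b'" "g' \<in> Hom totB b' b''" "fst a = fst (snd b)"
    for f f' g g' a a' a'' b b' b''
    using that by (auto simp: hcomp_comp)
  show "iso totB (tot_assoc B a b c)"
    if "a \<in> Ob totB" "b \<in> Ob totB" "c \<in> Ob totB"
      "fst a = fst (snd b)" "fst b = fst (snd c)" for a b c
    using that by (auto simp: BAssoc_iso)
  show "tot_assoc B a' b' c' \<cdot>\<^bsub>totB\<^esub> tot_prod V B (tot_prod V B f g) h =
      tot_prod V B f (tot_prod V B g h) \<cdot>\<^bsub>totB\<^esub> tot_assoc B a b c"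
    if "f \<in> Hom totB a a'" "g \<in> Hom totB b b'"
      "h \<in> Hom totB c c'" "fst a = fst (snd b)" "fst b = fst (snd c)" for f g h a a' b b' c c'
    using that by (auto simp: BAssoc_nat)
  show "iso totB (tot_lunit B a)" "iso totB (tot_runit B a)"
    if "a \<in> Ob totB" for a
    using that by (auto simp: BLunit_iso BRunit_iso)
  show "tot_lunit B b \<cdot>\<^bsub>totB\<^esub>
      tot_prod V B (\<one>\<^bsub>totB\<^esub> (fst (snd a), fst (snd a), BId B (fst (snd a)))) f =
      f \<cdot>\<^bsub>totB\<^esub> tot_lunit B a"
    "tot_runit B b \<cdot>\<^bsub>totB\<^esub>
      tot_prod V B f (\<one>\<^bsub>totB\<^esub> (fst a, fst a, BId B (fst a))) =
      f \<cdot>\<^bsub>totB\<^esub> tot_runit B a"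
    if "f \<in> Hom totB a b" for f a b
    using that by (auto simp: BLunit_nat BRunit_nat)
  show "tot_assoc B a b (tot_prod_ob B c d) \<cdot>\<^bsub>totB\<^esub> tot_assoc B (tot_prod_ob B a b) c d =
      tot_prod V B (\<one>\<^bsub>totB\<^esub> a) (tot_assoc B b c d) \<cdot>\<^bsub>totB\<^esub>
      tot_assoc B a (tot_prod_ob B b c) d \<cdot>\<^bsub>totB\<^esub>
      tot_prod V B (tot_assoc B a b c) (\<one>\<^bsub>totB\<^esub> d)"
    if "a \<in> Ob totB" "b \<in> Ob totB" "c \<in> Ob totB"
      "d \<in> Ob totB" "fst a = fst (snd b)" "fst b = fst (snd c)" "fst c = fst (snd d)" for a b c d
    using that by (auto simp: bicat_pentagon[unfolded Let_def])
  show "tot_prod V B (\<one>\<^bsub>totB\<^esub> a) (tot_lunit B b) \<cdot>\<^bsub>totB\<^esub>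
      tot_assoc B a (fst (snd b), fst (snd b), BId B (fst (snd b))) b =
      tot_prod V B (tot_runit B a) (\<one>\<^bsub>totB\<^esub> b)"
    if "a \<in> Ob totB" "b \<in> Ob totB" "fst a = fst (snd b)" for a b
    using that by (auto simp: bicat_triangle[unfolded Let_def])
qed (auto elim!: Hom_totE Ob_totE Arr_totE simp: Hom_tot iso_tot loc_typing)

end

subsection \<open>The six conditions\<close>

context locally_reflective
begin

abbreviation unit_left where
  "unit_left x y z b b' \<equiv> map_cell2 V (BCmp B x y z) b (T y z b) b' b' (\<eta> y z b) (VId (BHom B x y) b')"

abbreviation unit_right where
  "unit_right x y z b' b \<equiv> map_cell2 V (BCmp B x y z) b' b' b (T x y b) (VId (BHom B y z) b') (\<eta> x y b)"

abbreviation inverts_left where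
  "inverts_left x y z b b' \<equiv> cell_iso V (C x z) (FO (\<psi> x z) (hcomp B x y z b b'))
     (FO (\<psi> x z) (hcomp B x y z (T y z b) b'))
     (map_cell V (\<psi> x z) (hcomp B x y z b b') (hcomp B x y z (T y z b) b') (unit_left x y z b b'))"

abbreviation inverts_right where
  "inverts_right x y z b' b \<equiv> cell_iso V (C x z) (FO (\<psi> x z) (hcomp B x y z b' b))
     (FO (\<psi> x z) (hcomp B x y z b' (T x y b)))
     (map_cell V (\<psi> x z) (hcomp B x y z b' b) (hcomp B x y z b' (T x y b)) (unit_right x y z b' b))"

text \<open>In terms of orthogonality: the embedded 1-cell of \<open>c\<close> cannot distinguish a
  whiskered unit from an isomorphism. This is the intermediate notion to which all conditions on
  quotients are reduced.\<close>

abbreviation orthogonal_left where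
  "orthogonal_left x y z b b' c \<equiv> iso V (pre_comp V (BHom B x z) (FO (\<theta> x z) c)
     (hcomp B x y z b b') (hcomp B x y z (T y z b) b') (unit_left x y z b b'))"

abbreviation orthogonal_right where
  "orthogonal_right x y z b' b c \<equiv> iso V (pre_comp V (BHom B x z) (FO (\<theta> x z) c)
     (hcomp B x y z b' b) (hcomp B x y z b' (T x y b)) (unit_right x y z b' b))"

context
  fixes x y z
  assumes xyz: "x \<in> BOb B" "y \<in> BOb B" "z \<in> BOb B"
begin

lemma
  assumes "b \<in> VOb (BHom B y z)" "b' \<in> VOb (BHom B x y)"
  shows unit_left_cell: "unit_left x y z b b' \<in> cell V (BHom B x z) (hcomp B x y z b b') (hcomp B x y z (T y z b) b')"
    and unit_right_cell: "unit_right x y z b b' \<in> cell V (BHom B x z) (hcomp B x y z b b') (hcomp B x y z b (T x y b'))"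
  using assms xyz by (simp_all add: loc_typing)

lemma inverts_left_orthogonal:
  assumes "b \<in> VOb (BHom B y z)" "b' \<in> VOb (BHom B x y)" "c \<in> VOb (C x z)" "inverts_left x y z b b'"
  shows "orthogonal_left x y z b b' c"
  using assms xyz iso_pre_L_iff[OF hyps[OF xyz(1,3)] _ _ _ unit_left_cell, of b b' c]
  by (simp add: iso_pre[OF C_vcategory] loc_typing)

lemma inverts_right_orthogonal:
  assumes "b' \<in> VOb (BHom B y z)" "b \<in> VOb (BHom B x y)" "c \<in> VOb (C x z)" "inverts_right x y z b' b"
  shows "orthogonal_right x y z b' b c"
  using assms xyz iso_pre_L_iff[OF hyps[OF xyz(1,3)] _ _ _ unit_right_cell, of b' b c]
  by (simp add: iso_pre[OF C_vcategory] loc_typing)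

lemma orthogonal_left_rdiv:
  assumes "b \<in> VOb (BHom B y z)" "b' \<in> VOb (BHom B x y)" "c \<in> VOb (C x z)"
  shows "orthogonal_left x y z b b' c \<longleftrightarrow>
    iso V (pre_comp V (BHom B y z) (rdiv B x y z (FO (\<theta> x z) c) b') b (T y z b) (\<eta> y z b))"
  by (rule iso_pre_left_iff_rdiv[OF xyz]) (use assms xyz in \<open>simp_all add: loc_typing\<close>)

lemma orthogonal_right_ldiv:
  assumes "b' \<in> VOb (BHom B y z)" "b \<in> VOb (BHom B x y)" "c \<in> VOb (C x z)"
  shows "orthogonal_right x y z b' b c \<longleftrightarrow>
    iso V (pre_comp V (BHom B x y) (ldiv B x y z b' (FO (\<theta> x z) c)) b (T x y b) (\<eta> x y b))"
  by (rule iso_pre_right_iff_ldiv[OF xyz]) (use assms xyz in \<open>simp_all add: loc_typing\<close>)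

lemma orthogonal_left_ldiv:
  assumes "b \<in> VOb (BHom B y z)" "b' \<in> VOb (BHom B x y)" "c \<in> VOb (C x z)"
  shows "orthogonal_left x y z b b' c \<longleftrightarrow>
    iso V (post_comp V (BHom B x y) b' (ldiv B x y z (T y z b) (FO (\<theta> x z) c)) (ldiv B x y z b (FO (\<theta> x z) c))
      (map_cell2 V (LDiv B x y z) (T y z b) b (FO (\<theta> x z) c) (FO (\<theta> x z) c) (\<eta> y z b) (VId (BHom B x z) (FO (\<theta> x z) c))))"
  by (rule iso_pre_left_iff_ldiv[OF xyz]) (use assms xyz in \<open>simp_all add: loc_typing\<close>)

lemma orthogonal_right_rdiv:
  assumes "b' \<in> VOb (BHom B y z)" "b \<in> VOb (BHom B x y)" "c \<in> VOb (C x z)"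
  shows "orthogonal_right x y z b' b c \<longleftrightarrow>
    iso V (post_comp V (BHom B y z) b' (rdiv B x y z (FO (\<theta> x z) c) (T x y b)) (rdiv B x y z (FO (\<theta> x z) c) b)
      (map_cell2 V (RDiv B x y z) (FO (\<theta> x z) c) (FO (\<theta> x z) c) (T x y b) b (VId (BHom B x z) (FO (\<theta> x z) c)) (\<eta> x y b)))"
  by (rule iso_pre_right_iff_rdiv[OF xyz]) (use assms xyz in \<open>simp_all add: loc_typing\<close>)

text \<open>A local quotient is orthogonal to the bare unit, and residuation converts this into
  orthogonality of the dividend to the whiskered unit.\<close>

lemma local_rdiv_orthogonal:
  assumes "b \<in> VOb (BHom B y z)" "b' \<in> VOb (BHom B x y)" "c \<in> VOb (C x z)"
    and "cell_iso V (BHom B y z) q (T y z q) (\<eta> y z q)" "q = rdiv B x y z (FO (\<theta> x z) c) b'"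
  shows "orthogonal_left x y z b b' c"
  unfolding orthogonal_left_rdiv[OF assms(1-3)] using assms xyz
  by (intro iso_pre_unit_local[OF hyps[OF xyz(2,3)]]) (auto simp: loc_typing rdiv_in)

lemma local_ldiv_orthogonal:
  assumes "b' \<in> VOb (BHom B y z)" "b \<in> VOb (BHom B x y)" "c \<in> VOb (C x z)"
    and "cell_iso V (BHom B x y) q (T x y q) (\<eta> x y q)" "q = ldiv B x y z b' (FO (\<theta> x z) c)"
  shows "orthogonal_right x y z b' b c"
  unfolding orthogonal_right_ldiv[OF assms(1-3)] using assms xyz
  by (intro iso_pre_unit_local[OF hyps[OF xyz(1,2)]]) (auto simp: loc_typing ldiv_in)

context
  fixes \<A> :: "'x \<Rightarrow> 'x \<Rightarrow> 'b set" and \<D> :: "'x \<Rightarrow> 'x \<Rightarrow> 'c set"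
  assumes gen: "locally_strongly_generating V (BOb B) (BHom B) \<A>"
    and cogen: "locally_strongly_cogenerating V (BOb B) C \<D>"
begin

lemma generator_in: "a \<in> \<A> x y \<Longrightarrow> a \<in> VOb (BHom B x y)" "a \<in> \<A> y z \<Longrightarrow> a \<in> VOb (BHom B y z)"
  and cogenerator_in: "d \<in> \<D> x z \<Longrightarrow> d \<in> VOb (C x z)"
  using gen cogen xyz unfolding locally_strongly_generating_def locally_strongly_cogenerating_def by blast+

lemma generatorsI:
  assumes "p \<in> BOb B" "q \<in> BOb B" "a \<in> VOb (BHom B p q)" "b \<in> VOb (BHom B p q)" "f \<in> cell V (BHom B p q) a b"
    and "\<And>d. d \<in> \<A> p q \<Longrightarrow> iso V (post_comp V (BHom B p q) d a b f)"
  shows "cell_iso V (BHom B p q) a b f"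
  using gen assms unfolding locally_strongly_generating_def by blast

lemma cogeneratorsI:
  assumes "a \<in> VOb (C x z)" "b \<in> VOb (C x z)" "f \<in> cell V (C x z) a b"
    and "\<And>d. d \<in> \<D> x z \<Longrightarrow> iso V (pre_comp V (C x z) d a b f)"
  shows "cell_iso V (C x z) a b f"
  using cogen assms xyz unfolding locally_strongly_cogenerating_def by blast

lemma orthogonal_inverts_left:
  assumes "b \<in> VOb (BHom B y z)" "b' \<in> VOb (BHom B x y)" "\<And>d. d \<in> \<D> x z \<Longrightarrow> orthogonal_left x y z b b' d"
  shows "inverts_left x y z b b'"
  by (rule cogeneratorsI)
    (use assms xyz in \<open>simp_all add: loc_typing cogenerator_in iso_pre_L_iff[OF hyps[OF xyz(1,3)]]\<close>)

lemma orthogonal_inverts_right: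
  assumes "b' \<in> VOb (BHom B y z)" "b \<in> VOb (BHom B x y)" "\<And>d. d \<in> \<D> x z \<Longrightarrow> orthogonal_right x y z b' b d"
  shows "inverts_right x y z b' b"
  by (rule cogeneratorsI)
    (use assms xyz in \<open>simp_all add: loc_typing cogenerator_in iso_pre_L_iff[OF hyps[OF xyz(1,3)]]\<close>)

lemma generators_inverts_left:
  assumes b: "b \<in> VOb (BHom B y z)" and b': "b' \<in> VOb (BHom B x y)"
    and orth: "\<And>a d. \<lbrakk>a \<in> \<A> x y; d \<in> \<D> x z\<rbrakk> \<Longrightarrow> orthogonal_left x y z b a d"
  shows "inverts_left x y z b b'"
proof (rule orthogonal_inverts_left[OF b b'])
  fix d assume d: "d \<in> \<D> x z"
  let ?d = "FO (\<theta> x z) d"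
  have d': "d \<in> VOb (C x z)" "?d \<in> VOb (BHom B x z)" using d xyz by (simp_all add: cogenerator_in loc_typing)
  have Tb: "T y z b \<in> VOb (BHom B y z)" using b xyz by (simp add: loc_typing)
  have u: "\<eta> y z b \<in> cell V (vop V (BHom B y z)) (T y z b) b"
    using \<eta>_cell[OF xyz(2,3) b] by (simp add: cell_def)
  \<comment> \<open>The cell induced by the unit between the two left quotients of
    \<open>?d\<close>. Residuation identifies its action on maps out of a 1-cell with orthogonality
    for whiskering by that 1-cell, so generators detect that the cell itself is invertible, and then
    every \<open>b'\<close> may be used.\<close>
  have "cell_iso V (BHom B x y) (ldiv B x y z (T y z b) ?d) (ldiv B x y z b ?d)
      (map_cell2 V (LDiv B x y z) (T y z b) b ?d ?d (\<eta> y z b) (VId (BHom B x z) ?d))"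
  proof (rule generatorsI)
    fix a assume a: "a \<in> \<A> x y"
    have "inverts_left x y z b a"
      by (rule orthogonal_inverts_left) (use a b orth in \<open>auto simp: generator_in\<close>)
    then have "orthogonal_left x y z b a d"
      by (intro inverts_left_orthogonal) (use a b d' in \<open>auto simp: generator_in\<close>)
    then show "iso V (post_comp V (BHom B x y) a (ldiv B x y z (T y z b) ?d) (ldiv B x y z b ?d)
        (map_cell2 V (LDiv B x y z) (T y z b) b ?d ?d (\<eta> y z b) (VId (BHom B x z) ?d)))"
      using a b d' by (simp add: orthogonal_left_ldiv generator_in)
  qed (use b Tb d' xyz map_cell2_cell[OF LDiv_vmap[OF xyz] _ _ _ _ u, of ?d ?d] in \<open>auto simp: ldiv_in loc_typing\<close>)
  then show "orthogonal_left x y z b b' d"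
    unfolding orthogonal_left_ldiv[OF b b' d'(1)] using b b' Tb d' xyz
    by (intro iso_post[OF BHom_vcategory]) (auto simp: ldiv_in)
qed

lemma generators_inverts_right:
  assumes b': "b' \<in> VOb (BHom B y z)" and b: "b \<in> VOb (BHom B x y)"
    and orth: "\<And>a d. \<lbrakk>a \<in> \<A> y z; d \<in> \<D> x z\<rbrakk> \<Longrightarrow> orthogonal_right x y z a b d"
  shows "inverts_right x y z b' b"
proof (rule orthogonal_inverts_right[OF b' b])
  fix d assume d: "d \<in> \<D> x z"
  let ?d = "FO (\<theta> x z) d"
  have d': "d \<in> VOb (C x z)" "?d \<in> VOb (BHom B x z)" using d xyz by (simp_all add: cogenerator_in loc_typing)
  have Tb: "T x y b \<in> VOb (BHom B x y)" using b xyz by (simp add: loc_typing)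
  have u: "\<eta> x y b \<in> cell V (vop V (BHom B x y)) (T x y b) b"
    using \<eta>_cell[OF xyz(1,2) b] by (simp add: cell_def)
  have "cell_iso V (BHom B y z) (rdiv B x y z ?d (T x y b)) (rdiv B x y z ?d b)
      (map_cell2 V (RDiv B x y z) ?d ?d (T x y b) b (VId (BHom B x z) ?d) (\<eta> x y b))"
  proof (rule generatorsI)
    fix a assume a: "a \<in> \<A> y z"
    have "inverts_right x y z a b"
      by (rule orthogonal_inverts_right) (use a b orth in \<open>auto simp: generator_in\<close>)
    then have "orthogonal_right x y z a b d"
      by (intro inverts_right_orthogonal) (use a b d' in \<open>auto simp: generator_in\<close>)
    then show "iso V (post_comp V (BHom B y z) a (rdiv B x y z ?d (T x y b)) (rdiv B x y z ?d b)
        (map_cell2 V (RDiv B x y z) ?d ?d (T x y b) b (VId (BHom B x z) ?d) (\<eta> x y b)))"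
      using a b d' by (simp add: orthogonal_right_rdiv generator_in)
  qed (use b Tb d' xyz map_cell2_cell[OF RDiv_vmap[OF xyz] _ _ _ _ _ u, of ?d ?d] in \<open>auto simp: rdiv_in loc_typing\<close>)
  then show "orthogonal_right x y z b' b d"
    unfolding orthogonal_right_rdiv[OF b' b d'(1)] using b b' Tb d' xyz
    by (intro iso_post[OF BHom_vcategory]) (auto simp: rdiv_in)
qed

section \<open>Reduction of the individual conditions\<close>

lemma condition2:
  assumes "\<forall>d\<in>\<D> x z. \<forall>a\<in>\<A> x y. let q = rdiv B x y z (FO (\<theta> x z) d) a in
            cell_iso V (BHom B y z) q (T y z q) (\<eta> y z q)"
    and "\<forall>a\<in>\<A> y z. \<forall>d\<in>\<D> x z. let q = ldiv B x y z a (FO (\<theta> x z) d) in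
            cell_iso V (BHom B x y) q (T x y q) (\<eta> x y q)"
    and b: "b \<in> VOb (BHom B y z)" and b': "b' \<in> VOb (BHom B x y)"
  shows "inverts_left x y z b b' \<and> inverts_right x y z b b'"
  using assms by (auto intro!: generators_inverts_left generators_inverts_right
      local_rdiv_orthogonal local_ldiv_orthogonal simp: Let_def generator_in cogenerator_in)

text \<open>Generators and cogenerators are 1-cells of \<open>B\<close> and of \<open>C\<close>, so
  this is a special case of \<open>condition2\<close>.\<close>

lemma condition1:
  assumes "\<forall>c\<in>VOb (C x z). \<forall>b\<in>VOb (BHom B x y). let q = rdiv B x y z (FO (\<theta> x z) c) b in
            cell_iso V (BHom B y z) q (T y z q) (\<eta> y z q)"
    and "\<forall>b\<in>VOb (BHom B y z). \<forall>c\<in>VOb (C x z). let q = ldiv B x y z b (FO (\<theta> x z) c) in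
            cell_iso V (BHom B x y) q (T x y q) (\<eta> x y q)"
    and b: "b \<in> VOb (BHom B y z)" and b': "b' \<in> VOb (BHom B x y)"
  shows "inverts_left x y z b b' \<and> inverts_right x y z b b'"
  by (rule condition2[OF _ _ b b']) (use assms generator_in cogenerator_in in blast)+

text \<open>An invertible cell between quotients acts invertibly on maps out of every 1-cell.
  Residuation makes this orthogonality of each embedded object to the whiskered unit, and in
  particular of the cogenerators.\<close>

lemma condition3:
  assumes 1: "\<forall>b\<in>VOb (BHom B y z). \<forall>c\<in>VOb (C x z). let c' = FO (\<theta> x z) c in
            cell_iso V (BHom B x y) (ldiv B x y z (T y z b) c') (ldiv B x y z b c')
              (map_cell2 V (LDiv B x y z) (T y z b) b c' c' (\<eta> y z b) (VId (BHom B x z) c'))"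
    and 2: "\<forall>c\<in>VOb (C x z). \<forall>b\<in>VOb (BHom B x y). let c' = FO (\<theta> x z) c in
            cell_iso V (BHom B y z) (rdiv B x y z c' (T x y b)) (rdiv B x y z c' b)
              (map_cell2 V (RDiv B x y z) c' c' (T x y b) b (VId (BHom B x z) c') (\<eta> x y b))"
    and b: "b \<in> VOb (BHom B y z)" and b': "b' \<in> VOb (BHom B x y)"
  shows "inverts_left x y z b b' \<and> inverts_right x y z b b'"
proof
  show "inverts_left x y z b b'"
  proof (rule orthogonal_inverts_left[OF b b'])
    fix d assume "d \<in> \<D> x z"
    then have d: "d \<in> VOb (C x z)" by (rule cogenerator_in)
    then show "orthogonal_left x y z b b' d"
      unfolding orthogonal_left_ldiv[OF b b' d] using 1 b b' xyz
      by (intro iso_post[OF BHom_vcategory]) (auto simp: Let_def ldiv_in loc_typing)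
  qed
  show "inverts_right x y z b b'"
  proof (rule orthogonal_inverts_right[OF b b'])
    fix d assume "d \<in> \<D> x z"
    then have d: "d \<in> VOb (C x z)" by (rule cogenerator_in)
    then show "orthogonal_right x y z b b' d"
      unfolding orthogonal_right_rdiv[OF b b' d] using 2 b b' xyz
      by (intro iso_post[OF BHom_vcategory]) (auto simp: Let_def rdiv_in loc_typing)
  qed
qed

text \<open>What \<open>\<psi>\<close> inverts is orthogonal to all embedded objects; this supplies
  the hypothesis on generators and cogenerators from which whiskering by a generator is extended to
  whiskering by any 1-cell.\<close>

lemma condition5:
  assumes "\<forall>b\<in>VOb (BHom B y z). \<forall>a\<in>\<A> x y. inverts_left x y z b a"
    and "\<forall>a\<in>\<A> y z. \<forall>b\<in>VOb (BHom B x y). inverts_right x y z a b"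
    and b: "b \<in> VOb (BHom B y z)" and b': "b' \<in> VOb (BHom B x y)"
  shows "inverts_left x y z b b' \<and> inverts_right x y z b b'"
proof
  show "inverts_left x y z b b'"
    by (rule generators_inverts_left[OF b b' inverts_left_orthogonal[OF b generator_in(1) cogenerator_in]])
      (use assms(1) b in blast)+
  show "inverts_right x y z b b'"
    by (rule generators_inverts_right[OF b b' inverts_right_orthogonal[OF generator_in(2) b' cogenerator_in]])
      (use assms(2) b' in blast)+
qed

end

end

text \<open>Separating the two units uses the hypothesis also at reflected 1-cells, not just at
  \<open>b\<close> and \<open>b'\<close>; it is therefore translated as a whole into the total
  category, where \<open>iso_whisker\<close> applies.\<close>

lemma condition6:
  assumes "\<forall>x\<in>BOb B. \<forall>y\<in>BOb B. \<forall>z\<in>BOb B. \<forall>b\<in>VOb (BHom B y z). \<forall>b'\<in>VOb (BHom B x y).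
            cell_iso V (C x z) (FO (\<psi> x z) (hcomp B x y z b b'))
              (FO (\<psi> x z) (hcomp B x y z (T y z b) (T x y b')))
              (map_cell V (\<psi> x z) (hcomp B x y z b b') (hcomp B x y z (T y z b) (T x y b'))
                (map_cell2 V (BCmp B x y z) b (T y z b) b' (T x y b') (\<eta> y z b) (\<eta> x y b')))"
    and xyz: "x \<in> BOb B" "y \<in> BOb B" "z \<in> BOb B" and b: "b \<in> VOb (BHom B y z)" and b': "b' \<in> VOb (BHom B x y)"
  shows "inverts_left x y z b b' \<and> inverts_right x y z b b'"
proof -
  have iso: "iso totC (tot_map V \<psi> (tot_prod V B (tot_unit \<theta> \<psi> \<eta> p) (tot_unit \<theta> \<psi> \<eta> q)))"
    if "p \<in> Ob totB" "q \<in> Ob totB" "fst p = fst (snd q)" for p q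
    using that assms(1) by (auto elim!: Ob_totE simp: iso_tot loc_typing)
  have "iso totC (tot_map V \<psi> (tot_prod V B (tot_unit \<theta> \<psi> \<eta> (y, z, b)) (\<one>\<^bsub>totB\<^esub> (x, y, b'))))"
    by (rule total.iso_whisker(1), rule iso, assumption+) (simp_all add: xyz b b')
  moreover have "iso totC (tot_map V \<psi> (tot_prod V B (\<one>\<^bsub>totB\<^esub> (y, z, b)) (tot_unit \<theta> \<psi> \<eta> (x, y, b'))))"
    by (rule total.iso_whisker(2), rule iso, assumption+) (simp_all add: xyz b b')
  ultimately show ?thesis by (simp add: iso_tot)
qed

end

section \<open>The reflected bicategory\<close>

fun tot_cell :: "'x \<times> 'x \<times> 'a \<times> 'm \<times> 'a \<Rightarrow> 'm" where
  "tot_cell (x, y, a, f, b) = f"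

locale compatible_locally_reflective = locally_reflective +
  assumes left_iso: "\<lbrakk>x \<in> BOb B; y \<in> BOb B; z \<in> BOb B; b \<in> VOb (BHom B y z); b' \<in> VOb (BHom B x y)\<rbrakk> \<Longrightarrow>
      inverts_left x y z b b'"
    and right_iso: "\<lbrakk>x \<in> BOb B; y \<in> BOb B; z \<in> BOb B; b \<in> VOb (BHom B y z); b' \<in> VOb (BHom B x y)\<rbrakk> \<Longrightarrow>
      inverts_right x y z b b'"
begin

sublocale total: compatible_reflection totB totC "BOb B" fst "\<lambda>p. fst (snd p)"
  "tot_ob \<psi>" "tot_map V \<psi>" "tot_ob \<theta>" "tot_map V \<theta>" "tot_unit \<theta> \<psi> \<eta>" "tot_counit \<theta> \<psi> \<epsilon>"
  "tot_prod_ob B" "tot_prod V B" "\<lambda>x. (x, x, BId B x)" "tot_assoc B" "tot_lunit B" "tot_runit B"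
  by unfold_locales (auto elim!: Ob_totE simp: iso_tot loc_typing left_iso right_iso)

abbreviation embedded_comp where
  "embedded_comp x y z \<equiv> vfun_comp V (BCmp B x y z) (vfun_tensor V (\<theta> y z) (\<theta> x y))"

abbreviation refl_comp where
  "refl_comp x y z \<equiv> vfun_comp V (\<psi> x z) (embedded_comp x y z)"

abbreviation refl_rdiv where
  "refl_rdiv x y z \<equiv> vfun_comp V (\<psi> y z) (vfun_comp V (RDiv B x y z) (vfun_tensor V (\<theta> x z) (vfun_op (\<theta> x y))))"

abbreviation refl_ldiv where
  "refl_ldiv x y z \<equiv> vfun_comp V (\<psi> x y) (vfun_comp V (LDiv B x y z) (vfun_tensor V (vfun_op (\<theta> y z)) (\<theta> x z)))"

text \<open>The quotients are reflections of quotients in \<open>B\<close>, with which the unit will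
  identify them. \<open>LIso\<close> is accordingly a composite of four steps: transposition from
  \<open>C\<close> to \<open>B\<close>, residuation in \<open>B\<close>, composition with the unit
  at the quotient, and return to \<open>C\<close> by inverting the action of
  \<open>\<theta>\<close>; \<open>RIso\<close> is built in the same way.\<close>

definition refl_bicat where
  "refl_bicat =
     \<lparr>BOb = BOb B, BHom = C, BCmp = refl_comp, BId = \<lambda>x. FO (\<psi> x x) (BId B x),
     BAssoc = \<lambda>w x y z ((f, g), h). tot_cell (total.\<alpha>\<^sub>C (y, z, f) (x, y, g) (w, x, h)),
     BLunit = \<lambda>x y f. tot_cell (total.\<upsilon>\<^sub>C (x, y, f)),
     BRunit = \<lambda>x y f. tot_cell (total.\<rho>\<^sub>C (x, y, f)),
     RDiv = refl_rdiv, LDiv = refl_ldiv,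
     LIso = \<lambda>x y z ((f, g), h).
       let fg = hcomp B x y z (FO (\<theta> y z) f) (FO (\<theta> x y) g); q = ldiv B x y z (FO (\<theta> y z) f) (FO (\<theta> x z) h) in
       name (VHom (C x z) (FO (\<psi> x z) fg) h) (VHom (C x y) g (FO (\<psi> x y) q))
         (inv_arr V (FM (\<theta> x y) g (FO (\<psi> x y) q)) \<cdot>
          post_comp V (BHom B x y) (FO (\<theta> x y) g) q (T x y q) (\<eta> x y q) \<cdot>
          lres x y z (FO (\<theta> y z) f) (FO (\<theta> x y) g) (FO (\<theta> x z) h) \<cdot>
          pre_comp V (BHom B x z) (FO (\<theta> x z) h) fg (T x z fg) (\<eta> x z fg) \<cdot>
          FM (\<theta> x z) (FO (\<psi> x z) fg) h),
     RIso = \<lambda>x y z ((f, g), h).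
       let fg = hcomp B x y z (FO (\<theta> y z) f) (FO (\<theta> x y) g); q = rdiv B x y z (FO (\<theta> x z) h) (FO (\<theta> x y) g) in
       name (VHom (C x z) (FO (\<psi> x z) fg) h) (VHom (C y z) f (FO (\<psi> y z) q))
         (inv_arr V (FM (\<theta> y z) f (FO (\<psi> y z) q)) \<cdot>
          post_comp V (BHom B y z) (FO (\<theta> y z) f) q (T y z q) (\<eta> y z q) \<cdot>
          rres x y z (FO (\<theta> y z) f) (FO (\<theta> x y) g) (FO (\<theta> x z) h) \<cdot>
          pre_comp V (BHom B x z) (FO (\<theta> x z) h) fg (T x z fg) (\<eta> x z fg) \<cdot>
          FM (\<theta> x z) (FO (\<psi> x z) fg) h)\<rparr>"

lemma refl_simps [simp]:
  "BOb refl_bicat = BOb B" "BHom refl_bicat = C" "BCmp refl_bicat = refl_comp" "BId refl_bicat x = FO (\<psi> x x) (BId B x)"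
  "RDiv refl_bicat = refl_rdiv" "LDiv refl_bicat = refl_ldiv"
  by (simp_all add: refl_bicat_def)

lemmas fm_typing = Arr_FM[OF \<psi>_vmap] Dom_FM[OF \<psi>_vmap] Cod_FM[OF \<psi>_vmap]
  Arr_FM[OF \<theta>_vmap] Dom_FM[OF \<theta>_vmap] Cod_FM[OF \<theta>_vmap] res_typing loc_typing

lemma
  assumes "x \<in> BOb B" "y \<in> BOb B" "z \<in> BOb B"
  shows embedded_comp_vmap: "vmap V (vtensor V (C y z) (C x y)) (BHom B x z) (embedded_comp x y z)"
    and refl_comp_vfunctor: "vfunctor V (vtensor V (C y z) (C x y)) (C x z) (refl_comp x y z)"
proof -
  have "vfunctor V (vtensor V (C y z) (C x y)) (BHom B x z) (embedded_comp x y z)"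
    using assms by (intro vfunctor_comp[OF vfunctor_tensor BCmp_vfunctor] \<theta>_vfunctor vgraph_vtensor BHom_vgraph C_vgraph)
  then show "vmap V (vtensor V (C y z) (C x y)) (BHom B x z) (embedded_comp x y z)"
    "vfunctor V (vtensor V (C y z) (C x y)) (C x z) (refl_comp x y z)"
    using assms by (auto intro: vfunctor_vmap vfunctor_comp[OF _ \<psi>_vfunctor] vgraph_vtensor BHom_vgraph C_vgraph)
qed

lemmas refl_comp_vmap = vfunctor_vmap[OF refl_comp_vfunctor]

lemma map_cell_refl_comp:
  assumes "x \<in> BOb B" "y \<in> BOb B" "z \<in> BOb B" "f \<in> VOb (C y z)" "f' \<in> VOb (C y z)" "g \<in> VOb (C x y)" "g' \<in> VOb (C x y)"
    and u: "u \<in> cell V (C y z) f f'" and v: "v \<in> cell V (C x y) g g'"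
  shows "map_cell2 V (refl_comp x y z) f f' g g' u v =
    map_cell V (\<psi> x z) (hcomp B x y z (FO (\<theta> y z) f) (FO (\<theta> x y) g)) (hcomp B x y z (FO (\<theta> y z) f') (FO (\<theta> x y) g'))
      (map_cell2 V (BCmp B x y z) (FO (\<theta> y z) f) (FO (\<theta> y z) f') (FO (\<theta> x y) g) (FO (\<theta> x y) g')
        (map_cell V (\<theta> y z) f f' u) (map_cell V (\<theta> x y) g g' v))"
proof -
  note t = cellD[OF u] cellD[OF v] cellD[OF pair_cell_cell[OF u v]]
  have "(FM (\<theta> y z) f f' \<odot> FM (\<theta> x y) g g') \<cdot> pair_cell V u v =
      pair_cell V (map_cell V (\<theta> y z) f f' u) (map_cell V (\<theta> x y) g g' v)"
    using assms by (subst pair_cell_tensor[OF u v]) (simp_all add: fm_typing map_cell_def)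
  then show ?thesis
    using assms t by (simp add: map_cell2_def map_cell_def fm_typing v_typing assoc_Cmp)
qed

text \<open>The dictionary between the constraint of the total category, a tuple with its endpoints,
  and the component stored in \<open>refl_bicat\<close>. Coherence equations between tuples are
  unpacked with it into the bicategory axioms.\<close>

lemma \<alpha>\<^sub>C_tot:
  assumes "w \<in> BOb B" "x \<in> BOb B" "y \<in> BOb B" "z \<in> BOb B" "f \<in> VOb (C y z)" "g \<in> VOb (C x y)" "h \<in> VOb (C w x)"
  shows "total.\<alpha>\<^sub>C (y, z, f) (x, y, g) (w, x, h) =
      (w, z, hcomp refl_bicat w x z (hcomp refl_bicat x y z f g) h, BAssoc refl_bicat w x y z ((f, g), h), hcomp refl_bicat w y z f (hcomp refl_bicat w x y g h))"
    and "cell_iso V (C w z) (hcomp refl_bicat w x z (hcomp refl_bicat x y z f g) h) (hcomp refl_bicat w y z f (hcomp refl_bicat w x y g h))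
      (BAssoc refl_bicat w x y z ((f, g), h))"
  using total.\<alpha>\<^sub>C_in[of "(y, z, f)" "(x, y, g)" "(w, x, h)"] total.iso_\<alpha>\<^sub>C[of "(y, z, f)" "(x, y, g)" "(w, x, h)"] assms
  by (cases "total.\<alpha>\<^sub>C (y, z, f) (x, y, g) (w, x, h)"; simp add: refl_bicat_def Hom_tot total.tens_def iso_tot)+

lemma
  assumes "x \<in> BOb B" "y \<in> BOb B" "f \<in> VOb (C x y)"
  shows \<upsilon>\<^sub>C_tot: "total.\<upsilon>\<^sub>C (x, y, f) = (x, y, hcomp refl_bicat x y y (BId refl_bicat y) f, BLunit refl_bicat x y f, f)"
    and BLunit_refl_iso: "cell_iso V (C x y) (hcomp refl_bicat x y y (BId refl_bicat y) f) f (BLunit refl_bicat x y f)"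
    and \<rho>\<^sub>C_tot: "total.\<rho>\<^sub>C (x, y, f) = (x, y, hcomp refl_bicat x x y f (BId refl_bicat x), BRunit refl_bicat x y f, f)"
    and BRunit_refl_iso: "cell_iso V (C x y) (hcomp refl_bicat x x y f (BId refl_bicat x)) f (BRunit refl_bicat x y f)"
  using total.\<upsilon>\<^sub>C_in[of "(x, y, f)"] total.iso_\<upsilon>\<^sub>C[of "(x, y, f)"]
    total.\<rho>\<^sub>C_in[of "(x, y, f)"] total.iso_\<rho>\<^sub>C[of "(x, y, f)"] assms
  by (cases "total.\<upsilon>\<^sub>C (x, y, f)"; cases "total.\<rho>\<^sub>C (x, y, f)"; simp add: refl_bicat_def Hom_tot total.tens_def iso_tot)+

section \<open>Enriched naturality of the reflected constraints\<close>

lemmas graphs = BHom_vgraph C_vgraph vgraph_vtensor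

text \<open>The functor \<open>K\<close> is left open because whiskered units are needed at pairs of
  different shapes: a composite followed by a 1-cell, a 1-cell followed by a composite, and a plain
  pair.\<close>

lemma
  assumes xyz: "x \<in> BOb B" "y \<in> BOb B" "z \<in> BOb B"
    and K: "vmap V W (vtensor V (BHom B y z) (BHom B x y)) K"
  shows unit_left_vnatural: "vnatural V W (C x z) (vfun_comp V (\<psi> x z) (vfun_comp V (BCmp B x y z) K))
      (vfun_comp V (\<psi> x z) (vfun_comp V (BCmp B x y z)
        (vfun_comp V (vfun_tensor V (vfun_comp V (\<theta> y z) (\<psi> y z)) (vfun_id V (BHom B x y))) K)))
      (\<lambda>w. case FO K w of (b, b') \<Rightarrow> map_cell V (\<psi> x z) (hcomp B x y z b b') (hcomp B x y z (T y z b) b') (unit_left x y z b b'))"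
    and unit_right_vnatural: "vnatural V W (C x z) (vfun_comp V (\<psi> x z) (vfun_comp V (BCmp B x y z) K))
      (vfun_comp V (\<psi> x z) (vfun_comp V (BCmp B x y z)
        (vfun_comp V (vfun_tensor V (vfun_id V (BHom B y z)) (vfun_comp V (\<theta> x y) (\<psi> x y))) K)))
      (\<lambda>w. case FO K w of (b, b') \<Rightarrow> map_cell V (\<psi> x z) (hcomp B x y z b b') (hcomp B x y z b (T x y b')) (unit_right x y z b b'))"
    and unit_both_vnatural: "vnatural V W (C x z) (vfun_comp V (\<psi> x z) (vfun_comp V (BCmp B x y z) K))
      (vfun_comp V (\<psi> x z) (vfun_comp V (BCmp B x y z)
        (vfun_comp V (vfun_tensor V (vfun_comp V (\<theta> y z) (\<psi> y z)) (vfun_comp V (\<theta> x y) (\<psi> x y))) K)))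
      (\<lambda>w. case FO K w of (b, b') \<Rightarrow> map_cell V (\<psi> x z) (hcomp B x y z b b') (hcomp B x y z (T y z b) (T x y b'))
        (map_cell2 V (BCmp B x y z) b (T y z b) b' (T x y b') (\<eta> y z b) (\<eta> x y b')))"
proof -
  have g: "vgraph V (BHom B y z)" "vgraph V (BHom B x y)" "vgraph V (BHom B x z)" "vgraph V (C x z)"
    "vgraph V (vtensor V (BHom B y z) (BHom B x y))"
    using xyz by (auto intro: graphs)
  note m = vmap_id[OF g(1)] vmap_id[OF g(2)] vmap_comp[OF \<psi>_vmap \<theta>_vmap, OF xyz(2,3,2,3)]
    vmap_comp[OF \<psi>_vmap \<theta>_vmap, OF xyz(1,2,1,2)]
  note Y = BHom_vcategory[OF xyz(2,3)] BHom_vcategory[OF xyz(1,2)]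
  note t = vnatural_apply[OF vnatural_apply[OF vnatural_whisker[OF _ K g(5)] BCmp_vfunctor[OF xyz] g(5,3)]
      \<psi>_vfunctor[OF xyz(1,3)] g(3,4)]
  note mm = vmap_tensor[OF m(1,2)] vmap_tensor[OF m(3,2)] vmap_tensor[OF m(1,4)] vmap_tensor[OF m(3,4)]
  note mk = vmap_comp[OF K mm(1)] vmap_comp[OF K mm(2)] vmap_comp[OF K mm(3)] vmap_comp[OF K mm(4)]
  note mb = vmap_comp[OF mk(1) BCmp_vmap[OF xyz]] vmap_comp[OF mk(2) BCmp_vmap[OF xyz]]
    vmap_comp[OF mk(3) BCmp_vmap[OF xyz]] vmap_comp[OF mk(4) BCmp_vmap[OF xyz]]
  note tl = t[OF vnatural_tensor[OF \<eta>_vnatural[OF xyz(2,3)] vnatural_VId[OF Y(2) m(2)] g(1,2) m(1,3) m(2,2)] mm(1,2) mk(1,2) mb(1,2)]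
  note tr = t[OF vnatural_tensor[OF vnatural_VId[OF Y(1) m(1)] \<eta>_vnatural[OF xyz(1,2)] g(1,2) m(1,1) m(2,4)] mm(1,3) mk(1,3) mb(1,3)]
  note tb = t[OF vnatural_tensor[OF \<eta>_vnatural[OF xyz(2,3)] \<eta>_vnatural[OF xyz(1,2)] g(1,2) m(1,3) m(2,4)] mm(1,4) mk(1,4) mb(1,4)]
  define k where "k w = fst (FO K w)" for w
  define k' where "k' w = snd (FO K w)" for w
  have K1: "FO K w = (k w, k' w)" "k w \<in> VOb (BHom B y z)" "k' w \<in> VOb (BHom B x y)" if "w \<in> VOb W" for w
    using vmap_FO[OF K that] by (auto simp: k_def k'_def)
  \<comment> \<open>Tensoring the unit transformations yields a functor of the form identity tensor
    identity, composed with \<open>K\<close>; this equation identifies its action with that of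
    \<open>K\<close>.\<close>
  have K2: "(\<one> (VHom (BHom B y z) (k w) (k w')) \<odot> \<one> (VHom (BHom B x y) (k' w) (k' w'))) \<cdot> FM K w w' = FM K w w'"
    if "w \<in> VOb W" "w' \<in> VOb W" for w w'
    using that Arr_FM[OF K that] Cod_FM[OF K that] g
    by (simp add: K1 tensor_Idn Idn_left v_typing)
  show "vnatural V W (C x z) (vfun_comp V (\<psi> x z) (vfun_comp V (BCmp B x y z) K))
      (vfun_comp V (\<psi> x z) (vfun_comp V (BCmp B x y z)
        (vfun_comp V (vfun_tensor V (vfun_comp V (\<theta> y z) (\<psi> y z)) (vfun_id V (BHom B x y))) K)))
      (\<lambda>w. case FO K w of (b, b') \<Rightarrow> map_cell V (\<psi> x z) (hcomp B x y z b b') (hcomp B x y z (T y z b) b') (unit_left x y z b b'))"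
    by (rule vnatural_cong[OF tl]) (simp_all add: K1 K2 map_cell2_def)
  show "vnatural V W (C x z) (vfun_comp V (\<psi> x z) (vfun_comp V (BCmp B x y z) K))
      (vfun_comp V (\<psi> x z) (vfun_comp V (BCmp B x y z)
        (vfun_comp V (vfun_tensor V (vfun_id V (BHom B y z)) (vfun_comp V (\<theta> x y) (\<psi> x y))) K)))
      (\<lambda>w. case FO K w of (b, b') \<Rightarrow> map_cell V (\<psi> x z) (hcomp B x y z b b') (hcomp B x y z b (T x y b')) (unit_right x y z b b'))"
    by (rule vnatural_cong[OF tr]) (simp_all add: K1 K2 map_cell2_def)
  show "vnatural V W (C x z) (vfun_comp V (\<psi> x z) (vfun_comp V (BCmp B x y z) K))
      (vfun_comp V (\<psi> x z) (vfun_comp V (BCmp B x y z)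
        (vfun_comp V (vfun_tensor V (vfun_comp V (\<theta> y z) (\<psi> y z)) (vfun_comp V (\<theta> x y) (\<psi> x y))) K)))
      (\<lambda>w. case FO K w of (b, b') \<Rightarrow> map_cell V (\<psi> x z) (hcomp B x y z b b') (hcomp B x y z (T y z b) (T x y b'))
        (map_cell2 V (BCmp B x y z) b (T y z b) b' (T x y b') (\<eta> y z b) (\<eta> x y b')))"
    by (rule vnatural_cong[OF tb]) (simp_all add: K1 K2 map_cell2_def)
qed

text \<open>By its defining equation the reflected associator turns the whiskered unit
  \<open>?t\<close> into the composite of \<open>?r1\<close> and \<open>?r2\<close>. All three of
  these are natural and \<open>?t\<close> is invertible, so \<open>vnatural_cancel\<close>
  applies.\<close>

lemma BAssoc_refl_vnatural:
  assumes wxyz: "w \<in> BOb B" "x \<in> BOb B" "y \<in> BOb B" "z \<in> BOb B"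
  shows "vnatural V (vtensor V (vtensor V (C y z) (C x y)) (C w x)) (C w z)
         (vfun_comp V (refl_comp w x z) (vfun_tensor V (refl_comp x y z) (vfun_id V (C w x))))
         (vfun_comp V (refl_comp w y z)
           (vfun_comp V (vfun_tensor V (vfun_id V (C y z)) (refl_comp w x y))
             (vfun_assoc V (C y z) (C x y) (C w x))))
         (BAssoc refl_bicat w x y z)" (is "vnatural V ?W _ ?G ?H ?s")
proof -
  let ?K1 = "vfun_tensor V (embedded_comp x y z) (\<theta> w x)"
  let ?K2 = "vfun_comp V (vfun_tensor V (\<theta> y z) (embedded_comp w x y)) (vfun_assoc V (C y z) (C x y) (C w x))"
  let ?E = "vfun_tensor V (vfun_tensor V (\<theta> y z) (\<theta> x y)) (\<theta> w x)"
  \<comment> \<open>\<open>?F\<close> and \<open>?F'\<close> are the reflections of the two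
    bracketings of embedded 1-cells formed in \<open>B\<close>; \<open>?G\<close> and
    \<open>?H\<close> are the bracketings in \<open>C\<close>, which contain an additional
    reflection inside. The units compare \<open>?F\<close> with \<open>?G\<close> and
    \<open>?F'\<close> with \<open>?H\<close>.\<close>
  let ?F = "vfun_comp V (\<psi> w z) (vfun_comp V (BCmp B w x z) ?K1)"
  let ?F' = "vfun_comp V (\<psi> w z) (vfun_comp V (BCmp B w y z) ?K2)"
  note [simp] = wxyz fm_typing
  have K1: "vmap V ?W (vtensor V (BHom B x z) (BHom B w x)) ?K1"
    by (intro vmap_tensor embedded_comp_vmap \<theta>_vmap) simp_all
  have K2: "vmap V ?W (vtensor V (BHom B y z) (BHom B w y)) ?K2"
    by (intro vmap_comp[OF vmap_assoc vmap_tensor] embedded_comp_vmap \<theta>_vmap) simp_all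
  have E: "vmap V ?W (vtensor V (vtensor V (BHom B y z) (BHom B x y)) (BHom B w x)) ?E"
    by (intro vmap_tensor \<theta>_vmap) simp_all
  have F: "vmap V ?W (C w z) ?F"
    by (rule vmap_comp[OF vmap_comp[OF K1 BCmp_vmap] \<psi>_vmap]) simp_all
  have F': "vmap V ?W (C w z) ?F'"
    by (rule vmap_comp[OF vmap_comp[OF K2 BCmp_vmap] \<psi>_vmap]) simp_all
  have G: "vmap V ?W (C w z) ?G"
    by (rule vmap_comp[OF vmap_tensor[OF refl_comp_vmap vmap_id] refl_comp_vmap]) simp_all
  have H: "vmap V ?W (C w z) ?H"
    by (rule vmap_comp[OF vmap_comp[OF vmap_assoc vmap_tensor[OF vmap_id refl_comp_vmap]] refl_comp_vmap]) simp_all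
  let ?fg = "\<lambda>f g. hcomp B x y z (FO (\<theta> y z) f) (FO (\<theta> x y) g)" and ?gh = "\<lambda>g h. hcomp B w x y (FO (\<theta> x y) g) (FO (\<theta> w x) h)"
  let ?t = "\<lambda>((f, g), h). map_cell V (\<psi> w z) (hcomp B w x z (?fg f g) (FO (\<theta> w x) h))
      (hcomp B w x z (T x z (?fg f g)) (FO (\<theta> w x) h)) (unit_left w x z (?fg f g) (FO (\<theta> w x) h))"
  let ?r1 = "\<lambda>((f, g), h). map_cell V (\<psi> w z) (hcomp B w x z (?fg f g) (FO (\<theta> w x) h))
      (hcomp B w y z (FO (\<theta> y z) f) (?gh g h)) (BAssoc B w x y z ((FO (\<theta> y z) f, FO (\<theta> x y) g), FO (\<theta> w x) h))"
  let ?r2 = "\<lambda>((f, g), h). map_cell V (\<psi> w z) (hcomp B w y z (FO (\<theta> y z) f) (?gh g h))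
      (hcomp B w y z (FO (\<theta> y z) f) (T w y (?gh g h))) (unit_right w y z (FO (\<theta> y z) f) (?gh g h))"
  have t: "vnatural V ?W (C w z) ?F ?G ?t"
    by (rule vnatural_cong[OF unit_left_vnatural[OF wxyz(1,2,4) K1]]) (auto simp: v_simps)
  have bs: "vmap V ?W (BHom B w z) (vfun_comp V (vfun_comp V (BCmp B w x z) (vfun_tensor V (BCmp B x y z) (vfun_id V (BHom B w x)))) ?E)"
    "vmap V ?W (BHom B w z) (vfun_comp V (vfun_comp V (BCmp B w y z)
           (vfun_comp V (vfun_tensor V (vfun_id V (BHom B y z)) (BCmp B w x y))
             (vfun_assoc V (BHom B y z) (BHom B x y) (BHom B w x)))) ?E)"
    by (rule vmap_comp[OF E assoc_vmap(1)[OF wxyz]], rule vmap_comp[OF E assoc_vmap(2)[OF wxyz]])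
  have r1: "vnatural V ?W (C w z) ?F ?F' ?r1"
    by (rule vnatural_cong[OF vnatural_apply[OF vnatural_whisker[OF BAssoc_vnatural[OF wxyz] E _ assoc_vmap[OF wxyz]]
            \<psi>_vfunctor _ _ bs]])
      (auto simp: v_simps assoc_natural)
  have r2: "vnatural V ?W (C w z) ?F' ?H ?r2"
    by (rule vnatural_cong[OF unit_right_vnatural[OF wxyz(1,3,4) K2]]) (auto simp: v_simps)
  note r = vnatural_comp[OF C_vcategory[OF wxyz(1,4)] F F' H r1 r2]
  show ?thesis
  proof (rule vnatural_cancel[OF C_vcategory[OF wxyz(1,4)] F G H t r])
    fix a assume "a \<in> VOb ?W"
    then obtain f g h where a: "a = ((f, g), h)" and ob: "f \<in> VOb (C y z)" "g \<in> VOb (C x y)" "h \<in> VOb (C w x)"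
      by auto
    note s = \<alpha>\<^sub>C_tot[OF wxyz ob]
    show "cell_iso V (C w z) (FO ?F a) (FO ?G a) (?t a)"
      using ob left_iso by (simp add: a)
    show "?s a \<in> cell V (C w z) (FO ?G a) (FO ?H a)"
      using cell_iso_cell[OF s(2)] by (simp add: a)
    show "cell_comp V (C w z) (FO ?F a) (FO ?F' a) (FO ?H a) (?r2 a) (?r1 a) =
        cell_comp V (C w z) (FO ?F a) (FO ?G a) (FO ?H a) (?s a) (?t a)"
      using total.\<alpha>\<^sub>C_left[of "(y, z, f)" "(x, y, g)" "(w, x, h)"] ob s(1) by (simp add: a)
  qed
qed

text \<open>Cancellation as for the associator. The second leg passes through \<open>?P\<close>,
  because the unit constraint of \<open>B\<close> ends at an embedded 1-cell whose reflection has to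
  be brought back to the 1-cell itself by the counit.\<close>

lemma unit_refl_vnatural:
  assumes xy: "x \<in> BOb B" "y \<in> BOb B"
  shows BLunit_refl_vnatural: "vnatural V (C x y) (C x y)
      (vfun_fix_left V (C y y) (C x y) (refl_comp x y y) (FO (\<psi> y y) (BId B y))) (vfun_id V (C x y)) (BLunit refl_bicat x y)"
    and BRunit_refl_vnatural: "vnatural V (C x y) (C x y)
      (vfun_fix_right V (C x y) (C x x) (refl_comp x x y) (FO (\<psi> x x) (BId B x))) (vfun_id V (C x y)) (BRunit refl_bicat x y)"
proof -
  note [simp] = xy fm_typing
  let ?I = "BId B y" and ?J = "BId B x"
  let ?Fl = "vfun_comp V (\<psi> x y) (vfun_comp V (vfun_fix_left V (BHom B y y) (BHom B x y) (BCmp B x y y) ?I) (\<theta> x y))"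
  let ?Fr = "vfun_comp V (\<psi> x y) (vfun_comp V (vfun_fix_right V (BHom B x y) (BHom B x x) (BCmp B x x y) ?J) (\<theta> x y))"
  let ?Gl = "vfun_fix_left V (C y y) (C x y) (refl_comp x y y) (FO (\<psi> y y) ?I)"
  let ?Gr = "vfun_fix_right V (C x y) (C x x) (refl_comp x x y) (FO (\<psi> x x) ?J)"
  let ?P = "vfun_comp V (\<psi> x y) (\<theta> x y)"
  have Fl: "vmap V (C x y) (C x y) ?Fl" and Fr: "vmap V (C x y) (C x y) ?Fr"
    by (rule vmap_comp[OF vmap_comp[OF \<theta>_vmap unit_vmap(1)] \<psi>_vmap]; simp)
      (rule vmap_comp[OF vmap_comp[OF \<theta>_vmap unit_vmap(2)] \<psi>_vmap]; simp)
  have Gl: "vmap V (C x y) (C x y) ?Gl" and Gr: "vmap V (C x y) (C x y) ?Gr"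
    unfolding vfun_fix_left_eq vfun_fix_right_eq
    by (rule vmap_comp[OF vmap_pair_left refl_comp_vmap]; simp)
      (rule vmap_comp[OF vmap_pair_right refl_comp_vmap]; simp)
  have P: "vmap V (C x y) (C x y) ?P" and I: "vmap V (C x y) (C x y) (vfun_id V (C x y))"
    by (rule vmap_comp[OF \<theta>_vmap \<psi>_vmap]; simp) (rule vmap_id; simp)
  have I': "vmap V (BHom B x y) (BHom B x y) (vfun_id V (BHom B x y))"
    by (rule vmap_id) simp
  have pl: "vmap V (C x y) (vtensor V (BHom B y y) (BHom B x y)) (vfun_comp V (vfun_pair_left (BHom B y y) (BHom B x y) a) (\<theta> x y))"
    "vmap V (BHom B x y) (vtensor V (BHom B y y) (BHom B x y)) (vfun_pair_left (BHom B y y) (BHom B x y) a)"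
    if "a \<in> VOb (BHom B y y)" for a
    using that by (auto intro!: vmap_comp[OF \<theta>_vmap vmap_pair_left] vmap_pair_left)
  have pr: "vmap V (C x y) (vtensor V (BHom B x y) (BHom B x x)) (vfun_comp V (vfun_pair_right (BHom B x y) (BHom B x x) a) (\<theta> x y))"
    "vmap V (BHom B x y) (vtensor V (BHom B x y) (BHom B x x)) (vfun_pair_right (BHom B x y) (BHom B x x) a)"
    if "a \<in> VOb (BHom B x x)" for a
    using that by (auto intro!: vmap_comp[OF \<theta>_vmap vmap_pair_right] vmap_pair_right)
  have tl: "vnatural V (C x y) (C x y) ?Fl ?Gl (\<lambda>f. map_cell V (\<psi> x y) (hcomp B x y y ?I (FO (\<theta> x y) f))
      (hcomp B x y y (T y y ?I) (FO (\<theta> x y) f)) (unit_left x y y ?I (FO (\<theta> x y) f)))"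
    by (rule vnatural_cong[OF vnatural_apply[OF vnatural_apply[OF vnatural_whisker[OF
              vnatural_pair_left[OF BHom_vcategory BHom_vcategory _ _ \<eta>_cell] \<theta>_vmap _ pl(2) pl(2)]
            BCmp_vfunctor _ _ pl(1) pl(1)] \<psi>_vfunctor _ _ vmap_comp[OF pl(1) BCmp_vmap] vmap_comp[OF pl(1) BCmp_vmap]]])
      (auto simp: vfun_fix_left_def vfun_pair_left_def vgraph_vtensor v_simps li_natural map_cell2_def vfunctor.FM_VId[OF \<theta>_vfunctor])
  have tr: "vnatural V (C x y) (C x y) ?Fr ?Gr (\<lambda>f. map_cell V (\<psi> x y) (hcomp B x x y (FO (\<theta> x y) f) ?J)
      (hcomp B x x y (FO (\<theta> x y) f) (T x x ?J)) (unit_right x x y (FO (\<theta> x y) f) ?J))"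
    by (rule vnatural_cong[OF vnatural_apply[OF vnatural_apply[OF vnatural_whisker[OF
              vnatural_pair_right[OF BHom_vcategory BHom_vcategory _ _ \<eta>_cell] \<theta>_vmap _ pr(2) pr(2)]
            BCmp_vfunctor _ _ pr(1) pr(1)] \<psi>_vfunctor _ _ vmap_comp[OF pr(1) BCmp_vmap] vmap_comp[OF pr(1) BCmp_vmap]]])
      (auto simp: vfun_fix_right_def vfun_pair_right_def vgraph_vtensor v_simps ri_natural map_cell2_def vfunctor.FM_VId[OF \<theta>_vfunctor])
  have "vnatural V (C x y) (C x y) ?Fl ?P (\<lambda>f. map_cell V (\<psi> x y) (hcomp B x y y ?I (FO (\<theta> x y) f)) (FO (\<theta> x y) f) (BLunit B x y (FO (\<theta> x y) f)))"
    by (rule vnatural_cong[OF vnatural_apply[OF vnatural_whisker[OF BLunit_vnatural \<theta>_vmap _ unit_vmap(1) I'] \<psi>_vfunctor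
          _ _ vmap_comp[OF \<theta>_vmap unit_vmap(1)] vmap_comp[OF \<theta>_vmap I']]])
      (auto simp: v_simps vfun_fix_left_def)
  from vnatural_comp[OF C_vcategory Fl P I this \<epsilon>_vnatural]
  have rl: "vnatural V (C x y) (C x y) ?Fl (vfun_id V (C x y)) (\<lambda>f. cell_comp V (C x y) (FO ?Fl f) (FO ?P f) f (\<epsilon> x y f)
      (map_cell V (\<psi> x y) (hcomp B x y y ?I (FO (\<theta> x y) f)) (FO (\<theta> x y) f) (BLunit B x y (FO (\<theta> x y) f))))"
    by simp
  have "vnatural V (C x y) (C x y) ?Fr ?P (\<lambda>f. map_cell V (\<psi> x y) (hcomp B x x y (FO (\<theta> x y) f) ?J) (FO (\<theta> x y) f) (BRunit B x y (FO (\<theta> x y) f)))"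
    by (rule vnatural_cong[OF vnatural_apply[OF vnatural_whisker[OF BRunit_vnatural \<theta>_vmap _ unit_vmap(2) I'] \<psi>_vfunctor
          _ _ vmap_comp[OF \<theta>_vmap unit_vmap(2)] vmap_comp[OF \<theta>_vmap I']]])
      (auto simp: v_simps vfun_fix_right_def)
  from vnatural_comp[OF C_vcategory Fr P I this \<epsilon>_vnatural]
  have rr: "vnatural V (C x y) (C x y) ?Fr (vfun_id V (C x y)) (\<lambda>f. cell_comp V (C x y) (FO ?Fr f) (FO ?P f) f (\<epsilon> x y f)
      (map_cell V (\<psi> x y) (hcomp B x x y (FO (\<theta> x y) f) ?J) (FO (\<theta> x y) f) (BRunit B x y (FO (\<theta> x y) f))))"
    by simp
  show "vnatural V (C x y) (C x y) ?Gl (vfun_id V (C x y)) (BLunit refl_bicat x y)"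
  proof (rule vnatural_cancel[OF C_vcategory[OF xy] Fl Gl I tl rl])
    fix f assume f: "f \<in> VOb (C x y)"
    show "BLunit refl_bicat x y f \<in> cell V (C x y) (FO ?Gl f) (FO (vfun_id V (C x y)) f)"
      using cell_iso_cell[OF BLunit_refl_iso[OF xy f]] by (simp add: vfun_fix_left_def)
  qed (use total.\<upsilon>\<^sub>C_\<eta>[of "(x, y, _)"] \<upsilon>\<^sub>C_tot[OF xy] left_iso in \<open>simp_all add: vfun_fix_left_def\<close>)
  show "vnatural V (C x y) (C x y) ?Gr (vfun_id V (C x y)) (BRunit refl_bicat x y)"
  proof (rule vnatural_cancel[OF C_vcategory[OF xy] Fr Gr I tr rr])
    fix f assume f: "f \<in> VOb (C x y)"
    show "BRunit refl_bicat x y f \<in> cell V (C x y) (FO ?Gr f) (FO (vfun_id V (C x y)) f)"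
      using cell_iso_cell[OF BRunit_refl_iso[OF xy f]] by (simp add: vfun_fix_right_def)
  qed (use total.\<rho>\<^sub>C_\<eta>[of "(x, y, _)"] \<rho>\<^sub>C_tot[OF xy] right_iso in \<open>simp_all add: vfun_fix_right_def\<close>)
qed

lemma bicategory_refl: "bicategory V refl_bicat"
proof (intro bicategory.intro)
  note [simp] = fm_typing
  note tot_eqs = \<alpha>\<^sub>C_tot(1) \<upsilon>\<^sub>C_tot \<rho>\<^sub>C_tot
  note tc = cell_iso_cell[OF \<alpha>\<^sub>C_tot(2), simplified] cell_iso_cell[OF BLunit_refl_iso, simplified] cell_iso_cell[OF BRunit_refl_iso, simplified]
  show "vnatural_iso V (vtensor V (vtensor V (BHom refl_bicat y z) (BHom refl_bicat x y)) (BHom refl_bicat w x)) (BHom refl_bicat w z)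
         (vfun_comp V (BCmp refl_bicat w x z) (vfun_tensor V (BCmp refl_bicat x y z) (vfun_id V (BHom refl_bicat w x))))
         (vfun_comp V (BCmp refl_bicat w y z)
           (vfun_comp V (vfun_tensor V (vfun_id V (BHom refl_bicat y z)) (BCmp refl_bicat w x y))
             (vfun_assoc V (BHom refl_bicat y z) (BHom refl_bicat x y) (BHom refl_bicat w x))))
         (BAssoc refl_bicat w x y z)"
    if "w \<in> BOb refl_bicat" "x \<in> BOb refl_bicat" "y \<in> BOb refl_bicat" "z \<in> BOb refl_bicat" for w x y z
    using that BAssoc_refl_vnatural[of w x y z] \<alpha>\<^sub>C_tot(2)[of w x y z]
    by (auto intro!: vnatural_iso.intro vnatural_iso_axioms.intro)
  show "vnatural_iso V (BHom refl_bicat x y) (BHom refl_bicat x y)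
         (vfun_fix_left V (BHom refl_bicat y y) (BHom refl_bicat x y) (BCmp refl_bicat x y y) (BId refl_bicat y))
         (vfun_id V (BHom refl_bicat x y)) (BLunit refl_bicat x y)"
    "vnatural_iso V (BHom refl_bicat x y) (BHom refl_bicat x y)
         (vfun_fix_right V (BHom refl_bicat x y) (BHom refl_bicat x x) (BCmp refl_bicat x x y) (BId refl_bicat x))
         (vfun_id V (BHom refl_bicat x y)) (BRunit refl_bicat x y)"
    if "x \<in> BOb refl_bicat" "y \<in> BOb refl_bicat" for x y
    using that unit_refl_vnatural[of x y] BLunit_refl_iso[of x y] BRunit_refl_iso[of x y]
    by (auto intro!: vnatural_iso.intro vnatural_iso_axioms.intro simp: vfun_fix_left_def vfun_fix_right_def)
  fix x y z f g
  assume a: "x \<in> BOb refl_bicat" "y \<in> BOb refl_bicat" "z \<in> BOb refl_bicat" "f \<in> VOb (BHom refl_bicat y z)" "g \<in> VOb (BHom refl_bicat x y)"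
  show "let fI = hcomp refl_bicat y y z f (BId refl_bicat y); Ig = hcomp refl_bicat x y y (BId refl_bicat y) g
       in cell_comp V (BHom refl_bicat x z) (hcomp refl_bicat x y z fI g) (hcomp refl_bicat x y z f Ig) (hcomp refl_bicat x y z f g)
            (map_cell2 V (BCmp refl_bicat x y z) f f Ig g (VId (BHom refl_bicat y z) f) (BLunit refl_bicat x y g))
            (BAssoc refl_bicat x y y z ((f, BId refl_bicat y), g)) =
          map_cell2 V (BCmp refl_bicat x y z) fI f g g (BRunit refl_bicat y z f) (VId (BHom refl_bicat x y) g)"
    using total.triangle\<^sub>C[of "(y, z, f)" "(x, y, g)"] a
    by (simp add: Let_def total.tens_arr_def tot_eqs map_cell_refl_comp tc)
  fix v w h k
  assume b: "v \<in> BOb refl_bicat" "w \<in> BOb refl_bicat" "h \<in> VOb (BHom refl_bicat w x)" "k \<in> VOb (BHom refl_bicat v w)"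
  show "let fg = hcomp refl_bicat x y z f g; gh = hcomp refl_bicat w x y g h; hk = hcomp refl_bicat v w x h k;
           p1 = hcomp refl_bicat v w z (hcomp refl_bicat w x z fg h) k;
           p2 = hcomp refl_bicat v x z fg hk;
           p3 = hcomp refl_bicat v y z f (hcomp refl_bicat v x y g hk);
           p4 = hcomp refl_bicat v w z (hcomp refl_bicat w y z f gh) k;
           p5 = hcomp refl_bicat v y z f (hcomp refl_bicat v w y gh k)
       in cell_comp V (BHom refl_bicat v z) p1 p2 p3 (BAssoc refl_bicat v x y z ((f, g), hk)) (BAssoc refl_bicat v w x z ((fg, h), k)) =
          cell_comp V (BHom refl_bicat v z) p1 p5 p3
            (map_cell2 V (BCmp refl_bicat v y z) f f (hcomp refl_bicat v w y gh k) (hcomp refl_bicat v x y g hk)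
              (VId (BHom refl_bicat y z) f) (BAssoc refl_bicat v w x y ((g, h), k)))
            (cell_comp V (BHom refl_bicat v z) p1 p4 p5
              (BAssoc refl_bicat v w y z ((f, gh), k))
              (map_cell2 V (BCmp refl_bicat v w z) (hcomp refl_bicat w x z fg h) (hcomp refl_bicat w y z f gh) k k
                (BAssoc refl_bicat w x y z ((f, g), h)) (VId (BHom refl_bicat v w) k)))"
    using total.pentagon\<^sub>C[of "(y, z, f)" "(x, y, g)" "(w, x, h)" "(v, w, k)"] a b
    by (simp add: Let_def total.tens_arr_def total.tens_def tot_eqs map_cell_refl_comp tc)
qed (auto simp: C_vcategory refl_comp_vfunctor loc_typing)

section \<open>The reflection as a strong morphism\<close>

definition comparison where
  "comparison x y z = (\<lambda>(f, g). tot_cell (total.\<phi> (y, z, f) (x, y, g)))"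

lemma
  assumes "x \<in> BOb B" "y \<in> BOb B" "z \<in> BOb B" "f \<in> VOb (BHom B y z)" "g \<in> VOb (BHom B x y)"
  shows \<phi>_tot: "total.\<phi> (y, z, f) (x, y, g) =
      (x, z, hcomp refl_bicat x y z (FO (\<psi> y z) f) (FO (\<psi> x y) g), comparison x y z (f, g), FO (\<psi> x z) (hcomp B x y z f g))"
    and comparison_iso: "cell_iso V (C x z) (hcomp refl_bicat x y z (FO (\<psi> y z) f) (FO (\<psi> x y) g)) (FO (\<psi> x z) (hcomp B x y z f g))
      (comparison x y z (f, g))"
  using total.\<phi>_in[of "(y, z, f)" "(x, y, g)"] total.iso_\<phi>[of "(y, z, f)" "(x, y, g)"] assms
  by (cases "total.\<phi> (y, z, f) (x, y, g)"; simp add: comparison_def Hom_tot total.tens_def iso_tot)+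

text \<open>The comparison is a left inverse of the natural and invertible family given by the units
  on both factors; cancelling that family from the identity transformation proves
  naturality.\<close>

lemma comparison_vnatural:
  assumes xyz: "x \<in> BOb B" "y \<in> BOb B" "z \<in> BOb B"
  shows "vnatural V (vtensor V (BHom B y z) (BHom B x y)) (C x z)
    (vfun_comp V (refl_comp x y z) (vfun_tensor V (\<psi> y z) (\<psi> x y))) (vfun_comp V (\<psi> x z) (BCmp B x y z)) (comparison x y z)"
    (is "vnatural V ?W _ ?G ?F _")
proof -
  note [simp] = xyz fm_typing
  have F: "vmap V ?W (C x z) ?F" by (rule vmap_comp[OF BCmp_vmap \<psi>_vmap]) simp_all
  have G: "vmap V ?W (C x z) ?G" by (rule vmap_comp[OF vmap_tensor[OF \<psi>_vmap \<psi>_vmap] refl_comp_vmap]) simp_all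
  have "vmap V ?W ?W (vfun_id V ?W)" by (rule vmap_id) (simp add: vgraph_vtensor)
  note t0 = unit_both_vnatural[OF xyz this]
  have t: "vnatural V ?W (C x z) ?F ?G (\<lambda>(f, g). map_cell V (\<psi> x z) (hcomp B x y z f g) (hcomp B x y z (T y z f) (T x y g))
        (map_cell2 V (BCmp B x y z) f (T y z f) g (T x y g) (\<eta> y z f) (\<eta> x y g)))"
    by (rule vnatural_cong[OF t0]) (auto simp: v_simps)
  have iso: "cell_iso V (C x z) (FO ?F a) (FO ?G a) ((\<lambda>(f, g). map_cell V (\<psi> x z) (hcomp B x y z f g) (hcomp B x y z (T y z f) (T x y g))
        (map_cell2 V (BCmp B x y z) f (T y z f) g (T x y g) (\<eta> y z f) (\<eta> x y g))) a)" if "a \<in> VOb ?W" for a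
    using that total.iso_both[of "(y, z, fst a)" "(x, y, snd a)"] by (auto simp: iso_tot)
  have s: "comparison x y z a \<in> cell V (C x z) (FO ?G a) (FO ?F a)" if "a \<in> VOb ?W" for a
    using that cell_iso_cell[OF comparison_iso[OF xyz]] by auto
  show ?thesis
  proof (rule vnatural_cancel[OF C_vcategory[OF xyz(1,3)] F G F t vnatural_VId[OF C_vcategory[OF xyz(1,3)] F] iso s])
    fix a assume "a \<in> VOb ?W"
    then obtain f g where a: "a = (f, g)" and ob: "f \<in> VOb (BHom B y z)" "g \<in> VOb (BHom B x y)" by auto
    show "VId (C x z) (FO ?F a) = cell_comp V (C x z) (FO ?F a) (FO ?G a) (FO ?F a) (comparison x y z a)
        ((\<lambda>(f, g). map_cell V (\<psi> x z) (hcomp B x y z f g) (hcomp B x y z (T y z f) (T x y g))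
        (map_cell2 V (BCmp B x y z) f (T y z f) g (T x y g) (\<eta> y z f) (\<eta> x y g))) a)"
      using total.\<phi>_\<eta>[of "(y, z, f)" "(x, y, g)"] \<phi>_tot[OF xyz ob] ob by (simp add: a)
  qed
qed

text \<open>The units need no comparison beyond an identity, since the unit 1-cells of
  \<open>refl_bicat\<close> were chosen as reflections. The remaining axioms are the equations for
  \<open>total.\<phi>\<close> with their endpoints stripped off.\<close>

lemma strong_morphism:
  "strong_bicat_morphism V B refl_bicat (\<lambda>x. x) \<psi> comparison (\<lambda>x. VId (C x x) (FO (\<psi> x x) (BId B x)))"
proof (intro strong_bicat_morphism.intro strong_bicat_morphism_axioms.intro bicat_morphism.intro)
  note [simp] = fm_typing
  note tot_eqs = \<alpha>\<^sub>C_tot(1) \<upsilon>\<^sub>C_tot \<rho>\<^sub>C_tot \<phi>_tot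
  note tc = cell_iso_cell[OF comparison_iso, simplified]
  show "cell_iso V (BHom refl_bicat x x) (BId refl_bicat x) (FO (\<psi> x x) (BId B x)) (VId (C x x) (FO (\<psi> x x) (BId B x)))"
    if "x \<in> BOb B" for x
    using that cell_comp_VId_left[OF C_vcategory, of x x] by (auto simp: cell_iso_def)
  fix x y z f g
  assume a: "x \<in> BOb B" "y \<in> BOb B" "z \<in> BOb B" "f \<in> VOb (BHom B y z)" "g \<in> VOb (BHom B x y)"
  fix w h
  assume b: "w \<in> BOb B" "h \<in> VOb (BHom B w x)"
  show "let Ff = FO (\<psi> y z) f; Fg = FO (\<psi> x y) g; Fh = FO (\<psi> w x) h;
           fg = hcomp B x y z f g; gh = hcomp B w x y g h;
           Ffg = FO (\<psi> x z) fg; Fgh = FO (\<psi> w y) gh;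
           FfFg = hcomp refl_bicat x y z Ff Fg; FgFh = hcomp refl_bicat w x y Fg Fh;
           q1 = hcomp refl_bicat w x z FfFg Fh;
           q2 = hcomp refl_bicat w y z Ff FgFh;
           q3 = hcomp refl_bicat w y z Ff Fgh;
           q4 = FO (\<psi> w z) (hcomp B w y z f gh);
           q5 = hcomp refl_bicat w x z Ffg Fh;
           q6 = FO (\<psi> w z) (hcomp B w x z fg h)
       in cell_comp V (BHom refl_bicat w z) q1 q3 q4 (comparison w y z (f, gh))
            (cell_comp V (BHom refl_bicat w z) q1 q2 q3
              (map_cell2 V (BCmp refl_bicat w y z) Ff Ff FgFh Fgh
                (VId (BHom refl_bicat y z) Ff) (comparison w x y (g, h)))
              (BAssoc refl_bicat w x y z ((Ff, Fg), Fh))) =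
          cell_comp V (BHom refl_bicat w z) q1 q6 q4
            (map_cell V (\<psi> w z) (hcomp B w x z fg h) (hcomp B w y z f gh) (BAssoc B w x y z ((f, g), h)))
            (cell_comp V (BHom refl_bicat w z) q1 q5 q6
              (comparison w x z (fg, h))
              (map_cell2 V (BCmp refl_bicat w x z) FfFg Ffg Fh Fh
                (comparison x y z (f, g)) (VId (BHom refl_bicat w x) Fh)))"
    using total.\<phi>_assoc[of "(y, z, f)" "(x, y, g)" "(w, x, h)"] a b
    by (simp add: Let_def total.tens_arr_def tot_eqs map_cell_refl_comp tc)
next
  note [simp] = fm_typing
  note tot_eqs = \<alpha>\<^sub>C_tot(1) \<upsilon>\<^sub>C_tot \<rho>\<^sub>C_tot \<phi>_tot
  fix x y f
  assume a: "x \<in> BOb B" "y \<in> BOb B" "f \<in> VOb (BHom B x y)"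
  show "let Ff = FO (\<psi> x y) f; If = hcomp B x y y (BId B y) f; FI = FO (\<psi> y y) (BId B y);
           q1 = hcomp refl_bicat x y y (BId refl_bicat y) Ff;
           q2 = hcomp refl_bicat x y y FI Ff;
           q3 = FO (\<psi> x y) If
       in cell_comp V (BHom refl_bicat x y) q1 q3 Ff
            (map_cell V (\<psi> x y) If f (BLunit B x y f))
            (cell_comp V (BHom refl_bicat x y) q1 q2 q3
              (comparison x y y (BId B y, f))
              (map_cell2 V (BCmp refl_bicat x y y) (BId refl_bicat y) FI Ff Ff
                (VId (C y y) (FO (\<psi> y y) (BId B y))) (VId (BHom refl_bicat x y) Ff))) =
          BLunit refl_bicat x y Ff"
    using total.\<phi>_lunit[of "(x, y, f)"] a
    by (simp add: Let_def total.tens_arr_def tot_eqs map_cell_refl_comp)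
  show "let Ff = FO (\<psi> x y) f; fI = hcomp B x x y f (BId B x); FI = FO (\<psi> x x) (BId B x);
           q1 = hcomp refl_bicat x x y Ff (BId refl_bicat x);
           q2 = hcomp refl_bicat x x y Ff FI;
           q3 = FO (\<psi> x y) fI
       in cell_comp V (BHom refl_bicat x y) q1 q3 Ff
            (map_cell V (\<psi> x y) fI f (BRunit B x y f))
            (cell_comp V (BHom refl_bicat x y) q1 q2 q3
              (comparison x x y (f, BId B x))
              (map_cell2 V (BCmp refl_bicat x x y) Ff Ff (BId refl_bicat x) FI
                (VId (BHom refl_bicat x y) Ff) (VId (C x x) (FO (\<psi> x x) (BId B x))))) =
          BRunit refl_bicat x y Ff"
    using total.\<phi>_runit[of "(x, y, f)"] a
    by (simp add: Let_def total.tens_arr_def tot_eqs map_cell_refl_comp)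
qed (auto simp: \<psi>_vfunctor comparison_vnatural loc_typing comparison_iso[simplified])

section \<open>The reflected residuation\<close>

context
  fixes x y z
  assumes xyz: "x \<in> BOb B" "y \<in> BOb B" "z \<in> BOb B"
begin

text \<open>Compatibility is applied to \<open>b\<close> and the quotient \<open>q\<close> itself.
  Residuation then says that \<open>q\<close> is orthogonal to its own unit, which forces that unit
  to be invertible by \<open>cell_iso_unit\<close>.\<close>

lemma ldiv_local:
  assumes b: "b \<in> VOb (BHom B y z)" and c: "c \<in> VOb (C x z)" and q: "q = ldiv B x y z b (FO (\<theta> x z) c)"
  shows "cell_iso V (BHom B x y) q (T x y q) (\<eta> x y q)"
proof (rule cell_iso_unit[OF hyps[OF xyz(1,2)]])
  show q': "q \<in> VOb (BHom B x y)" using xyz b c by (simp add: q ldiv_in loc_typing)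
  show "iso V (pre_comp V (BHom B x y) q q (T x y q) (\<eta> x y q))"
    using orthogonal_right_ldiv[OF xyz b q' c] inverts_right_orthogonal[OF xyz b q' c right_iso[OF xyz b q']]
    by (simp add: q)
qed

lemma rdiv_local:
  assumes b: "b \<in> VOb (BHom B x y)" and c: "c \<in> VOb (C x z)" and q: "q = rdiv B x y z (FO (\<theta> x z) c) b"
  shows "cell_iso V (BHom B y z) q (T y z q) (\<eta> y z q)"
proof (rule cell_iso_unit[OF hyps[OF xyz(2,3)]])
  show q': "q \<in> VOb (BHom B y z)" using xyz b c by (simp add: q rdiv_in loc_typing)
  show "iso V (pre_comp V (BHom B y z) q q (T y z q) (\<eta> y z q))"
    using orthogonal_left_rdiv[OF xyz q' b c] inverts_left_orthogonal[OF xyz q' b c left_iso[OF xyz q' b]]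
    by (simp add: q)
qed

lemma refl_rdiv_vfunctor: "vfunctor V (vtensor V (C x z) (vop V (C x y))) (C y z) (refl_rdiv x y z)"
  and refl_ldiv_vfunctor: "vfunctor V (vtensor V (vop V (C y z)) (C x z)) (C x y) (refl_ldiv x y z)"
proof -
  note [simp] = xyz vgraph_vtensor vgraph_vop BHom_vgraph C_vgraph
  show "vfunctor V (vtensor V (C x z) (vop V (C x y))) (C y z) (refl_rdiv x y z)"
    by (rule vfunctor_comp[OF vfunctor_comp[OF vfunctor_tensor[OF \<theta>_vfunctor vfunctor_op[OF \<theta>_vfunctor]] RDiv_vfunctor] \<psi>_vfunctor])
      simp_all
  show "vfunctor V (vtensor V (vop V (C y z)) (C x z)) (C x y) (refl_ldiv x y z)"
    by (rule vfunctor_comp[OF vfunctor_comp[OF vfunctor_tensor[OF vfunctor_op[OF \<theta>_vfunctor] \<theta>_vfunctor] LDiv_vfunctor] \<psi>_vfunctor])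
      simp_all
qed

abbreviation refl_triples where
  "refl_triples \<equiv> vtensor V (vtensor V (vop V (C y z)) (vop V (C x y))) (C x z)"

abbreviation refl_hom_of_comp where
  "refl_hom_of_comp \<equiv> vfun_comp V (vhom V (C x z)) (vfun_tensor V (vfun_op (refl_comp x y z)) (vfun_id V (C x z)))"

abbreviation refl_hom_to_ldiv where
  "refl_hom_to_ldiv \<equiv> vfun_comp V (vhom V (C x y))
          (vfun_comp V (vfun_tensor V (vfun_id V (vop V (C x y))) (refl_ldiv x y z))
            (vfun_comp V (vfun_assoc V (vop V (C x y)) (vop V (C y z)) (C x z))
              (vfun_tensor V (vfun_swap V (vop V (C y z)) (vop V (C x y)))
                (vfun_id V (C x z)))))"

abbreviation refl_hom_to_rdiv where
  "refl_hom_to_rdiv \<equiv> vfun_comp V (vhom V (C y z))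
          (vfun_comp V (vfun_tensor V (vfun_id V (vop V (C y z))) (refl_rdiv x y z))
            (vfun_comp V (vfun_tensor V (vfun_id V (vop V (C y z)))
                (vfun_swap V (vop V (C x y)) (C x z)))
              (vfun_assoc V (vop V (C y z)) (vop V (C x y)) (C x z))))"

abbreviation embedded_triples where
  "embedded_triples \<equiv> vfun_tensor V (vfun_tensor V (vfun_op (\<theta> y z)) (vfun_op (\<theta> x y))) (\<theta> x z)"

lemmas refl_graphs = BHom_vgraph[OF xyz(1,2)] BHom_vgraph[OF xyz(2,3)] BHom_vgraph[OF xyz(1,3)]
  C_vgraph[OF xyz(1,2)] C_vgraph[OF xyz(2,3)] C_vgraph[OF xyz(1,3)]

lemmas vhom_typing = HomD[OF FM_vhom_in] ihom_in

lemma vmap_refl_hom: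
  "vmap V refl_triples (vself V) refl_hom_of_comp"
  "vmap V refl_triples (vself V) refl_hom_to_ldiv"
  "vmap V refl_triples (vself V) refl_hom_to_rdiv"
  using refl_graphs xyz by (auto simp: vmap_def fm_typing v_typing vhom_typing intro!: HomI)

lemma vmap_embedded_triples: "vmap V refl_triples (triples x y z) embedded_triples"
  using xyz by (intro vmap_tensor vmap_op \<theta>_vmap)

text \<open>The adjunction isomorphism \<open>C(\<psi>(\<theta> f \<circ> \<theta> g), h) \<rightarrow> B(\<theta> f \<circ> \<theta> g, \<theta> h)\<close>.\<close>

abbreviation transpose where
  "transpose \<equiv> \<lambda>((f, g), h). let fg = hcomp B x y z (FO (\<theta> y z) f) (FO (\<theta> x y) g) in
     pre_comp V (BHom B x z) (FO (\<theta> x z) h) fg (T x z fg) (\<eta> x z fg) \<cdot> FM (\<theta> x z) (FO (\<psi> x z) fg) h"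

text \<open>Natural in all three variables as a composite of two families meeting at
  \<open>?A1\<close>: the action of \<open>\<theta>\<close> on hom-objects, and precomposition with
  the unit at the composite 1-cell.\<close>

lemma hnatural_transpose:
  "hnatural refl_triples refl_hom_of_comp (vfun_comp V (hom_of_comp x y z) embedded_triples) transpose"
proof -
  note [simp] = xyz fm_typing
  note g = refl_graphs
  let ?A1 = "vfun_comp V (vhom V (BHom B x z)) (vfun_tensor V (vfun_op (vfun_comp V (\<theta> x z) (refl_comp x y z))) (\<theta> x z))"
  let ?fg = "\<lambda>f g. hcomp B x y z (FO (\<theta> y z) f) (FO (\<theta> x y) g)"
  have A1: "vmap V refl_triples (vself V) ?A1"
    using g by (auto simp: vmap_def v_typing vhom_typing intro!: HomI)
  have K1: "vmap V refl_triples (vtensor V (vop V (C x z)) (C x z)) (vfun_tensor V (vfun_op (refl_comp x y z)) (vfun_id V (C x z)))"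
    using g by (auto simp: vmap_def v_typing intro!: HomI)
  have K2: "vmap V refl_triples (vtensor V (vop V (BHom B x z)) (BHom B x z)) (vfun_tensor V (vfun_op (embedded_comp x y z)) (\<theta> x z))"
    using g by (auto simp: vmap_def v_typing intro!: HomI)
  have G1: "vmap V (vtensor V (vop V (C x z)) (C x z)) (vself V)
      (vfun_comp V (vhom V (BHom B x z)) (vfun_tensor V (vfun_op (\<theta> x z)) (\<theta> x z)))"
    by (intro vmap_comp[OF vmap_tensor[OF vmap_op] vmap_vhom] \<theta>_vmap) (use g in simp_all)
  have I: "vmap V (BHom B x z) (BHom B x z) (vfun_id V (BHom B x z))" by (rule vmap_id[OF g(3)])
  have TT: "vmap V (BHom B x z) (BHom B x z) (vfun_comp V (\<theta> x z) (\<psi> x z))"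
    by (rule vmap_comp[OF \<psi>_vmap \<theta>_vmap]) simp_all
  have G2: "vmap V (vtensor V (vop V (BHom B x z)) (BHom B x z)) (vself V)
      (vfun_comp V (vhom V (BHom B x z)) (vfun_tensor V (vfun_op F) (vfun_id V (BHom B x z))))"
    if "vmap V (BHom B x z) (BHom B x z) F" for F
    by (rule vmap_comp[OF vmap_tensor[OF vmap_op[OF that] I] vmap_vhom[OF g(3)]])
  let ?n1 = "\<lambda>((f, g), h). FM (\<theta> x z) (FO (\<psi> x z) (?fg f g)) h"
  let ?n2 = "\<lambda>((f, g), h). pre_comp V (BHom B x z) (FO (\<theta> x z) h) (?fg f g) (T x z (?fg f g)) (\<eta> x z (?fg f g))"
  have n1: "hnatural refl_triples refl_hom_of_comp ?A1 ?n1"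
    by (rule hnatural_cong[OF hnatural_whisker[OF hnatural_functor[OF \<theta>_vfunctor[OF xyz(1,3)] g(6,3)] K1 vmap_vhom[OF g(6)] G1]])
      (use g in \<open>auto simp: v_simps vhom_typing\<close>)
  have n2: "hnatural refl_triples ?A1 (vfun_comp V (hom_of_comp x y z) embedded_triples) ?n2"
    by (rule hnatural_cong[OF hnatural_whisker[OF hnatural_pre[OF \<eta>_vnatural[OF xyz(1,3)] g(3) BHom_vcategory[OF xyz(1,3)] I TT]
            K2 G2[OF TT] G2[OF I]]])
      (use g in \<open>auto simp: v_simps vhom_typing\<close>)
  have A2: "vmap V refl_triples (vself V) (vfun_comp V (hom_of_comp x y z) embedded_triples)"
    by (rule vmap_comp[OF vmap_embedded_triples vmap_hom_of_comp[OF xyz]])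
  show ?thesis
    by (rule hnatural_cong[OF hnatural_comp[OF vmap_refl_hom(1) A1 A2 n1 n2]]) (auto simp: Let_def)
qed

lemma iso_transpose_embedded:
  assumes "f \<in> VOb (C y z)" "g \<in> VOb (C x y)" "h \<in> VOb (C x z)"
  shows "iso V (transpose ((f, g), h))"
  using assms xyz iso_transpose[OF hyps[OF xyz(1,3)]] by (simp add: Let_def fm_typing)

abbreviation refl_lres where
  "refl_lres \<equiv> \<lambda>((f, g), h). let q = ldiv B x y z (FO (\<theta> y z) f) (FO (\<theta> x z) h) in
     inv_arr V (FM (\<theta> x y) g (FO (\<psi> x y) q)) \<cdot>
     post_comp V (BHom B x y) (FO (\<theta> x y) g) q (T x y q) (\<eta> x y q) \<cdot>
     lres x y z (FO (\<theta> y z) f) (FO (\<theta> x y) g) (FO (\<theta> x z) h) \<cdot> transpose ((f, g), h)"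

abbreviation refl_rres where
  "refl_rres \<equiv> \<lambda>((f, g), h). let q = rdiv B x y z (FO (\<theta> x z) h) (FO (\<theta> x y) g) in
     inv_arr V (FM (\<theta> y z) f (FO (\<psi> y z) q)) \<cdot>
     post_comp V (BHom B y z) (FO (\<theta> y z) f) q (T y z q) (\<eta> y z q) \<cdot>
     rres x y z (FO (\<theta> y z) f) (FO (\<theta> x y) g) (FO (\<theta> x z) h) \<cdot> transpose ((f, g), h)"

lemma
  assumes fgh: "f \<in> VOb (C y z)" "g \<in> VOb (C x y)" "h \<in> VOb (C x z)"
  shows refl_lres_in: "refl_lres ((f, g), h) \<in> Hom V (FO refl_hom_of_comp ((f, g), h)) (FO refl_hom_to_ldiv ((f, g), h))"
    and iso_refl_lres: "iso V (refl_lres ((f, g), h))"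
    and refl_rres_in: "refl_rres ((f, g), h) \<in> Hom V (FO refl_hom_of_comp ((f, g), h)) (FO refl_hom_to_rdiv ((f, g), h))"
    and iso_refl_rres: "iso V (refl_rres ((f, g), h))"
proof -
  note [simp] = xyz fm_typing
  note g = refl_graphs
  let ?f = "FO (\<theta> y z) f" and ?g = "FO (\<theta> x y) g" and ?h = "FO (\<theta> x z) h"
  let ?l = "ldiv B x y z ?f ?h" and ?r = "rdiv B x y z ?h ?g"
  have ff: "iso V (FM (\<theta> x y) g (FO (\<psi> x y) ?l))" "iso V (FM (\<theta> y z) f (FO (\<psi> y z) ?r))"
    using fgh \<theta>_ff by (simp_all add: fully_faithful_def)
  have ob: "?f \<in> VOb (BHom B y z)" "?g \<in> VOb (BHom B x y)" "?h \<in> VOb (BHom B x z)" using fgh by simp_all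
  note res = iso_lres[OF xyz ob] iso_rres[OF xyz ob] HomD[OF lres_in[OF xyz ob]] HomD[OF rres_in[OF xyz ob]]
  note tr = iso_transpose_embedded[OF fgh]
  have tr': "transpose ((f, g), h) \<in> Hom V (VHom (C x z) (FO (\<psi> x z) (hcomp B x y z ?f ?g)) h) (VHom (BHom B x z) (hcomp B x y z ?f ?g) ?h)"
    using hnatural_in[OF hnatural_transpose, of "((f, g), h)"] fgh by simp
  note [simp] = pp_typing[OF g(1)] pp_typing[OF g(2)]
  have "iso V (post_comp V (BHom B x y) ?g ?l (T x y ?l) (\<eta> x y ?l))" "iso V (post_comp V (BHom B y z) ?f ?r (T y z ?r) (\<eta> y z ?r))"
    using fgh ldiv_local[OF ob(1) fgh(3) refl] rdiv_local[OF ob(2) fgh(3) refl]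
    by (auto intro!: iso_post[OF BHom_vcategory])
  then show "iso V (refl_lres ((f, g), h))" "iso V (refl_rres ((f, g), h))"
    using fgh ff res tr HomD[OF tr'] unfolding Let_def split
    by (auto intro!: iso_Cmp iso_inv simp: inv_simps typing)
  show "refl_lres ((f, g), h) \<in> Hom V (FO refl_hom_of_comp ((f, g), h)) (FO refl_hom_to_ldiv ((f, g), h))"
    "refl_rres ((f, g), h) \<in> Hom V (FO refl_hom_of_comp ((f, g), h)) (FO refl_hom_to_rdiv ((f, g), h))"
    using fgh ff res HomD[OF tr'] unfolding Let_def split
    by (auto intro!: HomI simp: inv_simps typing)
qed

text \<open>The last factor inverts the action \<open>?n5\<close> of \<open>\<theta>\<close>.
  Composed with \<open>?n5\<close>, the family becomes transposition followed by residuation in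
  \<open>B\<close> and the unit at the quotient, a composite of natural families;
  \<open>hnatural_cancel\<close> then removes \<open>?n5\<close>.\<close>

lemma hnatural_refl_lres: "hnatural refl_triples refl_hom_of_comp refl_hom_to_ldiv refl_lres"
proof -
  note [simp] = xyz fm_typing
  note g = refl_graphs
  let ?S = "vfun_comp V (vfun_assoc V (vop V (C x y)) (vop V (C y z)) (C x z))
      (vfun_tensor V (vfun_swap V (vop V (C y z)) (vop V (C x y))) (vfun_id V (C x z)))"
  let ?K4 = "vfun_comp V (vfun_tensor V (vfun_op (\<theta> x y)) (vfun_comp V (LDiv B x y z) (vfun_tensor V (vfun_op (\<theta> y z)) (\<theta> x z)))) ?S"
  let ?K5 = "vfun_comp V (vfun_tensor V (vfun_id V (vop V (C x y))) (refl_ldiv x y z)) ?S"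
  let ?TT = "vfun_comp V (\<theta> x y) (\<psi> x y)"
  let ?A4 = "vfun_comp V (vhom V (BHom B x y)) (vfun_comp V (vfun_tensor V (vfun_id V (vop V (BHom B x y))) ?TT) ?K4)"
  let ?A3 = "vfun_comp V (hom_to_ldiv x y z) embedded_triples"
  have A4: "vmap V refl_triples (vself V) ?A4" and A3: "vmap V refl_triples (vself V) ?A3"
    and K4: "vmap V refl_triples (vtensor V (vop V (BHom B x y)) (BHom B x y)) ?K4"
    and K5: "vmap V refl_triples (vtensor V (vop V (C x y)) (C x y)) ?K5"
    using g by (auto simp: vmap_def v_typing vhom_typing intro!: HomI)
  have A2: "vmap V refl_triples (vself V) (vfun_comp V (hom_of_comp x y z) embedded_triples)"
    by (rule vmap_comp[OF vmap_embedded_triples vmap_hom_of_comp[OF xyz]])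
  have I: "vmap V (BHom B x y) (BHom B x y) (vfun_id V (BHom B x y))" by (rule vmap_id[OF g(1)])
  have TT: "vmap V (BHom B x y) (BHom B x y) ?TT" by (rule vmap_comp[OF \<psi>_vmap \<theta>_vmap]) simp_all
  have G4: "vmap V (vtensor V (vop V (BHom B x y)) (BHom B x y)) (vself V)
      (vfun_comp V (vhom V (BHom B x y)) (vfun_tensor V (vfun_id V (vop V (BHom B x y))) F))"
    if "vmap V (BHom B x y) (BHom B x y) F" for F
    by (rule vmap_comp[OF vmap_tensor[OF vmap_id[OF vgraph_vop[OF g(1)]] that] vmap_vhom[OF g(1)]])
  have G5: "vmap V (vtensor V (vop V (C x y)) (C x y)) (vself V)
      (vfun_comp V (vhom V (BHom B x y)) (vfun_tensor V (vfun_op (\<theta> x y)) (\<theta> x y)))"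
    by (intro vmap_comp[OF vmap_tensor[OF vmap_op] vmap_vhom] \<theta>_vmap) (use g in simp_all)
  let ?q = "\<lambda>f h. ldiv B x y z (FO (\<theta> y z) f) (FO (\<theta> x z) h)"
  let ?n3 = "\<lambda>((f, g), h). lres x y z (FO (\<theta> y z) f) (FO (\<theta> x y) g) (FO (\<theta> x z) h)"
  let ?n4 = "\<lambda>((f, g), h). post_comp V (BHom B x y) (FO (\<theta> x y) g) (?q f h) (T x y (?q f h)) (\<eta> x y (?q f h))"
  let ?n5 = "\<lambda>((f, g), h). FM (\<theta> x y) g (FO (\<psi> x y) (?q f h))"
  have n3: "hnatural refl_triples (vfun_comp V (hom_of_comp x y z) embedded_triples) ?A3 ?n3"
    by (rule hnatural_cong[OF hnatural_whisker[OF hnatural_lres[OF xyz] vmap_embedded_triples vmap_hom_of_comp[OF xyz] vmap_hom_to_ldiv[OF xyz]]])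
      auto
  \<comment> \<open>The two functors use the symmetry and the associator before and after the
    embedding respectively; naturality of both constraints, in the merged form of
    \<open>assoc_natural_split\<close>, identifies them.\<close>
  have n4: "hnatural refl_triples ?A3 ?A4 ?n4"
    by (rule hnatural_cong[OF hnatural_whisker[OF hnatural_post[OF \<eta>_vnatural[OF xyz(1,2)] g(1) BHom_vcategory[OF xyz(1,2)] I TT]
            K4 G4[OF I] G4[OF TT]]])
      (use g in \<open>auto simp: v_simps vhom_typing braid_natural assoc_natural assoc_natural_split\<close>)
  have n5: "hnatural refl_triples refl_hom_to_ldiv ?A4 ?n5"
    by (rule hnatural_cong[OF hnatural_whisker[OF hnatural_functor[OF \<theta>_vfunctor[OF xyz(1,2)] g(4,1)] K5 vmap_vhom[OF g(4)] G5]])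
      (use g in \<open>auto simp: v_simps vhom_typing\<close>)
  note r = hnatural_comp[OF vmap_refl_hom(1) A3 A4 hnatural_comp[OF vmap_refl_hom(1) A2 A3 hnatural_transpose n3] n4]
  have ff: "iso V (?n5 a)" if "a \<in> VOb refl_triples" for a
    using that \<theta>_ff by (auto simp: fully_faithful_def)
  show ?thesis
  proof (rule hnatural_cancel[OF vmap_refl_hom(1,2) A4 n5 r ff])
    show "refl_lres a \<in> Hom V (FO refl_hom_of_comp a) (FO refl_hom_to_ldiv a)" if "a \<in> VOb refl_triples" for a
      using that refl_lres_in by auto
    show "?n5 a \<cdot> refl_lres a = ?n4 a \<cdot> ?n3 a \<cdot> transpose a" if "a \<in> VOb refl_triples" for a
      using that ff[OF that] HomD[OF hnatural_in[OF hnatural_transpose that]] HomD[OF hnatural_in[OF n3 that]] HomD[OF hnatural_in[OF n4 that]]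
      by (auto simp: Let_def inv_simps typing)
  qed
qed

lemma hnatural_refl_rres: "hnatural refl_triples refl_hom_of_comp refl_hom_to_rdiv refl_rres"
proof -
  note [simp] = xyz fm_typing
  note g = refl_graphs
  let ?S = "vfun_comp V (vfun_tensor V (vfun_id V (vop V (C y z))) (vfun_swap V (vop V (C x y)) (C x z)))
      (vfun_assoc V (vop V (C y z)) (vop V (C x y)) (C x z))"
  let ?K4 = "vfun_comp V (vfun_tensor V (vfun_op (\<theta> y z)) (vfun_comp V (RDiv B x y z) (vfun_tensor V (\<theta> x z) (vfun_op (\<theta> x y))))) ?S"
  let ?K5 = "vfun_comp V (vfun_tensor V (vfun_id V (vop V (C y z))) (refl_rdiv x y z)) ?S"
  let ?TT = "vfun_comp V (\<theta> y z) (\<psi> y z)"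
  let ?A4 = "vfun_comp V (vhom V (BHom B y z)) (vfun_comp V (vfun_tensor V (vfun_id V (vop V (BHom B y z))) ?TT) ?K4)"
  let ?A3 = "vfun_comp V (hom_to_rdiv x y z) embedded_triples"
  have A4: "vmap V refl_triples (vself V) ?A4" and A3: "vmap V refl_triples (vself V) ?A3"
    and K4: "vmap V refl_triples (vtensor V (vop V (BHom B y z)) (BHom B y z)) ?K4"
    and K5: "vmap V refl_triples (vtensor V (vop V (C y z)) (C y z)) ?K5"
    using g by (auto simp: vmap_def v_typing vhom_typing intro!: HomI)
  have A2: "vmap V refl_triples (vself V) (vfun_comp V (hom_of_comp x y z) embedded_triples)"
    by (rule vmap_comp[OF vmap_embedded_triples vmap_hom_of_comp[OF xyz]])
  have I: "vmap V (BHom B y z) (BHom B y z) (vfun_id V (BHom B y z))" by (rule vmap_id[OF g(2)])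
  have TT: "vmap V (BHom B y z) (BHom B y z) ?TT" by (rule vmap_comp[OF \<psi>_vmap \<theta>_vmap]) simp_all
  have G4: "vmap V (vtensor V (vop V (BHom B y z)) (BHom B y z)) (vself V)
      (vfun_comp V (vhom V (BHom B y z)) (vfun_tensor V (vfun_id V (vop V (BHom B y z))) F))"
    if "vmap V (BHom B y z) (BHom B y z) F" for F
    by (rule vmap_comp[OF vmap_tensor[OF vmap_id[OF vgraph_vop[OF g(2)]] that] vmap_vhom[OF g(2)]])
  have G5: "vmap V (vtensor V (vop V (C y z)) (C y z)) (vself V)
      (vfun_comp V (vhom V (BHom B y z)) (vfun_tensor V (vfun_op (\<theta> y z)) (\<theta> y z)))"
    by (intro vmap_comp[OF vmap_tensor[OF vmap_op] vmap_vhom] \<theta>_vmap) (use g in simp_all)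
  let ?q = "\<lambda>g h. rdiv B x y z (FO (\<theta> x z) h) (FO (\<theta> x y) g)"
  let ?n3 = "\<lambda>((f, g), h). rres x y z (FO (\<theta> y z) f) (FO (\<theta> x y) g) (FO (\<theta> x z) h)"
  let ?n4 = "\<lambda>((f, g), h). post_comp V (BHom B y z) (FO (\<theta> y z) f) (?q g h) (T y z (?q g h)) (\<eta> y z (?q g h))"
  let ?n5 = "\<lambda>((f, g), h). FM (\<theta> y z) f (FO (\<psi> y z) (?q g h))"
  have n3: "hnatural refl_triples (vfun_comp V (hom_of_comp x y z) embedded_triples) ?A3 ?n3"
    by (rule hnatural_cong[OF hnatural_whisker[OF hnatural_rres[OF xyz] vmap_embedded_triples vmap_hom_of_comp[OF xyz] vmap_hom_to_rdiv[OF xyz]]])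
      auto
  have n4: "hnatural refl_triples ?A3 ?A4 ?n4"
    by (rule hnatural_cong[OF hnatural_whisker[OF hnatural_post[OF \<eta>_vnatural[OF xyz(2,3)] g(2) BHom_vcategory[OF xyz(2,3)] I TT]
            K4 G4[OF I] G4[OF TT]]])
      (use g in \<open>auto simp: v_simps vhom_typing braid_natural assoc_natural\<close>)
  have n5: "hnatural refl_triples refl_hom_to_rdiv ?A4 ?n5"
    by (rule hnatural_cong[OF hnatural_whisker[OF hnatural_functor[OF \<theta>_vfunctor[OF xyz(2,3)] g(5,2)] K5 vmap_vhom[OF g(5)] G5]])
      (use g in \<open>auto simp: v_simps vhom_typing\<close>)
  note r = hnatural_comp[OF vmap_refl_hom(1) A3 A4 hnatural_comp[OF vmap_refl_hom(1) A2 A3 hnatural_transpose n3] n4]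
  have ff: "iso V (?n5 a)" if "a \<in> VOb refl_triples" for a
    using that \<theta>_ff by (auto simp: fully_faithful_def)
  show ?thesis
  proof (rule hnatural_cancel[OF vmap_refl_hom(1,3) A4 n5 r ff])
    show "refl_rres a \<in> Hom V (FO refl_hom_of_comp a) (FO refl_hom_to_rdiv a)" if "a \<in> VOb refl_triples" for a
      using that refl_rres_in by auto
    show "?n5 a \<cdot> refl_rres a = ?n4 a \<cdot> ?n3 a \<cdot> transpose a" if "a \<in> VOb refl_triples" for a
      using that ff[OF that] HomD[OF hnatural_in[OF hnatural_transpose that]] HomD[OF hnatural_in[OF n3 that]] HomD[OF hnatural_in[OF n4 that]]
      by (auto simp: Let_def inv_simps typing)
  qed
qed

lemma LIso_refl_vnatural_iso: "vnatural_iso V refl_triples (vself V) refl_hom_of_comp refl_hom_to_ldiv (LIso refl_bicat x y z)"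
proof (intro vnatural_iso.intro vnatural_iso_axioms.intro)
  have l: "LIso refl_bicat x y z = (\<lambda>a. name (FO refl_hom_of_comp a) (FO refl_hom_to_ldiv a) (refl_lres a))"
    by (auto simp: fun_eq_iff refl_bicat_def Let_def)
  show "vnatural V refl_triples (vself V) refl_hom_of_comp refl_hom_to_ldiv (LIso refl_bicat x y z)"
    unfolding l by (rule iffD2[OF vnatural_hnatural[OF vmap_refl_hom(1,2)] hnatural_refl_lres])
      (rule hnatural_in[OF hnatural_refl_lres])
  show "cell_iso V (vself V) (FO refl_hom_of_comp a) (FO refl_hom_to_ldiv a) (LIso refl_bicat x y z a)" if "a \<in> VOb refl_triples" for a
    unfolding l cell_iso_name[OF hnatural_in[OF hnatural_refl_lres that]] using that iso_refl_lres by auto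
qed

lemma RIso_refl_vnatural_iso: "vnatural_iso V refl_triples (vself V) refl_hom_of_comp refl_hom_to_rdiv (RIso refl_bicat x y z)"
proof (intro vnatural_iso.intro vnatural_iso_axioms.intro)
  have l: "RIso refl_bicat x y z = (\<lambda>a. name (FO refl_hom_of_comp a) (FO refl_hom_to_rdiv a) (refl_rres a))"
    by (auto simp: fun_eq_iff refl_bicat_def Let_def)
  show "vnatural V refl_triples (vself V) refl_hom_of_comp refl_hom_to_rdiv (RIso refl_bicat x y z)"
    unfolding l by (rule iffD2[OF vnatural_hnatural[OF vmap_refl_hom(1,3)] hnatural_refl_rres])
      (rule hnatural_in[OF hnatural_refl_rres])
  show "cell_iso V (vself V) (FO refl_hom_of_comp a) (FO refl_hom_to_rdiv a) (RIso refl_bicat x y z a)" if "a \<in> VOb refl_triples" for a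
    unfolding l cell_iso_name[OF hnatural_in[OF hnatural_refl_rres that]] using that iso_refl_rres by auto
qed

end

lemma biclosed_refl: "biclosed_bicategory V refl_bicat"
  using bicategory_refl refl_rdiv_vfunctor refl_ldiv_vfunctor LIso_refl_vnatural_iso RIso_refl_vnatural_iso
  by (auto intro!: biclosed_bicategory.intro biclosed_bicategory_axioms.intro)

end

theorem mainTheorem1:
  fixes V :: "('o, 'm) smc"
    and B :: "('x, 'b, 'o, 'm) biclosed_bicat"
    and C :: "'x \<Rightarrow> 'x \<Rightarrow> ('c, 'o, 'm) vcat"
    and \<theta> :: "'x \<Rightarrow> 'x \<Rightarrow> ('c, 'b, 'm) vfun"
    and \<psi> :: "'x \<Rightarrow> 'x \<Rightarrow> ('b, 'c, 'm) vfun"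
    and \<eta> :: "'x \<Rightarrow> 'x \<Rightarrow> 'b \<Rightarrow> 'm"
    and \<epsilon> :: "'x \<Rightarrow> 'x \<Rightarrow> 'c \<Rightarrow> 'm"
    and \<A> :: "'x \<Rightarrow> 'x \<Rightarrow> 'b set"
    and \<D> :: "'x \<Rightarrow> 'x \<Rightarrow> 'c set"
  assumes "symmetric_monoidal_closed_category V"
    and "complete TYPE('s) V" and "cocomplete TYPE('s) V"
    and "biclosed_bicategory V B"
    and "\<And>x y. \<lbrakk>x \<in> BOb B; y \<in> BOb B\<rbrakk> \<Longrightarrow> vcategory V (C x y)"
    and "\<And>x y. \<lbrakk>x \<in> BOb B; y \<in> BOb B\<rbrakk> \<Longrightarrow> vfunctor V (C x y) (BHom B x y) (\<theta> x y)"
    and "\<And>x y. \<lbrakk>x \<in> BOb B; y \<in> BOb B\<rbrakk> \<Longrightarrow> fully_faithful V (C x y) (\<theta> x y)"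
    and "\<And>x y. \<lbrakk>x \<in> BOb B; y \<in> BOb B\<rbrakk> \<Longrightarrow>
           vadjunction V (BHom B x y) (C x y) (\<psi> x y) (\<theta> x y) (\<eta> x y) (\<epsilon> x y)"
    and "locally_strongly_generating V (BOb B) (BHom B) \<A>"
    and "locally_strongly_cogenerating V (BOb B) C \<D>"
    and "(\<forall>x\<in>BOb B. \<forall>y\<in>BOb B. \<forall>z\<in>BOb B.
         (\<forall>c\<in>VOb (C x z). \<forall>b\<in>VOb (BHom B x y). let q = rdiv B x y z (FO (\<theta> x z) c) b in
            cell_iso V (BHom B y z) q (reflection \<theta> \<psi> y z q) (\<eta> y z q)) \<and>
         (\<forall>b\<in>VOb (BHom B y z). \<forall>c\<in>VOb (C x z). let q = ldiv B x y z b (FO (\<theta> x z) c) in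
            cell_iso V (BHom B x y) q (reflection \<theta> \<psi> x y q) (\<eta> x y q)))
    \<or> (\<forall>x\<in>BOb B. \<forall>y\<in>BOb B. \<forall>z\<in>BOb B.
         (\<forall>d\<in>\<D> x z. \<forall>a\<in>\<A> x y. let q = rdiv B x y z (FO (\<theta> x z) d) a in
            cell_iso V (BHom B y z) q (reflection \<theta> \<psi> y z q) (\<eta> y z q)) \<and>
         (\<forall>a\<in>\<A> y z. \<forall>d\<in>\<D> x z. let q = ldiv B x y z a (FO (\<theta> x z) d) in
            cell_iso V (BHom B x y) q (reflection \<theta> \<psi> x y q) (\<eta> x y q)))
    \<or> (\<forall>x\<in>BOb B. \<forall>y\<in>BOb B. \<forall>z\<in>BOb B.
         (\<forall>b\<in>VOb (BHom B y z). \<forall>c\<in>VOb (C x z). let c' = FO (\<theta> x z) c in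
            cell_iso V (BHom B x y) (ldiv B x y z (reflection \<theta> \<psi> y z b) c') (ldiv B x y z b c')
              (map_cell2 V (LDiv B x y z) (reflection \<theta> \<psi> y z b) b c' c' (\<eta> y z b) (VId (BHom B x z) c'))) \<and>
         (\<forall>c\<in>VOb (C x z). \<forall>b\<in>VOb (BHom B x y). let c' = FO (\<theta> x z) c in
            cell_iso V (BHom B y z) (rdiv B x y z c' (reflection \<theta> \<psi> x y b)) (rdiv B x y z c' b)
              (map_cell2 V (RDiv B x y z) c' c' (reflection \<theta> \<psi> x y b) b (VId (BHom B x z) c') (\<eta> x y b))))
    \<or> (\<forall>x\<in>BOb B. \<forall>y\<in>BOb B. \<forall>z\<in>BOb B.
         (\<forall>b\<in>VOb (BHom B y z). \<forall>b'\<in>VOb (BHom B x y).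
            cell_iso V (C x z) (FO (\<psi> x z) (hcomp B x y z b b'))
              (FO (\<psi> x z) (hcomp B x y z (reflection \<theta> \<psi> y z b) b'))
              (map_cell V (\<psi> x z) (hcomp B x y z b b') (hcomp B x y z (reflection \<theta> \<psi> y z b) b')
                (map_cell2 V (BCmp B x y z) b (reflection \<theta> \<psi> y z b) b' b' (\<eta> y z b) (VId (BHom B x y) b')))) \<and>
         (\<forall>b'\<in>VOb (BHom B y z). \<forall>b\<in>VOb (BHom B x y).
            cell_iso V (C x z) (FO (\<psi> x z) (hcomp B x y z b' b))
              (FO (\<psi> x z) (hcomp B x y z b' (reflection \<theta> \<psi> x y b)))
              (map_cell V (\<psi> x z) (hcomp B x y z b' b) (hcomp B x y z b' (reflection \<theta> \<psi> x y b))
                (map_cell2 V (BCmp B x y z) b' b' b (reflection \<theta> \<psi> x y b) (VId (BHom B y z) b') (\<eta> x y b)))))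
    \<or> (\<forall>x\<in>BOb B. \<forall>y\<in>BOb B. \<forall>z\<in>BOb B.
         (\<forall>b\<in>VOb (BHom B y z). \<forall>a\<in>\<A> x y.
            cell_iso V (C x z) (FO (\<psi> x z) (hcomp B x y z b a))
              (FO (\<psi> x z) (hcomp B x y z (reflection \<theta> \<psi> y z b) a))
              (map_cell V (\<psi> x z) (hcomp B x y z b a) (hcomp B x y z (reflection \<theta> \<psi> y z b) a)
                (map_cell2 V (BCmp B x y z) b (reflection \<theta> \<psi> y z b) a a (\<eta> y z b) (VId (BHom B x y) a)))) \<and>
         (\<forall>a\<in>\<A> y z. \<forall>b\<in>VOb (BHom B x y).
            cell_iso V (C x z) (FO (\<psi> x z) (hcomp B x y z a b))
              (FO (\<psi> x z) (hcomp B x y z a (reflection \<theta> \<psi> x y b)))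
              (map_cell V (\<psi> x z) (hcomp B x y z a b) (hcomp B x y z a (reflection \<theta> \<psi> x y b))
                (map_cell2 V (BCmp B x y z) a a b (reflection \<theta> \<psi> x y b) (VId (BHom B y z) a) (\<eta> x y b)))))
    \<or> (\<forall>x\<in>BOb B. \<forall>y\<in>BOb B. \<forall>z\<in>BOb B.
         \<forall>b\<in>VOb (BHom B y z). \<forall>b'\<in>VOb (BHom B x y).
            cell_iso V (C x z) (FO (\<psi> x z) (hcomp B x y z b b'))
              (FO (\<psi> x z) (hcomp B x y z (reflection \<theta> \<psi> y z b) (reflection \<theta> \<psi> x y b')))
              (map_cell V (\<psi> x z) (hcomp B x y z b b')
                (hcomp B x y z (reflection \<theta> \<psi> y z b) (reflection \<theta> \<psi> x y b'))
                (map_cell2 V (BCmp B x y z) b (reflection \<theta> \<psi> y z b) b' (reflection \<theta> \<psi> x y b') (\<eta> y z b) (\<eta> x y b'))))"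
  shows "\<exists>(CC :: ('x, 'c, 'o, 'm) biclosed_bicat) \<psi>t \<psi>0.
           BOb CC = BOb B \<and>
           (\<forall>x\<in>BOb B. \<forall>y\<in>BOb B. BHom CC x y = C x y) \<and>
           biclosed_bicategory V CC \<and>
           strong_bicat_morphism V B CC (\<lambda>x. x) \<psi> \<psi>t \<psi>0"
proof -
  interpret symmetric_monoidal_closed_category V by fact
  interpret locally_reflective V B C \<theta> \<psi> \<eta> \<epsilon>
    by (intro locally_reflective.intro locally_reflective_axioms.intro enriched_biclosed_bicategory.intro assms)
  \<comment> \<open>All six conditions are brought to the two inversions required by
    \<open>compatible_locally_reflective\<close>. The fourth disjunct states these inversions
    directly; each of the others is covered by its own reduction lemma.\<close>
  have "inverts_left x y z b b' \<and> inverts_right x y z b b'"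
    if "x \<in> BOb B" "y \<in> BOb B" "z \<in> BOb B" "b \<in> VOb (BHom B y z)" "b' \<in> VOb (BHom B x y)" for x y z b b'
    using assms(11)
  proof (elim disjE)
  qed (use that condition1[OF that(1-3) assms(9,10) _ _ that(4,5)] condition2[OF that(1-3) assms(9,10) _ _ that(4,5)]
      condition3[OF that(1-3) assms(9,10) _ _ that(4,5)] condition5[OF that(1-3) assms(9,10) _ _ that(4,5)]
      condition6[OF _ that] in blast)+
  then interpret compatible_locally_reflective V B C \<theta> \<psi> \<eta> \<epsilon>
    by unfold_locales blast+
  show ?thesis
    using biclosed_refl strong_morphism by (intro exI[of _ refl_bicat] exI) auto
qed

end
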